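(* Let $f\ge0$ and let $v\in W^{s,p}_\beta(\mathbb R^N)$ be a supersolution of $(-\Delta)^s_{p,\beta}v=f$ in $\Omega$ with $v\ge0$, $v\not\equiv0$ in $\mathbb R^N$. Then for every $0<q<\frac{N(p-1)}{N-ps}$ there exists $C>0$ independent of $v$ such that for every $0<r<R/16$, $$\Big(\int_{B_r}v^q|x|^{-2\beta}dx\Big)^{1/q}\le C\inf_{B_{3r/2}}v .$$
   Context: Standing assumptions: $s\in(0,1)$, $1<p<N$, $ps<N$, $0\le\beta<\frac{N-ps}{2}$, $\Omega\subset\mathbb R^N$ a smooth bounded domain containing the origin; $B_\rho$ denotes the ball of radius $\rho$ centered at the origin, and $R>0$ is such that $B_R\subset\Omega$. $d\mu=|x|^{-2\beta}dx$, $d\nu=\frac{dx\,dy}{|x-y|^{N+ps}|x|^\beta|y|^\beta}$. For an open set $U$, $D_U=(\mathbb R^N\times\mathbb R^N)\setminus((\mathbb R^N\setminus U)\times(\mathbb R^N\setminus U))$ and $W^{s,p}_{\beta,0}(U)$ is the closure of $C_c^\infty(U)$ in the norm $(\int_U|\phi|^pd\mu)^{1/p}+(\int_U\int_U|\phi(x)-\phi(y)|^pd\nu)^{1/p}$ (elements extended by $0$). $W^{s,p}_\beta(\mathbb R^N)=\{\phi\in L^p(\mathbb R^N,d\mu):\iint_{\mathbb R^N\times\mathbb R^N}|\phi(x)-\phi(y)|^pd\nu<\infty\}$. Supersolution: $v$ is a supersolution of $(-\Delta)^s_{p,\beta}v=f$ in $\Omega$ if for every $\Omega_1\subset\subset\Omega$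 and every nonnegative $\varphi\in W^{s,p}_{\beta,0}(\Omega_1)$, $\iint_{D_{\Omega_1}}|v(x)-v(y)|^{p-2}(v(x)-v(y))(\varphi(x)-\varphi(y))d\nu\ge\int_{\Omega_1}f\varphi\,dx$. *)

theory Defs
  imports "HOL-Analysis.Analysis"
begin

fun Ck :: "nat \<Rightarrow> ('a::euclidean_space \<Rightarrow> real) \<Rightarrow> bool" where
  "Ck 0 f = continuous_on UNIV f"
| "Ck (Suc k) f = (f differentiable_on UNIV \<and>
      (\<forall>i\<in>Basis. Ck k (\<lambda>x. frechet_derivative f (at x) i)))"

definition Cinf :: "('a::euclidean_space \<Rightarrow> real) \<Rightarrow> bool" where
  "Cinf f \<longleftrightarrow> (\<forall>k. Ck k f)"

definition test_fun :: "'a::euclidean_space set \<Rightarrow> ('a \<Rightarrow> real) \<Rightarrow> bool" where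
  "test_fun U \<phi> \<longleftrightarrow> Cinf \<phi> \<and> compact (closure {x. \<phi> x \<noteq> 0}) \<and> closure {x. \<phi> x \<noteq> 0} \<subseteq> U"

definition smooth_bounded_domain :: "'a::euclidean_space set \<Rightarrow> bool" where
  "smooth_bounded_domain \<Omega> \<longleftrightarrow> open \<Omega> \<and> bounded \<Omega> \<and> connected \<Omega> \<and> \<Omega> \<noteq> {} \<and>
     (\<exists>\<rho>. Cinf \<rho> \<and> \<Omega> = {x. \<rho> x < 0} \<and>
          (\<forall>x. \<rho> x = 0 \<longrightarrow> frechet_derivative \<rho> (at x) \<noteq> (\<lambda>h. 0)))"

definition wmu :: "real \<Rightarrow> 'a::euclidean_space \<Rightarrow> real" where
  "wmu \<beta> x = norm x powr (-2 * \<beta>)"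

definition knu :: "real \<Rightarrow> real \<Rightarrow> real \<Rightarrow> 'a::euclidean_space \<Rightarrow> 'a \<Rightarrow> real" where
  "knu s p \<beta> x y = 1 / (norm (x - y) powr (real DIM('a) + p * s) * norm x powr \<beta> * norm y powr \<beta>)"

definition DU :: "'a set \<Rightarrow> ('a \<times> 'a) set" where
  "DU U = UNIV - ((UNIV - U) \<times> (UNIV - U))"

text \<open>W^{s,p}_{beta,0}(U): closure of C_c^infinity(U) in the norm
  (int_U |phi|^p d\<mu>)^(1/p) + (int_U int_U |phi x - phi y|^p d\<nu>)^(1/p),
  elements extended by 0 outside U. Convergence in this norm means that both
  p-th power integrals of the difference tend to 0.\<close>
definition W0 :: "real \<Rightarrow> real \<Rightarrow> real \<Rightarrow> 'a::euclidean_space set \<Rightarrow> ('a \<Rightarrow> real) set" where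
  "W0 s p \<beta> U = {\<phi>. \<phi> \<in> borel_measurable lborel \<and> (\<forall>x. x \<notin> U \<longrightarrow> \<phi> x = 0) \<and>
     (\<exists>\<psi>::nat \<Rightarrow> 'a \<Rightarrow> real. (\<forall>n. test_fun U (\<psi> n)) \<and>
        ((\<lambda>n. \<integral>\<^sup>+ x\<in>U. ennreal (\<bar>\<psi> n x - \<phi> x\<bar> powr p * wmu \<beta> x) \<partial>lborel) \<longlonglongrightarrow> 0) \<and>
        ((\<lambda>n. \<integral>\<^sup>+ z\<in>U \<times> U. ennreal (\<bar>(\<psi> n (fst z) - \<phi> (fst z)) - (\<psi> n (snd z) - \<phi> (snd z))\<bar> powr p
                 * knu s p \<beta> (fst z) (snd z)) \<partial>(lborel \<Otimes>\<^sub>M lborel)) \<longlonglongrightarrow> 0))}"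

definition Wsp :: "real \<Rightarrow> real \<Rightarrow> real \<Rightarrow> ('a::euclidean_space \<Rightarrow> real) set" where
  "Wsp s p \<beta> = {v. v \<in> borel_measurable lborel \<and>
     (\<integral>\<^sup>+ x. ennreal (\<bar>v x\<bar> powr p * wmu \<beta> x) \<partial>lborel) < \<infinity> \<and>
     (\<integral>\<^sup>+ z. ennreal (\<bar>v (fst z) - v (snd z)\<bar> powr p * knu s p \<beta> (fst z) (snd z))
        \<partial>(lborel \<Otimes>\<^sub>M lborel)) < \<infinity>}"

definition Jp :: "real \<Rightarrow> real \<Rightarrow> real" where
  "Jp p t = \<bar>t\<bar> powr (p - 2) * t"

definition supersolution :: "real \<Rightarrow> real \<Rightarrow> real \<Rightarrow> 'a::euclidean_space set \<Rightarrow> ('a \<Rightarrow> real) \<Rightarrow> ('a \<Rightarrow> real) \<Rightarrow> bool" where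
  "supersolution s p \<beta> \<Omega> f v \<longleftrightarrow>
     (\<forall>\<Omega>1. open \<Omega>1 \<and> compact (closure \<Omega>1) \<and> closure \<Omega>1 \<subseteq> \<Omega> \<longrightarrow>
        (\<forall>\<phi>\<in>W0 s p \<beta> \<Omega>1. (\<forall>x. 0 \<le> \<phi> x) \<longrightarrow>
           (\<integral> z. indicator (DU \<Omega>1) z * (Jp p (v (fst z) - v (snd z)) * (\<phi> (fst z) - \<phi> (snd z))
                 * knu s p \<beta> (fst z) (snd z)) \<partial>(lborel \<Otimes>\<^sub>M lborel))
           \<ge> (\<integral> x. indicator \<Omega>1 x * (f x * \<phi> x) \<partial>lborel)))"

definition ess_inf_on :: "'a::euclidean_space set \<Rightarrow> ('a \<Rightarrow> real) \<Rightarrow> ereal" where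
  "ess_inf_on A v = Sup {c::ereal. AE x in lborel. x \<in> A \<longrightarrow> c \<le> ereal (v x)}"

end

theory Submission
  imports Defs
begin

text \<open>
  Since the datum is nonnegative, a supersolution satisfies \<open>E(v,\<phi>) \<ge> 0\<close> for smooth
  nonnegative \<open>\<phi>\<close>, where \<open>E\<close> is the nonlocal form. By weak continuity of \<open>E(v,\<cdot>)\<close> (almost everywhere
  convergence with bounded energy suffices), cutting off at the origin and mollifying, this extends to all
  bounded compactly supported \<open>\<phi>\<close> of finite energy, and by scaling one may take \<open>r = 1\<close>.

  Bound from below. Let \<open>b\<close> be a Lipschitz cutoff that equals 1 on the ball of radius 3/2 and vanishes
  outside the ball of radius 2. In the test with
  \<open>(b - t - v)\<^sup>+\<close> the long-range interaction with the set where \<open>v\<close> is large contributes a multiple of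
  \<open>\<integral> v\<^sup>p\<^sup>-\<^sup>1 |y|\<^sup>-\<^sup>\<beta>\<close>. If that integral is large, it absorbs the errors from distant pairs of points and makes
  the level sets of \<open>b - v\<close> small, and a De Giorgi iteration on these level sets yields \<open>v \<ge> 1/2\<close> on the ball of
  radius 3/2. So the integral is controlled by the infimum.

  Higher integrability. Testing with \<open>b\<^sup>p u\<^sup>-\<^sup>\<epsilon>\<close>, \<open>u = v + 1\<close>, bounds the interaction energy between superlevel
  and sublevel sets of \<open>u\<close>. Comparing consecutive dyadic balls controls the growth of \<open>u\<close> towards the origin, and
  inside each ball the measure \<open>a(t)\<close> of the superlevel sets satisfies a recursion of the form
  \<open>a(2t) \<le> C t\<^sup>-\<^sup>\<theta> a(t)\<^sup>\<lambda>\<close> with \<open>\<theta> = p - 1 - \<epsilon>\<close> and \<open>\<lambda> = ps/N\<close>, whose decay rate \<open>\<theta> N/(N - ps)\<close>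
  is the exponent in the theorem.
\<close>

section \<open>Smooth mollifiers\<close>

text \<open>Two obstacles shape the proof. First, the weight is singular at the origin and not
  invariant under translations, so a test function can be mollified only if it vanishes near 0.
  Cutting it off there costs bounded energy because the energy on a ball of radius r scales like r
  to the power N - ps - 2 \<beta>, which is positive by the bound on \<beta>. Second, no Sobolev,
  Poincare or logarithmic estimate is used: the only lower bound on an energy compares a superlevel
  set with the complement of a lower one inside a ball of the right size, where the kernel is at
  least the ball's scale to the power -(N + ps), up to the weights. Normalising by twice a number t
  above the essential infimum excludes the alternative v >= 1/2 almost everywhere on the ball of
  radius 3/2, so every later bound has a constant that does not depend on v. Letting t decrease to
  the infimum afterwards also covers infimum 0. The loss \<epsilon> is the price of a test function
  that turns a sign into an energy; it tends to 0 as q approaches the critical exponent.\<close>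

lemma Ck_SucI:
  assumes "\<And>x. (f has_derivative f' x) (at x)"
    and "\<And>i. i \<in> Basis \<Longrightarrow> Ck k (\<lambda>x. f' x i)"
  shows "Ck (Suc k) f"
proof -
  have "frechet_derivative f (at x) = f' x" for x
    using frechet_derivative_at[OF assms(1)] by simp
  then show ?thesis
    using assms by (auto simp: differentiable_on_def differentiable_def)
qed

text \<open>At each order the definition asks only for differentiability and speaks of the partial
  derivatives, so that smoothness of higher order implies smoothness of lower order needs its own
  induction. The product rule depends on it, since undifferentiated factors reappear there.\<close>

lemma Ck_SucD: "Ck (Suc k) f \<Longrightarrow> Ck k f"
proof (induction k arbitrary: f)
  case 0
  then show ?case by (auto intro: differentiable_imp_continuous_on)
next
  case (Suc k)
  have "f differentiable_on UNIV" using Suc.prems by simp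
  moreover have "Ck k (\<lambda>x. frechet_derivative f (at x) i)" if "i \<in> Basis" for i
    using Suc.prems that by (intro Suc.IH) simp
  ultimately show ?case by simp
qed

lemma Ck_Suc_has_derivative:
  assumes "Ck (Suc k) f"
  shows "(f has_derivative frechet_derivative f (at x)) (at x)"
  using assms by (auto simp: differentiable_on_def frechet_derivative_works)

lemma Ck_const: "Ck k (\<lambda>x. c)"
proof (induction k arbitrary: c)
  case (Suc k)
  show ?case by (rule Ck_SucI[where f'="\<lambda>_ _. 0"]) (auto intro: Suc.IH)
qed simp

lemma Ck_inner_left: "Ck k (\<lambda>x. x \<bullet> i)"
proof (cases k)
  case (Suc m)
  show ?thesis unfolding Suc
    by (rule Ck_SucI[where f'="\<lambda>_ y. y \<bullet> i"]) (auto intro!: derivative_eq_intros Ck_const)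
qed (auto intro!: continuous_intros)

lemma Ck_add: "Ck k f \<Longrightarrow> Ck k g \<Longrightarrow> Ck k (\<lambda>x. f x + g x)"
proof (induction k arbitrary: f g)
  case (Suc k)
  show ?case
    by (rule Ck_SucI[where f'="\<lambda>x y. frechet_derivative f (at x) y + frechet_derivative g (at x) y"])
      (use Suc in \<open>auto intro!: Suc.IH has_derivative_add Ck_Suc_has_derivative\<close>)
qed (auto intro!: continuous_intros)

lemma Ck_mult: "Ck k f \<Longrightarrow> Ck k g \<Longrightarrow> Ck k (\<lambda>x. f x * g x)"
proof (induction k arbitrary: f g)
  case (Suc k)
  have fg: "Ck k f" "Ck k g"
    using Suc.prems by (auto intro: Ck_SucD)
  show ?case
  proof (rule Ck_SucI[where f'="\<lambda>x y. f x * frechet_derivative g (at x) y + frechet_derivative f (at x) y * g x"])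
    show "((\<lambda>x. f x * g x) has_derivative (\<lambda>y. f x * frechet_derivative g (at x) y + frechet_derivative f (at x) y * g x)) (at x)" for x
      using Suc.prems by (intro has_derivative_mult Ck_Suc_has_derivative)
    show "Ck k (\<lambda>x. f x * frechet_derivative g (at x) i + frechet_derivative f (at x) i * g x)" if "i \<in> Basis" for i
      using Suc.prems that fg by (intro Ck_add Suc.IH) auto
  qed
qed (auto intro!: continuous_intros)

section \<open>A flat one-dimensional bump and its derivatives\<close>

definition exp_bump :: "nat \<Rightarrow> real \<Rightarrow> real" where
  "exp_bump n t = (if t > 0 then exp (- 1 / t) / t ^ n else 0)"

lemma power_le_fact_exp:
  fixes x :: real
  assumes "0 \<le> x"
  shows "x ^ n \<le> fact n * exp x"
proof -
  have "(\<Sum>k\<in>{n}. x ^ k /\<^sub>R fact k) \<le> exp x"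
    unfolding exp_def using assms
    by (intro sum_le_suminf summable_exp_generic) auto
  then show ?thesis by (simp add: field_simps)
qed

text \<open>One term of the series of exp(1/t), of order n + 2, beats the pole of order n and leaves
  a square. This quadratic flatness gives derivative 0 at the gluing point t = 0.\<close>

lemma exp_bump_le: "\<bar>exp_bump n t\<bar> \<le> fact (n + 2) * t\<^sup>2"
proof (cases "t > 0")
  case True
  have "(1 / t) ^ (n + 2) \<le> fact (n + 2) * exp (1 / t)"
    using True by (intro power_le_fact_exp) auto
  then have "1 / (t ^ n * t\<^sup>2) \<le> fact (n + 2) * exp (1 / t)"
    by (simp add: power_one_over power_add power2_eq_square mult_ac del: fact_Suc)
  then have "exp (- 1 / t) / t ^ n \<le> fact (n + 2) * t\<^sup>2"
    using True by (simp add: exp_minus divide_simps mult_ac)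
  then show ?thesis using True by (simp add: exp_bump_def)
qed (simp add: exp_bump_def)

text \<open>The negative powers of t are in the definition for this reason: the family indexed by n
  is closed under differentiation, so smoothness of all orders follows by one induction with n
  general.\<close>

lemma exp_bump_has_derivative:
  "(exp_bump n has_real_derivative (exp_bump (n + 2) t - n * exp_bump (n + 1) t)) (at t)"
proof -
  consider "t > 0" | "t < 0" | "t = 0" by linarith
  then show ?thesis
  proof cases
    case 1
    have "((\<lambda>t. exp (- 1 / t) / t ^ n) has_real_derivative (exp_bump (n + 2) t - n * exp_bump (n + 1) t)) (at t)"
    proof (rule DERIV_cong)
      show "((\<lambda>t. exp (- 1 / t) / t ^ n) has_real_derivative
          (exp (- 1 / t) * (1 / t\<^sup>2) * t ^ n - exp (- 1 / t) * (real n * t ^ (n - 1))) / (t ^ n * t ^ n)) (at t)"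
        using 1 by (auto intro!: derivative_eq_intros simp: power2_eq_square)
      show "(exp (- 1 / t) * (1 / t\<^sup>2) * t ^ n - exp (- 1 / t) * (real n * t ^ (n - 1))) / (t ^ n * t ^ n)
          = exp_bump (n + 2) t - n * exp_bump (n + 1) t"
        using 1 by (cases n) (simp_all add: exp_bump_def field_simps power2_eq_square)
    qed
    then show ?thesis
      by (rule DERIV_cong_ev[THEN iffD1, OF refl _ refl, rotated])
        (use eventually_nhds_in_open[of "{0<..}" t] 1 in \<open>auto elim!: eventually_mono simp: exp_bump_def\<close>)
  next
    case 2
    have "((\<lambda>t. 0) has_real_derivative (exp_bump (n + 2) t - n * exp_bump (n + 1) t)) (at t)"
      using 2 by (auto simp: exp_bump_def)
    then show ?thesis
      by (rule DERIV_cong_ev[THEN iffD1, OF refl _ refl, rotated])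
        (use eventually_nhds_in_open[of "{..<0}" t] 2 in \<open>auto elim!: eventually_mono simp: exp_bump_def\<close>)
  next
    case 3
    have "(\<lambda>h. exp_bump n h / h) \<midarrow>0\<rightarrow> 0"
    proof (rule Lim_null_comparison)
      show "\<forall>\<^sub>F h in at 0. norm (exp_bump n h / h) \<le> fact (n + 2) * \<bar>h\<bar>"
      proof (rule eventually_mono[OF eventually_True])
        fix h :: real
        show "norm (exp_bump n h / h) \<le> fact (n + 2) * \<bar>h\<bar>"
          using exp_bump_le[of n h]
          by (cases "h = 0") (auto simp: abs_divide divide_le_eq power2_eq_square abs_mult[symmetric] mult.assoc)
      qed
      show "((\<lambda>h::real. fact (n + 2) * \<bar>h\<bar>) \<longlongrightarrow> 0) (at 0)"
        by (auto intro!: tendsto_eq_intros)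
    qed
    then show ?thesis
      using 3 by (simp add: has_field_derivative_iff exp_bump_def)
  qed
qed

lemma Ck_exp_bump: "Ck k (\<lambda>x::'a::euclidean_space. exp_bump n (c - x \<bullet> x))"
proof (induction k arbitrary: n)
  case 0
  have "continuous_on UNIV (exp_bump n)"
    by (rule DERIV_continuous_on) (auto intro: has_field_derivative_at_within exp_bump_has_derivative)
  moreover have "continuous_on UNIV (\<lambda>x::'a. c - x \<bullet> x)"
    by (intro continuous_intros)
  ultimately show ?case
    using continuous_on_compose2[of UNIV "exp_bump n" UNIV "\<lambda>x::'a. c - x \<bullet> x"] by simp
next
  case (Suc k)
  show ?case
  proof (rule Ck_SucI)
    show "((\<lambda>x. exp_bump n (c - x \<bullet> x)) has_derivative
       (\<lambda>y. (exp_bump (n + 2) (c - x \<bullet> x) + (- real n) * exp_bump (n + 1) (c - x \<bullet> x)) * ((-2) * (x \<bullet> y)))) (at x)" for x :: 'a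
    proof -
      have 1: "((\<lambda>x::'a. c - x \<bullet> x) has_derivative (\<lambda>y. (-2) * (x \<bullet> y))) (at x)"
        by (auto intro!: derivative_eq_intros simp: inner_commute)
      show ?thesis
        using has_derivative_compose[OF 1, OF exp_bump_has_derivative[of n, unfolded has_field_derivative_def]]
        by (simp add: algebra_simps)
    qed
    show "Ck k (\<lambda>x. (exp_bump (n + 2) (c - x \<bullet> x) + (- real n) * exp_bump (n + 1) (c - x \<bullet> x)) * ((-2) * (x \<bullet> i)))" for i :: 'a
      by (intro Ck_mult Ck_add Ck_const Suc.IH Ck_inner_left)
  qed
qed

section \<open>Differentiating a convolution under the integral\<close>

lemma continuous_compact_support_bounded:
  fixes h :: "'a::euclidean_space \<Rightarrow> real"
  assumes "continuous_on UNIV h" and "\<And>x. norm x \<ge> L \<Longrightarrow> h x = 0"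
  obtains B where "\<And>x. \<bar>h x\<bar> \<le> B"
proof -
  have "compact (h ` cball 0 \<bar>L\<bar>)"
    by (intro compact_continuous_image continuous_on_subset[OF assms(1)]) auto
  then obtain B where B: "\<And>x. x \<in> cball 0 \<bar>L\<bar> \<Longrightarrow> norm (h x) \<le> B" and "B > 0"
    using compact_imp_bounded bounded_pos by (metis (no_types, lifting) image_eqI)
  have "\<bar>h x\<bar> \<le> B" for x
    using B[of x] assms(2)[of x] \<open>B > 0\<close> by (cases "norm x \<le> \<bar>L\<bar>") auto
  then show ?thesis by (rule that)
qed

lemma uniformly_continuous_compact_support:
  fixes h :: "'a::euclidean_space \<Rightarrow> real"
  assumes "continuous_on UNIV h" and "\<And>x. norm x \<ge> L \<Longrightarrow> h x = 0"
  shows "uniformly_continuous_on UNIV h"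
proof -
  have u: "uniformly_continuous_on (cball 0 (\<bar>L\<bar> + 1)) h"
    by (intro compact_uniformly_continuous continuous_on_subset[OF assms(1)]) auto
  show ?thesis
    unfolding uniformly_continuous_on_def
  proof safe
    fix e :: real assume "e > 0"
    then obtain d where d: "d > 0" "\<And>x y. x \<in> cball 0 (\<bar>L\<bar> + 1) \<Longrightarrow> y \<in> cball 0 (\<bar>L\<bar> + 1) \<Longrightarrow>
        dist y x < d \<Longrightarrow> dist (h y) (h x) < e"
      using u unfolding uniformly_continuous_on_def by metis
    show "\<exists>d>0. \<forall>x\<in>UNIV. \<forall>x'\<in>UNIV. dist x' x < d \<longrightarrow> dist (h x') (h x) < e"
    proof (intro exI[of _ "min d 1"] conjI ballI impI)
      fix x y :: 'a assume xy: "dist y x < min d 1"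
      show "dist (h y) (h x) < e"
      proof (cases "norm x \<le> \<bar>L\<bar> + 1 \<and> norm y \<le> \<bar>L\<bar> + 1")
        case True
        then show ?thesis using d(2)[of x y] xy by auto
      next
        case False
        have "\<bar>norm y - norm x\<bar> \<le> dist y x" by (simp add: dist_norm norm_triangle_ineq3)
        then have "norm x \<ge> L" "norm y \<ge> L" using False xy by auto
        then show ?thesis using assms(2) \<open>e > 0\<close> by simp
      qed
    qed (use d in auto)
  qed
qed

lemma frechet_derivative_zero_outside:
  fixes h :: "'a::euclidean_space \<Rightarrow> real"
  assumes supp: "\<And>x. norm x \<ge> L \<Longrightarrow> h x = 0" and der: "(h has_derivative D) (at x)" and "norm x > L"
  shows "D = (\<lambda>_. 0)"
proof -
  have "\<forall>\<^sub>F y in at x. 0 = h y"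
    using eventually_at_in_open'[of "{y. L < norm y}" x] assms
    by (auto elim!: eventually_mono simp: open_Collect_less continuous_intros)
  then have "(h has_derivative (\<lambda>_. 0)) (at x)"
    using has_derivative_transform_eventually[of "\<lambda>_. 0" "\<lambda>_. 0" x UNIV h] assms by simp
  then show ?thesis using der has_derivative_unique by blast
qed

text \<open>The partial derivatives are continuous with compact support, hence uniformly continuous,
  and the mean value inequality turns this into a Taylor remainder that is small uniformly in x.
  Uniformity is what permits integration against a merely integrable function.\<close>

lemma uniform_linearization:
  fixes h :: "'a::euclidean_space \<Rightarrow> real"
  assumes h: "Ck 1 h" and supp: "\<And>x. norm x \<ge> L \<Longrightarrow> h x = 0" and "e > 0"
  shows "\<exists>d>0. \<forall>x y. norm y < d \<longrightarrow> \<bar>h (x + y) - h x - frechet_derivative h (at x) y\<bar> \<le> e * norm y"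
proof -
  let ?D = "\<lambda>x. frechet_derivative h (at x)"
  have der: "(h has_derivative ?D x) (at x)" for x
    using h Ck_Suc_has_derivative[of 0 h] by simp
  have lin: "bounded_linear (?D x)" for x using der has_derivative_bounded_linear by blast
  have D0: "?D x = (\<lambda>_. 0)" if "norm x \<ge> L + 1" for x
    using frechet_derivative_zero_outside[OF supp der] that by simp
  let ?m = "real DIM('a)"
  have "\<exists>d>0. \<forall>x y. dist y x < d \<longrightarrow> dist (?D y i) (?D x i) < e / ?m" if "i \<in> Basis" for i
  proof -
    have "uniformly_continuous_on UNIV (\<lambda>x. ?D x i)"
      using h that D0 by (intro uniformly_continuous_compact_support[of _ "L + 1"]) auto
    then show ?thesis
      using \<open>e > 0\<close> unfolding uniformly_continuous_on_def by (auto elim!: allE[of _ "e / ?m"])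
  qed
  then obtain d where d: "\<And>i. i \<in> Basis \<Longrightarrow> d i > 0"
      "\<And>i x y. i \<in> Basis \<Longrightarrow> dist y x < d i \<Longrightarrow> dist (?D y i) (?D x i) < e / ?m"
    by metis
  define d0 where "d0 = Min (d ` Basis)"
  have "d0 > 0" unfolding d0_def using d(1) by (subst Min_gr_iff) auto
  have d0: "\<bar>?D y i - ?D x i\<bar> \<le> e / ?m" if "i \<in> Basis" "dist y x < d0" for i x y
  proof -
    have "d0 \<le> d i" unfolding d0_def using that by (intro Min_le) auto
    then show ?thesis using d(2)[of i y x] that by (simp add: dist_real_def)
  qed
  show ?thesis
  proof (intro exI[of _ d0] conjI allI impI \<open>d0 > 0\<close>)
    fix x y :: 'a assume y: "norm y < d0"
    have "norm (h (x + y) - h x - ?D x (x + y - x)) \<le> norm (x + y - x) * e"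
    proof (rule differentiable_bound_linearization[where S="ball x d0"])
      fix t :: real assume "t \<in> {0..1}"
      then have "norm (t *\<^sub>R y) \<le> norm y" by (auto simp: mult_left_le_one_le)
      then show "x + t *\<^sub>R (x + y - x) \<in> ball x d0"
        using y by (auto simp: dist_norm)
    next
      fix w show "(h has_derivative ?D w) (at w within ball x d0)"
        using der by (rule has_derivative_at_withinI)
    next
      fix w assume w: "w \<in> ball x d0"
      show "onorm (?D w - ?D x) \<le> e"
      proof (rule onorm_le)
        fix v :: 'a
        have lv: "?D z v = (\<Sum>i\<in>Basis. (v \<bullet> i) * ?D z i)" for z
        proof -
          have "?D z v = ?D z (\<Sum>i\<in>Basis. (v \<bullet> i) *\<^sub>R i)" by (simp add: euclidean_representation)
          also have "\<dots> = (\<Sum>i\<in>Basis. (v \<bullet> i) * ?D z i)"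
            using lin[of z] by (simp add: linear_sum bounded_linear.linear linear_cmul)
          finally show ?thesis .
        qed
        have "norm (?D w v - ?D x v) = \<bar>\<Sum>i\<in>Basis. (v \<bullet> i) * (?D w i - ?D x i)\<bar>"
          by (simp add: lv[of w] lv[of x] sum_subtractf right_diff_distrib)
        also have "\<dots> \<le> (\<Sum>i\<in>Basis. \<bar>(v \<bullet> i) * (?D w i - ?D x i)\<bar>)" by (rule sum_abs)
        also have "\<dots> \<le> (\<Sum>i\<in>(Basis::'a set). norm v * (e / ?m))"
          using d0[of _ w x] w unfolding abs_mult
          by (intro sum_mono mult_mono Basis_le_norm) (auto simp: dist_commute)
        also have "\<dots> = e * norm v" by simp
        finally show "norm ((?D w - ?D x) v) \<le> e * norm v" by simp
      qed
    qed (use \<open>d0 > 0\<close> in auto)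
    then show "\<bar>h (x + y) - h x - ?D x y\<bar> \<le> e * norm y" by (simp add: mult.commute)
  qed
qed

lemma integrable_shift_mult:
  fixes h \<phi> :: "'a::euclidean_space \<Rightarrow> real"
  assumes "continuous_on UNIV h" "\<And>x. norm x \<ge> L \<Longrightarrow> h x = 0" "integrable lborel \<phi>"
  shows "integrable lborel (\<lambda>z. h (x - z) * \<phi> z)"
proof -
  obtain B where B: "\<And>x. \<bar>h x\<bar> \<le> B" using continuous_compact_support_bounded assms by blast
  have [measurable]: "h \<in> borel_measurable borel" using assms(1) by (rule borel_measurable_continuous_onI)
  have [measurable]: "\<phi> \<in> borel_measurable borel" using assms(3) by (auto dest: borel_measurable_integrable)
  have "\<bar>h (x - z) * \<phi> z\<bar> \<le> \<bar>B * \<phi> z\<bar>" for z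
    using B[of "x - z"] by (auto simp: abs_mult intro!: mult_right_mono)
  then show ?thesis
    by (intro Bochner_Integration.integrable_bound[OF integrable_mult_right[OF assms(3), of B]]) auto
qed

text \<open>All derivatives fall on h, whose partial derivatives are again smooth and vanish outside
  a slightly larger ball; hence the induction is general in h and in the radius L.\<close>

lemma Ck_convolution:
  fixes h \<phi> :: "'a::euclidean_space \<Rightarrow> real"
  assumes \<phi>: "integrable lborel \<phi>"
  shows "Cinf h \<Longrightarrow> (\<And>x. norm x \<ge> L \<Longrightarrow> h x = 0) \<Longrightarrow> Ck k (\<lambda>x. \<integral>z. h (x - z) * \<phi> z \<partial>lborel)"
proof (induction k arbitrary: h L)
  have der: "((\<lambda>x. \<integral>z. h (x - z) * \<phi> z \<partial>lborel) has_derivative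
      (\<lambda>y. \<Sum>i\<in>Basis. (y \<bullet> i) * (\<integral>z. frechet_derivative h (at (x - z)) i * \<phi> z \<partial>lborel))) (at x)"
    and D0: "norm x \<ge> L + 1 \<Longrightarrow> frechet_derivative h (at x) i = 0"
    if h: "Cinf h" and supp: "\<And>x. norm x \<ge> L \<Longrightarrow> h x = 0" for h L x i
  proof -
    let ?D = "\<lambda>x. frechet_derivative h (at x)"
    have ck: "Ck k h" for k using h by (simp add: Cinf_def)
    have hder: "(h has_derivative ?D x) (at x)" for x
      using Ck_Suc_has_derivative[OF ck] by simp
    have D0': "?D x i = 0" if "norm x \<ge> L + 1" for x i
      using frechet_derivative_zero_outside[OF supp hder[of x]] that by (simp add: fun_eq_iff)
    then show "norm x \<ge> L + 1 \<Longrightarrow> ?D x i = 0" by blast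
    have lv: "?D z v = (\<Sum>i\<in>Basis. (v \<bullet> i) * ?D z i)" for z v
    proof -
      have lin: "bounded_linear (?D z)" using hder has_derivative_bounded_linear by blast
      have "?D z v = ?D z (\<Sum>i\<in>Basis. (v \<bullet> i) *\<^sub>R i)" by (simp add: euclidean_representation)
      also have "\<dots> = (\<Sum>i\<in>Basis. (v \<bullet> i) * ?D z i)"
        using lin by (simp add: linear_sum bounded_linear.linear linear_cmul)
      finally show ?thesis .
    qed
    have cont: "continuous_on UNIV h" using ck[of 0] by simp
    have contD: "continuous_on UNIV (\<lambda>x. ?D x i)" if "i \<in> Basis" for i
      using ck[of 1] that by simp
    have int: "integrable lborel (\<lambda>z. h (x - z) * \<phi> z)" for x
      by (rule integrable_shift_mult[OF cont supp \<phi>])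
    have intD: "integrable lborel (\<lambda>z. ?D (x - z) i * \<phi> z)" if "i \<in> Basis" for x i
      by (rule integrable_shift_mult[OF contD[OF that] D0' \<phi>])
    have sumD: "(\<Sum>i\<in>Basis. (y \<bullet> i) * (\<integral>z. ?D (x - z) i * \<phi> z \<partial>lborel)) = (\<integral>z. ?D (x - z) y * \<phi> z \<partial>lborel)"
      and intDy: "integrable lborel (\<lambda>z. ?D (x - z) y * \<phi> z)" for y x
    proof -
      have eq: "(\<lambda>z. ?D (x - z) y * \<phi> z) = (\<lambda>z. \<Sum>i\<in>Basis. (y \<bullet> i) * (?D (x - z) i * \<phi> z))"
        by (subst lv) (simp add: sum_distrib_right mult.assoc)
      show "integrable lborel (\<lambda>z. ?D (x - z) y * \<phi> z)"
        unfolding eq by (intro Bochner_Integration.integrable_sum integrable_mult_right intD)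
      show "(\<Sum>i\<in>Basis. (y \<bullet> i) * (\<integral>z. ?D (x - z) i * \<phi> z \<partial>lborel)) = (\<integral>z. ?D (x - z) y * \<phi> z \<partial>lborel)"
        unfolding eq by (subst Bochner_Integration.integral_sum) (auto intro!: intD integrable_mult_right)
    qed
    show "((\<lambda>x. \<integral>z. h (x - z) * \<phi> z \<partial>lborel) has_derivative
      (\<lambda>y. \<Sum>i\<in>Basis. (y \<bullet> i) * (\<integral>z. ?D (x - z) i * \<phi> z \<partial>lborel))) (at x)"
      unfolding has_derivative_at_alt
    proof (intro conjI allI impI)
      show "bounded_linear (\<lambda>y. \<Sum>i\<in>Basis. (y \<bullet> i) * (\<integral>z. ?D (x - z) i * \<phi> z \<partial>lborel))"
        by (intro bounded_linear_sum bounded_linear_mult_const bounded_linear_inner_left)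
      fix e :: real assume "e > 0"
      \<comment> \<open>The remainder is integrated against the absolute value of \<phi>, so the
        tolerance is e divided by the L1 norm; adding 1 covers \<phi> = 0.\<close>
      define I where "I = (\<integral>z. \<bar>\<phi> z\<bar> \<partial>lborel)"
      have "I \<ge> 0" by (simp add: I_def)
      have "\<exists>d>0. \<forall>x y. norm y < d \<longrightarrow> \<bar>h (x + y) - h x - ?D x y\<bar> \<le> (e / (I + 1)) * norm y"
        by (rule uniform_linearization[OF ck supp]) (use \<open>e > 0\<close> \<open>I \<ge> 0\<close> in auto)
      then obtain d where d: "d > 0" "\<And>x y. norm y < d \<Longrightarrow> \<bar>h (x + y) - h x - ?D x y\<bar> \<le> (e / (I + 1)) * norm y"
        by blast
      show "\<exists>d>0. \<forall>y. norm (y - x) < d \<longrightarrow>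
          norm ((\<integral>z. h (y - z) * \<phi> z \<partial>lborel) - (\<integral>z. h (x - z) * \<phi> z \<partial>lborel)
           - (\<Sum>i\<in>Basis. ((y - x) \<bullet> i) * (\<integral>z. ?D (x - z) i * \<phi> z \<partial>lborel))) \<le> e * norm (y - x)"
      proof (intro exI[of _ d] conjI allI impI d(1))
        fix y assume y: "norm (y - x) < d"
        have "(\<integral>z. h (y - z) * \<phi> z \<partial>lborel) - (\<integral>z. h (x - z) * \<phi> z \<partial>lborel)
           - (\<Sum>i\<in>Basis. ((y - x) \<bullet> i) * (\<integral>z. ?D (x - z) i * \<phi> z \<partial>lborel))
          = (\<integral>z. (h (y - z) - h (x - z) - ?D (x - z) (y - x)) * \<phi> z \<partial>lborel)"
          unfolding sumD by (simp add: left_diff_distrib int intDy)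
        also have "norm \<dots> \<le> (\<integral>z. (e / (I + 1)) * norm (y - x) * \<bar>\<phi> z\<bar> \<partial>lborel)"
        proof (rule integral_norm_bound[THEN order_trans], rule integral_mono)
          show "integrable lborel (\<lambda>z. norm ((h (y - z) - h (x - z) - ?D (x - z) (y - x)) * \<phi> z))"
            unfolding left_diff_distrib by (intro integrable_norm Bochner_Integration.integrable_diff int intDy)
          show "integrable lborel (\<lambda>z. (e / (I + 1)) * norm (y - x) * \<bar>\<phi> z\<bar>)" using \<phi> by auto
          fix z
          show "norm ((h (y - z) - h (x - z) - ?D (x - z) (y - x)) * \<phi> z) \<le> (e / (I + 1)) * norm (y - x) * \<bar>\<phi> z\<bar>"
          proof -
            have "x - z + (y - x) = y - z" by simp
            then have "\<bar>h (y - z) - h (x - z) - ?D (x - z) (y - x)\<bar> \<le> (e / (I + 1)) * norm (y - x)"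
              using d(2)[OF y, of "x - z"] by (simp only:)
            then show ?thesis by (simp only: real_norm_def abs_mult mult_right_mono abs_ge_zero)
          qed
        qed
        also have "\<dots> = e * norm (y - x) * (I / (I + 1))" by (simp add: I_def)
        also have "\<dots> \<le> e * norm (y - x)"
          using \<open>I \<ge> 0\<close> \<open>e > 0\<close> by (intro mult_left_le) auto
        finally show "norm ((\<integral>z. h (y - z) * \<phi> z \<partial>lborel) - (\<integral>z. h (x - z) * \<phi> z \<partial>lborel)
           - (\<Sum>i\<in>Basis. ((y - x) \<bullet> i) * (\<integral>z. ?D (x - z) i * \<phi> z \<partial>lborel))) \<le> e * norm (y - x)" .
      qed
    qed
  qed
  {
    case 0
    have "(\<lambda>x. \<integral>z. h (x - z) * \<phi> z \<partial>lborel) differentiable (at x)" for x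
      unfolding differentiable_def by (rule exI, rule der[OF 0])
    then show ?case
      by (auto intro!: differentiable_imp_continuous_on simp: differentiable_on_def)
  next
    case (Suc k)
    show ?case
    proof (rule Ck_SucI[OF der[OF Suc.prems]])
      fix i :: 'a assume i: "i \<in> Basis"
      have "Cinf (\<lambda>x. frechet_derivative h (at x) i)"
        unfolding Cinf_def
      proof
        fix k
        have "Ck (Suc k) h" using Suc.prems(1) unfolding Cinf_def by blast
        then show "Ck k (\<lambda>x. frechet_derivative h (at x) i)" using i by simp
      qed
      then have "Ck k (\<lambda>x. \<integral>z. frechet_derivative h (at (x - z)) i * \<phi> z \<partial>lborel)"
        using D0[OF Suc.prems] by (intro Suc.IH[of _ "L + 1"])
      moreover have "(\<Sum>j\<in>Basis. (i \<bullet> j) * (\<integral>z. frechet_derivative h (at (x - z)) j * \<phi> z \<partial>lborel))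
        = (\<integral>z. frechet_derivative h (at (x - z)) i * \<phi> z \<partial>lborel)" for x
        using i by (simp add: inner_Basis if_distrib[of "\<lambda>c. c * _"] cong: if_cong)
      ultimately show "Ck k (\<lambda>x. \<Sum>j\<in>Basis. (i \<bullet> j) * (\<integral>z. frechet_derivative h (at (x - z)) j * \<phi> z \<partial>lborel))"
        by simp
    qed
  }
qed

section \<open>Elementary inequalities\<close>

lemma powr_abs_add_le:
  fixes a b p :: real
  assumes "0 < p"
  shows "\<bar>a + b\<bar> powr p \<le> 2 powr p * (\<bar>a\<bar> powr p + \<bar>b\<bar> powr p)"
proof -
  have "\<bar>a + b\<bar> powr p \<le> (2 * max \<bar>a\<bar> \<bar>b\<bar>) powr p"
    using assms by (intro powr_mono2) auto
  also have "\<dots> = 2 powr p * max \<bar>a\<bar> \<bar>b\<bar> powr p" by (simp add: powr_mult)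
  also have "\<dots> \<le> 2 powr p * (\<bar>a\<bar> powr p + \<bar>b\<bar> powr p)"
    by (intro mult_left_mono) (auto simp: max_def)
  finally show ?thesis .
qed

lemma power_powr_swap: "0 < (c::real) \<Longrightarrow> (c ^ j) powr a = (c powr a) ^ j"
  by (simp add: powr_def ln_realpow exp_of_nat_mult[symmetric] mult_ac)

section \<open>The p-Laplacian nonlinearity and related inequalities\<close>

lemma Jp_minus: "Jp p (- t) = - Jp p t"
  by (simp add: Jp_def)

lemma Jp_nonneg_eq: "0 \<le> t \<Longrightarrow> Jp p t = t powr (p - 1)"
  by (cases "t = 0") (auto simp: Jp_def powr_diff power2_eq_square)

lemma abs_Jp: "\<bar>Jp p t\<bar> = \<bar>t\<bar> powr (p - 1)"
  using Jp_nonneg_eq[of "\<bar>t\<bar>" p] by (simp add: Jp_def abs_mult)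

lemma Jp_mono:
  assumes "1 < p" "a \<le> b" shows "Jp p a \<le> Jp p b"
proof -
  consider "0 \<le> a" | "a < 0" "0 \<le> b" | "b < 0" by linarith
  then show ?thesis
  proof cases
    case 1
    then show ?thesis using assms by (auto simp: Jp_nonneg_eq intro!: powr_mono2)
  next
    case 2
    have "Jp p a \<le> 0" using 2 by (auto simp: Jp_def mult_nonneg_nonpos)
    moreover have "0 \<le> Jp p b" using 2 by (auto simp: Jp_def)
    ultimately show ?thesis by linarith
  next
    case 3
    have "Jp p (- b) \<le> Jp p (- a)"
      using 3 assms by (auto simp: Jp_nonneg_eq intro!: powr_mono2)
    then show ?thesis by (simp add: Jp_minus)
  qed
qed

lemma Jp_scale:
  assumes "0 < c" shows "Jp p (c * t) = c powr (p - 1) * Jp p t"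
  using assms by (simp add: Jp_def abs_mult powr_mult powr_diff power2_eq_square field_simps)

lemma powr_mult_self: "0 \<le> (a::real) \<Longrightarrow> a powr (p - 1) * a = a powr p"
  by (cases "a = 0") (auto simp: powr_diff)

text \<open>Young's inequality, read as the tangent line of the p-th power of the absolute value at
  m lying below its graph. In this form it yields Jensen's inequality and Lipschitz bounds for
  powers.\<close>

lemma Jp_tangent:
  fixes a m :: real
  assumes "1 < p"
  shows "p * (Jp p m * a) \<le> (p - 1) * \<bar>m\<bar> powr p + \<bar>a\<bar> powr p"
proof -
  have "\<bar>m\<bar> powr (p - 1) * \<bar>a\<bar> \<le> (\<bar>m\<bar> powr (p - 1)) powr (p / (p - 1)) / (p / (p - 1)) + \<bar>a\<bar> powr p / p"
    using assms by (intro Youngs_inequality) (auto simp: field_simps)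
  also have "\<dots> = (p - 1) / p * \<bar>m\<bar> powr p + \<bar>a\<bar> powr p / p"
    using assms by (simp add: powr_powr)
  finally have "p * (\<bar>m\<bar> powr (p - 1) * \<bar>a\<bar>) \<le> (p - 1) * \<bar>m\<bar> powr p + \<bar>a\<bar> powr p"
    using assms by (simp add: field_simps)
  moreover have "Jp p m * a \<le> \<bar>m\<bar> powr (p - 1) * \<bar>a\<bar>"
    using abs_Jp[of p m] by (metis abs_ge_self abs_mult)
  ultimately show ?thesis
    using assms by (smt (verit) mult_left_mono)
qed

lemma abs_Jp_mult_le:
  fixes a e :: real
  assumes "1 < p"
  shows "\<bar>Jp p a * e\<bar> \<le> \<bar>a\<bar> powr p + \<bar>e\<bar> powr p"
proof -
  let ?m = "max \<bar>a\<bar> \<bar>e\<bar>"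
  have "\<bar>Jp p a * e\<bar> \<le> ?m powr (p - 1) * ?m"
    unfolding abs_mult abs_Jp using assms by (intro mult_mono powr_mono2) auto
  also have "\<dots> = ?m powr p" by (intro powr_mult_self) auto
  also have "\<dots> \<le> \<bar>a\<bar> powr p + \<bar>e\<bar> powr p" by (auto simp: max_def)
  finally show ?thesis .
qed

text \<open>\<open>D\<close> stands for the increment of the test function and \<open>B\<close> for
  that of the cutoff. If \<open>D\<close> dominates, B - D has the sign opposite to \<open>D\<close>
  and at least half its size; otherwise every term is controlled by a power of
  \<open>B\<close>.\<close>

lemma Jp_barrier_ineq:
  fixes B D :: real
  assumes "1 < p"
  shows "Jp p (B - D) * D \<le> - ((1 / 2) powr p * \<bar>D\<bar> powr p) + (2 * 3 powr (p - 1) + 1) * \<bar>B\<bar> powr p"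
proof (cases "\<bar>D\<bar> \<ge> 2 * \<bar>B\<bar>")
  case True
  have "Jp p (B - D) * D = - (\<bar>B - D\<bar> powr (p - 1) * \<bar>D\<bar>)"
  proof (cases "D \<ge> 0")
    case True
    then have "0 \<le> D - B" using \<open>\<bar>D\<bar> \<ge> 2 * \<bar>B\<bar>\<close> by linarith
    then have "Jp p (D - B) = \<bar>B - D\<bar> powr (p - 1)" by (simp add: Jp_nonneg_eq abs_minus_commute[of B])
    then show ?thesis using Jp_minus[of p "D - B"] True by simp
  next
    case False
    then have "0 \<le> B - D" using \<open>\<bar>D\<bar> \<ge> 2 * \<bar>B\<bar>\<close> by linarith
    then have "Jp p (B - D) = \<bar>B - D\<bar> powr (p - 1)" by (simp add: Jp_nonneg_eq)
    then show ?thesis using False by simp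
  qed
  also have "\<dots> \<le> - ((\<bar>D\<bar> / 2) powr (p - 1) * \<bar>D\<bar>)"
  proof -
    have "\<bar>D\<bar> / 2 \<le> \<bar>B - D\<bar>" using True by linarith
    then have "(\<bar>D\<bar> / 2) powr (p - 1) \<le> \<bar>B - D\<bar> powr (p - 1)" using assms by (intro powr_mono2) auto
    then show ?thesis by (simp only: neg_le_iff_le) (rule mult_right_mono, auto)
  qed
  also have "(\<bar>D\<bar> / 2) powr (p - 1) * \<bar>D\<bar> = (1 / 2) powr (p - 1) * \<bar>D\<bar> powr p"
    using powr_mult_self[of "\<bar>D\<bar>" p] by (simp add: powr_divide divide_simps)
  also have "- ((1 / 2) powr (p - 1) * \<bar>D\<bar> powr p) \<le> - ((1 / 2) powr p * \<bar>D\<bar> powr p)"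
    by (auto intro!: mult_right_mono powr_mono')
  also have "\<dots> \<le> - ((1 / 2) powr p * \<bar>D\<bar> powr p) + (2 * 3 powr (p - 1) + 1) * \<bar>B\<bar> powr p"
    by simp
  finally show ?thesis .
next
  case False
  have "Jp p (B - D) * D \<le> \<bar>B - D\<bar> powr (p - 1) * \<bar>D\<bar>"
    using abs_Jp[of p "B - D"] by (metis abs_ge_self abs_mult)
  also have "\<dots> \<le> (3 * \<bar>B\<bar>) powr (p - 1) * (2 * \<bar>B\<bar>)"
    using False assms by (intro mult_mono powr_mono2) auto
  also have "\<dots> = 2 * 3 powr (p - 1) * \<bar>B\<bar> powr p"
    using powr_mult_self[of "\<bar>B\<bar>" p] by (simp add: powr_mult)
  finally have 1: "Jp p (B - D) * D \<le> 2 * 3 powr (p - 1) * \<bar>B\<bar> powr p" .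
  have "(1 / 2) powr p * \<bar>D\<bar> powr p = (\<bar>D\<bar> / 2) powr p" by (simp add: powr_divide)
  also have "\<dots> \<le> \<bar>B\<bar> powr p" using False assms by (intro powr_mono2) auto
  finally show ?thesis using 1 by (simp add: algebra_simps)
qed

text \<open>Convexity of the p-th power, with y + d written as a convex combination of y/(1-l) and
  d/l. The explicit power of \<eta> in front of d matters: it has to cancel a power of the relative
  gap in the inequality for negative powers.\<close>

lemma powr_add_le_eps:
  fixes y d \<eta> p :: real
  assumes "1 < p" "0 \<le> y" "0 \<le> d" "0 < \<eta>" "\<eta> \<le> 1"
  shows "(y + d) powr p \<le> (1 + \<eta>) * y powr p + (2 * p - 1) powr (p - 1) * \<eta> powr (1 - p) * d powr p"
proof (cases "y = 0 \<or> d = 0")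
  case True
  have "1 \<le> (2 * p - 1) powr (p - 1)" "1 \<le> \<eta> powr (1 - p)"
    using assms powr_mono2'[of "1 - p" \<eta> 1] by (auto simp: ge_one_powr_ge_zero)
  then have "1 * 1 \<le> (2 * p - 1) powr (p - 1) * \<eta> powr (1 - p)" by (intro mult_mono) auto
  then have "1 * d powr p \<le> (2 * p - 1) powr (p - 1) * \<eta> powr (1 - p) * d powr p"
    by (intro mult_right_mono) auto
  moreover have "1 * y powr p \<le> (1 + \<eta>) * y powr p" using assms by (intro mult_right_mono) auto
  ultimately show ?thesis using True assms by auto
next
  case False
  \<comment> \<open>With this choice the coefficient of y is (1+\<mu>) to the power p - 1, at most
    exp(\<eta>/2), which is at most 1 + \<eta> for \<eta> up to 1. The same restriction turns 1/l =
    1 + 2(p-1)/\<eta> into at most (2p-1)/\<eta>.\<close>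
  define \<mu> where "\<mu> = \<eta> / (2 * (p - 1))"
  define l where "l = \<mu> / (1 + \<mu>)"
  have \<mu>: "\<mu> > 0" using assms by (simp add: \<mu>_def)
  have l: "0 < l" "l < 1" using \<mu> by (auto simp: l_def)
  have l1: "1 - l = 1 / (1 + \<mu>)" using \<mu> by (simp add: l_def field_simps)
  have "(y + d) powr p = ((1 - l) * (y / (1 - l)) + l * (d / l)) powr p" using l by simp
  also have "\<dots> \<le> (1 - l) * (y / (1 - l)) powr p + l * (d / l) powr p"
    using l assms convex_onD[OF powr_convex[of p], of l "y / (1 - l)" "d / l"] False by simp
  also have "(1 - l) * (y / (1 - l)) powr p = (1 - l) powr (1 - p) * y powr p"
    using l assms by (simp add: powr_divide powr_diff)
  also have "l * (d / l) powr p = l powr (1 - p) * d powr p"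
    using l assms by (simp add: powr_divide powr_diff)
  finally have 1: "(y + d) powr p \<le> (1 - l) powr (1 - p) * y powr p + l powr (1 - p) * d powr p" .
  have "(1 - l) powr (1 - p) = (1 + \<mu>) powr (p - 1)"
    unfolding l1 using \<mu> by (simp add: powr_divide powr_minus powr_diff field_simps)
  also have "\<dots> = exp ((p - 1) * ln (1 + \<mu>))" using \<mu> by (simp add: powr_def)
  also have "\<dots> \<le> exp ((p - 1) * \<mu>)"
    using \<mu> assms ln_add_one_self_le_self[of \<mu>] by (simp add: mult_left_mono)
  also have "(p - 1) * \<mu> = \<eta> / 2" using assms by (simp add: \<mu>_def field_simps)
  also have "exp (\<eta> / 2) \<le> 1 + \<eta>"
  proof -
    have "ln (1 / (1 + \<eta>)) \<le> 1 / (1 + \<eta>) - 1"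
      using assms by (intro ln_le_minus_one) auto
    then have "\<eta> / (1 + \<eta>) \<le> ln (1 + \<eta>)"
      using assms by (simp add: ln_div field_simps)
    moreover have "\<eta> / 2 \<le> \<eta> / (1 + \<eta>)" using assms by (intro divide_left_mono) auto
    ultimately have "\<eta> / 2 \<le> ln (1 + \<eta>)" by linarith
    then show ?thesis using assms by (metis add_pos_pos exp_le_cancel_iff exp_ln zero_less_one)
  qed
  finally have 2: "(1 - l) powr (1 - p) \<le> 1 + \<eta>" .
  have "l powr (1 - p) = (1 / l) powr (p - 1)"
    using l by (simp add: powr_divide powr_minus powr_diff field_simps)
  also have "1 / l = 1 + 2 * (p - 1) / \<eta>" using \<mu> assms by (simp add: l_def \<mu>_def field_simps)
  also have "\<dots> \<le> (2 * p - 1) / \<eta>" using assms by (simp add: field_simps)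
  then have "(1 + 2 * (p - 1) / \<eta>) powr (p - 1) \<le> ((2 * p - 1) / \<eta>) powr (p - 1)"
    using assms by (intro powr_mono2) (auto intro!: add_nonneg_nonneg)
  also have "\<dots> = (2 * p - 1) powr (p - 1) * \<eta> powr (1 - p)"
    using assms by (simp add: powr_divide powr_diff field_simps)
  finally have 3: "l powr (1 - p) \<le> (2 * p - 1) powr (p - 1) * \<eta> powr (1 - p)" .
  show ?thesis
    by (rule order_trans[OF 1]) (intro add_mono mult_right_mono 2 3; simp)
qed

text \<open>The negative power increases by a relative amount of at least \<epsilon>\<tau> from A
  down to B, where \<tau> is the relative gap. That gain absorbs the error of replacing a1 by a2 at
  tolerance \<eta> = \<epsilon>\<tau>. The factor \<tau> to the power 1 - p lost in this way cancels
  the factor \<tau> to the power p - 1 of the nonlinearity, so what remains involves only the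
  increment of the cutoff and a power of the larger value.\<close>

lemma Jp_negative_power_ineq:
  fixes A B a1 a2 \<epsilon> p :: real
  assumes "1 < p" "0 < B" "B \<le> A" "0 \<le> a1" "0 \<le> a2" "0 < \<epsilon>" "\<epsilon> \<le> 1"
  shows "(A - B) powr (p - 1) * (a1 powr p * A powr (- \<epsilon>) - a2 powr p * B powr (- \<epsilon>))
     \<le> (2 * p - 1) powr (p - 1) * \<epsilon> powr (1 - p) * (\<bar>a1 - a2\<bar> powr p * A powr (p - 1 - \<epsilon>))"
proof (cases "A = B \<or> a1 \<le> a2")
  case True
  have "a1 powr p * A powr (- \<epsilon>) \<le> a2 powr p * B powr (- \<epsilon>)" if "a1 \<le> a2"
    using that assms by (intro mult_mono powr_mono2 powr_mono2') auto
  then have "(A - B) powr (p - 1) * (a1 powr p * A powr (- \<epsilon>) - a2 powr p * B powr (- \<epsilon>)) \<le> 0"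
    using True by (auto simp: mult_nonneg_nonpos)
  also have "0 \<le> (2 * p - 1) powr (p - 1) * \<epsilon> powr (1 - p) * (\<bar>a1 - a2\<bar> powr p * A powr (p - 1 - \<epsilon>))"
    by simp
  finally show ?thesis .
next
  case False
  define \<tau> where "\<tau> = (A - B) / A"
  have \<tau>: "0 < \<tau>" "\<tau> < 1" using False assms by (auto simp: \<tau>_def)
  have B: "B = A * (1 - \<tau>)" using assms by (simp add: \<tau>_def field_simps)
  have AB: "A - B = A * \<tau>" using assms by (simp add: \<tau>_def field_simps)
  have \<eta>: "0 < \<epsilon> * \<tau>" "\<epsilon> * \<tau> \<le> 1" using \<tau> assms by (auto intro: mult_le_one)
  have "1 + \<epsilon> * \<tau> \<le> exp (\<epsilon> * \<tau>)" by (rule exp_ge_add_one_self)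
  also have "\<dots> \<le> exp (- \<epsilon> * ln (1 - \<tau>))"
    using mult_left_mono[OF ln_le_minus_one[of "1 - \<tau>"], of \<epsilon>] \<tau> assms by simp
  also have "\<dots> = (1 - \<tau>) powr (- \<epsilon>)" using \<tau> by (simp add: powr_def)
  finally have "A powr (- \<epsilon>) * (1 + \<epsilon> * \<tau>) \<le> A powr (- \<epsilon>) * (1 - \<tau>) powr (- \<epsilon>)"
    by (intro mult_left_mono) auto
  also have "\<dots> = B powr (- \<epsilon>)" using assms \<tau> by (simp add: B powr_mult)
  finally have Be: "A powr (- \<epsilon>) * (1 + \<epsilon> * \<tau>) \<le> B powr (- \<epsilon>)" .
  have "a1 powr p * A powr (- \<epsilon>) - a2 powr p * B powr (- \<epsilon>)
      \<le> a1 powr p * A powr (- \<epsilon>) - a2 powr p * (A powr (- \<epsilon>) * (1 + \<epsilon> * \<tau>))"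
    by (intro diff_left_mono mult_left_mono Be) auto
  also have "\<dots> = A powr (- \<epsilon>) * (a1 powr p - (1 + \<epsilon> * \<tau>) * a2 powr p)" by (simp add: algebra_simps)
  also have "\<dots> \<le> A powr (- \<epsilon>) * ((2 * p - 1) powr (p - 1) * (\<epsilon> * \<tau>) powr (1 - p) * (a1 - a2) powr p)"
    using powr_add_le_eps[of p a2 "a1 - a2" "\<epsilon> * \<tau>"] \<eta> assms False by (intro mult_left_mono) auto
  finally have "(A - B) powr (p - 1) * (a1 powr p * A powr (- \<epsilon>) - a2 powr p * B powr (- \<epsilon>))
      \<le> (A * \<tau>) powr (p - 1) * (A powr (- \<epsilon>) * ((2 * p - 1) powr (p - 1) * (\<epsilon> * \<tau>) powr (1 - p) * (a1 - a2) powr p))"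
    unfolding AB by (intro mult_left_mono) auto
  also have "\<dots> = (2 * p - 1) powr (p - 1) * \<epsilon> powr (1 - p) * (\<tau> powr (p - 1) * \<tau> powr (1 - p))
      * ((a1 - a2) powr p * (A powr (p - 1) * A powr (- \<epsilon>)))"
    using assms \<tau> by (simp add: powr_mult mult_ac)
  also have "\<tau> powr (p - 1) * \<tau> powr (1 - p) = 1"
    using \<tau> by (simp add: powr_add[symmetric])
  also have "A powr (p - 1) * A powr (- \<epsilon>) = A powr (p - 1 - \<epsilon>)"
    by (simp add: powr_add[symmetric])
  finally show ?thesis using False by simp
qed

text \<open>The price of a jump from at most T/\<kappa> to at least T. The exponent p - 1 -
  \<epsilon> of T, called \<theta> later, governs all decay rates of superlevel sets.\<close>

lemma gap_energy_ge:
  fixes A B T \<kappa> \<epsilon> p :: real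
  assumes "1 < p" "0 < B" "1 < \<kappa>" "0 < \<epsilon>" "0 < T" "T \<le> A" "B \<le> T / \<kappa>"
  shows "(1 - 1 / \<kappa>) powr (p - 1) * (\<kappa> powr \<epsilon> - 1) * T powr (p - 1 - \<epsilon>)
     \<le> \<bar>A - B\<bar> powr (p - 1) * \<bar>A powr (- \<epsilon>) - B powr (- \<epsilon>)\<bar>"
proof -
  have "T * (1 - 1 / \<kappa>) \<le> A - B" using assms by (simp add: right_diff_distrib)
  moreover have "0 \<le> T * (1 - 1 / \<kappa>)" using assms by auto
  ultimately have 1: "(T * (1 - 1 / \<kappa>)) powr (p - 1) \<le> \<bar>A - B\<bar> powr (p - 1)"
    using assms by (intro powr_mono2) auto
  have "T powr (- \<epsilon>) * \<kappa> powr \<epsilon> = (T / \<kappa>) powr (- \<epsilon>)"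
    using assms by (simp add: powr_divide powr_minus field_simps)
  also have "\<dots> \<le> B powr (- \<epsilon>)" using assms by (intro powr_mono2') auto
  moreover have "A powr (- \<epsilon>) \<le> T powr (- \<epsilon>)" using assms by (intro powr_mono2') auto
  ultimately have 2: "T powr (- \<epsilon>) * (\<kappa> powr \<epsilon> - 1) \<le> \<bar>A powr (- \<epsilon>) - B powr (- \<epsilon>)\<bar>"
    by (simp add: algebra_simps)
  have "0 \<le> T powr (- \<epsilon>) * (\<kappa> powr \<epsilon> - 1)"
    using assms by (auto simp: ge_one_powr_ge_zero)
  then have "(T * (1 - 1 / \<kappa>)) powr (p - 1) * (T powr (- \<epsilon>) * (\<kappa> powr \<epsilon> - 1))
      \<le> \<bar>A - B\<bar> powr (p - 1) * \<bar>A powr (- \<epsilon>) - B powr (- \<epsilon>)\<bar>"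
    using 1 2 by (intro mult_mono) auto
  also have "(T * (1 - 1 / \<kappa>)) powr (p - 1) * (T powr (- \<epsilon>) * (\<kappa> powr \<epsilon> - 1))
     = (1 - 1 / \<kappa>) powr (p - 1) * (\<kappa> powr \<epsilon> - 1) * (T powr (p - 1) * T powr (- \<epsilon>))"
    using assms by (simp add: powr_mult mult_ac)
  also have "T powr (p - 1) * T powr (- \<epsilon>) = T powr (p - 1 - \<epsilon>)"
    by (simp add: powr_add[symmetric])
  finally show ?thesis .
qed

text \<open>Superlinear recursion: the exponent 1 + l makes a sufficiently small starting value
  decay geometrically, fast enough to pay for the shrinking distance between consecutive
  levels.\<close>

lemma De_Giorgi_iteration:
  fixes g :: "real \<Rightarrow> real" and C \<delta> p l :: real
  assumes nonneg: "\<And>t. 0 \<le> g t" and anti: "\<And>t h. t \<le> h \<Longrightarrow> g h \<le> g t"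
    and step: "\<And>t h. 1 / 4 \<le> t \<Longrightarrow> t < h \<Longrightarrow> h < 1 / 2 \<Longrightarrow> g h \<le> C * (h - t) powr (- p) * g t powr (1 + l)"
    and "0 < l" "0 < p" "0 \<le> C" "0 < \<delta>" and start: "g (1 / 4) \<le> \<delta>"
    and small: "C * 8 powr p * \<delta> powr l \<le> 2 powr (- p / l)"
  shows "g (1 / 2) = 0"
proof -
  \<comment> \<open>The decay rate is chosen so that \<kappa> to the power l is 2 to the power -p,
    which cancels the growth by 2 to the power p per step caused by halving the distance between
    levels.\<close>
  define \<kappa> where "\<kappa> = 2 powr (- p / l)"
  have \<kappa>: "0 < \<kappa>" "\<kappa> < 1" using assms by (auto simp: \<kappa>_def powr_less_one)
  have \<kappa>l: "\<kappa> powr l = (1 / 2) powr p" using assms by (simp add: \<kappa>_def powr_powr powr_minus_divide powr_divide)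
  \<comment> \<open>Levels increase from 1/4 towards 1/2; consecutive ones differ by 1/8 times a
    power of 1/2, whence the factor \<open>8 powr p\<close>.\<close>
  define t :: "nat \<Rightarrow> real" where "t j = 1 / 2 - (1 / 4) * (1 / 2) ^ j" for j :: nat
  have "g (t j) \<le> \<delta> * \<kappa> ^ j" for j
  proof (induction j)
    case 0
    then show ?case using start by (simp add: t_def)
  next
    case (Suc j)
    have d: "t (Suc j) - t j = (1 / 8) * (1 / 2) ^ j" by (simp add: t_def)
    have lt: "1 / 4 \<le> t j" "t (Suc j) < 1 / 2" by (auto simp: t_def power_le_one)
    have "0 < t (Suc j) - t j" unfolding d by simp
    then have "t j < t (Suc j)" by simp
    then have "g (t (Suc j)) \<le> C * (t (Suc j) - t j) powr (- p) * g (t j) powr (1 + l)"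
      using lt by (intro step) auto
    also have "\<dots> \<le> C * (t (Suc j) - t j) powr (- p) * (\<delta> * \<kappa> ^ j) powr (1 + l)"
      using assms Suc.IH nonneg by (intro mult_left_mono powr_mono2) auto
    also have "(t (Suc j) - t j) powr (- p) = 8 powr p * (2 powr p) ^ j"
      unfolding d by (simp add: powr_mult power_powr_swap powr_minus powr_divide power_one_over)
    also have "(\<delta> * \<kappa> ^ j) powr (1 + l) = \<delta> * \<kappa> ^ j * (\<delta> powr l * ((1 / 2) powr p) ^ j)"
      using \<kappa> assms by (simp add: powr_add powr_mult \<kappa>l[symmetric] power_powr_swap mult_ac)
    also have "C * (8 powr p * (2 powr p) ^ j) * (\<delta> * \<kappa> ^ j * (\<delta> powr l * ((1 / 2) powr p) ^ j))
       = \<delta> * \<kappa> ^ j * (C * 8 powr p * \<delta> powr l) * ((2 powr p) ^ j * ((1 / 2) powr p) ^ j)" by (simp add: mult_ac)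
    also have "(2 powr p) ^ j * ((1 / 2) powr p) ^ j = (1::real)"
      by (simp add: power_mult_distrib[symmetric] powr_mult[symmetric])
    also have "\<delta> * \<kappa> ^ j * (C * 8 powr p * \<delta> powr l) * 1 \<le> \<delta> * \<kappa> ^ j * \<kappa>"
      using small \<kappa> assms by (simp add: \<kappa>_def mult_left_mono)
    finally show ?case by (simp add: mult_ac)
  qed
  moreover have "g (1 / 2) \<le> g (t j)" for j by (intro anti) (simp add: t_def)
  ultimately have le: "g (1 / 2) \<le> \<delta> * \<kappa> ^ j" for j using order_trans by blast
  have "(\<lambda>j. \<delta> * \<kappa> ^ j) \<longlonglongrightarrow> \<delta> * 0"
    using \<kappa> by (intro tendsto_intros LIMSEQ_power_zero) auto
  then have "g (1 / 2) \<le> 0" using le by (intro LIMSEQ_le_const[of _ "0"]) auto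
  then show ?thesis using nonneg[of "1 / 2"] by linarith
qed

lemma sublinear_recursion_decay:
  fixes a :: "nat \<Rightarrow> real" and C A \<theta> l :: real
  assumes nonneg: "\<And>i. 0 \<le> a i" and start: "a 0 \<le> A"
    and step: "\<And>i. a (Suc i) \<le> C * 2 powr (- (real i * \<theta>)) * a i powr l"
    and "0 \<le> l" "l < 1" "0 < C"
  shows "a i \<le> max A ((C * 2 powr (\<theta> / (1 - l))) powr (1 / (1 - l))) * 2 powr (- (real i * (\<theta> / (1 - l))))"
proof -
  \<comment> \<open>The second entry is the least constant for which one step of the recursion
    closes, i.e. C times 2 to the power \<sigma> is at most D to the power 1 - l; the first covers
    the start.\<close>
  define D where "D = max A ((C * 2 powr (\<theta> / (1 - l))) powr (1 / (1 - l)))"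
  define \<sigma> where "\<sigma> = \<theta> / (1 - l)"
  have "D > 0" using assms by (auto simp: D_def less_max_iff_disj)
  have "C * 2 powr \<sigma> = ((C * 2 powr \<sigma>) powr (1 / (1 - l))) powr (1 - l)"
    using assms by (simp add: powr_powr)
  also have "\<dots> \<le> D powr (1 - l)"
    using assms by (intro powr_mono2) (auto simp: D_def \<sigma>_def)
  finally have D: "C * 2 powr \<sigma> \<le> D powr (1 - l)" .
  have \<sigma>: "\<theta> + \<sigma> * l = \<sigma>" using assms by (simp add: \<sigma>_def field_simps)
  have "a i \<le> D * 2 powr (- (real i * \<sigma>))"
  proof (induction i)
    case 0
    then show ?case using start by (simp add: D_def)
  next
    case (Suc i)
    have "a (Suc i) \<le> C * 2 powr (- (real i * \<theta>)) * a i powr l" by (rule step)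
    also have "\<dots> \<le> C * 2 powr (- (real i * \<theta>)) * (D * 2 powr (- (real i * \<sigma>))) powr l"
      using assms Suc nonneg by (intro mult_left_mono powr_mono2) auto
    also have "\<dots> = C * D powr l * 2 powr (- (real i * \<theta>) - real i * \<sigma> * l)"
      using \<open>D > 0\<close> by (simp add: powr_mult powr_powr powr_add[symmetric] mult.assoc)
    also have "- (real i * \<theta>) - real i * \<sigma> * l = - (real i * \<sigma>)"
      by (subst (2) \<sigma>[symmetric]) (simp add: algebra_simps)
    also have "C * D powr l * 2 powr (- (real i * \<sigma>)) = (C * 2 powr \<sigma>) * D powr l * 2 powr (- (real (Suc i) * \<sigma>))"
      by (simp add: powr_add[symmetric] algebra_simps)
    also have "\<dots> \<le> D powr (1 - l) * D powr l * 2 powr (- (real (Suc i) * \<sigma>))"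
      by (intro mult_right_mono D) auto
    also have "D powr (1 - l) * D powr l = D" using \<open>D > 0\<close> by (simp add: powr_add[symmetric])
    finally show ?case .
  qed
  then show ?thesis by (simp add: D_def \<sigma>_def)
qed

section \<open>Lebesgue integrals\<close>

lemma nn_integral_lborel_affine:
  fixes f :: "'a::euclidean_space \<Rightarrow> ennreal"
  assumes [measurable]: "f \<in> borel_measurable borel" and c: "c \<noteq> 0"
  shows "(\<integral>\<^sup>+x. f x \<partial>lborel) = ennreal (\<bar>c\<bar> ^ DIM('a)) * (\<integral>\<^sup>+x. f (t + c *\<^sub>R x) \<partial>lborel)"
  by (subst lborel_affine[OF c, of t])
     (simp add: nn_integral_density nn_integral_distr nn_integral_cmult ennreal_power[symmetric])

lemma integral_lborel_affine:
  fixes f :: "'a::euclidean_space \<Rightarrow> real"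
  assumes [measurable]: "f \<in> borel_measurable borel" and c: "c \<noteq> 0"
  shows "(\<integral>x. f x \<partial>lborel) = \<bar>c\<bar> ^ DIM('a) * (\<integral>x. f (t + c *\<^sub>R x) \<partial>lborel)"
  by (subst lborel_affine[OF c, of t])
     (simp add: integral_density integral_distr ennreal_power)

section \<open>Dyadic shells and integrability of powers of the norm\<close>

lemma ex_dyadic_below:
  fixes y R :: real
  assumes "0 < y" "y < R"
  shows "\<exists>k. R * (1 / 2) ^ Suc k \<le> y \<and> y < R * (1 / 2) ^ k"
proof -
  obtain n where "(1 / 2) ^ n < y / R" using real_arch_pow_inv[of "y / R" "1 / 2"] assms by auto
  then have n: "R * (1 / 2) ^ n \<le> y" using assms by (simp add: field_simps)
  define m where "m = (LEAST n. R * (1 / 2) ^ n \<le> y)"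
  have m: "R * (1 / 2) ^ m \<le> y" unfolding m_def using n by (rule LeastI)
  then have "m \<noteq> 0" using assms by (metis less_le_not_le mult.right_neutral power_0)
  then obtain k where k: "m = Suc k" by (cases m) auto
  have "\<not> R * (1 / 2) ^ k \<le> y" using not_less_Least[of k "\<lambda>n. R * (1 / 2) ^ n \<le> y"] k m_def by auto
  then show ?thesis using m k by auto
qed

lemma ex_dyadic_above:
  fixes y R :: real
  assumes "0 < R" "R \<le> y"
  shows "\<exists>k. R * 2 ^ k \<le> y \<and> y < R * 2 ^ Suc k"
proof -
  obtain n where "y / R < 2 ^ n" using real_arch_pow[of 2 "y / R"] by auto
  then have n: "y < R * 2 ^ n" using assms by (simp add: field_simps)
  define m where "m = (LEAST n. y < R * 2 ^ n)"
  have m: "y < R * 2 ^ m" unfolding m_def using n by (rule LeastI)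
  then have "m \<noteq> 0" using assms by (metis not_le mult.right_neutral power_0)
  then obtain k where k: "m = Suc k" by (cases m) auto
  have "\<not> y < R * 2 ^ k" using not_less_Least[of k "\<lambda>n. y < R * 2 ^ n"] k m_def by auto
  then show ?thesis using m k by (intro exI[of _ k]) auto
qed

text \<open>Dyadic shells take the place of polar coordinates. Enlarging each shell to a full ball
  loses only a constant factor, and the point 0, which lies in no shell, is null.\<close>

lemma nn_integral_le_suminf_balls:
  fixes f :: "'a::euclidean_space \<Rightarrow> ennreal" and c r :: "nat \<Rightarrow> real"
  assumes pt: "\<And>x. f x \<noteq> 0 \<Longrightarrow> x \<noteq> 0 \<Longrightarrow> \<exists>k. f x \<le> ennreal (c k) \<and> norm x < r k"
    and c: "\<And>k. 0 \<le> c k" and r: "\<And>k. 0 \<le> r k" and sm: "summable (\<lambda>k. c k * r k ^ DIM('a))"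
  shows "(\<integral>\<^sup>+x. f x \<partial>lborel) < \<infinity>"
proof -
  have "(\<integral>\<^sup>+x. f x \<partial>lborel) \<le> (\<integral>\<^sup>+x. (\<Sum>k. ennreal (c k) * indicator (ball 0 (r k)) (x::'a)) \<partial>lborel)"
  proof (rule nn_integral_mono_AE)
    have "AE x in lborel. (x::'a) \<noteq> 0" using AE_lborel_singleton[of 0] by (simp add: eq_commute)
    then show "AE x in lborel. f x \<le> (\<Sum>k. ennreal (c k) * indicator (ball 0 (r k)) x)"
    proof eventually_elim
      case (elim x)
      show ?case
      proof (cases "f x = 0")
        case False
        then obtain k where k: "f x \<le> ennreal (c k)" "norm x < r k" using pt elim by blast
        have "f x \<le> ennreal (c k) * indicator (ball 0 (r k)) x" using k by simp
        also have "\<dots> \<le> (\<Sum>k. ennreal (c k) * indicator (ball 0 (r k)) x)"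
          using sum_le_suminf[of "\<lambda>k. ennreal (c k) * indicator (ball 0 (r k)) x" "{k}"]
          by (simp del: sum_mult_indicator)
        finally show ?thesis .
      qed simp
    qed
  qed
  also have "\<dots> = (\<Sum>k. ennreal (c k) * emeasure lborel (ball (0::'a) (r k)))"
  proof -
    have m: "ball (0::'a) (r k) \<in> sets lborel" for k by simp
    show ?thesis
      by (subst nn_integral_suminf, intro borel_measurable_times_ennreal borel_measurable_const borel_measurable_indicator m)
        (simp only: nn_integral_cmult_indicator[OF m])
  qed
  also have "\<dots> = (\<Sum>k. ennreal (unit_ball_vol (real DIM('a)) * (c k * r k ^ DIM('a))))"
    using c r by (simp add: emeasure_ball ennreal_mult[symmetric] mult_ac)
  also have "\<dots> < \<infinity>"
  proof -
    have "(\<Sum>k. ennreal (unit_ball_vol (real DIM('a)) * (c k * r k ^ DIM('a)))) \<noteq> top"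
      using c r sm by (intro ennreal_suminf_neq_top summable_mult) auto
    then show ?thesis by (simp add: top.not_eq_extremum)
  qed
  finally show ?thesis .
qed

lemma nn_integral_norm_powr_ball:
  fixes a R :: real
  assumes "0 \<le> a" "a < real DIM('a::euclidean_space)" "0 < R"
  shows "(\<integral>\<^sup>+x\<in>ball 0 R. ennreal (norm (x::'a) powr (- a)) \<partial>lborel) < \<infinity>"
proof (rule nn_integral_le_suminf_balls[where c="\<lambda>k. (R * (1 / 2) ^ Suc k) powr (- a)" and r="\<lambda>k. R * (1 / 2) ^ k"])
  fix x :: 'a
  assume x: "ennreal (norm x powr (- a)) * indicator (ball 0 R) x \<noteq> 0" "x \<noteq> 0"
  then have "norm x < R" by (auto simp: indicator_def split: if_splits)
  then obtain k where k: "R * (1 / 2) ^ Suc k \<le> norm x" "norm x < R * (1 / 2) ^ k"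
    using ex_dyadic_below[of "norm x" R] x by auto
  have "norm x powr (- a) \<le> (R * (1 / 2) ^ Suc k) powr (- a)"
    using k assms by (intro powr_mono2') auto
  then have "ennreal (norm x powr (- a)) * indicator (ball 0 R) x \<le> ennreal ((R * (1 / 2) ^ Suc k) powr (- a))"
    using \<open>norm x < R\<close> by (simp add: ennreal_leI)
  then show "\<exists>k. ennreal (norm x powr (- a)) * indicator (ball 0 R) x \<le> ennreal ((R * (1 / 2) ^ Suc k) powr (- a)) \<and> norm x < R * (1 / 2) ^ k"
    using k by blast
next
  let ?n = "DIM('a)"
  have "(R * (1 / 2) ^ Suc k) powr (- a) * (R * (1 / 2) ^ k) ^ ?n
      = (R / 2) powr (- a) * R ^ ?n * (2 powr (a - real ?n)) ^ k" for k
  proof -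
    have "(R * (1 / 2) ^ Suc k) powr (- a) = (R / 2) powr (- a) * ((1 / 2) ^ k) powr (- a)"
      using assms by (subst powr_mult[symmetric]) auto
    also have "((1 / 2) ^ k) powr (- a) = (2 powr a) ^ k"
      by (simp add: power_powr_swap powr_minus powr_divide power_one_over)
    moreover have "(R * (1 / 2) ^ k) ^ ?n = R ^ ?n * (2 powr (- real ?n)) ^ k"
    proof -
      have "((1 / 2) ^ k) ^ ?n = ((1 / (2::real)) ^ ?n) ^ k" by (simp only: power_mult[symmetric] mult.commute)
      also have "(1 / 2) ^ ?n = (2::real) powr (- real ?n)"
        by (simp add: powr_minus powr_realpow power_one_over inverse_eq_divide)
      finally show ?thesis by (simp only: power_mult_distrib)
    qed
    moreover have "(2 powr (a - real ?n)) ^ k = (2 powr a) ^ k * (2 powr (- real ?n)) ^ k"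
      by (simp add: power_mult_distrib[symmetric] powr_add[symmetric])
    ultimately show ?thesis by (simp only: mult_ac)
  qed
  moreover have "summable (\<lambda>k. (2 powr (a - real ?n)) ^ k)"
    using assms by (intro summable_geometric) (auto simp: powr_less_one)
  ultimately show "summable (\<lambda>k. (R * (1 / 2) ^ Suc k) powr (- a) * (R * (1 / 2) ^ k) ^ ?n)"
    by (auto intro: summable_mult)
qed (use assms in auto)

lemma nn_integral_norm_powr_outside:
  fixes a R :: real
  assumes "real DIM('a::euclidean_space) < a" "0 < R"
  shows "(\<integral>\<^sup>+x\<in>{x. R \<le> norm x}. ennreal (norm (x::'a) powr (- a)) \<partial>lborel) < \<infinity>"
proof (rule nn_integral_le_suminf_balls[where c="\<lambda>k. (R * 2 ^ k) powr (- a)" and r="\<lambda>k. R * 2 ^ Suc k"])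
  fix x :: 'a
  assume x: "ennreal (norm x powr (- a)) * indicator {x. R \<le> norm x} x \<noteq> 0" "x \<noteq> 0"
  then have "R \<le> norm x" by (auto simp: indicator_def split: if_splits)
  then obtain k where k: "R * 2 ^ k \<le> norm x" "norm x < R * 2 ^ Suc k"
    using ex_dyadic_above[of R "norm x"] assms by auto
  have "norm x powr (- a) \<le> (R * 2 ^ k) powr (- a)"
    using k assms by (intro powr_mono2') auto
  then have "ennreal (norm x powr (- a)) * indicator {x. R \<le> norm x} x \<le> ennreal ((R * 2 ^ k) powr (- a))"
    using \<open>R \<le> norm x\<close> by (simp add: ennreal_leI)
  then show "\<exists>k. ennreal (norm x powr (- a)) * indicator {x. R \<le> norm x} x \<le> ennreal ((R * 2 ^ k) powr (- a)) \<and> norm x < R * 2 ^ Suc k"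
    using k by blast
next
  let ?n = "DIM('a)"
  have "(R * 2 ^ k) powr (- a) * (R * 2 ^ Suc k) ^ ?n
      = R powr (- a) * (R * 2) ^ ?n * (2 powr (real ?n - a)) ^ k" for k
  proof -
    have "(R * 2 ^ k) powr (- a) = R powr (- a) * (2 powr (- a)) ^ k"
      using assms by (simp add: powr_mult power_powr_swap)
    moreover have "(R * 2 ^ Suc k) ^ ?n = (R * 2) ^ ?n * (2 powr real ?n) ^ k"
    proof -
      have "(2 ^ k) ^ ?n = ((2::real) ^ ?n) ^ k" by (simp only: power_mult[symmetric] mult.commute)
      then show ?thesis by (simp add: power_mult_distrib powr_realpow)
    qed
    moreover have "(2 powr (real ?n - a)) ^ k = (2 powr real ?n) ^ k * (2 powr (- a)) ^ k"
      by (simp add: power_mult_distrib[symmetric] powr_add[symmetric])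
    ultimately show ?thesis by (simp only: mult_ac)
  qed
  moreover have "summable (\<lambda>k. (2 powr (real ?n - a)) ^ k)"
    using assms by (intro summable_geometric) (auto simp: powr_less_one)
  ultimately show "summable (\<lambda>k. (R * 2 ^ k) powr (- a) * (R * 2 ^ Suc k) ^ ?n)"
    by (auto intro: summable_mult)
qed (use assms in auto)

text \<open>The passage from a nonnegative form to an energy estimate: I is the form integrand, P
  the energy sought, Q the error. Integrability of P is not known beforehand; if the integral of Q
  is infinite there is nothing to show, and otherwise P is dominated by Q - I.\<close>

lemma nn_integral_energy_le:
  fixes I P Q :: "'a \<Rightarrow> real"
  assumes I: "integrable M I" "0 \<le> (\<integral>x. I x \<partial>M)"
    and [measurable]: "P \<in> borel_measurable M" "Q \<in> borel_measurable M"
    and le: "AE x in M. 0 \<le> P x \<and> 0 \<le> Q x \<and> I x + P x \<le> Q x"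
  shows "(\<integral>\<^sup>+x. ennreal (P x) \<partial>M) \<le> (\<integral>\<^sup>+x. ennreal (Q x) \<partial>M)"
proof (cases "(\<integral>\<^sup>+x. ennreal (Q x) \<partial>M) = \<infinity>")
  case False
  have Q: "integrable M Q"
    using le False by (intro integrableI_nonneg) (auto simp: top.not_eq_extremum)
  have P: "integrable M P"
    using le by (intro Bochner_Integration.integrable_bound[OF Bochner_Integration.integrable_diff[OF Q I(1)]]) auto
  have "(\<integral>x. P x \<partial>M) \<le> (\<integral>x. Q x - I x \<partial>M)"
    using P Q I le by (intro integral_mono_AE) auto
  also have "\<dots> \<le> (\<integral>x. Q x \<partial>M)" using Q I by simp
  finally have "ennreal (\<integral>x. P x \<partial>M) \<le> ennreal (\<integral>x. Q x \<partial>M)" by (rule ennreal_leI)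
  then show ?thesis using P Q le by (simp add: nn_integral_eq_integral)
qed simp

section \<open>The weighted Gagliardo energy\<close>

lemma AE_pair_fst_snd:
  fixes P :: "'a::euclidean_space \<Rightarrow> bool"
  assumes "AE x in lborel. P x"
  shows "AE z in lborel \<Otimes>\<^sub>M (lborel :: 'a measure). P (fst z) \<and> P (snd z)"
proof -
  obtain N where N: "N \<in> null_sets lborel" "\<And>x. x \<notin> N \<Longrightarrow> P x"
    using assms by (auto simp: eventually_ae_filter)
  have "N \<times> UNIV \<in> null_sets (lborel \<Otimes>\<^sub>M (lborel :: 'a measure))"
    "UNIV \<times> N \<in> null_sets (lborel \<Otimes>\<^sub>M (lborel :: 'a measure))"
    using N(1) by auto
  then have "N \<times> UNIV \<union> UNIV \<times> N \<in> null_sets (lborel \<Otimes>\<^sub>M (lborel :: 'a measure))" by auto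
  then show ?thesis
  proof (rule AE_I')
    show "{z \<in> space (lborel \<Otimes>\<^sub>M lborel). \<not> (P (fst z) \<and> P (snd z))} \<subseteq> N \<times> UNIV \<union> UNIV \<times> N"
    proof
      fix z assume "z \<in> {z \<in> space (lborel \<Otimes>\<^sub>M lborel). \<not> (P (fst z) \<and> P (snd z))}"
      then have "fst z \<in> N \<or> snd z \<in> N" using N(2) by blast
      then show "z \<in> N \<times> UNIV \<union> UNIV \<times> N" by (auto simp: mem_Times_iff)
    qed
  qed
qed

lemma nn_integral_lborel_pair:
  fixes F :: "'a::euclidean_space \<Rightarrow> 'a \<Rightarrow> ennreal"
  assumes [measurable]: "(\<lambda>z. F (fst z) (snd z)) \<in> borel_measurable (lborel \<Otimes>\<^sub>M lborel)"
  shows "(\<integral>\<^sup>+z. F (fst z) (snd z) \<partial>(lborel \<Otimes>\<^sub>M lborel)) = (\<integral>\<^sup>+x. \<integral>\<^sup>+y. F x y \<partial>lborel \<partial>lborel)"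
    and "(\<integral>\<^sup>+z. F (fst z) (snd z) \<partial>(lborel \<Otimes>\<^sub>M lborel)) = (\<integral>\<^sup>+x. \<integral>\<^sup>+y. F y x \<partial>lborel \<partial>lborel)"
  using lborel.nn_integral_fst[OF assms] lborel_pair.nn_integral_snd[of "\<lambda>z. F (fst z) (snd z)"] assms
  by auto

lemma nn_integral_reflect:
  fixes g :: "'a::euclidean_space \<Rightarrow> ennreal"
  assumes "g \<in> borel_measurable borel"
  shows "(\<integral>\<^sup>+y. g (x - y) \<partial>lborel) = (\<integral>\<^sup>+y. g y \<partial>lborel)"
  using nn_integral_lborel_affine[OF assms, of "-1" x] by simp

section \<open>The cutoff and its interaction with the kernel\<close>

definition cutoff :: "'a::euclidean_space \<Rightarrow> real" where
  "cutoff x = max 0 (min 1 (4 - 2 * norm x))"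

lemma cutoff_range: "0 \<le> cutoff x" "cutoff x \<le> 1"
  by (auto simp: cutoff_def)

lemma cutoff_eq_1: "norm x \<le> 3 / 2 \<Longrightarrow> cutoff x = 1"
  by (auto simp: cutoff_def)

lemma cutoff_eq_0: "2 \<le> norm x \<Longrightarrow> cutoff x = 0"
  by (auto simp: cutoff_def)

lemma cutoff_diff_le: "\<bar>cutoff x - cutoff y\<bar> \<le> 2 * norm (x - y)"
proof -
  have "\<bar>norm x - norm y\<bar> \<le> norm (x - y)" by (rule norm_triangle_ineq3)
  then show ?thesis by (auto simp: cutoff_def max_def min_def abs_if split: if_splits)
qed

lemma cutoff_diff_le_1: "\<bar>cutoff x - cutoff y\<bar> \<le> 1"
  using cutoff_range[of x] cutoff_range[of y] by linarith

lemma cutoff_measurable [measurable]: "cutoff \<in> borel_measurable borel"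
  unfolding cutoff_def by measurable

lemma Jp_measurable [measurable]:
  "f \<in> borel_measurable M \<Longrightarrow> (\<lambda>x. Jp p (f x)) \<in> borel_measurable M"
  unfolding Jp_def by measurable

text \<open>The argument \<open>T\<close> ties the locale to the type \<open>'a\<close>. Its
  dimension is repeated as a real number \<open>N\<close> because it occurs in exponents
  throughout.\<close>

locale weighted_kernel =
  fixes s p \<beta> N :: real and T :: "'a::euclidean_space itself"
  assumes N_def: "N = real DIM('a)"
    and s_pos: "0 < s" and s_less: "s < 1" and p_gt: "1 < p" and p_less: "p < N"
    and ps_less: "p * s < N"
    and \<beta>_nonneg: "0 \<le> \<beta>" and \<beta>_less: "\<beta> < (N - p * s) / 2"
begin

abbreviation K :: "'a \<Rightarrow> 'a \<Rightarrow> real" where "K \<equiv> knu s p \<beta>"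
abbreviation M2 :: "('a \<times> 'a) measure" where "M2 \<equiv> lborel \<Otimes>\<^sub>M lborel"

definition gag :: "('a \<Rightarrow> real) \<Rightarrow> ennreal" where
  "gag f = (\<integral>\<^sup>+z. ennreal (\<bar>f (fst z) - f (snd z)\<bar> powr p * K (fst z) (snd z)) \<partial>M2)"

definition form_integrand :: "('a \<Rightarrow> real) \<Rightarrow> ('a \<Rightarrow> real) \<Rightarrow> 'a \<times> 'a \<Rightarrow> real" where
  "form_integrand v f z = Jp p (v (fst z) - v (snd z)) * (f (fst z) - f (snd z)) * K (fst z) (snd z)"

definition form :: "('a \<Rightarrow> real) \<Rightarrow> ('a \<Rightarrow> real) \<Rightarrow> real" where
  "form v f = (\<integral>z. form_integrand v f z \<partial>M2)"

lemma ps_pos: "0 < p * s" using p_gt s_pos by simp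
lemma ps_less_p: "p * s < p" using p_gt s_less s_pos by (simp add: mult_less_cancel_left1)
lemma \<beta>_less_N: "\<beta> < N" "2 * \<beta> < N" using \<beta>_less \<beta>_nonneg ps_pos by (auto simp: field_simps)

lemma K_eq: "K x y = norm (x - y) powr (- (N + p * s)) * norm x powr (- \<beta>) * norm y powr (- \<beta>)"
  unfolding knu_def N_def[symmetric] powr_minus_divide by simp

lemma K_nonneg [simp]: "0 \<le> K x y" by (simp add: K_eq)

lemma K_sym: "K x y = K y x" by (simp add: K_eq norm_minus_commute mult_ac)

lemma K_measurable [measurable]:
  assumes [measurable]: "f \<in> borel_measurable M" "g \<in> borel_measurable M"
  shows "(\<lambda>z. K (f z) (g z)) \<in> borel_measurable M"
  unfolding K_eq by measurable

lemma weight_le_1: "1 \<le> a \<Longrightarrow> a powr (- \<beta>) \<le> 1"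
  using powr_mono2'[of "- \<beta>" 1 a] \<beta>_nonneg by simp

lemma form_integrand_measurable [measurable]:
  assumes [measurable]: "v \<in> borel_measurable borel" "f \<in> borel_measurable borel"
  shows "form_integrand v f \<in> borel_measurable M2"
  unfolding form_integrand_def by measurable

lemma K_scale:
  assumes "0 < c"
  shows "K (c *\<^sub>R x) (c *\<^sub>R y) = c powr (- (N + p * s + 2 * \<beta>)) * K x y"
proof -
  have "norm (c *\<^sub>R x - c *\<^sub>R y) = c * norm (x - y)"
    using assms by (simp add: scaleR_diff_right[symmetric])
  then have "K (c *\<^sub>R x) (c *\<^sub>R y) = (c powr (- (N + p * s)) * c powr (- \<beta>) * c powr (- \<beta>)) * K x y"
    using assms by (simp add: K_eq powr_mult mult_ac)
  also have "c powr (- (N + p * s)) * c powr (- \<beta>) * c powr (- \<beta>) = c powr (- (N + p * s + 2 * \<beta>))"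
    using assms by (simp add: powr_add[symmetric])
  finally show ?thesis .
qed

text \<open>For y in the unit ball the distance factor is bounded and the weight at y is integrable;
  outside the unit ball the weight at y is at most 1 and the distance factor is integrable at
  infinity. The weight at x survives as a factor in both cases.\<close>

lemma far_kernel_bound:
  "\<exists>C>0. \<forall>x. (\<integral>\<^sup>+y. ennreal (indicator {y. 1 / 4 \<le> norm (x - y)} y * K x y) \<partial>lborel) \<le> ennreal (C * norm x powr (- \<beta>))"
proof -
  let ?a = "N + p * s"
  define I1 where "I1 = (\<integral>\<^sup>+y\<in>ball 0 1. ennreal (norm (y::'a) powr (- \<beta>)) \<partial>lborel)"
  define I2 where "I2 = (\<integral>\<^sup>+y\<in>{y. 1 / 4 \<le> norm y}. ennreal (norm (y::'a) powr (- ?a)) \<partial>lborel)"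
  have fin: "I1 < \<infinity>" "I2 < \<infinity>"
    unfolding I1_def I2_def using \<beta>_nonneg \<beta>_less_N ps_pos N_def
    by (intro nn_integral_norm_powr_ball nn_integral_norm_powr_outside; simp)+
  define C where "C = enn2real (ennreal (4 powr ?a) * I1 + I2) + 1"
  have C0: "C > 0" by (simp add: C_def add_nonneg_pos)
  have C: "ennreal (4 powr ?a) * I1 + I2 \<le> ennreal C"
  proof -
    have "ennreal (4 powr ?a) * I1 + I2 < \<infinity>" using fin by (simp add: ennreal_mult_less_top)
    then have "ennreal (4 powr ?a) * I1 + I2 = ennreal (enn2real (ennreal (4 powr ?a) * I1 + I2))" by simp
    also have "\<dots> \<le> ennreal C" unfolding C_def by (intro ennreal_leI) simp
    finally show ?thesis .
  qed
  have "(\<integral>\<^sup>+y. ennreal (indicator {y. 1 / 4 \<le> norm (x - y)} y * K x y) \<partial>lborel) \<le> ennreal (C * norm x powr (- \<beta>))" for x :: 'a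
  proof -
    have "(\<integral>\<^sup>+y. ennreal (indicator {y. 1 / 4 \<le> norm (x - y)} y * K x y) \<partial>lborel)
      \<le> (\<integral>\<^sup>+y. ennreal (norm x powr (- \<beta>)) * (ennreal (4 powr ?a) * (ennreal (norm y powr (- \<beta>)) * indicator (ball 0 1) y)
            + ennreal (norm (x - y) powr (- ?a)) * indicator {y. 1 / 4 \<le> norm y} (x - y)) \<partial>lborel)"
    proof (rule nn_integral_mono)
      fix y :: 'a
      show "ennreal (indicator {y. 1 / 4 \<le> norm (x - y)} y * K x y)
        \<le> ennreal (norm x powr (- \<beta>)) * (ennreal (4 powr ?a) * (ennreal (norm y powr (- \<beta>)) * indicator (ball 0 1) y)
            + ennreal (norm (x - y) powr (- ?a)) * indicator {y. 1 / 4 \<le> norm y} (x - y))"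
      proof (cases "1 / 4 \<le> norm (x - y)")
        case far: True
        show ?thesis
        proof (cases "norm y < 1")
          case True
          have "norm (x - y) powr (- ?a) \<le> (1 / 4) powr (- ?a)"
            using far ps_pos p_gt p_less by (intro powr_mono2') auto
          also have "\<dots> = 4 powr ?a" unfolding powr_minus by (simp add: powr_divide)
          finally have "K x y \<le> norm x powr (- \<beta>) * (4 powr ?a * norm y powr (- \<beta>))"
            unfolding K_eq by (auto simp: mult_ac intro!: mult_left_mono)
          then have "ennreal (K x y) \<le> ennreal (norm x powr (- \<beta>)) * (ennreal (4 powr ?a) * ennreal (norm y powr (- \<beta>)))"
            by (simp add: ennreal_mult[symmetric] ennreal_leI)
          also have "\<dots> \<le> ennreal (norm x powr (- \<beta>)) * (ennreal (4 powr ?a) * ennreal (norm y powr (- \<beta>)) + ennreal (norm (x - y) powr (- ?a)))"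
            by (intro mult_left_mono) auto
          finally show ?thesis using True far by simp
        next
          case False
          have "norm y powr (- \<beta>) \<le> 1"
            using False by (intro weight_le_1) auto
          then have "K x y \<le> norm x powr (- \<beta>) * norm (x - y) powr (- ?a)"
            unfolding K_eq by (subst mult.assoc, subst mult.left_commute) (intro mult_left_mono mult_left_le, auto)
          then show ?thesis using False far by (simp add: ennreal_mult[symmetric] ennreal_leI)
        qed
      qed simp
    qed
    also have "\<dots> = ennreal (norm x powr (- \<beta>)) * (ennreal (4 powr ?a) * I1 + I2)"
    proof -
      define g1 where "g1 y = ennreal (norm y powr (- \<beta>)) * indicator (ball 0 1) y" for y :: 'a
      define g2 where "g2 y = ennreal (norm y powr (- ?a)) * indicator {y. 1 / 4 \<le> norm y} y" for y :: 'a
      have [measurable]: "ball (0::'a) 1 \<in> sets borel" "{y::'a. 1 / 4 \<le> norm y} \<in> sets borel" by auto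
      have [measurable]: "g1 \<in> borel_measurable borel" "g2 \<in> borel_measurable borel"
        unfolding g1_def g2_def by measurable
      have [measurable]: "(\<lambda>y. g2 (x - y)) \<in> borel_measurable borel" by measurable
      have "(\<integral>\<^sup>+y. ennreal (norm x powr (- \<beta>)) * (ennreal (4 powr ?a) * g1 y + g2 (x - y)) \<partial>lborel)
        = ennreal (norm x powr (- \<beta>)) * (ennreal (4 powr ?a) * (\<integral>\<^sup>+y. g1 y \<partial>lborel) + (\<integral>\<^sup>+y. g2 (x - y) \<partial>lborel))"
        by (simp add: nn_integral_cmult nn_integral_add)
      also have "(\<integral>\<^sup>+y. g2 (x - y) \<partial>lborel) = (\<integral>\<^sup>+y. g2 y \<partial>lborel)"
        by (rule nn_integral_reflect) simp
      finally show ?thesis unfolding g1_def g2_def I1_def I2_def .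
    qed
    also have "ennreal (norm x powr (- \<beta>)) * (ennreal (4 powr ?a) * I1 + I2) \<le> ennreal (norm x powr (- \<beta>)) * ennreal C"
      by (intro mult_left_mono C) auto
    also have "\<dots> = ennreal (C * norm x powr (- \<beta>))"
      using C0 by (simp add: ennreal_mult[symmetric] mult.commute)
    finally show ?thesis .
  qed
  moreover have "C > 0" by (simp add: C_def add_nonneg_pos)
  ultimately show ?thesis by blast
qed

text \<open>The cutoff is constant near the origin, so near pairs on which it varies never see the
  singular weight.\<close>

lemma cutoff_near_weight:
  assumes "cutoff x \<noteq> cutoff y" "norm (x - y) < 1 / 4"
  shows "1 \<le> norm (x::'a)" "1 \<le> norm y"
proof -
  have "\<bar>norm x - norm y\<bar> \<le> norm (x - y)" by (rule norm_triangle_ineq3)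
  moreover have "3 / 2 < norm x \<or> 3 / 2 < norm y"
    using assms(1) cutoff_eq_1 by (metis not_le)
  ultimately show "1 \<le> norm x" "1 \<le> norm y" using assms(2) by auto
qed

text \<open>The bound is uniform in x, without the weight at x. The Lipschitz estimate lowers the
  singularity to order N + ps - p, which is below N since s < 1. The weights are at most 1 where the
  cutoff varies.\<close>

lemma near_cutoff_bound:
  "\<exists>C>0. \<forall>x::'a. (\<integral>\<^sup>+y. ennreal (indicator {y. norm (x - y) < 1 / 4} y * (\<bar>cutoff x - cutoff y\<bar> powr p * K x y)) \<partial>lborel) \<le> ennreal C"
proof -
  let ?a = "N + p * s - p"
  define I where "I = (\<integral>\<^sup>+y\<in>ball 0 (1 / 4). ennreal (norm (y::'a) powr (- ?a)) \<partial>lborel)"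
  have fin: "I < \<infinity>"
    unfolding I_def using p_less ps_pos ps_less_p N_def
    by (intro nn_integral_norm_powr_ball) auto
  define C where "C = enn2real (ennreal (2 powr p) * I) + 1"
  have C: "ennreal (2 powr p) * I \<le> ennreal C"
  proof -
    have "ennreal (2 powr p) * I < \<infinity>" using fin by (simp add: ennreal_mult_less_top)
    then have "ennreal (2 powr p) * I = ennreal (enn2real (ennreal (2 powr p) * I))" by simp
    also have "\<dots> \<le> ennreal C" unfolding C_def by (intro ennreal_leI) simp
    finally show ?thesis .
  qed
  have "(\<integral>\<^sup>+y. ennreal (indicator {y. norm (x - y) < 1 / 4} y * (\<bar>cutoff x - cutoff y\<bar> powr p * K x y)) \<partial>lborel) \<le> ennreal C" for x :: 'a
  proof -
    have "(\<integral>\<^sup>+y. ennreal (indicator {y. norm (x - y) < 1 / 4} y * (\<bar>cutoff x - cutoff y\<bar> powr p * K x y)) \<partial>lborel)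
      \<le> (\<integral>\<^sup>+y. ennreal (2 powr p) * (ennreal (norm (x - y) powr (- ?a)) * indicator (ball 0 (1 / 4)) (x - y)) \<partial>lborel)"
    proof (rule nn_integral_mono)
      fix y :: 'a
      show "ennreal (indicator {y. norm (x - y) < 1 / 4} y * (\<bar>cutoff x - cutoff y\<bar> powr p * K x y))
         \<le> ennreal (2 powr p) * (ennreal (norm (x - y) powr (- ?a)) * indicator (ball 0 (1 / 4)) (x - y))"
      proof (cases "norm (x - y) < 1 / 4 \<and> cutoff x \<noteq> cutoff y")
        case True
        then have xy: "1 \<le> norm x" "1 \<le> norm y" using cutoff_near_weight by auto
        have w: "norm x powr (- \<beta>) \<le> 1" "norm y powr (- \<beta>) \<le> 1"
          using xy by (auto intro!: weight_le_1)
        have "\<bar>cutoff x - cutoff y\<bar> powr p * K x y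
            \<le> (2 * norm (x - y)) powr p * (norm (x - y) powr (- (N + p * s)) * 1 * 1)"
          unfolding K_eq using w p_gt by (intro mult_mono powr_mono2[of p] cutoff_diff_le order_refl) auto
        also have "\<dots> = 2 powr p * norm (x - y) powr (- ?a)"
          by (simp add: powr_mult powr_add[symmetric] algebra_simps)
        finally have "ennreal (\<bar>cutoff x - cutoff y\<bar> powr p * K x y) \<le> ennreal (2 powr p) * ennreal (norm (x - y) powr (- ?a))"
          by (subst ennreal_mult[symmetric]) (auto intro: ennreal_leI)
        moreover have "indicator (ball 0 (1 / 4)) (x - y) = (1::ennreal)" "indicator {y. norm (x - y) < 1 / 4} y = (1::real)"
          using True by auto
        ultimately show ?thesis by simp
      qed (auto simp: indicator_def)
    qed
    also have "\<dots> = ennreal (2 powr p) * I"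
    proof -
      define g where "g y = ennreal (norm y powr (- ?a)) * indicator (ball 0 (1 / 4)) y" for y :: 'a
      have [measurable]: "ball (0::'a) (1 / 4) \<in> sets borel" by simp
      have [measurable]: "g \<in> borel_measurable borel" unfolding g_def by measurable
      have "(\<integral>\<^sup>+y. ennreal (2 powr p) * g (x - y) \<partial>lborel) = ennreal (2 powr p) * (\<integral>\<^sup>+y. g (x - y) \<partial>lborel)"
        by (rule nn_integral_cmult) measurable
      also have "(\<integral>\<^sup>+y. g (x - y) \<partial>lborel) = (\<integral>\<^sup>+y. g y \<partial>lborel)"
        by (rule nn_integral_reflect) simp
      finally show ?thesis unfolding g_def I_def .
    qed
    also note C
    finally show ?thesis .
  qed
  moreover have "C > 0" by (simp add: C_def add_nonneg_pos)
  ultimately show ?thesis by blast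
qed

lemma cutoff_kernel_bound:
  "\<exists>C>0. \<forall>x::'a. (\<integral>\<^sup>+y. ennreal (\<bar>cutoff x - cutoff y\<bar> powr p * K x y) \<partial>lborel) \<le> ennreal (C * (1 + norm x powr (- \<beta>)))"
proof -
  obtain C1 where C1: "C1 > 0" "\<And>x::'a. (\<integral>\<^sup>+y. ennreal (indicator {y. norm (x - y) < 1 / 4} y * (\<bar>cutoff x - cutoff y\<bar> powr p * K x y)) \<partial>lborel) \<le> ennreal C1"
    using near_cutoff_bound by blast
  obtain C2 where C2: "C2 > 0" "\<And>x::'a. (\<integral>\<^sup>+y. ennreal (indicator {y. 1 / 4 \<le> norm (x - y)} y * K x y) \<partial>lborel) \<le> ennreal (C2 * norm x powr (- \<beta>))"
    using far_kernel_bound by blast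
  have "(\<integral>\<^sup>+y. ennreal (\<bar>cutoff x - cutoff y\<bar> powr p * K x y) \<partial>lborel) \<le> ennreal (max C1 C2 * (1 + norm x powr (- \<beta>)))" for x :: 'a
  proof -
    have "(\<integral>\<^sup>+y. ennreal (\<bar>cutoff x - cutoff y\<bar> powr p * K x y) \<partial>lborel)
      \<le> (\<integral>\<^sup>+y. ennreal (indicator {y. norm (x - y) < 1 / 4} y * (\<bar>cutoff x - cutoff y\<bar> powr p * K x y))
           + ennreal (indicator {y. 1 / 4 \<le> norm (x - y)} y * K x y) \<partial>lborel)"
    proof (rule nn_integral_mono)
      fix y :: 'a
      have "\<bar>cutoff x - cutoff y\<bar> powr p \<le> 1 powr p"
        using p_gt cutoff_diff_le_1 by (intro powr_mono2) auto
      then have "\<bar>cutoff x - cutoff y\<bar> powr p * K x y \<le> K x y" by (simp add: mult_left_le_one_le)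
      then show "ennreal (\<bar>cutoff x - cutoff y\<bar> powr p * K x y)
        \<le> ennreal (indicator {y. norm (x - y) < 1 / 4} y * (\<bar>cutoff x - cutoff y\<bar> powr p * K x y))
           + ennreal (indicator {y. 1 / 4 \<le> norm (x - y)} y * K x y)"
        by (cases "norm (x - y) < 1 / 4") (auto intro: ennreal_leI)
    qed
    also have "\<dots> \<le> ennreal C1 + ennreal (C2 * norm x powr (- \<beta>))"
      using C1(2) C2(2) by (subst nn_integral_add) (auto intro!: add_mono)
    also have "\<dots> = ennreal (C1 + C2 * norm x powr (- \<beta>))"
      using C1 C2 by (intro ennreal_plus[symmetric]) auto
    also have "\<dots> \<le> ennreal (max C1 C2 * (1 + norm x powr (- \<beta>)))"
      by (intro ennreal_leI) (auto simp: distrib_left intro!: add_mono mult_right_mono)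
    finally show ?thesis .
  qed
  then show ?thesis using C1 by (intro exI[of _ "max C1 C2"]) auto
qed

lemma nn_integral_weight_ball: "0 < R \<Longrightarrow> (\<integral>\<^sup>+x\<in>ball 0 R. ennreal (1 + norm (x::'a) powr (- \<beta>)) \<partial>lborel) < \<infinity>"
proof -
  assume R: "0 < R"
  have "(\<integral>\<^sup>+x\<in>ball 0 R. ennreal (1 + norm (x::'a) powr (- \<beta>)) \<partial>lborel)
     = emeasure lborel (ball (0::'a) R) + (\<integral>\<^sup>+x\<in>ball 0 R. ennreal (norm (x::'a) powr (- \<beta>)) \<partial>lborel)"
  proof -
    have m: "ball (0::'a) R \<in> sets lborel" by simp
    have "(\<integral>\<^sup>+x\<in>ball 0 R. ennreal (1 + norm (x::'a) powr (- \<beta>)) \<partial>lborel)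
       = (\<integral>\<^sup>+x. indicator (ball 0 R) x + ennreal (norm (x::'a) powr (- \<beta>)) * indicator (ball 0 R) x \<partial>lborel)"
      by (simp add: ennreal_plus distrib_right)
    also have "\<dots> = (\<integral>\<^sup>+x. indicator (ball (0::'a) R) x \<partial>lborel) + (\<integral>\<^sup>+x\<in>ball 0 R. ennreal (norm (x::'a) powr (- \<beta>)) \<partial>lborel)"
      by (rule nn_integral_add) (intro borel_measurable_times_ennreal borel_measurable_indicator m measurable_compose[OF _ measurable_ennreal]; measurable)+
    finally show ?thesis using nn_integral_indicator[OF m] by (simp only:)
  qed
  also have "\<dots> < \<infinity>"
    using nn_integral_norm_powr_ball[of \<beta> R, where 'a='a] R \<beta>_nonneg \<beta>_less_N N_def
    by (simp add: emeasure_ball)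
  finally show ?thesis .
qed

text \<open>A pair contributes only if one of its points lies in the ball of radius 2; by symmetry
  that point can be taken as the outer variable.\<close>

lemma gag_cutoff: "gag cutoff < \<infinity>"
proof -
  obtain C where C: "C > 0" "\<And>x::'a. (\<integral>\<^sup>+y. ennreal (\<bar>cutoff x - cutoff y\<bar> powr p * K x y) \<partial>lborel) \<le> ennreal (C * (1 + norm x powr (- \<beta>)))"
    using cutoff_kernel_bound by blast
  let ?h = "\<lambda>x y::'a. \<bar>cutoff x - cutoff y\<bar> powr p * K x y"
  let ?F = "\<lambda>x y::'a. indicator (ball 0 2) x * ennreal (?h x y)"
  have [measurable]: "ball (0::'a) 2 \<in> sets borel" by simp
  have "gag cutoff \<le> (\<integral>\<^sup>+z. ?F (fst z) (snd z) + ?F (snd z) (fst z) \<partial>M2)"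
    unfolding gag_def
  proof (rule nn_integral_mono)
    fix z :: "'a \<times> 'a"
    show "ennreal (?h (fst z) (snd z)) \<le> ?F (fst z) (snd z) + ?F (snd z) (fst z)"
      using cutoff_eq_0[of "fst z"] cutoff_eq_0[of "snd z"] p_gt K_sym[of "fst z" "snd z"]
      by (cases "norm (fst z) < 2"; cases "norm (snd z) < 2") (auto simp: abs_minus_commute)
  qed
  also have "\<dots> = (\<integral>\<^sup>+z. ?F (fst z) (snd z) \<partial>M2) + (\<integral>\<^sup>+z. ?F (snd z) (fst z) \<partial>M2)"
    by (rule nn_integral_add) measurable
  also have "(\<integral>\<^sup>+z. ?F (snd z) (fst z) \<partial>M2) = (\<integral>\<^sup>+x. \<integral>\<^sup>+y. ?F x y \<partial>lborel \<partial>lborel)"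
    by (rule nn_integral_lborel_pair(2)) measurable
  also have "(\<integral>\<^sup>+z. ?F (fst z) (snd z) \<partial>M2) = (\<integral>\<^sup>+x. \<integral>\<^sup>+y. ?F x y \<partial>lborel \<partial>lborel)"
    by (rule nn_integral_lborel_pair(1)) measurable
  also have "(\<integral>\<^sup>+x. \<integral>\<^sup>+y. ?F x y \<partial>lborel \<partial>lborel) \<le> (\<integral>\<^sup>+x. ennreal C * (ennreal (1 + norm (x::'a) powr (- \<beta>)) * indicator (ball 0 2) x) \<partial>lborel)"
  proof (rule nn_integral_mono)
    fix x :: 'a
    have "(\<integral>\<^sup>+y. ?F x y \<partial>lborel) = indicator (ball 0 2) x * (\<integral>\<^sup>+y. ennreal (?h x y) \<partial>lborel)"
      by (rule nn_integral_cmult) measurable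
    also have "\<dots> \<le> indicator (ball 0 2) x * ennreal (C * (1 + norm x powr (- \<beta>)))"
      by (intro mult_left_mono C) auto
    also have "\<dots> = ennreal C * (ennreal (1 + norm x powr (- \<beta>)) * indicator (ball 0 2) x)"
      using C(1) by (simp add: ennreal_mult mult_ac)
    finally show "(\<integral>\<^sup>+y. ?F x y \<partial>lborel) \<le> ennreal C * (ennreal (1 + norm x powr (- \<beta>)) * indicator (ball 0 2) x)" .
  qed
  also have "\<dots> = ennreal C * (\<integral>\<^sup>+x\<in>ball 0 2. ennreal (1 + norm (x::'a) powr (- \<beta>)) \<partial>lborel)"
    by (rule nn_integral_cmult) measurable
  finally have "gag cutoff \<le> ennreal C * (\<integral>\<^sup>+x\<in>ball 0 2. ennreal (1 + norm (x::'a) powr (- \<beta>)) \<partial>lborel)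
     + ennreal C * (\<integral>\<^sup>+x\<in>ball 0 2. ennreal (1 + norm (x::'a) powr (- \<beta>)) \<partial>lborel)"
    by (simp add: add_mono)
  also have "\<dots> < \<infinity>" using nn_integral_weight_ball[of 2] by (simp add: ennreal_mult_less_top)
  finally show ?thesis .
qed

section \<open>Functions of finite energy and the nonlocal form\<close>

lemma gag_le_add:
  assumes [measurable]: "f \<in> borel_measurable borel" "g \<in> borel_measurable borel"
    and le: "\<And>x y. \<bar>h x - h y\<bar> \<le> \<bar>f x - f y\<bar> + \<bar>g x - g y\<bar>"
  shows "gag h \<le> ennreal (2 powr p) * (gag f + gag g)"
proof -
  have "gag h \<le> (\<integral>\<^sup>+z. ennreal (2 powr p) * (ennreal (\<bar>f (fst z) - f (snd z)\<bar> powr p * K (fst z) (snd z))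
      + ennreal (\<bar>g (fst z) - g (snd z)\<bar> powr p * K (fst z) (snd z))) \<partial>M2)"
    unfolding gag_def
  proof (rule nn_integral_mono)
    fix z :: "'a \<times> 'a"
    let ?a = "\<bar>f (fst z) - f (snd z)\<bar>" and ?b = "\<bar>g (fst z) - g (snd z)\<bar>" and ?k = "K (fst z) (snd z)"
    have "\<bar>h (fst z) - h (snd z)\<bar> powr p \<le> \<bar>?a + ?b\<bar> powr p"
      using le[of "fst z" "snd z"] p_gt by (intro powr_mono2) auto
    also have "\<dots> \<le> 2 powr p * (?a powr p + ?b powr p)"
      using powr_abs_add_le[of p ?a ?b] p_gt by simp
    finally have "\<bar>h (fst z) - h (snd z)\<bar> powr p * ?k \<le> 2 powr p * (?a powr p + ?b powr p) * ?k"
      by (rule mult_right_mono) simp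
    also have "\<dots> = 2 powr p * (?a powr p * ?k + ?b powr p * ?k)" by (simp add: algebra_simps)
    finally show "ennreal (\<bar>h (fst z) - h (snd z)\<bar> powr p * ?k) \<le> ennreal (2 powr p) * (ennreal (?a powr p * ?k) + ennreal (?b powr p * ?k))"
      by (simp add: ennreal_mult[symmetric] ennreal_plus[symmetric] ennreal_leI del: ennreal_plus)
  qed
  also have "\<dots> = ennreal (2 powr p) * (gag f + gag g)"
    unfolding gag_def by (simp add: nn_integral_cmult nn_integral_add)
  finally show ?thesis .
qed

lemma gag_finite_add:
  assumes "f \<in> borel_measurable borel" "g \<in> borel_measurable borel"
    and "\<And>x y. \<bar>h x - h y\<bar> \<le> \<bar>f x - f y\<bar> + \<bar>g x - g y\<bar>" "gag f < \<infinity>" "gag g < \<infinity>"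
  shows "gag h < \<infinity>"
  using gag_le_add[OF assms(1-3)] assms(4,5)
  by (auto simp: ennreal_mult_less_top intro: le_less_trans)

lemma gag_integrable:
  assumes [measurable]: "f \<in> borel_measurable borel" and "gag f < \<infinity>"
  shows "integrable M2 (\<lambda>z. \<bar>f (fst z) - f (snd z)\<bar> powr p * K (fst z) (snd z))"
  using assms unfolding gag_def by (intro integrableI_nonneg) auto

lemma form_integrable:
  assumes [measurable]: "v \<in> borel_measurable borel" "f \<in> borel_measurable borel"
    and "gag v < \<infinity>" "gag f < \<infinity>"
  shows "integrable M2 (form_integrand v f)"
proof (rule Bochner_Integration.integrable_bound)
  show "integrable M2 (\<lambda>z. \<bar>v (fst z) - v (snd z)\<bar> powr p * K (fst z) (snd z) + \<bar>f (fst z) - f (snd z)\<bar> powr p * K (fst z) (snd z))"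
    using assms by (intro Bochner_Integration.integrable_add gag_integrable)
  show "AE z in M2. norm (form_integrand v f z) \<le> norm (\<bar>v (fst z) - v (snd z)\<bar> powr p * K (fst z) (snd z) + \<bar>f (fst z) - f (snd z)\<bar> powr p * K (fst z) (snd z))"
  proof (rule AE_I2)
    fix z :: "'a \<times> 'a"
    let ?v = "v (fst z) - v (snd z)" and ?f = "f (fst z) - f (snd z)"
    have "\<bar>Jp p ?v * ?f\<bar> * K (fst z) (snd z) \<le> (\<bar>?v\<bar> powr p + \<bar>?f\<bar> powr p) * K (fst z) (snd z)"
      by (intro mult_right_mono abs_Jp_mult_le p_gt) simp
    then show "norm (form_integrand v f z) \<le> norm (\<bar>?v\<bar> powr p * K (fst z) (snd z) + \<bar>?f\<bar> powr p * K (fst z) (snd z))"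
      by (simp add: form_integrand_def abs_mult distrib_right)
  qed
qed measurable

end

text \<open>Where the increment of \<open>f n - g\<close> is at most \<open>L\<close> times that of \<open>v\<close>, dominated convergence
  applies; elsewhere the integrand is at most \<open>L\<^sup>1\<^sup>-\<^sup>p\<close> times the energy density of \<open>f n - g\<close>.\<close>

lemma (in weighted_kernel) form_tendsto:
  assumes [measurable]: "v \<in> borel_measurable borel" "\<And>n. f n \<in> borel_measurable borel" "g \<in> borel_measurable borel"
    and gv: "gag v < \<infinity>" and gg: "gag g < \<infinity>" and gf: "\<And>n. gag (f n) \<le> ennreal B"
    and lim: "AE x in lborel. (\<lambda>n. f n x) \<longlonglongrightarrow> g x"
  shows "(\<lambda>n. form v (f n)) \<longlonglongrightarrow> form v g"
proof -
  define d where "d n x = f n x - g x" for n x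
  define D where "D n z = \<bar>d n (fst z) - d n (snd z)\<bar>" for n z
  define w where "w z = \<bar>v (fst z) - v (snd z)\<bar>" for z
  define k where "k z = K (fst z) (snd z)" for z
  have [measurable]: "d n \<in> borel_measurable borel" for n unfolding d_def by measurable
  have [measurable]: "D n \<in> borel_measurable M2" "w \<in> borel_measurable M2" "k \<in> borel_measurable M2" for n
    unfolding D_def w_def k_def by measurable
  have k0: "0 \<le> k z" and w0: "0 \<le> w z" and D0: "0 \<le> D n z" for z n by (auto simp: k_def w_def D_def)
  define B' where "B' = 2 powr p * (\<bar>B\<bar> + enn2real (gag g))"
  have B'0: "0 \<le> B'" by (simp add: B'_def)
  have gd: "gag (d n) \<le> ennreal B'" for n
  proof -
    have "gag (d n) \<le> ennreal (2 powr p) * (gag (f n) + gag g)"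
      by (rule gag_le_add) (auto simp: d_def)
    also have "\<dots> \<le> ennreal (2 powr p) * (ennreal \<bar>B\<bar> + ennreal (enn2real (gag g)))"
      using gf[of n] gg by (intro mult_left_mono add_mono) (auto intro: order_trans ennreal_leI)
    also have "\<dots> = ennreal B'"
      by (simp add: B'_def ennreal_mult[symmetric] ennreal_plus[symmetric] del: ennreal_plus)
    finally show ?thesis .
  qed
  have gd_fin: "gag (d n) < \<infinity>" for n using gd[of n] by (metis ennreal_less_top infinity_ennreal_def le_less_trans)
  have gf_fin: "gag (f n) < \<infinity>" for n using gf[of n] by (metis ennreal_less_top infinity_ennreal_def le_less_trans)
  have intD: "integrable M2 (\<lambda>z. D n z powr p * k z)" for n
    unfolding D_def k_def by (rule gag_integrable[OF _ gd_fin]) simp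
  have intw: "integrable M2 (\<lambda>z. w z powr p * k z)"
    unfolding w_def k_def by (rule gag_integrable[OF _ gv]) simp
  have IB: "(\<integral>z. D n z powr p * k z \<partial>M2) \<le> B'" for n
  proof -
    have "ennreal (\<integral>z. D n z powr p * k z \<partial>M2) = (\<integral>\<^sup>+z. ennreal (D n z powr p * k z) \<partial>M2)"
      by (rule nn_integral_eq_integral[symmetric, OF intD]) (simp add: k0)
    also have "\<dots> = gag (d n)" by (simp add: gag_def D_def k_def)
    also note gd
    finally show ?thesis using B'0 by (simp add: ennreal_le_iff)
  qed
  have intE: "integrable M2 (\<lambda>z. w z powr (p - 1) * D n z * k z)" for n
  proof -
    have "(\<lambda>z. w z powr (p - 1) * D n z * k z) = (\<lambda>z. norm (form_integrand v (d n) z))"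
      by (auto simp: form_integrand_def w_def D_def k_def abs_mult abs_Jp)
    then show ?thesis using integrable_norm[OF form_integrable[OF _ _ gv gd_fin[of n]]] by simp
  qed
  have diff: "\<bar>form v (f n) - form v g\<bar> \<le> (\<integral>z. w z powr (p - 1) * D n z * k z \<partial>M2)" for n
  proof -
    have "form v (f n) - form v g = (\<integral>z. form_integrand v (f n) z - form_integrand v g z \<partial>M2)"
      unfolding form_def using gv gg gf_fin by (intro Bochner_Integration.integral_diff[symmetric] form_integrable) auto
    also have "\<dots> = (\<integral>z. form_integrand v (d n) z \<partial>M2)"
      by (intro Bochner_Integration.integral_cong) (auto simp: form_integrand_def d_def algebra_simps)
    also have "\<bar>\<dots>\<bar> \<le> (\<integral>z. norm (form_integrand v (d n) z) \<partial>M2)"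
      using integral_norm_bound[of M2 "form_integrand v (d n)"] by simp
    also have "\<dots> = (\<integral>z. w z powr (p - 1) * D n z * k z \<partial>M2)"
      by (intro Bochner_Integration.integral_cong) (auto simp: form_integrand_def w_def D_def k_def abs_mult abs_Jp)
    finally show ?thesis .
  qed
  have "(\<lambda>n. form v (f n) - form v g) \<longlonglongrightarrow> 0"
  proof (rule tendstoI)
    fix e :: real assume e: "e > 0"
    \<comment> \<open>Chosen so that the part of the integral with large increments, at most
      \<open>B'\<close> times L to the power 1 - p, is at most e/2.\<close>
    define L where "L = (2 * (B' + 1) / e) powr (1 / (p - 1))"
    have L: "L > 0" using e B'0 by (simp add: L_def)
    have Lp: "L powr (p - 1) = 2 * (B' + 1) / e"
      using e B'0 p_gt by (simp add: L_def powr_powr)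
    \<comment> \<open>The integrand with the increment truncated at L times that of v: it has the
      integrable majorant L w^p k and tends to 0 almost everywhere.\<close>
    define m where "m n z = min (D n z) (L * w z) * (w z powr (p - 1) * k z)" for n z
    have mm[measurable]: "m n \<in> borel_measurable M2" for n unfolding m_def by measurable
    have mle: "\<bar>m n z\<bar> \<le> L * (w z powr p * k z)" for n z
    proof -
      have "0 \<le> m n z" using k0 w0 D0 L by (simp add: m_def)
      moreover have "m n z \<le> L * w z * (w z powr (p - 1) * k z)"
        unfolding m_def using k0 by (intro mult_right_mono) auto
      ultimately show ?thesis using powr_mult_self[OF w0, of z p] by (simp add: mult_ac)
    qed
    have mlim: "(\<lambda>n. \<integral>z. m n z \<partial>M2) \<longlonglongrightarrow> (\<integral>z. 0 \<partial>M2)"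
    proof (rule integral_dominated_convergence)
      show "integrable M2 (\<lambda>z. L * (w z powr p * k z))" using intw by simp
      show "AE z in M2. (\<lambda>n. m n z) \<longlonglongrightarrow> 0"
        using AE_pair_fst_snd[OF lim]
      proof eventually_elim
        case (elim z)
        have "(\<lambda>n. D n z) \<longlonglongrightarrow> \<bar>(g (fst z) - g (fst z)) - (g (snd z) - g (snd z))\<bar>"
          unfolding D_def d_def using elim by (intro tendsto_intros) auto
        then have "(\<lambda>n. D n z) \<longlonglongrightarrow> 0" by simp
        then have "(\<lambda>n. m n z) \<longlonglongrightarrow> min 0 (L * w z) * (w z powr (p - 1) * k z)"
          unfolding m_def by (intro tendsto_intros)
        then show ?case using L w0[of z] by simp
      qed
      show "AE z in M2. norm (m n z) \<le> L * (w z powr p * k z)" for n using mle by simp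
    qed (auto intro: mm)
    have intm: "integrable M2 (m n)" for n
      by (rule Bochner_Integration.integrable_bound[of _ "\<lambda>z. L * (w z powr p * k z)"])
        (use intw mm mle[of n] k0 w0 L in \<open>auto\<close>)
    have s1: "(\<integral>z. w z powr (p - 1) * D n z * k z \<partial>M2) \<le> (\<integral>z. m n z + L powr (1 - p) * (D n z powr p * k z) \<partial>M2)" for n
    proof (rule integral_mono)
      show "integrable M2 (\<lambda>z. m n z + L powr (1 - p) * (D n z powr p * k z))"
        using intm intD by simp
      fix z
      show "w z powr (p - 1) * D n z * k z \<le> m n z + L powr (1 - p) * (D n z powr p * k z)"
      proof (cases "D n z \<le> L * w z")
        case True
        then show ?thesis using k0 by (simp add: m_def mult_ac)
      next
        case False
        have "w z \<le> D n z / L" using False L by (simp add: field_simps)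
        then have "w z powr (p - 1) \<le> (D n z / L) powr (p - 1)"
          using w0 p_gt by (intro powr_mono2) auto
        also have "\<dots> = L powr (1 - p) * D n z powr (p - 1)"
          using L D0 by (simp add: powr_divide powr_diff field_simps)
        finally have "w z powr (p - 1) * D n z * k z \<le> L powr (1 - p) * D n z powr (p - 1) * D n z * k z"
          using k0 D0 by (intro mult_right_mono) auto
        also have "\<dots> = L powr (1 - p) * (D n z powr p * k z)"
          using powr_mult_self[OF D0, of n z p] by (simp add: mult.assoc)
        also have "\<dots> \<le> m n z + L powr (1 - p) * (D n z powr p * k z)"
          using k0 w0 D0 L by (simp add: m_def)
        finally show ?thesis .
      qed
    qed (rule intE)
    have s2: "(\<integral>z. m n z + L powr (1 - p) * (D n z powr p * k z) \<partial>M2)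
       \<le> (\<integral>z. m n z \<partial>M2) + L powr (1 - p) * B'" for n
      using intm intD IB[of n] by (simp add: mult_left_mono)
    have s3: "L powr (1 - p) = e / (2 * (B' + 1))"
    proof -
      have "L powr (1 - p) = 1 / L powr (p - 1)" using L by (simp add: powr_minus_divide[symmetric])
      then show ?thesis by (simp add: Lp)
    qed
    have le: "\<bar>form v (f n) - form v g\<bar> \<le> (\<integral>z. m n z \<partial>M2) + e / (2 * (B' + 1)) * B'" for n
      using diff[of n] s1[of n] s2[of n] unfolding s3 by linarith
    have small: "e / (2 * (B' + 1)) * B' \<le> e / 2" using e B'0 by (simp add: field_simps)
    have "\<forall>\<^sub>F n in sequentially. (\<integral>z. m n z \<partial>M2) < e / 2"
      using mlim e by (intro order_tendstoD(2)) auto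
    then show "\<forall>\<^sub>F n in sequentially. dist (form v (f n) - form v g) 0 < e"
    proof eventually_elim
      case (elim n)
      have "\<bar>form v (f n) - form v g\<bar> < e" using le[of n] small elim by linarith
      then show ?case by (simp add: dist_real_def)
    qed
  qed
  then show ?thesis by (simp add: LIM_zero_iff)
qed

section \<open>Scaling, and negligibility of the origin\<close>

context weighted_kernel
begin

text \<open>The scaling exponent of the energy: 2N from the double integral minus the homogeneity N
  + ps + 2 \<beta> of the kernel. It is the exponent of the capacity of a small ball, and its
  positivity says that the origin has capacity zero.\<close>

definition cap_exp :: real where "cap_exp = N - p * s - 2 * \<beta>"

lemma cap_exp_pos: "0 < cap_exp" using \<beta>_less by (simp add: cap_exp_def)

lemma scale_const:
  assumes "0 < c"
  shows "\<bar>c\<bar> ^ DIM('a \<times> 'a) * c powr (- (N + p * s + 2 * \<beta>)) = c powr cap_exp"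
proof -
  have "\<bar>c\<bar> ^ DIM('a \<times> 'a) = c powr (2 * N)"
    using assms by (simp add: N_def powr_realpow[symmetric])
  then show ?thesis using assms by (simp add: powr_add[symmetric] cap_exp_def algebra_simps)
qed

lemma gag_scale:
  assumes [measurable]: "f \<in> borel_measurable borel" and c: "0 < c"
  shows "gag f = ennreal (c powr cap_exp) * gag (\<lambda>x. f (c *\<^sub>R x))"
proof -
  let ?F = "\<lambda>z. ennreal (\<bar>f (fst z) - f (snd z)\<bar> powr p * K (fst z) (snd z))"
  have Fm: "?F \<in> borel_measurable borel"
    unfolding borel_prod[symmetric] by measurable
  have "gag f = (\<integral>\<^sup>+z. ?F z \<partial>lborel)" by (simp add: gag_def lborel_prod)
  also have "\<dots> = ennreal (\<bar>c\<bar> ^ DIM('a \<times> 'a)) * (\<integral>\<^sup>+z. ?F (0 + c *\<^sub>R z) \<partial>lborel)"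
    using c by (intro nn_integral_lborel_affine Fm) auto
  also have "(\<integral>\<^sup>+z. ?F (0 + c *\<^sub>R z) \<partial>lborel) = (\<integral>\<^sup>+z. ennreal (c powr (- (N + p * s + 2 * \<beta>))) *
      ennreal (\<bar>f (c *\<^sub>R fst z) - f (c *\<^sub>R snd z)\<bar> powr p * K (fst z) (snd z)) \<partial>lborel)"
  proof (rule nn_integral_cong)
    fix z :: "'a \<times> 'a"
    show "?F (0 + c *\<^sub>R z) = ennreal (c powr (- (N + p * s + 2 * \<beta>))) *
      ennreal (\<bar>f (c *\<^sub>R fst z) - f (c *\<^sub>R snd z)\<bar> powr p * K (fst z) (snd z))"
      by (subst ennreal_mult[symmetric]) (simp_all add: K_scale[OF c] mult_ac)
  qed
  also have "\<dots> = ennreal (c powr (- (N + p * s + 2 * \<beta>))) * gag (\<lambda>x. f (c *\<^sub>R x))"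
    unfolding gag_def lborel_prod[symmetric] by (rule nn_integral_cmult) measurable
  finally show ?thesis
    using scale_const[OF c] by (simp add: mult.assoc[symmetric] ennreal_mult[symmetric])
qed

lemma form_scale:
  assumes [measurable]: "v \<in> borel_measurable borel" "f \<in> borel_measurable borel" and c: "0 < c"
  shows "form v f = c powr cap_exp * form (\<lambda>x. v (c *\<^sub>R x)) (\<lambda>x. f (c *\<^sub>R x))"
proof -
  have [measurable]: "form_integrand v f \<in> borel_measurable borel"
    using form_integrand_measurable[of v f] by (simp add: lborel_prod)
  have "form v f = (\<integral>z. form_integrand v f z \<partial>lborel)" by (simp add: form_def lborel_prod)
  also have "\<dots> = \<bar>c\<bar> ^ DIM('a \<times> 'a) * (\<integral>z. form_integrand v f (0 + c *\<^sub>R z) \<partial>lborel)"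
    using c by (intro integral_lborel_affine) auto
  also have "(\<integral>z. form_integrand v f (0 + c *\<^sub>R z) \<partial>lborel)
    = (\<integral>z. c powr (- (N + p * s + 2 * \<beta>)) * form_integrand (\<lambda>x. v (c *\<^sub>R x)) (\<lambda>x. f (c *\<^sub>R x)) z \<partial>lborel)"
    by (intro Bochner_Integration.integral_cong) (auto simp: form_integrand_def K_scale[OF c])
  also have "\<dots> = c powr (- (N + p * s + 2 * \<beta>)) * form (\<lambda>x. v (c *\<^sub>R x)) (\<lambda>x. f (c *\<^sub>R x))"
    by (simp add: form_def lborel_prod)
  finally show ?thesis using scale_const[OF c] by (simp add: mult.assoc[symmetric])
qed

text \<open>The class of test functions that remains after approximation. The range [0, 1] loses
  nothing for the two tests to come and gives dominated convergence and integrability for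
  free.\<close>

definition admissible :: "real \<Rightarrow> ('a \<Rightarrow> real) \<Rightarrow> bool" where
  "admissible R f \<longleftrightarrow> f \<in> borel_measurable borel \<and> (\<forall>x. 0 \<le> f x \<and> f x \<le> 1) \<and>
     (\<forall>x. R \<le> norm x \<longrightarrow> f x = 0) \<and> gag f < \<infinity>"

text \<open>Removing shrinking neighbourhoods of the origin keeps the energy bounded and converges
  pointwise away from 0, so nonnegativity of the form passes to the limit. The reduction is needed
  because mollifying is harmless only away from the singular weight.\<close>

lemma form_nonneg_by_origin_cutoff:
  assumes [measurable]: "v \<in> borel_measurable borel" and gv: "gag v < \<infinity>" and f: "admissible R f"
    and pos: "\<And>h c. admissible R h \<Longrightarrow> 0 < c \<Longrightarrow> (\<And>x. norm x < c \<Longrightarrow> h x = 0) \<Longrightarrow> 0 \<le> form v h"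
  shows "0 \<le> form v f"
proof -
  have fm[measurable]: "f \<in> borel_measurable borel" and f01: "\<And>x. 0 \<le> f x" "\<And>x. f x \<le> 1"
    and f0: "\<And>x. R \<le> norm x \<Longrightarrow> f x = 0" and gf: "gag f < \<infinity>"
    using f by (auto simp: admissible_def)
  define \<eta> where "\<eta> n x = 1 - cutoff (real (Suc n) *\<^sub>R x)" for n and x :: 'a
  define h where "h n x = f x * \<eta> n x" for n x
  have [measurable]: "\<eta> n \<in> borel_measurable borel" "h n \<in> borel_measurable borel" for n
    unfolding \<eta>_def h_def by measurable
  have \<eta>01: "0 \<le> \<eta> n x" "\<eta> n x \<le> 1" for n x
    unfolding \<eta>_def using cutoff_range[of "real (Suc n) *\<^sub>R x"] by auto
  have g\<eta>: "gag (\<eta> n) \<le> gag cutoff" for n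
  proof -
    have "gag (\<eta> n) = gag (\<lambda>x. cutoff (real (Suc n) *\<^sub>R x))"
      unfolding gag_def \<eta>_def by (simp add: abs_minus_commute)
    also have "\<dots> = 1 * \<dots>" by simp
    \<comment> \<open>The factor is at least 1 because \<open>cap_exp\<close> is positive. By
      scaling, the product is exactly the energy of the fixed cutoff.\<close>
    also have "\<dots> \<le> ennreal (real (Suc n) powr cap_exp) * gag (\<lambda>x. cutoff (real (Suc n) *\<^sub>R x))"
      using cap_exp_pos by (intro mult_right_mono) (auto simp: ge_one_powr_ge_zero)
    also have "\<dots> = gag cutoff" by (subst gag_scale[of cutoff "real (Suc n)"]) auto
    finally show ?thesis .
  qed
  have gh: "gag (h n) \<le> ennreal (2 powr p) * (gag f + gag cutoff)" for n
  proof -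
    have "gag (h n) \<le> ennreal (2 powr p) * (gag f + gag (\<eta> n))"
    proof (rule gag_le_add)
      fix x y
      have "h n x - h n y = (f x - f y) * \<eta> n x + f y * (\<eta> n x - \<eta> n y)"
        by (simp add: h_def algebra_simps)
      also have "\<bar>\<dots>\<bar> \<le> \<bar>f x - f y\<bar> * \<eta> n x + f y * \<bar>\<eta> n x - \<eta> n y\<bar>"
        using f01(1)[of y] \<eta>01(1)[of n x] abs_triangle_ineq[of "(f x - f y) * \<eta> n x" "f y * (\<eta> n x - \<eta> n y)"]
        by (simp add: abs_mult)
      also have "\<dots> \<le> \<bar>f x - f y\<bar> + \<bar>\<eta> n x - \<eta> n y\<bar>"
        using f01 \<eta>01 by (intro add_mono mult_left_le mult_left_le_one_le) auto
      finally show "\<bar>h n x - h n y\<bar> \<le> \<bar>f x - f y\<bar> + \<bar>\<eta> n x - \<eta> n y\<bar>" .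
    qed measurable
    also have "\<dots> \<le> ennreal (2 powr p) * (gag f + gag cutoff)"
      by (intro mult_left_mono add_left_mono g\<eta>) auto
    finally show ?thesis .
  qed
  define B where "B = enn2real (ennreal (2 powr p) * (gag f + gag cutoff))"
  have B: "ennreal (2 powr p) * (gag f + gag cutoff) = ennreal B"
    unfolding B_def using gf gag_cutoff by (simp add: ennreal_mult_less_top)
  have "(\<lambda>n. form v (h n)) \<longlonglongrightarrow> form v f"
  proof (rule form_tendsto[OF _ _ _ gv gf])
    show "gag (h n) \<le> ennreal B" for n using gh B by simp
    have "AE x in lborel. (x::'a) \<noteq> 0" using AE_lborel_singleton[of 0] by (simp add: eq_commute)
    then show "AE x in lborel. (\<lambda>n. h n x) \<longlonglongrightarrow> f x"
    proof eventually_elim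
      case (elim x)
      obtain n0 :: nat where n0: "2 / norm x < real n0" using reals_Archimedean2 by blast
      have "h n x = f x" if "n \<ge> n0" for n
      proof -
        have "2 / norm x \<le> real (Suc n)" using n0 that by linarith
        then have "2 \<le> norm (real (Suc n) *\<^sub>R x)" using elim unfolding norm_scaleR by (simp add: field_simps)
        then show ?thesis unfolding h_def \<eta>_def by (simp add: cutoff_eq_0)
      qed
      then show ?case by (intro tendsto_eventually eventually_sequentiallyI[of n0])
    qed
  qed measurable
  moreover have "0 \<le> form v (h n)" for n
  proof (rule pos)
    have "gag (h n) < \<infinity>" using gh[of n] unfolding B by (simp add: le_less_trans)
    moreover have "0 \<le> h n x \<and> h n x \<le> 1" for x
      unfolding h_def using f01[of x] \<eta>01[where n=n and x=x] by (auto intro: mult_le_one)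
    ultimately show "admissible R (h n)" by (auto simp: admissible_def h_def f0)
    show "0 < 1 / real (Suc n)" by simp
    fix x :: 'a assume "norm x < 1 / real (Suc n)"
    then have "norm (real (Suc n) *\<^sub>R x) \<le> 3 / 2" unfolding norm_scaleR by (simp add: field_simps)
    then show "h n x = 0" unfolding h_def \<eta>_def by (simp add: cutoff_eq_1)
  qed
  ultimately show ?thesis by (intro LIMSEQ_le_const[of _ "form v f" 0]) auto
qed

end

section \<open>Testing with bounded finite-energy functions\<close>

lemma ex_mollifier:
  assumes "0 < \<epsilon>"
  shows "\<exists>\<rho>::'a::euclidean_space \<Rightarrow> real. Cinf \<rho> \<and> (\<forall>x. 0 \<le> \<rho> x) \<and> (\<forall>x. \<epsilon> \<le> norm x \<longrightarrow> \<rho> x = 0)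
    \<and> integrable lborel \<rho> \<and> (\<integral>x. \<rho> x \<partial>lborel) = 1"
proof -
  define r where "r x = exp_bump 0 (\<epsilon>\<^sup>2 - x \<bullet> x)" for x :: 'a
  have ck: "Ck k r" for k unfolding r_def by (rule Ck_exp_bump)
  have r0: "0 \<le> r x" for x by (simp add: r_def exp_bump_def)
  have rpos: "0 < r x \<longleftrightarrow> norm x < \<epsilon>" for x
  proof -
    have "norm x < \<epsilon> \<longleftrightarrow> (norm x)\<^sup>2 < \<epsilon>\<^sup>2" 
      using assms power2_less_imp_less[of "norm x" \<epsilon>] power_strict_mono[of "norm x" \<epsilon> 2] by auto
    also have "\<dots> \<longleftrightarrow> 0 < \<epsilon>\<^sup>2 - x \<bullet> x" by (simp add: power2_norm_eq_inner)
    finally show ?thesis by (simp add: r_def exp_bump_def)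
  qed
  have rz: "r x = 0" if "\<epsilon> \<le> norm x" for x using that rpos[of x] r0[of x] by auto
  have cont: "continuous_on UNIV r" using ck[of 0] by simp
  have int: "integrable lborel r"
  proof -
    have "integrable lborel (\<lambda>x. indicator (cball 0 \<epsilon>) x *\<^sub>R r x)"
      by (rule borel_integrable_compact) (auto intro: continuous_on_subset[OF cont])
    moreover have "(\<lambda>x. indicator (cball 0 \<epsilon>) x *\<^sub>R r x) = r" using rz by (auto simp: indicator_def fun_eq_iff not_le)
    ultimately show ?thesis by simp
  qed
  define I where "I = (\<integral>x. r x \<partial>lborel)"
  have "I \<noteq> 0"
  proof
    assume "I = 0"
    then have "AE x in lborel. r x = 0"
      unfolding I_def using integral_nonneg_eq_0_iff_AE[OF int] r0 by simp
    then have "AE x in lborel. x \<notin> ball (0::'a) \<epsilon>"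
      by eventually_elim (use rpos in \<open>auto simp: less_le\<close>)
    then have "emeasure lborel (ball (0::'a) \<epsilon>) = 0"
      by (subst (asm) AE_iff_measurable[OF _ refl]) (auto simp: ball_def)
    then show False using assms unit_ball_vol_pos[of "real DIM('a)"] by (simp add: emeasure_ball)
  qed
  moreover have "0 \<le> I" unfolding I_def using r0 by simp
  ultimately have I: "0 < I" by simp
  have "Cinf (\<lambda>x. (1 / I) * r x)" unfolding Cinf_def by (intro allI Ck_mult Ck_const ck)
  moreover have "(\<integral>x. (1 / I) * r x \<partial>lborel) = 1" using I by (simp add: I_def)
  ultimately show ?thesis
    using int r0 rz I by (intro exI[of _ "\<lambda>x. (1 / I) * r x"]) auto
qed

section \<open>Approximation and translation in L1\<close>

lemma integrable_bounded_support:
  fixes f :: "'a::euclidean_space \<Rightarrow> real"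
  assumes [measurable]: "f \<in> borel_measurable borel" and f01: "\<And>x. 0 \<le> f x" "\<And>x. f x \<le> 1"
    and f0: "\<And>x. R \<le> norm x \<Longrightarrow> f x = 0"
  shows "integrable lborel f"
proof (rule Bochner_Integration.integrable_bound)
  show "integrable lborel (indicator (ball (0::'a) R) :: 'a \<Rightarrow> real)"
    using emeasure_lborel_ball_finite[of "0::'a" R] by (intro integrable_real_indicator) simp_all
  show "AE x in lborel. norm (f x) \<le> norm (indicator (ball 0 R) x :: real)"
    using f01 f0 by (intro AE_I2) (auto simp: indicator_def not_less)
qed measurable

text \<open>Measurability supplies continuous functions converging almost everywhere, but without
  bounds. Clipping them to [0, 1] and multiplying by a rescaled cutoff does not disturb the limit
  and makes dominated convergence applicable.\<close>

lemma L1_approx_continuous: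
  fixes f :: "'a::euclidean_space \<Rightarrow> real"
  assumes fm[measurable]: "f \<in> borel_measurable borel" and f01: "\<And>x. 0 \<le> f x" "\<And>x. f x \<le> 1"
    and f0: "\<And>x. R \<le> norm x \<Longrightarrow> f x = 0" and R: "0 < R" and e: "0 < e"
  shows "\<exists>g. continuous_on UNIV g \<and> (\<forall>x. 2 * R \<le> norm x \<longrightarrow> g x = 0) \<and> (\<integral>\<^sup>+x. ennreal \<bar>f x - g x\<bar> \<partial>lborel) < ennreal e"
proof -
  have "f \<in> borel_measurable lebesgue" using fm by (intro measurable_completion) simp
  then have "f measurable_on UNIV" by (rule lebesgue_measurable_imp_measurable_on_real) simp
  then obtain S g where S: "negligible S" and gc: "\<And>n. continuous_on UNIV (g n)"
    and glim: "\<And>x. x \<notin> S \<Longrightarrow> (\<lambda>n. g n x) \<longlonglongrightarrow> f x"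
    by (auto simp: measurable_on_def)
  define q where "q x = cutoff ((1 / R) *\<^sub>R x)" for x :: 'a
  define h where "h n x = max 0 (min 1 (g n x)) * q x" for n x
  have qc: "continuous_on UNIV q" unfolding q_def cutoff_def by (intro continuous_intros)
  have hc: "continuous_on UNIV (h n)" for n unfolding h_def by (intro continuous_intros gc qc)
  then have [measurable]: "h n \<in> borel_measurable borel" for n by (rule borel_measurable_continuous_onI)
  have q0: "q x = 0" if "2 * R \<le> norm x" for x
    unfolding q_def using that R by (intro cutoff_eq_0) (simp add: field_simps)
  have q1: "q x = 1" if "norm x < R" for x
    unfolding q_def using that R by (intro cutoff_eq_1) (simp add: field_simps)
  have q01: "0 \<le> q x" "q x \<le> 1" for x unfolding q_def by (rule cutoff_range)+
  have h01: "0 \<le> h n x" "h n x \<le> 1" for n x unfolding h_def using q01 by (auto intro: mult_le_one)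
  have AEn: "AE x in lborel. x \<notin> S"
  proof -
    have "S \<in> null_sets lebesgue" using S by (simp add: negligible_iff_null_sets)
    then have "AE x in lebesgue. x \<notin> S" by (rule AE_not_in)
    then show ?thesis by (simp add: AE_completion_iff)
  qed
  have "(\<lambda>n. \<integral>x. \<bar>f x - h n x\<bar> \<partial>lborel) \<longlonglongrightarrow> integral\<^sup>L lborel (\<lambda>x::'a. 0::real)"
  proof (rule integral_dominated_convergence)
    show "integrable lborel (indicator (ball (0::'a) (2 * R)) :: 'a \<Rightarrow> real)"
      using emeasure_lborel_ball_finite[of "0::'a" "2 * R"] by (intro integrable_real_indicator) simp_all
    show "AE x in lborel. (\<lambda>n. \<bar>f x - h n x\<bar>) \<longlonglongrightarrow> 0"
      using AEn
    proof eventually_elim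
      case (elim x)
      have "(\<lambda>n. h n x) \<longlonglongrightarrow> max 0 (min 1 (f x)) * q x"
        unfolding h_def by (intro tendsto_intros glim elim)
      also have "max 0 (min 1 (f x)) * q x = f x"
        using f01[of x] f0[of x] q1[of x] by (cases "norm x < R") (auto simp: max_def min_def)
      finally have "(\<lambda>n. \<bar>f x - h n x\<bar>) \<longlonglongrightarrow> \<bar>f x - f x\<bar>" by (intro tendsto_intros)
      then show ?case by simp
    qed
    show "AE x in lborel. norm \<bar>f x - h n x\<bar> \<le> indicator (ball 0 (2 * R)) x" for n
    proof (rule AE_I2)
      fix x :: 'a
      show "norm \<bar>f x - h n x\<bar> \<le> indicator (ball 0 (2 * R)) x"
      proof (cases "norm x < 2 * R")
        case True
        then show ?thesis using f01[of x] h01[of n x] by (simp add: abs_le_iff)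
      next
        case False
        then have "f x = 0" "h n x = 0" using R by (auto simp: h_def q0 intro: f0)
        then show ?thesis by simp
      qed
    qed
  qed measurable
  then have "\<forall>\<^sub>F n in sequentially. (\<integral>x. \<bar>f x - h n x\<bar> \<partial>lborel) < e"
    using e by (intro order_tendstoD(2)) auto
  then obtain n where n: "(\<integral>x. \<bar>f x - h n x\<bar> \<partial>lborel) < e"
    by (auto simp: eventually_sequentially)
  have "integrable lborel (\<lambda>x. f x - h n x)"
  proof -
    have "h n x = 0" if "2 * R \<le> norm x" for x using that by (simp add: h_def q0)
    then show ?thesis
      using f01 h01 f0 R by (intro Bochner_Integration.integrable_diff integrable_bounded_support[of _ "2 * R"]) auto
  qed
  then have "(\<integral>\<^sup>+x. ennreal \<bar>f x - h n x\<bar> \<partial>lborel) = ennreal (\<integral>x. \<bar>f x - h n x\<bar> \<partial>lborel)"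
    by (intro nn_integral_eq_integral) auto
  also have "\<dots> < ennreal e" using n by (simp add: ennreal_lessI e)
  finally show ?thesis using hc q0 by (intro exI[of _ "h n"]) (auto simp: h_def)
qed

text \<open>Three thirds: the two approximation errors have the same norm by translation invariance,
  and the continuous approximant moves little uniformly on a ball of finite measure.\<close>

lemma L1_translation_continuous:
  fixes f :: "'a::euclidean_space \<Rightarrow> real"
  assumes fm[measurable]: "f \<in> borel_measurable borel" and f01: "\<And>x. 0 \<le> f x" "\<And>x. f x \<le> 1"
    and f0: "\<And>x. R \<le> norm x \<Longrightarrow> f x = 0" and R: "0 < R" and e: "0 < e"
  shows "\<exists>d>0. \<forall>z. norm z < d \<longrightarrow> (\<integral>\<^sup>+x. ennreal \<bar>f (x - z) - f x\<bar> \<partial>lborel) \<le> ennreal e"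
proof -
  obtain g where gc: "continuous_on UNIV g" and g0: "\<And>x. 2 * R \<le> norm x \<Longrightarrow> g x = 0"
    and gf: "(\<integral>\<^sup>+x. ennreal \<bar>f x - g x\<bar> \<partial>lborel) < ennreal (e / 3)"
    using L1_approx_continuous[OF fm f01 f0 R, of "e / 3"] e by auto
  have [measurable]: "g \<in> borel_measurable borel" using gc by (rule borel_measurable_continuous_onI)
  define V where "V = measure lborel (ball (0::'a) (2 * R + 1))"
  have V: "emeasure lborel (ball (0::'a) (2 * R + 1)) = ennreal V"
    unfolding V_def using emeasure_lborel_ball_finite[of "0::'a" "2 * R + 1"] by (intro emeasure_eq_ennreal_measure) simp
  have V0: "0 \<le> V" by (simp add: V_def)
  have "uniformly_continuous_on UNIV g" by (rule uniformly_continuous_compact_support[OF gc g0])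
  moreover have "0 < e / (3 * (V + 1))" using e V0 by simp
  ultimately obtain d where d: "d > 0" "\<And>x y. dist x y < d \<Longrightarrow> dist (g x) (g y) < e / (3 * (V + 1))"
    unfolding uniformly_continuous_on_def by (metis UNIV_I)
  have "(\<integral>\<^sup>+x. ennreal \<bar>f (x - z) - f x\<bar> \<partial>lborel) \<le> ennreal e" if z: "norm z < min d 1" for z
  proof -
    have "(\<integral>\<^sup>+x. ennreal \<bar>f (x - z) - f x\<bar> \<partial>lborel) \<le>
      (\<integral>\<^sup>+x. ennreal \<bar>f (x - z) - g (x - z)\<bar> + (ennreal (e / (3 * (V + 1))) * indicator (ball 0 (2 * R + 1)) x + ennreal \<bar>f x - g x\<bar>) \<partial>lborel)"
    proof (rule nn_integral_mono)
      fix x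
      have 1: "\<bar>g (x - z) - g x\<bar> \<le> e / (3 * (V + 1)) * indicator (ball 0 (2 * R + 1)) x"
      proof (cases "norm x < 2 * R + 1")
        case True
        have "dist (x - z) x < d" using z by (simp add: dist_norm)
        then show ?thesis using d(2)[of "x - z" x] True by (simp add: dist_real_def)
      next
        case False
        have "norm x - norm z \<le> norm (x - z)" by (rule norm_triangle_ineq2)
        then have "2 * R \<le> norm (x - z)" "2 * R \<le> norm x" using False z by auto
        then show ?thesis using g0 False by simp
      qed
      have "\<bar>f (x - z) - f x\<bar> \<le> \<bar>f (x - z) - g (x - z)\<bar> + (\<bar>g (x - z) - g x\<bar> + \<bar>f x - g x\<bar>)" by linarith
      also have "\<dots> \<le> \<bar>f (x - z) - g (x - z)\<bar> + (e / (3 * (V + 1)) * indicator (ball 0 (2 * R + 1)) x + \<bar>f x - g x\<bar>)"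
        using 1 by simp
      finally have "ennreal \<bar>f (x - z) - f x\<bar> \<le> ennreal (\<bar>f (x - z) - g (x - z)\<bar> + (e / (3 * (V + 1)) * indicator (ball 0 (2 * R + 1)) x + \<bar>f x - g x\<bar>))"
        by (rule ennreal_leI)
      also have "\<dots> = ennreal \<bar>f (x - z) - g (x - z)\<bar> + (ennreal (e / (3 * (V + 1))) * indicator (ball 0 (2 * R + 1)) x + ennreal \<bar>f x - g x\<bar>)"
        using e V0 by (subst ennreal_plus, simp, simp, subst ennreal_plus) (auto simp: ennreal_mult' indicator_def)
      finally show "ennreal \<bar>f (x - z) - f x\<bar> \<le> ennreal \<bar>f (x - z) - g (x - z)\<bar> + (ennreal (e / (3 * (V + 1))) * indicator (ball 0 (2 * R + 1)) x + ennreal \<bar>f x - g x\<bar>)" .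
    qed
    also have "\<dots> = (\<integral>\<^sup>+x. ennreal \<bar>f (x - z) - g (x - z)\<bar> \<partial>lborel) + (ennreal (e / (3 * (V + 1))) * ennreal V + (\<integral>\<^sup>+x. ennreal \<bar>f x - g x\<bar> \<partial>lborel))"
    proof -
      have [measurable]: "ball (0::'a) (2 * R + 1) \<in> sets borel" by simp
      have "(\<integral>\<^sup>+x. ennreal (e / (3 * (V + 1))) * indicator (ball (0::'a) (2 * R + 1)) x \<partial>lborel) = ennreal (e / (3 * (V + 1))) * ennreal V" (is ?V)
        unfolding V[symmetric] by (rule nn_integral_cmult_indicator) simp
      define k2 where "k2 x = ennreal (e / (3 * (V + 1))) * indicator (ball (0::'a) (2 * R + 1)) x" for x
      have [measurable]: "k2 \<in> borel_measurable borel" unfolding k2_def by measurable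
      have "(\<integral>\<^sup>+x. ennreal \<bar>f (x - z) - g (x - z)\<bar> + (k2 x + ennreal \<bar>f x - g x\<bar>) \<partial>lborel)
        = (\<integral>\<^sup>+x. ennreal \<bar>f (x - z) - g (x - z)\<bar> \<partial>lborel) + (\<integral>\<^sup>+x. k2 x + ennreal \<bar>f x - g x\<bar> \<partial>lborel)"
        by (rule nn_integral_add) measurable
      also have "(\<integral>\<^sup>+x. k2 x + ennreal \<bar>f x - g x\<bar> \<partial>lborel) = (\<integral>\<^sup>+x. k2 x \<partial>lborel) + (\<integral>\<^sup>+x. ennreal \<bar>f x - g x\<bar> \<partial>lborel)"
        by (rule nn_integral_add) measurable
      finally show ?thesis unfolding k2_def using \<open>?V\<close> by simp
    qed
    also have "(\<integral>\<^sup>+x. ennreal \<bar>f (x - z) - g (x - z)\<bar> \<partial>lborel) = (\<integral>\<^sup>+x. ennreal \<bar>f x - g x\<bar> \<partial>lborel)"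
      using nn_integral_lborel_affine[of "\<lambda>x. ennreal \<bar>f x - g x\<bar>" 1 "- z"] by simp
    also have "(\<integral>\<^sup>+x. ennreal \<bar>f x - g x\<bar> \<partial>lborel) + (ennreal (e / (3 * (V + 1))) * ennreal V + (\<integral>\<^sup>+x. ennreal \<bar>f x - g x\<bar> \<partial>lborel))
      \<le> ennreal (e / 3) + (ennreal (e / 3) + ennreal (e / 3))"
    proof (intro add_mono less_imp_le[OF gf])
      have "ennreal (e / (3 * (V + 1))) * ennreal V = ennreal (e / (3 * (V + 1)) * V)"
        using e V0 by (intro ennreal_mult[symmetric]) auto
      also have "\<dots> \<le> ennreal (e / 3)" using e V0 by (intro ennreal_leI) (simp add: field_simps)
      finally show "ennreal (e / (3 * (V + 1))) * ennreal V \<le> ennreal (e / 3)" .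
    qed
    also have "\<dots> = ennreal e" using e by (simp flip: ennreal_plus)
    finally show ?thesis .
  qed
  then show ?thesis using d(1) by (intro exI[of _ "min d 1"]) auto
qed

text \<open>Jensen's inequality for the probability density \<rho>: the tangent inequality at the
  mean value m is integrated. The bound 1 on g provides integrability.\<close>

lemma powr_integral_le:
  fixes \<rho> g :: "'a \<Rightarrow> real"
  assumes p: "1 < p" and \<rho>: "integrable M \<rho>" "\<And>z. 0 \<le> \<rho> z" "(\<integral>z. \<rho> z \<partial>M) = 1"
    and [measurable]: "g \<in> borel_measurable M" and g: "\<And>z. \<bar>g z\<bar> \<le> 1"
  shows "\<bar>\<integral>z. \<rho> z * g z \<partial>M\<bar> powr p \<le> (\<integral>z. \<rho> z * \<bar>g z\<bar> powr p \<partial>M)"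
proof -
  have [measurable]: "\<rho> \<in> borel_measurable M" using \<rho>(1) by auto
  have i1: "integrable M (\<lambda>z. \<rho> z * g z)"
    by (rule Bochner_Integration.integrable_bound[OF \<rho>(1)]) (use \<rho> g in \<open>auto simp: abs_mult intro!: mult_left_le\<close>)
  have "\<bar>g z\<bar> powr p \<le> 1" for z using powr_mono2[of p "\<bar>g z\<bar>" 1] g p by auto
  then have i2: "integrable M (\<lambda>z. \<rho> z * \<bar>g z\<bar> powr p)"
    by (intro Bochner_Integration.integrable_bound[OF \<rho>(1)]) (use \<rho> in \<open>auto simp: abs_mult intro!: mult_left_le\<close>)
  define m where "m = (\<integral>z. \<rho> z * g z \<partial>M)"
  have "p * (Jp p m * m) = (\<integral>z. p * Jp p m * (\<rho> z * g z) \<partial>M)" unfolding m_def by simp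
  also have "\<dots> \<le> (\<integral>z. (p - 1) * \<bar>m\<bar> powr p * \<rho> z + \<rho> z * \<bar>g z\<bar> powr p \<partial>M)"
  proof (rule integral_mono)
    fix z
    have "\<rho> z * (p * (Jp p m * g z)) \<le> \<rho> z * ((p - 1) * \<bar>m\<bar> powr p + \<bar>g z\<bar> powr p)"
      by (intro mult_left_mono Jp_tangent p \<rho>)
    then show "p * Jp p m * (\<rho> z * g z) \<le> (p - 1) * \<bar>m\<bar> powr p * \<rho> z + \<rho> z * \<bar>g z\<bar> powr p"
      by (simp add: algebra_simps)
  qed (use i1 i2 \<rho> in auto)
  also have "\<dots> = (p - 1) * \<bar>m\<bar> powr p + (\<integral>z. \<rho> z * \<bar>g z\<bar> powr p \<partial>M)"
    using i2 \<rho> by simp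
  finally have "p * (Jp p m * m) \<le> (p - 1) * \<bar>m\<bar> powr p + (\<integral>z. \<rho> z * \<bar>g z\<bar> powr p \<partial>M)" .
  moreover have "Jp p m * m = \<bar>m\<bar> powr p"
  proof -
    have "Jp p m * m = (\<bar>m\<bar> powr (p - 2) * \<bar>m\<bar>) * \<bar>m\<bar>" by (simp add: Jp_def mult.assoc)
    also have "\<bar>m\<bar> powr (p - 2) * \<bar>m\<bar> = \<bar>m\<bar> powr (p - 1)" using Jp_nonneg_eq[of "\<bar>m\<bar>" p] by (simp add: Jp_def)
    finally show ?thesis using powr_mult_self[of "\<bar>m\<bar>" p] by simp
  qed
  ultimately show ?thesis unfolding m_def by (simp add: algebra_simps)
qed

lemma convolution_flip:
  fixes \<rho> f :: "'a::euclidean_space \<Rightarrow> real"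
  assumes [measurable]: "\<rho> \<in> borel_measurable borel" "f \<in> borel_measurable borel"
  shows "(\<integral>z. \<rho> (x - z) * f z \<partial>lborel) = (\<integral>z. \<rho> z * f (x - z) \<partial>lborel)"
  using integral_lborel_affine[of "\<lambda>z. \<rho> (x - z) * f z" "-1" x] by simp

section \<open>Mollification and the energy\<close>

context weighted_kernel
begin

text \<open>Convolution commutes with translations, so it contracts only a translation invariant
  energy; this lemma moves from the weighted energy to such a one. Within a bounded region the
  weights are bounded below, and far pairs are integrable outright.\<close>

lemma unweighted_energy_finite:
  assumes h: "admissible R h" and R: "0 < R"
  shows "(\<integral>\<^sup>+z. ennreal (\<bar>h (fst z) - h (snd z)\<bar> powr p * norm (fst z - snd z) powr (- (N + p * s))) \<partial>M2) < \<infinity>"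
proof -
  let ?a = "N + p * s"
  have hm[measurable]: "h \<in> borel_measurable borel" and h01: "\<And>x. 0 \<le> h x" "\<And>x. h x \<le> 1"
    and h0: "\<And>x. R \<le> norm x \<Longrightarrow> h x = 0" and gh: "gag h < \<infinity>"
    using h by (auto simp: admissible_def)
  define q where "q y = ennreal (norm y powr (- ?a)) * indicator {y. 1 \<le> norm y} y" for y :: 'a
  have [measurable]: "{y::'a. 1 \<le> norm y} \<in> sets borel" "ball (0::'a) R \<in> sets borel" by auto
  have qm[measurable]: "q \<in> borel_measurable borel" unfolding q_def by measurable
  have qfin: "(\<integral>\<^sup>+y. q y \<partial>lborel) < \<infinity>"
    unfolding q_def using ps_pos N_def by (intro nn_integral_norm_powr_outside) auto
  define G where "G x y = indicator (ball 0 R) x * q (x - y)" for x y :: 'a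
  have Gm[measurable]: "(\<lambda>z. G (fst z) (snd z)) \<in> borel_measurable M2" "(\<lambda>z. G (snd z) (fst z)) \<in> borel_measurable M2"
    unfolding G_def by measurable
  have Gi: "(\<integral>\<^sup>+x. \<integral>\<^sup>+y. G x y \<partial>lborel \<partial>lborel) = emeasure lborel (ball (0::'a) R) * (\<integral>\<^sup>+y. q y \<partial>lborel)"
  proof -
    have "(\<integral>\<^sup>+y. G x y \<partial>lborel) = (\<integral>\<^sup>+y. q y \<partial>lborel) * indicator (ball 0 R) x" for x
    proof -
      have "(\<integral>\<^sup>+y. G x y \<partial>lborel) = indicator (ball 0 R) x * (\<integral>\<^sup>+y. q (x - y) \<partial>lborel)"
        unfolding G_def by (rule nn_integral_cmult) measurable
      then show ?thesis using nn_integral_reflect[OF qm, of x] by (simp add: mult.commute)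
    qed
    then have "(\<integral>\<^sup>+x. \<integral>\<^sup>+y. G x y \<partial>lborel \<partial>lborel) = (\<integral>\<^sup>+x. (\<integral>\<^sup>+y. q y \<partial>lborel) * indicator (ball (0::'a) R) x \<partial>lborel)"
      by simp
    also have "\<dots> = (\<integral>\<^sup>+y. q y \<partial>lborel) * emeasure lborel (ball (0::'a) R)"
      by (rule nn_integral_cmult_indicator) simp
    finally show ?thesis by (simp add: mult.commute)
  qed
  have fin: "(\<integral>\<^sup>+x. \<integral>\<^sup>+y. G x y \<partial>lborel \<partial>lborel) < \<infinity>"
    unfolding Gi using qfin emeasure_lborel_ball_finite[of "0::'a" R] by (simp add: ennreal_mult_less_top)
  let ?F = "\<lambda>z. ennreal (\<bar>h (fst z) - h (snd z)\<bar> powr p * norm (fst z - snd z) powr (- ?a))"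
  let ?H = "\<lambda>z. ennreal (\<bar>h (fst z) - h (snd z)\<bar> powr p * K (fst z) (snd z))"
  have "(\<integral>\<^sup>+z. ?F z \<partial>M2) \<le> (\<integral>\<^sup>+z. ennreal ((R + 1) powr (2 * \<beta>)) * ?H z + (G (fst z) (snd z) + G (snd z) (fst z)) \<partial>M2)"
  proof (rule nn_integral_mono_AE)
    have "AE x in lborel. (x::'a) \<noteq> 0" using AE_lborel_singleton[of 0] by (simp add: eq_commute)
    then have "AE z in M2. fst z \<noteq> 0 \<and> snd z \<noteq> 0" by (rule AE_pair_fst_snd)
    then show "AE z in M2. ?F z \<le> ennreal ((R + 1) powr (2 * \<beta>)) * ?H z + (G (fst z) (snd z) + G (snd z) (fst z))"
    proof eventually_elim
      case (elim z)
      define x y where "x = fst z" and "y = snd z"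
      have xy0: "x \<noteq> 0" "y \<noteq> 0" using elim by (auto simp: x_def y_def)
      have tri: "\<bar>norm x - norm y\<bar> \<le> norm (x - y)" by (rule norm_triangle_ineq3)
      have le1: "\<bar>h x - h y\<bar> powr p \<le> 1"
        using powr_mono2[of p "\<bar>h x - h y\<bar>" 1] h01[of x] h01[of y] p_gt by auto
      have far: "\<bar>h x - h y\<bar> powr p * norm (x - y) powr (- ?a) \<le> norm (x - y) powr (- ?a)"
        using le1 by (simp add: mult_left_le_one_le)
      \<comment> \<open>If a point has norm at least R + 1, then either the other one also lies
        outside the support and both values vanish, or the distance is at least 1 and the kernel is
        integrable.\<close>
      consider "norm x < R + 1" "norm y < R + 1" | "R \<le> norm x" "R \<le> norm y"
        | "R + 1 \<le> norm x" "norm y < R" | "R + 1 \<le> norm y" "norm x < R"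
        using R by linarith
      then have "ennreal (\<bar>h x - h y\<bar> powr p * norm (x - y) powr (- ?a)) \<le> ennreal ((R + 1) powr (2 * \<beta>)) * ennreal (\<bar>h x - h y\<bar> powr p * K x y) + (G x y + G y x)"
      proof cases
        case 1
        have "(R + 1) powr (- \<beta>) * (R + 1) powr (- \<beta>) \<le> norm x powr (- \<beta>) * norm y powr (- \<beta>)"
          using 1 xy0 \<beta>_nonneg by (intro mult_mono powr_mono2') auto
        then have "(R + 1) powr (2 * \<beta>) * ((R + 1) powr (- \<beta>) * (R + 1) powr (- \<beta>)) \<le> (R + 1) powr (2 * \<beta>) * (norm x powr (- \<beta>) * norm y powr (- \<beta>))"
          by (intro mult_left_mono) auto
        moreover have "(R + 1) powr (2 * \<beta>) * ((R + 1) powr (- \<beta>) * (R + 1) powr (- \<beta>)) = 1"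
          using R by (simp add: powr_add[symmetric])
        ultimately have "1 \<le> (R + 1) powr (2 * \<beta>) * (norm x powr (- \<beta>) * norm y powr (- \<beta>))" by simp
        then have "(\<bar>h x - h y\<bar> powr p * norm (x - y) powr (- ?a)) * 1 \<le> (\<bar>h x - h y\<bar> powr p * norm (x - y) powr (- ?a)) * ((R + 1) powr (2 * \<beta>) * (norm x powr (- \<beta>) * norm y powr (- \<beta>)))"
          by (intro mult_left_mono) auto
        also have "\<dots> = (R + 1) powr (2 * \<beta>) * (\<bar>h x - h y\<bar> powr p * K x y)"
          by (simp add: K_eq mult_ac)
        finally have "ennreal (\<bar>h x - h y\<bar> powr p * norm (x - y) powr (- ?a)) \<le> ennreal ((R + 1) powr (2 * \<beta>)) * ennreal (\<bar>h x - h y\<bar> powr p * K x y)"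
          by (subst ennreal_mult[symmetric]) (auto intro: ennreal_leI)
        then show ?thesis by (simp add: add_increasing2)
      next
        case 2
        then show ?thesis using h0 by simp
      next
        case 3
        then have "1 \<le> norm (y - x)" using tri by (simp add: norm_minus_commute)
        then have "G y x = ennreal (norm (x - y) powr (- ?a))" using 3 by (simp add: G_def q_def norm_minus_commute)
        then have "ennreal (\<bar>h x - h y\<bar> powr p * norm (x - y) powr (- ?a)) \<le> G y x" using far by (simp add: ennreal_leI)
        then show ?thesis by (simp add: add_increasing)
      next
        case 4
        then have "1 \<le> norm (x - y)" using tri by simp
        then have "G x y = ennreal (norm (x - y) powr (- ?a))" using 4 by (simp add: G_def q_def)
        then have "ennreal (\<bar>h x - h y\<bar> powr p * norm (x - y) powr (- ?a)) \<le> G x y" using far by (simp add: ennreal_leI)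
        then show ?thesis by (simp add: add_increasing add_increasing2)
      qed
      then show ?case by (simp add: x_def y_def)
    qed
  qed
  also have "\<dots> = ennreal ((R + 1) powr (2 * \<beta>)) * gag h + ((\<integral>\<^sup>+z. G (fst z) (snd z) \<partial>M2) + (\<integral>\<^sup>+z. G (snd z) (fst z) \<partial>M2))"
  proof -
    have "(\<integral>\<^sup>+z. ennreal ((R + 1) powr (2 * \<beta>)) * ?H z + (G (fst z) (snd z) + G (snd z) (fst z)) \<partial>M2)
      = (\<integral>\<^sup>+z. ennreal ((R + 1) powr (2 * \<beta>)) * ?H z \<partial>M2) + (\<integral>\<^sup>+z. G (fst z) (snd z) + G (snd z) (fst z) \<partial>M2)"
      by (rule nn_integral_add) measurable
    also have "(\<integral>\<^sup>+z. G (fst z) (snd z) + G (snd z) (fst z) \<partial>M2) = (\<integral>\<^sup>+z. G (fst z) (snd z) \<partial>M2) + (\<integral>\<^sup>+z. G (snd z) (fst z) \<partial>M2)"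
      by (rule nn_integral_add) measurable
    also have "(\<integral>\<^sup>+z. ennreal ((R + 1) powr (2 * \<beta>)) * ?H z \<partial>M2) = ennreal ((R + 1) powr (2 * \<beta>)) * (\<integral>\<^sup>+z. ?H z \<partial>M2)"
      by (rule nn_integral_cmult) measurable
    finally show ?thesis unfolding gag_def .
  qed
  also have "(\<integral>\<^sup>+z. G (fst z) (snd z) \<partial>M2) = (\<integral>\<^sup>+x. \<integral>\<^sup>+y. G x y \<partial>lborel \<partial>lborel)"
    by (rule nn_integral_lborel_pair(1)) measurable
  also have "(\<integral>\<^sup>+z. G (snd z) (fst z) \<partial>M2) = (\<integral>\<^sup>+x. \<integral>\<^sup>+y. G x y \<partial>lborel \<partial>lborel)"
    by (rule nn_integral_lborel_pair(2)) measurable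
  also have "ennreal ((R + 1) powr (2 * \<beta>)) * gag h + ((\<integral>\<^sup>+x. \<integral>\<^sup>+y. G x y \<partial>lborel \<partial>lborel) + (\<integral>\<^sup>+x. \<integral>\<^sup>+y. G x y \<partial>lborel \<partial>lborel)) < \<infinity>"
    using fin gh by (simp add: ennreal_mult_less_top)
  finally show ?thesis .
qed

text \<open>Jensen's inequality for each pair, then Fubini; the distance factor does not change when
  both points are shifted by the same z, so translation along the diagonal leaves the double
  integral unchanged.\<close>

lemma convolution_energy_le:
  assumes [measurable]: "h \<in> borel_measurable borel" and h01: "\<And>x. 0 \<le> h x" "\<And>x. h x \<le> 1"
    and \<rho>: "integrable lborel \<rho>" "\<And>z. 0 \<le> \<rho> z" "(\<integral>z. \<rho> z \<partial>lborel) = 1"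
    and hn: "\<And>x. hn x = (\<integral>z. \<rho> z * h (x - z) \<partial>lborel)"
    and int: "\<And>x. integrable lborel (\<lambda>z. \<rho> z * h (x - z))"
  shows "(\<integral>\<^sup>+z. ennreal (\<bar>hn (fst z) - hn (snd z)\<bar> powr p * norm (fst z - snd z :: 'a) powr (- a)) \<partial>M2)
    \<le> (\<integral>\<^sup>+z. ennreal (\<bar>h (fst z) - h (snd z)\<bar> powr p * norm (fst z - snd z) powr (- a)) \<partial>M2)"
proof -
  have [measurable]: "\<rho> \<in> borel_measurable borel" using borel_measurable_integrable[OF \<rho>(1)] by simp
  define F where "F w = ennreal (\<bar>h (fst w) - h (snd w)\<bar> powr p * norm (fst w - snd w) powr (- a))" for w :: "'a \<times> 'a"
  have Fm[measurable]: "F \<in> borel_measurable borel" unfolding F_def borel_prod[symmetric] by measurable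
  have pt: "ennreal (\<bar>hn x - hn y\<bar> powr p * norm (x - y) powr (- a)) \<le> (\<integral>\<^sup>+z. ennreal (\<rho> z) * F ((x, y) - (z, z)) \<partial>lborel)" for x y :: 'a
  proof -
    have d1: "\<bar>h (x - z) - h (y - z)\<bar> \<le> 1" for z using h01[of "x - z"] h01[of "y - z"] by auto
    have d1p: "\<bar>h (x - z) - h (y - z)\<bar> powr p \<le> 1" for z
      using powr_mono2[of p "\<bar>h (x - z) - h (y - z)\<bar>" 1] d1[of z] p_gt by auto
    have "hn x - hn y = (\<integral>z. \<rho> z * (h (x - z) - h (y - z)) \<partial>lborel)"
      unfolding hn using int by (simp add: right_diff_distrib)
    then have "\<bar>hn x - hn y\<bar> powr p \<le> (\<integral>z. \<rho> z * \<bar>h (x - z) - h (y - z)\<bar> powr p \<partial>lborel)"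
      using powr_integral_le[OF p_gt \<rho>, of "\<lambda>z. h (x - z) - h (y - z)"] d1 by simp
    then have "ennreal (\<bar>hn x - hn y\<bar> powr p) \<le> ennreal (\<integral>z. \<rho> z * \<bar>h (x - z) - h (y - z)\<bar> powr p \<partial>lborel)"
      by (rule ennreal_leI)
    also have "\<dots> = (\<integral>\<^sup>+z. ennreal (\<rho> z * \<bar>h (x - z) - h (y - z)\<bar> powr p) \<partial>lborel)"
      by (intro nn_integral_eq_integral[symmetric] Bochner_Integration.integrable_bound[OF \<rho>(1)])
        (use \<rho> d1p in \<open>auto simp: abs_mult intro!: mult_left_le\<close>)
    finally have "ennreal (\<bar>hn x - hn y\<bar> powr p * norm (x - y) powr (- a))
       \<le> (\<integral>\<^sup>+z. ennreal (\<rho> z * \<bar>h (x - z) - h (y - z)\<bar> powr p) \<partial>lborel) * ennreal (norm (x - y) powr (- a))"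
      by (subst ennreal_mult) (auto intro: mult_right_mono)
    also have "\<dots> = (\<integral>\<^sup>+z. ennreal (\<rho> z * \<bar>h (x - z) - h (y - z)\<bar> powr p) * ennreal (norm (x - y) powr (- a)) \<partial>lborel)"
      by (rule nn_integral_multc[symmetric]) measurable
    also have "\<dots> = (\<integral>\<^sup>+z. ennreal (\<rho> z) * F ((x, y) - (z, z)) \<partial>lborel)"
      using \<rho>(2) by (intro nn_integral_cong) (simp add: F_def ennreal_mult' ennreal_mult'' mult.assoc)
    finally show ?thesis .
  qed
  have "(\<integral>\<^sup>+w. ennreal (\<bar>hn (fst w) - hn (snd w)\<bar> powr p * norm (fst w - snd w :: 'a) powr (- a)) \<partial>M2)
     \<le> (\<integral>\<^sup>+w. (\<integral>\<^sup>+z. ennreal (\<rho> z) * F (w - (z, z)) \<partial>lborel) \<partial>M2)"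
    using pt by (intro nn_integral_mono) auto
  also have "\<dots> = (\<integral>\<^sup>+w. (\<integral>\<^sup>+z. ennreal (\<rho> z) * F (w - (z, z)) \<partial>lborel) \<partial>lborel)"
    by (simp add: lborel_prod)
  also have "\<dots> = (\<integral>\<^sup>+z. (\<integral>\<^sup>+w. ennreal (\<rho> z) * F (w - (z, z)) \<partial>lborel) \<partial>lborel)"
  proof (rule lborel_pair.Fubini'[symmetric])
    have "(\<lambda>q::('a \<times> 'a) \<times> 'a. ennreal (\<rho> (snd q)) * F (fst q - (snd q, snd q))) \<in> borel_measurable borel"
    proof -
      have "(\<lambda>q::('a \<times> 'a) \<times> 'a. fst q - (snd q, snd q)) \<in> borel_measurable borel"
        by (intro borel_measurable_continuous_onI continuous_intros)
      moreover have "(\<lambda>q::('a \<times> 'a) \<times> 'a. snd q) \<in> borel_measurable borel"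
        by (intro borel_measurable_continuous_onI continuous_intros)
      ultimately show ?thesis by measurable
    qed
    then show "(\<lambda>(w::'a \<times> 'a, z). ennreal (\<rho> z) * F (w - (z, z))) \<in> borel_measurable (lborel \<Otimes>\<^sub>M lborel)"
      by (simp add: split_beta' lborel_prod)
  qed
  also have "\<dots> = (\<integral>\<^sup>+z. ennreal (\<rho> z) * (\<integral>\<^sup>+w. F w \<partial>lborel) \<partial>lborel)"
  proof (rule nn_integral_cong)
    fix z :: 'a
    have "(\<integral>\<^sup>+w. ennreal (\<rho> z) * F (w - (z, z)) \<partial>lborel) = ennreal (\<rho> z) * (\<integral>\<^sup>+w. F (w - (z, z)) \<partial>lborel)"
      by (rule nn_integral_cmult) measurable
    also have "(\<integral>\<^sup>+w. F (w - (z, z)) \<partial>lborel) = (\<integral>\<^sup>+w. F w \<partial>lborel)"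
      using nn_integral_lborel_affine[OF Fm, of 1 "- (z, z)"] by (simp del: uminus_Pair)
    finally show "(\<integral>\<^sup>+w. ennreal (\<rho> z) * F (w - (z, z)) \<partial>lborel) = ennreal (\<rho> z) * (\<integral>\<^sup>+w. F w \<partial>lborel)" .
  qed
  also have "\<dots> = (\<integral>\<^sup>+z. ennreal (\<rho> z) \<partial>lborel) * (\<integral>\<^sup>+w. F w \<partial>lborel)"
    by (rule nn_integral_multc) measurable
  also have "(\<integral>\<^sup>+z. ennreal (\<rho> z) \<partial>lborel) = 1"
    using \<rho> by (simp add: nn_integral_eq_integral)
  finally show ?thesis by (simp add: F_def lborel_prod)
qed

text \<open>The mollified function is an average of translates by vectors shorter than d, so its L1
  distance is at most the worst distance among them.\<close>

lemma convolution_L1_le: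
  fixes h \<rho> :: "'a \<Rightarrow> real"
  assumes [measurable]: "h \<in> borel_measurable borel" and h01: "\<And>x. 0 \<le> h x" "\<And>x. h x \<le> 1"
    and \<rho>: "integrable lborel \<rho>" "\<And>z. 0 \<le> \<rho> z" "(\<integral>z. \<rho> z \<partial>lborel) = 1"
    and hn: "\<And>x. hn x = (\<integral>z. \<rho> z * h (x - z) \<partial>lborel)"
    and int: "\<And>x. integrable lborel (\<lambda>z. \<rho> z * h (x - z))"
    and supp: "\<And>z. d \<le> norm z \<Longrightarrow> \<rho> z = 0"
    and small: "\<And>z. norm z < d \<Longrightarrow> (\<integral>\<^sup>+x. ennreal \<bar>h (x - z) - h x\<bar> \<partial>lborel) \<le> ennreal e"
  shows "(\<integral>\<^sup>+x. ennreal \<bar>hn x - h x\<bar> \<partial>lborel) \<le> ennreal e"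
proof -
  have [measurable]: "\<rho> \<in> borel_measurable borel" using borel_measurable_integrable[OF \<rho>(1)] by simp
  have pt: "ennreal \<bar>hn x - h x\<bar> \<le> (\<integral>\<^sup>+z. ennreal (\<rho> z) * ennreal \<bar>h (x - z) - h x\<bar> \<partial>lborel)" for x
  proof -
    have d1: "\<bar>h (x - z) - h x\<bar> \<le> 1" for z using h01[of "x - z"] h01[of x] by auto
    have "hn x - h x = (\<integral>z. \<rho> z * h (x - z) \<partial>lborel) - (\<integral>z. \<rho> z * h x \<partial>lborel)"
      unfolding hn using \<rho> by simp
    also have "\<dots> = (\<integral>z. \<rho> z * (h (x - z) - h x) \<partial>lborel)"
      using int \<rho> by (simp add: right_diff_distrib)
    finally have "\<bar>hn x - h x\<bar> \<le> (\<integral>z. \<rho> z * \<bar>h (x - z) - h x\<bar> \<partial>lborel)"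
      using integral_norm_bound[of lborel "\<lambda>z. \<rho> z * (h (x - z) - h x)"] \<rho>(2) by (simp add: abs_mult)
    then have "ennreal \<bar>hn x - h x\<bar> \<le> ennreal (\<integral>z. \<rho> z * \<bar>h (x - z) - h x\<bar> \<partial>lborel)" by (rule ennreal_leI)
    also have "\<dots> = (\<integral>\<^sup>+z. ennreal (\<rho> z * \<bar>h (x - z) - h x\<bar>) \<partial>lborel)"
      by (intro nn_integral_eq_integral[symmetric] Bochner_Integration.integrable_bound[OF \<rho>(1)])
        (use \<rho> d1 in \<open>auto simp: abs_mult intro!: mult_left_le\<close>)
    finally show ?thesis using \<rho>(2) by (simp add: ennreal_mult')
  qed
  have "(\<integral>\<^sup>+x. ennreal \<bar>hn x - h x\<bar> \<partial>lborel) \<le> (\<integral>\<^sup>+x. (\<integral>\<^sup>+z. ennreal (\<rho> z) * ennreal \<bar>h (x - z) - h x\<bar> \<partial>lborel) \<partial>lborel)"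
    using pt by (intro nn_integral_mono) auto
  also have "\<dots> = (\<integral>\<^sup>+z. (\<integral>\<^sup>+x. ennreal (\<rho> z) * ennreal \<bar>h (x - z) - h x\<bar> \<partial>lborel) \<partial>lborel)"
    by (rule lborel_pair.Fubini'[symmetric]) measurable
  also have "\<dots> \<le> (\<integral>\<^sup>+z. ennreal (\<rho> z) * ennreal e \<partial>lborel)"
  proof (rule nn_integral_mono)
    fix z :: 'a
    have "(\<integral>\<^sup>+x. ennreal (\<rho> z) * ennreal \<bar>h (x - z) - h x\<bar> \<partial>lborel) = ennreal (\<rho> z) * (\<integral>\<^sup>+x. ennreal \<bar>h (x - z) - h x\<bar> \<partial>lborel)"
      by (rule nn_integral_cmult) measurable
    also have "\<dots> \<le> ennreal (\<rho> z) * ennreal e"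
      using small[of z] supp[of z] by (cases "norm z < d") (auto intro: mult_left_mono)
    finally show "(\<integral>\<^sup>+x. ennreal (\<rho> z) * ennreal \<bar>h (x - z) - h x\<bar> \<partial>lborel) \<le> ennreal (\<rho> z) * ennreal e" .
  qed
  also have "\<dots> = (\<integral>\<^sup>+z. ennreal (\<rho> z) \<partial>lborel) * ennreal e"
    by (rule nn_integral_multc) measurable
  also have "(\<integral>\<^sup>+z. ennreal (\<rho> z) \<partial>lborel) = 1"
    using \<rho> by (simp add: nn_integral_eq_integral)
  finally show ?thesis by simp
qed


text \<open>The mollified functions must have weighted energy bounded uniformly. They all vanish on
  a common ball around 0: if both points are at distance at least c/2 from the origin the weights
  are bounded and the unweighted energy controls the pair, and if one is closer the pair contributes
  only when the points are well separated.\<close>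

lemma form_nonneg_by_mollification:
  assumes [measurable]: "v \<in> borel_measurable borel" and gv: "gag v < \<infinity>" and h: "admissible R h"
    and R: "0 < R" "R < R'" and c: "0 < c" and hc: "\<And>x. norm x < c \<Longrightarrow> h x = 0"
    and smooth: "\<And>\<psi>. Cinf \<psi> \<Longrightarrow> (\<And>x. 0 \<le> \<psi> x) \<Longrightarrow> (\<And>x. R' \<le> norm x \<Longrightarrow> \<psi> x = 0) \<Longrightarrow> 0 \<le> form v \<psi>"
  shows "0 \<le> form v h"
proof -
  let ?a = "N + p * s"
  have hm[measurable]: "h \<in> borel_measurable borel" and h01: "\<And>x. 0 \<le> h x" "\<And>x. h x \<le> 1"
    and h0: "\<And>x. R \<le> norm x \<Longrightarrow> h x = 0" and gh: "gag h < \<infinity>"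
    using h by (auto simp: admissible_def)
  have hint: "integrable lborel h" by (rule integrable_bounded_support[OF hm h01 h0])
  \<comment> \<open>The three entries keep the mollified functions zero near the origin, supported
    in the ball of radius R', and supported in the ball of radius R + 1.\<close>
  define \<delta> where "\<delta> = min (min (c / 4) (R' - R)) 1"
  have \<delta>: "0 < \<delta>" "\<delta> \<le> c / 4" "\<delta> \<le> R' - R" "\<delta> \<le> 1" using R c unfolding \<delta>_def by linarith+
  define \<epsilon> where "\<epsilon> n = \<delta> / real (Suc n)" for n
  have \<epsilon>: "0 < \<epsilon> n" "\<epsilon> n \<le> \<delta>" for n using \<delta> by (auto simp: \<epsilon>_def divide_le_eq mult_le_cancel_left1)
  have "\<forall>n. \<exists>\<rho>::'a \<Rightarrow> real. Cinf \<rho> \<and> (\<forall>x. 0 \<le> \<rho> x) \<and> (\<forall>x. \<epsilon> n \<le> norm x \<longrightarrow> \<rho> x = 0)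
    \<and> integrable lborel \<rho> \<and> (\<integral>x. \<rho> x \<partial>lborel) = 1"
    using ex_mollifier \<epsilon>(1) by blast
  from choice[OF this] obtain \<rho> :: "nat \<Rightarrow> 'a \<Rightarrow> real" where
    \<rho>C: "\<And>n. Cinf (\<rho> n)" and \<rho>: "\<And>n x. 0 \<le> \<rho> n x" "\<And>n x. \<epsilon> n \<le> norm x \<Longrightarrow> \<rho> n x = 0"
      "\<And>n. integrable lborel (\<rho> n)" "\<And>n. (\<integral>x. \<rho> n x \<partial>lborel) = 1"
    by blast
  have [measurable]: "\<rho> n \<in> borel_measurable borel" for n using borel_measurable_integrable[OF \<rho>(3)[of n]] by simp
  define hn where "hn n x = (\<integral>z. \<rho> n (x - z) * h z \<partial>lborel)" for n x
  have hn2: "hn n x = (\<integral>z. \<rho> n z * h (x - z) \<partial>lborel)" for n x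
    unfolding hn_def by (rule convolution_flip) measurable
  have hnC: "Cinf (hn n)" for n
    unfolding Cinf_def hn_def using Ck_convolution[OF hint \<rho>C \<rho>(2)] by blast
  have int: "integrable lborel (\<lambda>z. \<rho> n z * h (x - z))" for n x
    by (rule Bochner_Integration.integrable_bound[OF \<rho>(3)[of n]])
      (use \<rho>(1) h01 in \<open>auto simp: abs_mult intro!: mult_left_le\<close>)
  have "continuous_on UNIV (hn n)" for n using hnC[of n] by (auto simp: Cinf_def dest: spec[of _ 0])
  then have hnm[measurable]: "hn n \<in> borel_measurable borel" for n by (rule borel_measurable_continuous_onI)
  have hn0: "0 \<le> hn n x" for n x unfolding hn2 using \<rho>(1) h01 by (intro integral_nonneg_AE) simp
  have hn1: "hn n x \<le> 1" for n x
  proof -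
    have "hn n x \<le> (\<integral>z. \<rho> n z \<partial>lborel)" unfolding hn2
      using int \<rho> h01 by (intro integral_mono) (auto intro: mult_left_le)
    then show ?thesis using \<rho>(4) by simp
  qed
  have hz: "hn n x = 0" if "\<And>z. norm z < \<epsilon> n \<Longrightarrow> h (x - z) = 0" for n x
  proof -
    have "\<rho> n z * h (x - z) = 0" for z using that[of z] \<rho>(2)[of n z] by (cases "norm z < \<epsilon> n") auto
    then have "(\<lambda>z. \<rho> n z * h (x - z)) = (\<lambda>z. 0)" by (rule ext)
    then show ?thesis unfolding hn2 by (simp only: lebesgue_integral_const) simp
  qed
  have hnR: "hn n x = 0" if x: "R + \<epsilon> n \<le> norm x" for n x
  proof (rule hz)
    fix z :: 'a assume "norm z < \<epsilon> n"
    then have "R \<le> norm (x - z)" using x norm_triangle_ineq2[of x z] by linarith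
    then show "h (x - z) = 0" by (rule h0)
  qed
  have hnc: "hn n x = 0" if x: "norm x < 3 * c / 4" for n x
  proof (rule hz)
    fix z :: 'a assume "norm z < \<epsilon> n"
    then have "norm (x - z) < c" using x norm_triangle_ineq4[of x z] \<epsilon>(2)[of n] \<delta>(2) by linarith
    then show "h (x - z) = 0" by (rule hc)
  qed
  define U where "U = (\<integral>\<^sup>+z. ennreal (\<bar>h (fst z) - h (snd z)\<bar> powr p * norm (fst z - snd z) powr (- ?a)) \<partial>M2)"
  have Ufin: "U < \<infinity>" unfolding U_def by (rule unweighted_energy_finite[OF h R(1)])
  \<comment> \<open>Bounds the kernel when |x - y| >= c/4 and |x| >= 3c/4, apart from the weight at
    y, which remains and is integrable on a ball.\<close>
  define Cb where "Cb = (c / 4) powr (- ?a) * (c / 2) powr (- \<beta>)"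
  define G where "G x y = ennreal Cb * (indicator (ball 0 (R + 1)) x * (ennreal (norm y powr (- \<beta>)) * indicator (ball 0 c) y))" for x y :: 'a
  have [measurable]: "ball (0::'a) (R + 1) \<in> sets borel" "ball (0::'a) c \<in> sets borel" by auto
  have Gm[measurable]: "(\<lambda>z. G (fst z) (snd z)) \<in> borel_measurable M2" "(\<lambda>z. G (snd z) (fst z)) \<in> borel_measurable M2"
    unfolding G_def by measurable
  define IG where "IG = (\<integral>\<^sup>+x. \<integral>\<^sup>+y. G x y \<partial>lborel \<partial>lborel)"
  have IGfin: "IG < \<infinity>"
  proof -
    define J where "J = (\<integral>\<^sup>+y\<in>ball 0 c. ennreal (norm (y::'a) powr (- \<beta>)) \<partial>lborel)"
    have J: "J < \<infinity>" unfolding J_def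
      using \<beta>_nonneg \<beta>_less_N N_def c by (intro nn_integral_norm_powr_ball) auto
    have "(\<integral>\<^sup>+y. G x y \<partial>lborel) = ennreal Cb * J * indicator (ball 0 (R + 1)) x" for x
    proof -
      have "(\<integral>\<^sup>+y. G x y \<partial>lborel) = (\<integral>\<^sup>+y. (ennreal Cb * indicator (ball 0 (R + 1)) x) * (ennreal (norm (y::'a) powr (- \<beta>)) * indicator (ball 0 c) y) \<partial>lborel)"
        unfolding G_def by (simp add: mult.assoc)
      also have "\<dots> = (ennreal Cb * indicator (ball 0 (R + 1)) x) * J"
        unfolding J_def by (rule nn_integral_cmult) measurable
      finally show ?thesis by (simp add: mult_ac)
    qed
    then have "IG = (\<integral>\<^sup>+x. ennreal Cb * J * indicator (ball (0::'a) (R + 1)) x \<partial>lborel)" by (simp add: IG_def)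
    also have "\<dots> = ennreal Cb * J * emeasure lborel (ball (0::'a) (R + 1))"
      by (rule nn_integral_cmult_indicator) simp
    also have "\<dots> < \<infinity>" using J emeasure_lborel_ball_finite[of "0::'a" "R + 1"] by (simp add: ennreal_mult_less_top)
    finally show ?thesis .
  qed
  have Gsym: "(\<integral>\<^sup>+z. G (fst z) (snd z) \<partial>M2) = IG" "(\<integral>\<^sup>+z. G (snd z) (fst z) \<partial>M2) = IG"
    unfolding IG_def using nn_integral_lborel_pair(1)[of G] nn_integral_lborel_pair(2)[of "\<lambda>x y. G y x"] by simp_all
  have side: "ennreal (\<bar>hn n x - hn n y\<bar> powr p * K x y) \<le> G x y" if y: "norm y < c / 2" for n x y
  proof (cases "hn n x = 0")
    case True
    have "hn n y = 0" by (rule hnc) (use y c in linarith)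
    then show ?thesis using True p_gt by simp
  next
    case False
    have yz: "hn n y = 0" by (rule hnc) (use y c in linarith)
    have x1: "3 * c / 4 \<le> norm x" using hnc[of x n] False by (meson not_le)
    have x2: "norm x < R + 1" using hnR[of n x] False \<epsilon>(2)[of n] \<delta>(4) by (meson not_le add_left_mono order_trans)
    have xy: "c / 4 \<le> norm (x - y)" using norm_triangle_ineq2[of x y] x1 y by linarith
    have "\<bar>hn n x - hn n y\<bar> powr p \<le> 1"
      using powr_mono2[of p "\<bar>hn n x - hn n y\<bar>" 1] hn0[of n x] hn1[of n x] yz p_gt by auto
    moreover have "K x y \<le> (c / 4) powr (- ?a) * (c / 2) powr (- \<beta>) * norm y powr (- \<beta>)"
      unfolding K_eq using c xy x1 ps_pos p_gt p_less \<beta>_nonneg by (intro mult_right_mono mult_mono powr_mono2') auto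
    ultimately have "\<bar>hn n x - hn n y\<bar> powr p * K x y \<le> 1 * (Cb * norm y powr (- \<beta>))"
      unfolding Cb_def by (intro mult_mono) auto
    then have "ennreal (\<bar>hn n x - hn n y\<bar> powr p * K x y) \<le> ennreal (Cb * norm y powr (- \<beta>))"
      by (intro ennreal_leI) simp
    also have "\<dots> = ennreal Cb * ennreal (norm y powr (- \<beta>))" by (rule ennreal_mult) (auto simp: Cb_def)
    finally show ?thesis using x2 y c by (simp add: G_def)
  qed
  define B where "B = enn2real (ennreal ((c / 2) powr (- 2 * \<beta>)) * U + (IG + IG))"
  have Beq: "ennreal ((c / 2) powr (- 2 * \<beta>)) * U + (IG + IG) = ennreal B"
    unfolding B_def using Ufin IGfin by (simp add: ennreal_mult_less_top)
  have gB: "gag (hn n) \<le> ennreal B" for n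
  proof -
    let ?F = "\<lambda>z. ennreal (\<bar>hn n (fst z) - hn n (snd z)\<bar> powr p * norm (fst z - snd z) powr (- ?a))"
    have "gag (hn n) \<le> (\<integral>\<^sup>+z. ennreal ((c / 2) powr (- 2 * \<beta>)) * ?F z + (G (fst z) (snd z) + G (snd z) (fst z)) \<partial>M2)"
      unfolding gag_def
    proof (rule nn_integral_mono)
      fix z :: "'a \<times> 'a"
      define x y where "x = fst z" and "y = snd z"
      consider "norm y < c / 2" | "norm x < c / 2" | "c / 2 \<le> norm x" "c / 2 \<le> norm y" by linarith
      then have "ennreal (\<bar>hn n x - hn n y\<bar> powr p * K x y)
        \<le> ennreal ((c / 2) powr (- 2 * \<beta>)) * ennreal (\<bar>hn n x - hn n y\<bar> powr p * norm (x - y) powr (- ?a)) + (G x y + G y x)"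
      proof cases
        case 1
        then show ?thesis using side[of y n x] by (simp add: add_increasing add_increasing2)
      next
        case 2
        then have "ennreal (\<bar>hn n x - hn n y\<bar> powr p * K x y) \<le> G y x"
          using side[of x n y] K_sym[of x y] by (simp add: abs_minus_commute)
        then show ?thesis by (simp add: add_increasing)
      next
        case 3
        have "norm x powr (- \<beta>) * norm y powr (- \<beta>) \<le> (c / 2) powr (- \<beta>) * (c / 2) powr (- \<beta>)"
          using 3 c \<beta>_nonneg by (intro mult_mono powr_mono2') auto
        also have "\<dots> = (c / 2) powr (- 2 * \<beta>)" by (simp add: powr_add[symmetric])
        finally have "(\<bar>hn n x - hn n y\<bar> powr p * norm (x - y) powr (- ?a)) * (norm x powr (- \<beta>) * norm y powr (- \<beta>))
          \<le> (\<bar>hn n x - hn n y\<bar> powr p * norm (x - y) powr (- ?a)) * (c / 2) powr (- 2 * \<beta>)"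
          by (intro mult_left_mono) auto
        then have "\<bar>hn n x - hn n y\<bar> powr p * K x y \<le> (c / 2) powr (- 2 * \<beta>) * (\<bar>hn n x - hn n y\<bar> powr p * norm (x - y) powr (- ?a))"
          by (simp add: K_eq mult_ac)
        then have "ennreal (\<bar>hn n x - hn n y\<bar> powr p * K x y) \<le> ennreal ((c / 2) powr (- 2 * \<beta>)) * ennreal (\<bar>hn n x - hn n y\<bar> powr p * norm (x - y) powr (- ?a))"
          by (subst ennreal_mult[symmetric]) (auto intro: ennreal_leI)
        then show ?thesis by (simp add: add_increasing2)
      qed
      then show "ennreal (\<bar>hn n (fst z) - hn n (snd z)\<bar> powr p * K (fst z) (snd z))
        \<le> ennreal ((c / 2) powr (- 2 * \<beta>)) * ?F z + (G (fst z) (snd z) + G (snd z) (fst z))"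
        by (simp add: x_def y_def)
    qed
    also have "\<dots> = (\<integral>\<^sup>+z. ennreal ((c / 2) powr (- 2 * \<beta>)) * ?F z \<partial>M2) + (\<integral>\<^sup>+z. G (fst z) (snd z) + G (snd z) (fst z) \<partial>M2)"
      by (rule nn_integral_add) measurable
    also have "(\<integral>\<^sup>+z. G (fst z) (snd z) + G (snd z) (fst z) \<partial>M2) = IG + IG"
      by (subst nn_integral_add) (simp_all add: Gm Gsym)
    also have "(\<integral>\<^sup>+z. ennreal ((c / 2) powr (- 2 * \<beta>)) * ?F z \<partial>M2) = ennreal ((c / 2) powr (- 2 * \<beta>)) * (\<integral>\<^sup>+z. ?F z \<partial>M2)"
      by (rule nn_integral_cmult) measurable
    also have "(\<integral>\<^sup>+z. ?F z \<partial>M2) \<le> U"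
      unfolding U_def by (rule convolution_energy_le[OF hm h01 \<rho>(3) \<rho>(1) \<rho>(4) hn2 int])
    finally show ?thesis unfolding Beq[symmetric] by (simp add: mult_left_mono add_right_mono)
  qed
  have hnint: "integrable lborel (\<lambda>x. hn n x - h x)" for n
    using hn0 hn1 hnR \<epsilon>(2)[of n] h01 h0 by (intro Bochner_Integration.integrable_diff hint integrable_bounded_support[of _ "R + \<epsilon> n"]) auto
  have "(\<lambda>n. \<integral>x. norm (hn n x - h x) \<partial>lborel) \<longlonglongrightarrow> 0"
  proof (rule LIMSEQ_I)
    fix e :: real assume e: "e > 0"
    obtain d where d: "d > 0" "\<And>z. norm z < d \<Longrightarrow> (\<integral>\<^sup>+x. ennreal \<bar>h (x - z) - h x\<bar> \<partial>lborel) \<le> ennreal (e / 2)"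
      using L1_translation_continuous[OF hm h01 h0 R(1), of "e / 2"] e by auto
    obtain n0 :: nat where n0: "\<delta> / d < real n0" using reals_Archimedean2 by blast
    have "norm ((\<integral>x. norm (hn n x - h x) \<partial>lborel) - 0) < e" if "n \<ge> n0" for n
    proof -
      have "\<delta> / d < real (Suc n)" using n0 that by simp
      then have \<epsilon>d: "\<epsilon> n < d" using d(1) by (simp add: \<epsilon>_def field_simps)
      have "(\<integral>\<^sup>+x. ennreal \<bar>hn n x - h x\<bar> \<partial>lborel) \<le> ennreal (e / 2)"
      proof (rule convolution_L1_le[OF hm h01 \<rho>(3) \<rho>(1) \<rho>(4) hn2 int])
        show "\<rho> n z = 0" if "d \<le> norm z" for z using \<rho>(2)[of n z] that \<epsilon>d by linarith
      qed (use d in auto)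
      also have "(\<integral>\<^sup>+x. ennreal \<bar>hn n x - h x\<bar> \<partial>lborel) = ennreal (\<integral>x. norm (hn n x - h x) \<partial>lborel)"
        using integrable_norm[OF hnint[of n]] by (simp add: nn_integral_eq_integral)
      finally have "(\<integral>x. norm (hn n x - h x) \<partial>lborel) \<le> e / 2" using e by (simp add: ennreal_le_iff)
      moreover have "0 \<le> (\<integral>x. norm (hn n x - h x) \<partial>lborel)" by simp
      ultimately show ?thesis using e by simp
    qed
    then show "\<exists>no. \<forall>n\<ge>no. norm ((\<integral>x. norm (hn n x - h x) \<partial>lborel) - 0) < e" by blast
  qed
  \<comment> \<open>L1 convergence gives almost everywhere convergence only along a subsequence,
    which suffices because each member of the sequence has a nonnegative form.\<close>
  then obtain r :: "nat \<Rightarrow> nat" where r: "AE x in lborel. (\<lambda>n. hn (r n) x - h x) \<longlonglongrightarrow> 0"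
    using tendsto_L1_AE_subseq[of lborel "\<lambda>n x. hn n x - h x", OF hnint] by blast
  have "(\<lambda>n. form v (hn (r n))) \<longlonglongrightarrow> form v h"
  proof (rule form_tendsto[OF _ _ _ gv gh])
    show "gag (hn (r n)) \<le> ennreal B" for n by (rule gB)
    show "AE x in lborel. (\<lambda>n. hn (r n) x) \<longlonglongrightarrow> h x"
      using r by eventually_elim (simp add: LIM_zero_iff)
  qed measurable
  moreover have "0 \<le> form v (hn n)" for n
  proof (rule smooth[OF hnC hn0])
    fix x :: 'a assume "R' \<le> norm x"
    then show "hn n x = 0" using \<epsilon>(2)[of n] \<delta>(3) by (intro hnR) linarith
  qed
  ultimately show ?thesis by (intro LIMSEQ_le_const[of _ "form v h" 0]) auto
qed

text \<open>The ball \<Omega>1 lies strictly between the support of \<psi> and the boundary of the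
  given ball. Pairs outside \<open>DU \<Omega>1\<close> contribute 0, so the localised form is the
  full one.\<close>

lemma supersolution_form_smooth:
  assumes sup: "supersolution s p \<beta> \<Omega> f v" and f: "\<And>x. 0 \<le> f x" and \<Omega>: "ball (0::'a) R \<subseteq> \<Omega>"
    and R': "0 < R'" "R' < R" and \<psi>: "Cinf \<psi>" "\<And>x. 0 \<le> \<psi> x" "\<And>x. R' \<le> norm x \<Longrightarrow> \<psi> x = 0"
  shows "0 \<le> form v \<psi>"
proof -
  define r where "r = (R' + R) / 2"
  have r: "0 < r" "R' < r" "r < R" using R' by (auto simp: r_def)
  define \<Omega>1 where "\<Omega>1 = ball (0::'a) r"
  have O1: "open \<Omega>1" "compact (closure \<Omega>1)" "closure \<Omega>1 \<subseteq> \<Omega>"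
    using r \<Omega> by (auto simp: \<Omega>1_def)
  have "continuous_on UNIV \<psi>" using \<psi>(1) by (auto simp: Cinf_def dest: spec[of _ 0])
  then have [measurable]: "\<psi> \<in> borel_measurable borel" by (rule borel_measurable_continuous_onI)
  have "closure {x. \<psi> x \<noteq> 0} \<subseteq> cball 0 R'"
    using \<psi>(3) by (intro closure_minimal) (auto, meson linear)
  moreover have "cball 0 R' \<subseteq> \<Omega>1" using r by (auto simp: \<Omega>1_def)
  ultimately have "test_fun \<Omega>1 \<psi>"
    using \<psi>(1) by (auto simp: test_fun_def intro: bounded_subset[OF bounded_cball] simp: compact_eq_bounded_closed)
  moreover have "\<psi> x = 0" if "x \<notin> \<Omega>1" for x using that \<psi>(3)[of x] r by (auto simp: \<Omega>1_def)
  \<comment> \<open>The constant sequence approximates \<psi> with error 0, so finiteness of the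
    norm of \<psi> does not enter.\<close>
  ultimately have W: "\<psi> \<in> W0 s p \<beta> \<Omega>1"
    unfolding W0_def using p_gt by (auto intro!: exI[of _ "\<lambda>_. \<psi>"])
  have "(\<integral>x. indicator \<Omega>1 x * (f x * \<psi> x) \<partial>lborel)
      \<le> (\<integral>z. indicator (DU \<Omega>1) z * (Jp p (v (fst z) - v (snd z)) * (\<psi> (fst z) - \<psi> (snd z)) * K (fst z) (snd z)) \<partial>M2)"
    using sup W \<psi>(2) O1 unfolding supersolution_def by blast
  also have "\<dots> = form v \<psi>"
    unfolding form_def form_integrand_def
  proof (rule Bochner_Integration.integral_cong[OF refl])
    fix z :: "'a \<times> 'a"
    have "\<psi> (fst z) = 0 \<and> \<psi> (snd z) = 0" if "z \<notin> DU \<Omega>1"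
      using that \<psi>(3) r by (auto simp: DU_def \<Omega>1_def)
    then show "indicator (DU \<Omega>1) z * (Jp p (v (fst z) - v (snd z)) * (\<psi> (fst z) - \<psi> (snd z)) * K (fst z) (snd z))
      = Jp p (v (fst z) - v (snd z)) * (\<psi> (fst z) - \<psi> (snd z)) * K (fst z) (snd z)"
      by (cases "z \<in> DU \<Omega>1") auto
  qed
  \<comment> \<open>The integral of f \<psi> is nonnegative also in the non-integrable case, where
    its value is 0 by default.\<close>
  finally show ?thesis
    using f \<psi>(2) by (intro order_trans[OF integral_nonneg_AE]) auto
qed

section \<open>From a supersolution in \<Omega> to a normalised one at unit scale\<close>

lemma supersolution_form_nonneg:
  assumes v: "v \<in> Wsp s p \<beta>" and sup: "supersolution s p \<beta> \<Omega> f v" and f: "\<And>x. 0 \<le> f x"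
    and \<Omega>: "ball (0::'a) R \<subseteq> \<Omega>" and R': "0 < R'" "R' < R" and h: "admissible R' h"
  shows "0 \<le> form v h"
proof -
  have vm: "v \<in> borel_measurable borel" and gv: "gag v < \<infinity>"
    using v by (auto simp: Wsp_def gag_def)
  show ?thesis
  proof (rule form_nonneg_by_origin_cutoff[OF vm gv h])
    fix h c assume h: "admissible R' h" "0 < c" "\<And>x. norm x < c \<Longrightarrow> h x = 0"
    show "0 \<le> form v h"
    proof (rule form_nonneg_by_mollification[OF vm gv h(1) R'(1) _ h(2,3), of "(R' + R) / 2"])
      fix \<psi> :: "'a \<Rightarrow> real" assume "Cinf \<psi>" "\<And>x. 0 \<le> \<psi> x" "\<And>x. (R' + R) / 2 \<le> norm x \<Longrightarrow> \<psi> x = 0"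
      then show "0 \<le> form v \<psi>"
        using R' by (intro supersolution_form_smooth[OF sup f \<Omega>, of "(R' + R) / 2"]) auto
    qed (use R' in auto)
  qed
qed

text \<open>All that the estimates use: the domain, the datum and the radius have disappeared, so
  constants obtained for this class depend only on s, p, \<beta> and the dimension, together with
  any chosen exponent.\<close>

definition unit_supersolution :: "('a \<Rightarrow> real) \<Rightarrow> bool" where
  "unit_supersolution w \<longleftrightarrow> w \<in> borel_measurable borel \<and> (\<forall>x. 0 \<le> w x) \<and> gag w < \<infinity> \<and>
     (\<forall>h. admissible 2 h \<longrightarrow> 0 \<le> form w h)"

lemma form_cong_AE:
  assumes [measurable]: "v \<in> borel_measurable borel" "w \<in> borel_measurable borel" "h \<in> borel_measurable borel"
    and eq: "AE x in lborel. v x = w x"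
  shows "form v h = form w h" "gag v = gag w"
proof -
  have ae: "AE z in M2. v (fst z) = w (fst z) \<and> v (snd z) = w (snd z)" by (rule AE_pair_fst_snd[OF eq])
  show "form v h = form w h"
    unfolding form_def
  proof (rule integral_cong_AE)
    show "AE z in M2. form_integrand v h z = form_integrand w h z"
      using ae by eventually_elim (simp add: form_integrand_def)
  qed measurable
  show "gag v = gag w"
    unfolding gag_def
  proof (rule nn_integral_cong_AE)
    show "AE z in M2. ennreal (\<bar>v (fst z) - v (snd z)\<bar> powr p * K (fst z) (snd z))
        = ennreal (\<bar>w (fst z) - w (snd z)\<bar> powr p * K (fst z) (snd z))"
      using ae by eventually_elim simp
  qed
qed

text \<open>A test function at unit scale is dilated to one supported in the ball of radius 2r,
  which lies inside the given ball. Both the dilation and the division by L multiply the form by a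
  positive factor. Taking the positive part changes v only on a null set and gives nonnegativity
  everywhere.\<close>

lemma supersolution_rescale:
  assumes v: "v \<in> Wsp s p \<beta>" and sup: "supersolution s p \<beta> \<Omega> f v" and f: "\<And>x. 0 \<le> f x"
    and \<Omega>: "ball (0::'a) R \<subseteq> \<Omega>" and v0: "AE x in lborel. 0 \<le> v x"
    and r: "0 < r" "2 * r < R" and L: "0 < L"
  shows "unit_supersolution (\<lambda>x. max 0 (v (r *\<^sub>R x)) / L)"
proof -
  have vm[measurable]: "v \<in> borel_measurable borel" and gv: "gag v < \<infinity>"
    using v by (auto simp: Wsp_def gag_def)
  define v' where "v' x = max 0 (v x)" for x
  have v'm[measurable]: "v' \<in> borel_measurable borel" unfolding v'_def by measurable
  have ae: "AE x in lborel. v' x = v x" using v0 by eventually_elim (simp add: v'_def)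
  define w where "w x = v' (r *\<^sub>R x)" for x
  have wm[measurable]: "w \<in> borel_measurable borel" unfolding w_def by measurable
  have gw: "gag w < \<infinity>"
  proof -
    have "ennreal (r powr cap_exp) * gag w = gag v'" unfolding w_def by (rule gag_scale[symmetric, OF v'm r(1)])
    also have "\<dots> = gag v" by (rule form_cong_AE(2)[OF v'm vm vm ae])
    finally have "ennreal (r powr cap_exp) * gag w < \<infinity>" using gv by simp
    then show ?thesis using r by (auto simp: ennreal_mult_less_top)
  qed
  have wl: "(\<lambda>x. max 0 (v (r *\<^sub>R x)) / L) = (\<lambda>x. w x / L)" by (simp add: w_def v'_def)
  have gwl: "gag (\<lambda>x. w x / L) < \<infinity>"
  proof -
    have "gag (\<lambda>x. w x / L) = (\<integral>\<^sup>+z. ennreal ((1 / L) powr p) * ennreal (\<bar>w (fst z) - w (snd z)\<bar> powr p * K (fst z) (snd z)) \<partial>M2)"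
      unfolding gag_def
    proof (rule nn_integral_cong)
      fix z :: "'a \<times> 'a"
      have "w (fst z) / L - w (snd z) / L = (1 / L) * (w (fst z) - w (snd z))" by (simp add: diff_divide_distrib)
      then have "\<bar>w (fst z) / L - w (snd z) / L\<bar> powr p = (1 / L) powr p * \<bar>w (fst z) - w (snd z)\<bar> powr p"
        using L by (simp only: abs_mult powr_mult) simp
      then show "ennreal (\<bar>w (fst z) / L - w (snd z) / L\<bar> powr p * K (fst z) (snd z)) = ennreal ((1 / L) powr p) * ennreal (\<bar>w (fst z) - w (snd z)\<bar> powr p * K (fst z) (snd z))"
        by (subst ennreal_mult[symmetric]) (simp_all add: mult.assoc)
    qed
    also have "\<dots> = ennreal ((1 / L) powr p) * gag w" unfolding gag_def by (rule nn_integral_cmult) measurable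
    also have "\<dots> < \<infinity>" using gw by (simp add: ennreal_mult_less_top)
    finally show ?thesis .
  qed
  have "0 \<le> form (\<lambda>x. w x / L) h" if h: "admissible 2 h" for h
  proof -
    have hm[measurable]: "h \<in> borel_measurable borel" using h by (simp add: admissible_def)
    \<comment> \<open>The dilated test function: it is tested against v itself, and scaling brings
      the inequality back to h and w.\<close>
    define h' where "h' x = h ((1 / r) *\<^sub>R x)" for x
    have h'm[measurable]: "h' \<in> borel_measurable borel" unfolding h'_def by measurable
    have hh: "(\<lambda>x. h' (r *\<^sub>R x)) = h" using r by (auto simp: h'_def)
    have "gag h' = ennreal (r powr cap_exp) * gag h" using gag_scale[OF h'm r(1)] unfolding hh .
    then have "gag h' < \<infinity>" using h by (simp add: admissible_def ennreal_mult_less_top)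
    moreover have "h' x = 0" if "2 * r \<le> norm x" for x
    proof -
      have "2 \<le> norm ((1 / r) *\<^sub>R x)" using that r by (simp add: field_simps)
      then show ?thesis using h by (simp add: h'_def admissible_def)
    qed
    ultimately have "admissible (2 * r) h'" using h h'm by (auto simp: admissible_def h'_def)
    then have "0 \<le> form v h'" using r by (intro supersolution_form_nonneg[OF v sup f \<Omega>, of "2 * r"]) auto
    also have "\<dots> = form v' h'" by (rule form_cong_AE(1)[OF v'm vm h'm ae, symmetric])
    also have "\<dots> = r powr cap_exp * form w h"
      using form_scale[OF v'm h'm r(1)] unfolding hh w_def .
    finally have "0 \<le> form w h" using r by (simp add: zero_le_mult_iff)
    moreover have "form (\<lambda>x. w x / L) h = (1 / L) powr (p - 1) * form w h"
    proof -
      have "form (\<lambda>x. w x / L) h = (\<integral>z. (1 / L) powr (p - 1) * form_integrand w h z \<partial>M2)"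
        unfolding form_def
      proof (rule Bochner_Integration.integral_cong[OF refl])
        fix z :: "'a \<times> 'a"
        have "w (fst z) / L - w (snd z) / L = (1 / L) * (w (fst z) - w (snd z))" by (simp add: diff_divide_distrib)
        then have "Jp p (w (fst z) / L - w (snd z) / L) = (1 / L) powr (p - 1) * Jp p (w (fst z) - w (snd z))"
          using Jp_scale[of "1 / L" p] L by simp
        then show "form_integrand (\<lambda>x. w x / L) h z = (1 / L) powr (p - 1) * form_integrand w h z"
          by (simp add: form_integrand_def mult.assoc)
      qed
      then show ?thesis by (simp add: form_def)
    qed
    ultimately show ?thesis by simp
  qed
  then show ?thesis
    unfolding unit_supersolution_def wl using gwl L by (auto simp: w_def v'_def)
qed

end

section \<open>The barrier argument\<close>

text \<open>Two bounds for the same product, suited to near and far pairs: the first keeps the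
  energy of the test function at the cost of the increment of the cutoff, the second gives up that
  energy for an error linear in f. Both retain the gain \<open>G\<close> from a partner at which v
  is at least 2.\<close>

lemma barrier_pointwise:
  fixes b1 b2 v1 v2 t p :: real
  defines "f1 \<equiv> max 0 (b1 - t - v1)" and "f2 \<equiv> max 0 (b2 - t - v2)"
  defines "G \<equiv> \<lambda>y f. if 2 \<le> y then (1 / 2) * (y / 2) powr (p - 1) * f else 0"
  assumes p: "1 < p" and b: "0 \<le> b1" "b1 \<le> 1" "0 \<le> b2" "b2 \<le> 1" and t: "0 \<le> t" and v: "0 \<le> v1" "0 \<le> v2"
  shows "Jp p (v1 - v2) * (f1 - f2) + ((1 / 2) powr p * \<bar>f1 - f2\<bar> powr p + (G v2 f1 + G v1 f2))
      \<le> (2 * 3 powr (p - 1) + 1) * (\<bar>b1 - b2\<bar> powr p * (of_bool (0 < f1) + of_bool (0 < f2)))" (is ?near)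
    and "Jp p (v1 - v2) * (f1 - f2) + (G v2 f1 + G v1 f2) \<le> f1 + f2" (is ?far)
proof -
  \<comment> \<open>Where both f1 and f2 are positive the two arguments of \<open>Jp\<close> agree.
    Where one vanishes, the truncation moves the argument in the direction that monotonicity of
    \<open>Jp\<close> makes favourable.\<close>
  have key: "Jp p (v1 - v2) * (f1 - f2) \<le> Jp p ((b1 - b2) - (f1 - f2)) * (f1 - f2)"
  proof -
    consider "0 < f1" "0 < f2" | "0 < f1" "f2 = 0" | "f1 = 0" "0 < f2" | "f1 = 0" "f2 = 0"
      unfolding f1_def f2_def by linarith
    then show ?thesis
    proof cases
      case 1
      then have "v1 - v2 = (b1 - b2) - (f1 - f2)" by (simp add: f1_def f2_def max_def split: if_splits)
      then show ?thesis by simp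
    next
      case 2
      then have "v1 - v2 \<le> (b1 - b2) - (f1 - f2)" by (simp add: f1_def f2_def max_def split: if_splits)
      then show ?thesis using 2 by (intro mult_right_mono Jp_mono p) auto
    next
      case 3
      then have "(b1 - b2) - (f1 - f2) \<le> v1 - v2" by (simp add: f1_def f2_def max_def split: if_splits)
      then show ?thesis using 3 by (intro mult_right_mono_neg Jp_mono p) auto
    qed auto
  qed
  have f1_le: "0 \<le> f1" "f1 \<le> 1" and f2_le: "0 \<le> f2" "f2 \<le> 1" using b t v by (auto simp: f1_def f2_def)
  have half: "(1 / 2) powr p \<le> 1 / 2" using powr_mono'[of 1 p "1 / 2"] p by simp
  \<comment> \<open>A partner with value y2 >= 2 leaves a gap of at least y2/2 to y1 < 1. Half of
    the resulting gain is kept as \<open>G\<close>, the other half pays for the energy term, since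
    (1/2)^p g^p <= g/2 for g in [0, 1].\<close>
  have big: "Jp p (y1 - y2) * (g1 - g2) + ((1 / 2) powr p * \<bar>g1 - g2\<bar> powr p + (G y2 g1 + G y1 g2)) \<le> 0"
    if "0 < g1" "g1 \<le> 1" "2 \<le> y2" "g2 = 0" "0 \<le> y1" "y1 < 1" for y1 y2 g1 g2
  proof -
    have "Jp p (y1 - y2) = - ((y2 - y1) powr (p - 1))"
      using that Jp_nonneg_eq[of "y2 - y1" p] Jp_minus[of p "y2 - y1"] by simp
    moreover have "(y2 / 2) powr (p - 1) \<le> (y2 - y1) powr (p - 1)"
      using that p by (intro powr_mono2) auto
    ultimately have J: "Jp p (y1 - y2) * (g1 - g2) \<le> - ((y2 / 2) powr (p - 1) * g1)"
      using that by (simp add: mult_right_mono)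
    have "g1 powr p \<le> g1 powr 1" using that p by (intro powr_mono') auto
    then have "(1 / 2) powr p * g1 powr p \<le> 1 / 2 * g1" using half that by (intro mult_mono) auto
    also have "\<dots> \<le> 1 / 2 * ((y2 / 2) powr (p - 1) * g1)"
      using that p by (intro mult_left_mono) (auto simp: ge_one_powr_ge_zero)
    finally show ?thesis using J that by (simp add: G_def)
  qed
  have C: "0 \<le> (2 * 3 powr (p - 1) + 1) * (\<bar>b1 - b2\<bar> powr p * (of_bool (0 < f1) + of_bool (0 < f2)))" by simp
  have D0: "0 \<le> (1 / 2) powr p * \<bar>f1 - f2\<bar> powr p" by simp
  consider (a) "0 < f1" "2 \<le> v2" | (b) "0 < f2" "2 \<le> v1" | (c) "\<not> (0 < f1 \<and> 2 \<le> v2)" "\<not> (0 < f2 \<and> 2 \<le> v1)" by blast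
  then have "?near \<and> ?far"
  proof cases
    case a
    have "f2 = 0" "v1 < 1" using a b t v by (auto simp: f1_def f2_def max_def split: if_splits)
    then have "Jp p (v1 - v2) * (f1 - f2) + ((1 / 2) powr p * \<bar>f1 - f2\<bar> powr p + (G v2 f1 + G v1 f2)) \<le> 0"
      using a f1_le v by (intro big) auto
    then show ?thesis using C D0 f1_le f2_le by (intro conjI; linarith)
  next
    case b': b
    have z: "f1 = 0" "v2 < 1" using b' b t v by (auto simp: f1_def f2_def max_def split: if_splits)
    have "Jp p (v2 - v1) * (f2 - f1) = Jp p (v1 - v2) * (f1 - f2)"
      using Jp_minus[of p "v1 - v2"] by (simp add: algebra_simps)
    moreover have "Jp p (v2 - v1) * (f2 - f1) + ((1 / 2) powr p * \<bar>f2 - f1\<bar> powr p + (G v1 f2 + G v2 f1)) \<le> 0"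
      using z b' f2_le v by (intro big) auto
    moreover have "\<bar>f2 - f1\<bar> = \<bar>f1 - f2\<bar>" by (rule abs_minus_commute)
    ultimately have "Jp p (v1 - v2) * (f1 - f2) + ((1 / 2) powr p * \<bar>f1 - f2\<bar> powr p + (G v2 f1 + G v1 f2)) \<le> 0"
      by simp
    then show ?thesis using C D0 f1_le f2_le by (intro conjI; linarith)
  next
    case c
    have G0: "G v2 f1 = 0" "G v1 f2 = 0" using c f1_le f2_le by (auto simp: G_def)
    have n: ?near
    proof (cases "f1 = 0 \<and> f2 = 0")
      case True
      then show ?thesis using G0 by simp
    next
      case False
      then have "1 \<le> of_bool (0 < f1) + (of_bool (0 < f2) :: real)" using f1_le f2_le by auto
      then have "\<bar>b1 - b2\<bar> powr p * 1 \<le> \<bar>b1 - b2\<bar> powr p * (of_bool (0 < f1) + of_bool (0 < f2))"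
        by (intro mult_left_mono) auto
      then have "(2 * 3 powr (p - 1) + 1) * (\<bar>b1 - b2\<bar> powr p) \<le> (2 * 3 powr (p - 1) + 1) * (\<bar>b1 - b2\<bar> powr p * (of_bool (0 < f1) + of_bool (0 < f2)))"
        by (intro mult_left_mono) auto
      then show ?thesis using key Jp_barrier_ineq[OF p, of "b1 - b2" "f1 - f2"] G0 by linarith
    qed
    have "Jp p ((b1 - b2) - (f1 - f2)) * (f1 - f2) \<le> Jp p (b1 - b2) * (f1 - f2)"
    proof (cases "0 \<le> f1 - f2")
      case True
      then show ?thesis by (intro mult_right_mono Jp_mono p) auto
    next
      case False
      then show ?thesis by (intro mult_right_mono_neg Jp_mono p) auto
    qed
    also have "\<dots> \<le> \<bar>b1 - b2\<bar> powr (p - 1) * \<bar>f1 - f2\<bar>"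
      using abs_Jp[of p "b1 - b2"] by (metis abs_ge_self abs_mult)
    also have "\<dots> \<le> 1 * (f1 + f2)"
    proof (intro mult_mono)
      show "\<bar>b1 - b2\<bar> powr (p - 1) \<le> 1" using powr_mono2[of "p - 1" "\<bar>b1 - b2\<bar>" 1] b p by auto
    qed (use f1_le f2_le in auto)
    finally have "Jp p (v1 - v2) * (f1 - f2) \<le> 1 * (f1 + f2)" by (rule order_trans[OF key])
    then have ?far unfolding G0 by simp
    with n show ?thesis by blast
  qed
  then show ?near ?far by auto
qed

section \<open>Level sets of the barrier\<close>

context weighted_kernel
begin

definition lev :: "('a \<Rightarrow> real) \<Rightarrow> real \<Rightarrow> 'a \<Rightarrow> real" where
  "lev v t x = max 0 (cutoff x - t - v x)"

text \<open>Restricted to near pairs because only there is the cutoff error free of the weight,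
  hence controlled by the Lebesgue measure of the level set that the iteration needs. The error of
  far pairs carries the weight and is absorbed otherwise.\<close>

definition near_energy :: "('a \<Rightarrow> real) \<Rightarrow> ennreal" where
  "near_energy f = (\<integral>\<^sup>+z. ennreal (if norm (fst z - snd z) < 1 / 4 then \<bar>f (fst z) - f (snd z)\<bar> powr p * K (fst z) (snd z) else 0) \<partial>M2)"

definition wint :: "('a \<Rightarrow> real) \<Rightarrow> ennreal" where
  "wint f = (\<integral>\<^sup>+x. ennreal (f x * norm x powr (- \<beta>)) \<partial>lborel)"

text \<open>The density of the long-range gain: v to the power p - 1 where v is large, up to
  constants. The restriction to the ball of radius 2 keeps the kernel bounded below.\<close>

definition big_part :: "('a \<Rightarrow> real) \<Rightarrow> 'a \<Rightarrow> real" where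
  "big_part v y = (if norm y < 2 \<and> 2 \<le> v y then (1 / 2) * (v y / 2) powr (p - 1) else 0)"

lemma lev_measurable [measurable]:
  assumes [measurable]: "v \<in> borel_measurable borel"
  shows "lev v t \<in> borel_measurable borel"
  unfolding lev_def by measurable

lemma big_part_measurable [measurable]:
  assumes [measurable]: "v \<in> borel_measurable borel"
  shows "big_part v \<in> borel_measurable borel"
  unfolding big_part_def by measurable

lemma big_part_nonneg: "0 \<le> big_part v y" by (simp add: big_part_def)

lemma lev_admissible:
  assumes v: "unit_supersolution v" and t: "0 \<le> t"
  shows "admissible 2 (lev v t)"
proof -
  have [measurable]: "v \<in> borel_measurable borel" and v0: "\<And>x. 0 \<le> v x" and gv: "gag v < \<infinity>"
    using v by (auto simp: unit_supersolution_def)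
  have "gag (lev v t) < \<infinity>"
    by (rule gag_finite_add[OF _ _ _ gag_cutoff gv]) (auto simp: lev_def)
  moreover have "lev v t x \<le> 1" for x unfolding lev_def using v0[of x] t cutoff_range(2)[of x] by simp
  moreover have "lev v t x = 0" if "2 \<le> norm x" for x
    unfolding lev_def using v0[of x] t cutoff_eq_0[OF that] by simp
  ultimately show ?thesis unfolding admissible_def by (auto simp: lev_def)
qed

lemma kernel_lower_bound:
  assumes "norm x < R" "norm y < R" "x \<noteq> y" "0 < R"
  shows "(2 * R) powr (- (N + p * s)) * (norm x powr (- \<beta>) * norm y powr (- \<beta>)) \<le> K x y"
proof -
  have "norm (x - y) \<le> 2 * R" using norm_triangle_ineq4[of x y] assms by linarith
  then have "(2 * R) powr (- (N + p * s)) \<le> norm (x - y) powr (- (N + p * s))"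
    using assms ps_pos p_gt p_less by (intro powr_mono2') auto
  then show ?thesis unfolding K_eq by (simp add: mult.assoc mult_right_mono)
qed

text \<open>The integrated barrier inequality. The errors are the measure of the level set (near
  pairs) and the weighted integral of the test function (far pairs). The gain on the left is a
  multiple of that same weighted integral, with a factor that is large when v is large on
  average.\<close>

lemma barrier_energy:
  "\<exists>A>0. \<exists>B>0. \<forall>v t. unit_supersolution v \<longrightarrow> 0 \<le> t \<longrightarrow>
     ennreal ((1 / 2) powr p) * near_energy (lev v t) + ennreal (4 powr (- (N + p * s))) * (wint (big_part v) * wint (lev v t))
     \<le> ennreal A * emeasure lborel {x. 0 < lev v t x} + ennreal B * wint (lev v t)"
proof -
  obtain C1 where C1: "C1 > 0" "\<And>x::'a. (\<integral>\<^sup>+y. ennreal (indicator {y. norm (x - y) < 1 / 4} y * (\<bar>cutoff x - cutoff y\<bar> powr p * K x y)) \<partial>lborel) \<le> ennreal C1"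
    using near_cutoff_bound by blast
  obtain C2 where C2: "C2 > 0" "\<And>x::'a. (\<integral>\<^sup>+y. ennreal (indicator {y. 1 / 4 \<le> norm (x - y)} y * K x y) \<partial>lborel) \<le> ennreal (C2 * norm x powr (- \<beta>))"
    using far_kernel_bound by blast
  define C0 where "C0 = 2 * 3 powr (p - 1) + (1::real)"
  have C0: "C0 > 0" by (simp add: C0_def add_nonneg_pos)
  have main: "ennreal ((1 / 2) powr p) * near_energy (lev v t) + ennreal (4 powr (- (N + p * s))) * (wint (big_part v) * wint (lev v t))
     \<le> ennreal (2 * (C0 * C1)) * emeasure lborel {x. 0 < lev v t x} + ennreal (2 * C2) * wint (lev v t)"
    if v: "unit_supersolution v" and t: "0 \<le> t" for v t
  proof -
    have vm[measurable]: "v \<in> borel_measurable borel" and v0: "\<And>x. 0 \<le> v x" and gv: "gag v < \<infinity>"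
      and pos: "\<And>h. admissible 2 h \<Longrightarrow> 0 \<le> form v h"
      using v by (auto simp: unit_supersolution_def)
    define f where "f = lev v t"
    have fm[measurable]: "f \<in> borel_measurable borel" unfolding f_def by measurable
    have adm: "admissible 2 f" unfolding f_def by (rule lev_admissible[OF v t])
    have f0: "0 \<le> f x" for x using adm by (simp add: admissible_def)
    have f2: "f x = 0" if "2 \<le> norm x" for x using adm that by (simp add: admissible_def)
    define nr where "nr z \<longleftrightarrow> norm (fst z - snd z :: 'a) < 1 / 4" for z
    have nrm[measurable]: "Measurable.pred M2 nr" unfolding nr_def by measurable
    define Pn where "Pn z = (if nr z then \<bar>f (fst z) - f (snd z)\<bar> powr p * K (fst z) (snd z) else 0)" for z
    define Pb where "Pb x y = big_part v y * f x * K x y" for x y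
    \<comment> \<open>The error is attributed to the point at which the test function is positive,
      so that for fixed x the integral over y is one of the two kernel bounds.\<close>
    define q where "q x y = (if norm (x - y) < 1 / 4 then C0 * (\<bar>cutoff x - cutoff y\<bar> powr p * of_bool (0 < f x)) * K x y else f x * K x y)" for x y :: 'a
    have Pnm[measurable]: "Pn \<in> borel_measurable M2" unfolding Pn_def by measurable
    have Pbm[measurable]: "(\<lambda>z. Pb (fst z) (snd z)) \<in> borel_measurable M2" "(\<lambda>z. Pb (snd z) (fst z)) \<in> borel_measurable M2"
      unfolding Pb_def by measurable
    have qm[measurable]: "(\<lambda>z. q (fst z) (snd z)) \<in> borel_measurable M2" "(\<lambda>z. q (snd z) (fst z)) \<in> borel_measurable M2"
      unfolding q_def by measurable
    have nn: "0 \<le> Pn z" "0 \<le> Pb x y" "0 \<le> q x y" for z x y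
      using f0 C0 big_part_nonneg by (auto simp: Pn_def Pb_def q_def)
    have "(\<integral>\<^sup>+z. ennreal ((1 / 2) powr p * Pn z + (Pb (fst z) (snd z) + Pb (snd z) (fst z))) \<partial>M2)
      \<le> (\<integral>\<^sup>+z. ennreal (q (fst z) (snd z) + q (snd z) (fst z)) \<partial>M2)"
    proof (rule nn_integral_energy_le)
      show "integrable M2 (form_integrand v f)"
        using adm gv by (intro form_integrable) (auto simp: admissible_def)
      show "0 \<le> (\<integral>z. form_integrand v f z \<partial>M2)" using pos[OF adm] by (simp add: form_def)
      show "AE z in M2. 0 \<le> (1 / 2) powr p * Pn z + (Pb (fst z) (snd z) + Pb (snd z) (fst z))
        \<and> 0 \<le> q (fst z) (snd z) + q (snd z) (fst z)
        \<and> form_integrand v f z + ((1 / 2) powr p * Pn z + (Pb (fst z) (snd z) + Pb (snd z) (fst z))) \<le> q (fst z) (snd z) + q (snd z) (fst z)"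
      proof (rule AE_I2, intro conjI)
        fix z :: "'a \<times> 'a"
        define x y where "x = fst z" and "y = snd z"
        define k where "k = K x y"
        have k: "0 \<le> k" "K y x = k" by (auto simp: k_def K_sym)
        define G where "G = (\<lambda>y f. if 2 \<le> y then (1 / 2) * (y / 2) powr (p - 1) * f else (0::real))"
        have Gle: "big_part v y * f x \<le> G (v y) (f x)" for x y
          using f0[of x] by (auto simp: big_part_def G_def)
        have fe: "f x = max 0 (cutoff x - t - v x)" for x by (simp add: f_def lev_def)
        have bp: "Jp p (v x - v y) * (f x - f y) + ((1 / 2) powr p * \<bar>f x - f y\<bar> powr p + (G (v y) (f x) + G (v x) (f y)))
            \<le> C0 * (\<bar>cutoff x - cutoff y\<bar> powr p * (of_bool (0 < f x) + of_bool (0 < f y)))"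
          "Jp p (v x - v y) * (f x - f y) + (G (v y) (f x) + G (v x) (f y)) \<le> f x + f y"
          unfolding fe G_def C0_def
          by (rule barrier_pointwise[OF p_gt cutoff_range[of x] cutoff_range[of y] t v0[of x] v0[of y]])+
        have Pbs: "Pb x y + Pb y x \<le> (G (v y) (f x) + G (v x) (f y)) * k"
          using mult_right_mono[OF Gle[of y x] k(1)] mult_right_mono[OF Gle[of x y] k(1)]
          by (simp add: Pb_def k k_def[symmetric] distrib_right)
        have "Jp p (v x - v y) * (f x - f y) * k + ((1 / 2) powr p * Pn z + (Pb x y + Pb y x)) \<le> q x y + q y x"
        proof (cases "norm (x - y) < 1 / 4")
          case True
          have P: "Pn z = \<bar>f x - f y\<bar> powr p * k" using True by (simp add: Pn_def nr_def x_def y_def k_def)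
          have q: "q x y + q y x = (C0 * (\<bar>cutoff x - cutoff y\<bar> powr p * (of_bool (0 < f x) + of_bool (0 < f y)))) * k"
            using True by (simp add: q_def k k_def[symmetric] norm_minus_commute abs_minus_commute algebra_simps)
          have "(Jp p (v x - v y) * (f x - f y) + ((1 / 2) powr p * \<bar>f x - f y\<bar> powr p + (G (v y) (f x) + G (v x) (f y)))) * k \<le> q x y + q y x"
            unfolding q by (rule mult_right_mono[OF bp(1) k(1)])
          then show ?thesis using Pbs unfolding P by (simp add: algebra_simps)
        next
          case False
          have P: "Pn z = 0" using False by (simp add: Pn_def nr_def x_def y_def)
          have q: "q x y + q y x = (f x + f y) * k"
            using False by (simp add: q_def k k_def[symmetric] norm_minus_commute algebra_simps)
          have "(Jp p (v x - v y) * (f x - f y) + (G (v y) (f x) + G (v x) (f y))) * k \<le> q x y + q y x"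
            unfolding q by (rule mult_right_mono[OF bp(2) k(1)])
          then show ?thesis using Pbs unfolding P by (simp add: algebra_simps)
        qed
        then show "form_integrand v f z + ((1 / 2) powr p * Pn z + (Pb (fst z) (snd z) + Pb (snd z) (fst z))) \<le> q (fst z) (snd z) + q (snd z) (fst z)"
          by (simp add: form_integrand_def x_def y_def k_def)
        show "0 \<le> (1 / 2) powr p * Pn z + (Pb (fst z) (snd z) + Pb (snd z) (fst z))"
          using nn by simp
        show "0 \<le> q (fst z) (snd z) + q (snd z) (fst z)" using nn by simp
      qed
    qed measurable
    also have "\<dots> = (\<integral>\<^sup>+z. ennreal (q (fst z) (snd z)) + ennreal (q (snd z) (fst z)) \<partial>M2)"
      using nn by (simp add: ennreal_plus)
    also have "\<dots> = (\<integral>\<^sup>+z. ennreal (q (fst z) (snd z)) \<partial>M2) + (\<integral>\<^sup>+z. ennreal (q (snd z) (fst z)) \<partial>M2)"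
      by (rule nn_integral_add) measurable
    also have "(\<integral>\<^sup>+z. ennreal (q (snd z) (fst z)) \<partial>M2) = (\<integral>\<^sup>+x. \<integral>\<^sup>+y. ennreal (q x y) \<partial>lborel \<partial>lborel)"
      by (rule nn_integral_lborel_pair(2)) measurable
    also have "(\<integral>\<^sup>+z. ennreal (q (fst z) (snd z)) \<partial>M2) = (\<integral>\<^sup>+x. \<integral>\<^sup>+y. ennreal (q x y) \<partial>lborel \<partial>lborel)"
      by (rule nn_integral_lborel_pair(1)) measurable
    also have "(\<integral>\<^sup>+x. \<integral>\<^sup>+y. ennreal (q x y) \<partial>lborel \<partial>lborel) \<le> (\<integral>\<^sup>+x. ennreal (C0 * C1) * indicator {x. 0 < f x} x + ennreal C2 * ennreal (f x * norm x powr (- \<beta>)) \<partial>lborel)"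
    proof (rule nn_integral_mono)
      fix x :: 'a
      have "(\<integral>\<^sup>+y. ennreal (q x y) \<partial>lborel)
        = (\<integral>\<^sup>+y. ennreal (C0 * of_bool (0 < f x)) * ennreal (indicator {y. norm (x - y) < 1 / 4} y * (\<bar>cutoff x - cutoff y\<bar> powr p * K x y))
            + ennreal (f x) * ennreal (indicator {y. 1 / 4 \<le> norm (x - y)} y * K x y) \<partial>lborel)"
        using C0 f0[of x] by (intro nn_integral_cong) (auto simp: q_def ennreal_mult[symmetric] mult_ac)
      also have "\<dots> = (\<integral>\<^sup>+y. ennreal (C0 * of_bool (0 < f x)) * ennreal (indicator {y. norm (x - y) < 1 / 4} y * (\<bar>cutoff x - cutoff y\<bar> powr p * K x y)) \<partial>lborel)
           + (\<integral>\<^sup>+y. ennreal (f x) * ennreal (indicator {y. 1 / 4 \<le> norm (x - y)} y * K x y) \<partial>lborel)"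
        by (rule nn_integral_add) measurable
      also have "(\<integral>\<^sup>+y. ennreal (C0 * of_bool (0 < f x)) * ennreal (indicator {y. norm (x - y) < 1 / 4} y * (\<bar>cutoff x - cutoff y\<bar> powr p * K x y)) \<partial>lborel)
         = ennreal (C0 * of_bool (0 < f x)) * (\<integral>\<^sup>+y. ennreal (indicator {y. norm (x - y) < 1 / 4} y * (\<bar>cutoff x - cutoff y\<bar> powr p * K x y)) \<partial>lborel)"
        by (rule nn_integral_cmult) measurable
      also have "(\<integral>\<^sup>+y. ennreal (f x) * ennreal (indicator {y. 1 / 4 \<le> norm (x - y)} y * K x y) \<partial>lborel)
         = ennreal (f x) * (\<integral>\<^sup>+y. ennreal (indicator {y. 1 / 4 \<le> norm (x - y)} y * K x y) \<partial>lborel)"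
        by (rule nn_integral_cmult) measurable
      also have "ennreal (C0 * of_bool (0 < f x)) * (\<integral>\<^sup>+y. ennreal (indicator {y. norm (x - y) < 1 / 4} y * (\<bar>cutoff x - cutoff y\<bar> powr p * K x y)) \<partial>lborel)
          + ennreal (f x) * (\<integral>\<^sup>+y. ennreal (indicator {y. 1 / 4 \<le> norm (x - y)} y * K x y) \<partial>lborel)
         \<le> ennreal (C0 * of_bool (0 < f x)) * ennreal C1 + ennreal (f x) * ennreal (C2 * norm x powr (- \<beta>))"
        by (intro add_mono mult_left_mono C1 C2) auto
      also have "ennreal (f x) * ennreal (C2 * norm x powr (- \<beta>)) = ennreal C2 * ennreal (f x * norm x powr (- \<beta>))"
        using C2(1) f0[of x] by (simp add: ennreal_mult[symmetric] mult_ac)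
      also have "ennreal (C0 * of_bool (0 < f x)) * ennreal C1 = ennreal (C0 * C1) * indicator {x. 0 < f x} x"
        using C0 C1 by (auto simp: ennreal_mult[symmetric] indicator_def)
      finally show "(\<integral>\<^sup>+y. ennreal (q x y) \<partial>lborel) \<le> ennreal (C0 * C1) * indicator {x. 0 < f x} x + ennreal C2 * ennreal (f x * norm x powr (- \<beta>))" .
    qed
    also have "(\<integral>\<^sup>+x. ennreal (C0 * C1) * indicator {x. 0 < f x} x + ennreal C2 * ennreal (f x * norm x powr (- \<beta>)) \<partial>lborel)
       = ennreal (C0 * C1) * emeasure lborel {x. 0 < f x} + ennreal C2 * wint f"
    proof -
      have [measurable]: "{x. 0 < f x} \<in> sets borel" by measurable
      have "(\<integral>\<^sup>+x. ennreal (C0 * C1) * indicator {x. 0 < f x} x + ennreal C2 * ennreal (f x * norm x powr (- \<beta>)) \<partial>lborel)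
        = (\<integral>\<^sup>+x. ennreal (C0 * C1) * indicator {x. 0 < f x} x \<partial>lborel) + (\<integral>\<^sup>+x. ennreal C2 * ennreal (f x * norm x powr (- \<beta>)) \<partial>lborel)"
        by (rule nn_integral_add) measurable
      moreover have "(\<integral>\<^sup>+x. ennreal (C0 * C1) * indicator {x. 0 < f x} x \<partial>lborel) = ennreal (C0 * C1) * emeasure lborel {x. 0 < f x}"
        by (rule nn_integral_cmult_indicator) simp
      moreover have "(\<integral>\<^sup>+x. ennreal C2 * ennreal (f x * norm x powr (- \<beta>)) \<partial>lborel) = ennreal C2 * wint f"
        unfolding wint_def by (rule nn_integral_cmult) measurable
      ultimately show ?thesis by simp
    qed
    finally have up: "(\<integral>\<^sup>+z. ennreal ((1 / 2) powr p * Pn z + (Pb (fst z) (snd z) + Pb (snd z) (fst z))) \<partial>M2)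
      \<le> (ennreal (C0 * C1) * emeasure lborel {x. 0 < f x} + ennreal C2 * wint f) + (ennreal (C0 * C1) * emeasure lborel {x. 0 < f x} + ennreal C2 * wint f)"
      by (simp add: add_mono)
    have "ennreal ((1 / 2) powr p) * near_energy f + (\<integral>\<^sup>+z. ennreal (Pb (fst z) (snd z)) \<partial>M2)
       = (\<integral>\<^sup>+z. ennreal ((1 / 2) powr p) * ennreal (Pn z) + ennreal (Pb (fst z) (snd z)) \<partial>M2)"
    proof -
      have "(\<integral>\<^sup>+z. ennreal ((1 / 2) powr p) * ennreal (Pn z) + ennreal (Pb (fst z) (snd z)) \<partial>M2)
        = (\<integral>\<^sup>+z. ennreal ((1 / 2) powr p) * ennreal (Pn z) \<partial>M2) + (\<integral>\<^sup>+z. ennreal (Pb (fst z) (snd z)) \<partial>M2)"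
        by (rule nn_integral_add) measurable
      moreover have "(\<integral>\<^sup>+z. ennreal ((1 / 2) powr p) * ennreal (Pn z) \<partial>M2) = ennreal ((1 / 2) powr p) * (\<integral>\<^sup>+z. ennreal (Pn z) \<partial>M2)"
        by (rule nn_integral_cmult) measurable
      ultimately show ?thesis by (simp add: near_energy_def Pn_def nr_def)
    qed
    also have "\<dots> \<le> (\<integral>\<^sup>+z. ennreal ((1 / 2) powr p * Pn z + (Pb (fst z) (snd z) + Pb (snd z) (fst z))) \<partial>M2)"
    proof (rule nn_integral_mono)
      fix z
      show "ennreal ((1 / 2) powr p) * ennreal (Pn z) + ennreal (Pb (fst z) (snd z)) \<le> ennreal ((1 / 2) powr p * Pn z + (Pb (fst z) (snd z) + Pb (snd z) (fst z)))"
        using nn by (simp add: ennreal_mult[symmetric] ennreal_plus[symmetric] ennreal_leI del: ennreal_plus)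
    qed
    also note up
    finally have est: "ennreal ((1 / 2) powr p) * near_energy f + (\<integral>\<^sup>+z. ennreal (Pb (fst z) (snd z)) \<partial>M2)
      \<le> (ennreal (C0 * C1) * emeasure lborel {x. 0 < f x} + ennreal C2 * wint f) + (ennreal (C0 * C1) * emeasure lborel {x. 0 < f x} + ennreal C2 * wint f)" .
    \<comment> \<open>Two points of the ball of radius 2 are at distance at most 4, so the kernel
      factorises from below and the double integral dominates a product. Only one of the two
      symmetric gains is kept.\<close>
    have "ennreal (4 powr (- (N + p * s))) * (wint (big_part v) * wint f) \<le> (\<integral>\<^sup>+z. ennreal (Pb (fst z) (snd z)) \<partial>M2)"
    proof -
      have "ennreal (4 powr (- (N + p * s))) * (wint (big_part v) * wint f)
        = (\<integral>\<^sup>+x. (ennreal (4 powr (- (N + p * s))) * wint (big_part v)) * ennreal (f x * norm x powr (- \<beta>)) \<partial>lborel)"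
      proof -
        have "(\<integral>\<^sup>+x. (ennreal (4 powr (- (N + p * s))) * wint (big_part v)) * ennreal (f x * norm x powr (- \<beta>)) \<partial>lborel)
          = (ennreal (4 powr (- (N + p * s))) * wint (big_part v)) * wint f"
          unfolding wint_def[of f] by (rule nn_integral_cmult) measurable
        then show ?thesis by (simp add: mult.assoc)
      qed
      also have "\<dots> \<le> (\<integral>\<^sup>+x. \<integral>\<^sup>+y. ennreal (Pb x y) \<partial>lborel \<partial>lborel)"
      proof (rule nn_integral_mono)
        fix x :: 'a
        have "(ennreal (4 powr (- (N + p * s))) * wint (big_part v)) * ennreal (f x * norm x powr (- \<beta>))
          = (\<integral>\<^sup>+y. (ennreal (4 powr (- (N + p * s))) * ennreal (f x * norm x powr (- \<beta>))) * ennreal (big_part v y * norm y powr (- \<beta>)) \<partial>lborel)"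
        proof -
          have "(\<integral>\<^sup>+y. (ennreal (4 powr (- (N + p * s))) * ennreal (f x * norm x powr (- \<beta>))) * ennreal (big_part v y * norm y powr (- \<beta>)) \<partial>lborel)
            = (ennreal (4 powr (- (N + p * s))) * ennreal (f x * norm x powr (- \<beta>))) * wint (big_part v)"
            unfolding wint_def by (rule nn_integral_cmult) measurable
          then show ?thesis by (simp add: mult_ac)
        qed
        also have "\<dots> \<le> (\<integral>\<^sup>+y. ennreal (Pb x y) \<partial>lborel)"
        proof (rule nn_integral_mono_AE)
          have "AE y in lborel. y \<noteq> x" using AE_lborel_singleton[of x] by (simp add: eq_commute)
          then show "AE y in lborel. (ennreal (4 powr (- (N + p * s))) * ennreal (f x * norm x powr (- \<beta>))) * ennreal (big_part v y * norm y powr (- \<beta>)) \<le> ennreal (Pb x y)"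
          proof eventually_elim
            case (elim y)
            have "4 powr (- (N + p * s)) * (f x * norm x powr (- \<beta>)) * (big_part v y * norm y powr (- \<beta>)) \<le> Pb x y"
            proof (cases "norm x < 2 \<and> norm y < 2")
              case True
              then have "(2 * 2) powr (- (N + p * s)) * (norm x powr (- \<beta>) * norm y powr (- \<beta>)) \<le> K x y"
                using elim by (intro kernel_lower_bound) auto
              then have "(big_part v y * f x) * ((2 * 2) powr (- (N + p * s)) * (norm x powr (- \<beta>) * norm y powr (- \<beta>))) \<le> (big_part v y * f x) * K x y"
                using f0 big_part_nonneg by (intro mult_left_mono) auto
              then show ?thesis by (simp add: Pb_def mult_ac)
            next
              case False
              then have "f x = 0 \<or> big_part v y = 0" using f2[of x] by (auto simp: big_part_def)
              then show ?thesis by (auto simp: Pb_def)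
            qed
            then show ?case
              using f0[of x] big_part_nonneg[of v y] by (simp add: ennreal_mult[symmetric] ennreal_leI)
          qed
        qed
        finally show "(ennreal (4 powr (- (N + p * s))) * wint (big_part v)) * ennreal (f x * norm x powr (- \<beta>)) \<le> (\<integral>\<^sup>+y. ennreal (Pb x y) \<partial>lborel)" .
      qed
      also have "\<dots> = (\<integral>\<^sup>+z. ennreal (Pb (fst z) (snd z)) \<partial>M2)"
        by (rule nn_integral_lborel_pair(1)[symmetric]) measurable
      finally show ?thesis .
    qed
    then have "ennreal ((1 / 2) powr p) * near_energy f + ennreal (4 powr (- (N + p * s))) * (wint (big_part v) * wint f)
      \<le> (ennreal (C0 * C1) * emeasure lborel {x. 0 < f x} + ennreal C2 * wint f) + (ennreal (C0 * C1) * emeasure lborel {x. 0 < f x} + ennreal C2 * wint f)"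
      using est by (meson add_left_mono order_trans)
    also have "\<dots> = (ennreal (C0 * C1) + ennreal (C0 * C1)) * emeasure lborel {x. 0 < f x} + (ennreal C2 + ennreal C2) * wint f"
      by (simp add: distrib_right add_ac)
    also have "\<dots> = ennreal (2 * (C0 * C1)) * emeasure lborel {x. 0 < f x} + ennreal (2 * C2) * wint f"
      using C0 C1 C2 by (simp flip: ennreal_plus)
    finally show ?thesis unfolding f_def .
  qed
  show ?thesis
    using main C0 C1(1) C2(1) by (intro exI[of _ "2 * (C0 * C1)"] exI[of _ "2 * C2"] conjI allI impI) auto
qed


text \<open>Finiteness is what allows this term to be cancelled from both sides of the energy
  inequality.\<close>

lemma wint_lev_finite:
  assumes "unit_supersolution v" "0 \<le> t"
  shows "wint (lev v t) < \<infinity>"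
proof -
  have "admissible 2 (lev v t)" by (rule lev_admissible[OF assms])
  then have f: "0 \<le> lev v t x" "lev v t x \<le> 1" "2 \<le> norm x \<Longrightarrow> lev v t x = 0" for x
    by (auto simp: admissible_def)
  have "wint (lev v t) \<le> (\<integral>\<^sup>+x\<in>ball 0 2. ennreal (norm (x::'a) powr (- \<beta>)) \<partial>lborel)"
    unfolding wint_def
  proof (rule nn_integral_mono)
    fix x :: 'a
    have "lev v t x * norm x powr (- \<beta>) \<le> norm x powr (- \<beta>)" using f by (simp add: mult_left_le_one_le)
    then show "ennreal (lev v t x * norm x powr (- \<beta>)) \<le> ennreal (norm x powr (- \<beta>)) * indicator (ball 0 2) x"
      using f(3)[of x] by (cases "norm x < 2") (auto intro: ennreal_leI)
  qed
  also have "\<dots> < \<infinity>" using \<beta>_nonneg \<beta>_less_N N_def by (intro nn_integral_norm_powr_ball) auto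
  finally show ?thesis .
qed

text \<open>This stands in for a fractional Sobolev inequality. Each x in the higher level set sees,
  within distance \<sigma>, a set of measure at least g on which the test function vanishes, and
  there the kernel is at least \<sigma> to the power -(N + ps) times the weights. Both points have
  norm below 3, whence the constant.\<close>

lemma near_energy_level_ge:
  assumes [measurable]: "v \<in> borel_measurable borel" and t: "0 \<le> t" "t < h" and \<sigma>: "0 < \<sigma>" "\<sigma> \<le> 1 / 4"
    and S: "\<And>t. S t = {x \<in> ball 0 2. t < cutoff x - v x}"
    and v0: "\<And>x. 0 \<le> v x"
    and g: "\<And>x. ennreal g \<le> emeasure lborel (ball x \<sigma> - S t)"
  shows "ennreal ((h - t) powr p * 3 powr (- 2 * \<beta>) * \<sigma> powr (- (N + p * s))) * (ennreal g * emeasure lborel (S h))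
    \<le> near_energy (lev v t)"
proof -
  let ?a = "N + p * s"
  define c where "c = (h - t) powr p * 3 powr (- 2 * \<beta>) * \<sigma> powr (- ?a)"
  have [measurable]: "S t \<in> sets borel" for t unfolding S by measurable
  let ?F = "\<lambda>x y. ennreal (if norm (x - y :: 'a) < 1 / 4 then \<bar>lev v t x - lev v t y\<bar> powr p * K x y else 0)"
  have pt: "c \<le> \<bar>lev v t x - lev v t y\<bar> powr p * K x y" if x: "x \<in> S h" "x \<noteq> 0" and y: "y \<in> ball x \<sigma> - S t" "y \<noteq> 0" "y \<noteq> x" for x y :: 'a
  proof -
    have lx: "lev v t x \<ge> h - t" using x by (auto simp: lev_def S)
    have ly: "lev v t y = 0"
      using y v0[of y] t cutoff_eq_0[of y] by (cases "norm y < 2") (auto simp: lev_def S)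
    have nx: "norm x < 3" using x by (auto simp: S)
    have d: "norm (x - y) < \<sigma>" using y by (simp add: dist_norm)
    have "norm y < 3"
      using norm_triangle_ineq2[of y x] d \<sigma> x by (auto simp: S norm_minus_commute)
    then have w: "3 powr (- \<beta>) * 3 powr (- \<beta>) \<le> norm x powr (- \<beta>) * norm y powr (- \<beta>)"
      using nx x y \<beta>_nonneg by (intro mult_mono powr_mono2') auto
    have "\<sigma> powr (- ?a) \<le> norm (x - y) powr (- ?a)"
      using d y ps_pos p_gt p_less by (intro powr_mono2') auto
    then have "\<sigma> powr (- ?a) * (3 powr (- \<beta>) * 3 powr (- \<beta>)) \<le> norm (x - y) powr (- ?a) * (norm x powr (- \<beta>) * norm y powr (- \<beta>))"
      using w by (rule mult_mono) auto
    moreover have "3 powr (- \<beta>) * 3 powr (- \<beta>) = (3::real) powr (- 2 * \<beta>)" by (simp add: powr_add[symmetric])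
    ultimately have "\<sigma> powr (- ?a) * 3 powr (- 2 * \<beta>) \<le> K x y" by (simp add: K_eq mult.assoc)
    moreover have "(h - t) powr p \<le> \<bar>lev v t x - lev v t y\<bar> powr p"
      using lx ly t p_gt by (intro powr_mono2) auto
    ultimately have "(h - t) powr p * (\<sigma> powr (- ?a) * 3 powr (- 2 * \<beta>)) \<le> \<bar>lev v t x - lev v t y\<bar> powr p * K x y"
      by (intro mult_mono) auto
    then show ?thesis by (simp add: c_def mult_ac)
  qed
  have ne0: "AE x in lborel. (x::'a) \<noteq> 0" using AE_lborel_singleton[of 0] by (simp add: eq_commute)
  have "ennreal c * (ennreal g * emeasure lborel (S h)) = (\<integral>\<^sup>+x. (ennreal c * ennreal g) * indicator (S h) x \<partial>lborel)"
    by (subst nn_integral_cmult_indicator) (simp_all add: mult.assoc)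
  also have "\<dots> \<le> (\<integral>\<^sup>+x. \<integral>\<^sup>+y. ?F x y \<partial>lborel \<partial>lborel)"
  proof (rule nn_integral_mono_AE)
    show "AE x in lborel. (ennreal c * ennreal g) * indicator (S h) x \<le> (\<integral>\<^sup>+y. ?F x y \<partial>lborel)"
      using ne0
    proof eventually_elim
      case (elim x)
      show ?case
      proof (cases "x \<in> S h")
        case True
        have "(ennreal c * ennreal g) * indicator (S h) x \<le> ennreal c * emeasure lborel (ball x \<sigma> - S t)"
          using True g[of x] by (simp add: mult_left_mono)
        also have "\<dots> = (\<integral>\<^sup>+y. ennreal c * indicator (ball x \<sigma> - S t) y \<partial>lborel)"
          by (subst nn_integral_cmult_indicator) simp_all
        also have "\<dots> \<le> (\<integral>\<^sup>+y. ?F x y \<partial>lborel)"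
        proof (rule nn_integral_mono_AE)
          have "AE y in lborel. y \<noteq> x" using AE_lborel_singleton[of x] by (simp add: eq_commute)
          with ne0 show "AE y in lborel. ennreal c * indicator (ball x \<sigma> - S t) y \<le> ?F x y"
          proof eventually_elim
            case (elim y)
            show ?case
            proof (cases "y \<in> ball x \<sigma> - S t")
              case y: True
              then have "norm (x - y) < 1 / 4" using \<sigma> by (auto simp: dist_norm)
              then show ?thesis using pt[OF True \<open>x \<noteq> 0\<close> y elim] y by (simp add: ennreal_leI)
            qed simp
          qed
        qed
        finally show ?thesis .
      qed simp
    qed
  qed
  also have "\<dots> = near_energy (lev v t)"
    unfolding near_energy_def by (rule nn_integral_lborel_pair(1)[symmetric]) measurable
  finally show ?thesis unfolding c_def .
qed

text \<open>By contradiction: a large weighted integral of \<open>big_part\<close> absorbs the far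
  error with surplus m. That surplus makes the level set at 1/4 small by Chebyshev's inequality, and
  the iteration then empties the level set at 1/2, i.e. v is at least 1/2 on the ball of radius
  3/2.\<close>

lemma barrier_conclusion:
  "\<exists>M>0. \<forall>v. unit_supersolution v \<longrightarrow> \<not> (AE x in lborel. norm x < 3 / 2 \<longrightarrow> 1 / 2 \<le> v x) \<longrightarrow> wint (big_part v) \<le> ennreal M"
proof -
  obtain A B where AB: "A > 0" "B > 0" and en: "\<And>v t. unit_supersolution v \<Longrightarrow> 0 \<le> t \<Longrightarrow>
     ennreal ((1 / 2) powr p) * near_energy (lev v t) + ennreal (4 powr (- (N + p * s))) * (wint (big_part v) * wint (lev v t))
     \<le> ennreal A * emeasure lborel {x. 0 < lev v t x} + ennreal B * wint (lev v t)"
    using barrier_energy by blast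
  let ?a = "N + p * s"
  define l where "l = p * s / N"
  have Npos: "0 < N" using p_gt p_less by linarith
  have l: "0 < l" using ps_pos Npos by (simp add: l_def)
  define \<omega> where "\<omega> = unit_ball_vol N"
  have \<omega>: "0 < \<omega>" unfolding \<omega>_def using Npos by simp
  define c4 where "c4 = (4::real) powr (- ?a)"
  have c4: "0 < c4" by (simp add: c4_def)
  define Cs where "Cs = A * 2 powr p * 3 powr (2 * \<beta>) * (2 / \<omega>) powr (1 + l)"
  have Cs: "0 < Cs" using AB \<omega> by (simp add: Cs_def)
  \<comment> \<open>The first entry forces the radius \<sigma> used in the iteration step to be at
    most 1/4, so that only near pairs occur; the second is the smallness demanded by the
    iteration.\<close>
  define \<delta> where "\<delta> = min (\<omega> * (1 / 4) powr N / 2) ((2 powr (- p / l) / (Cs * 8 powr p)) powr (1 / l))"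
  have \<delta>: "0 < \<delta>" using \<omega> Cs by (simp add: \<delta>_def)
  define V2 where "V2 = measure lborel (ball (0::'a) 2)"
  have V2: "emeasure lborel (ball (0::'a) 2) = ennreal V2"
    unfolding V2_def using emeasure_lborel_ball_finite[of "0::'a" 2] by (intro emeasure_eq_ennreal_measure) simp
  have V20: "0 \<le> V2" by (simp add: V2_def)
  \<comment> \<open>Solves m (1/4) 2^(-\<beta>) \<delta> = A (V2 + 1), so that the energy inequality
    at level 0 yields measure at most \<delta> at level 1/4.\<close>
  define m where "m = 4 * 2 powr \<beta> * A * (V2 + 1) / \<delta>"
  have m: "0 < m" using AB \<delta> V20 by (simp add: m_def)
  define M where "M = (B + m) / c4"
  have M: "0 < M" using AB m c4 by (simp add: M_def)
  have "wint (big_part v) \<le> ennreal M"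
    if v: "unit_supersolution v" and bad: "\<not> (AE x in lborel. norm x < 3 / 2 \<longrightarrow> 1 / 2 \<le> v x)" for v
  proof (rule ccontr)
    assume "\<not> wint (big_part v) \<le> ennreal M"
    then have "ennreal c4 * ennreal M \<le> ennreal c4 * wint (big_part v)" by (intro mult_left_mono) auto
    moreover have "ennreal c4 * ennreal M = ennreal (m + B)"
      using c4 M by (simp add: ennreal_mult[symmetric] M_def add.commute)
    ultimately have big: "ennreal m + ennreal B \<le> ennreal c4 * wint (big_part v)"
      using m AB by (simp add: ennreal_plus)
    have vm[measurable]: "v \<in> borel_measurable borel" and v0: "\<And>x. 0 \<le> v x"
      using v by (auto simp: unit_supersolution_def)
    define S where "S t = {x \<in> ball 0 2. t < cutoff x - v x}" for t
    have Sm[measurable]: "S t \<in> sets borel" for t unfolding S_def by measurable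
    define g where "g t = measure lborel (S t)" for t
    have Sfin: "emeasure lborel (S t) < \<infinity>" for t
    proof -
      have "emeasure lborel (S t) \<le> emeasure lborel (ball (0::'a) 2)" by (rule emeasure_mono) (auto simp: S_def)
      then show ?thesis unfolding V2 by (simp add: le_less_trans)
    qed
    have eg: "emeasure lborel (S t) = ennreal (g t)" for t
      unfolding g_def using Sfin[of t] by (intro emeasure_eq_ennreal_measure) simp
    have g0: "0 \<le> g t" for t by (simp add: g_def)
    have ganti: "g h \<le> g t" if "t \<le> h" for t h
      unfolding g_def using Sfin[of t] that by (intro measure_mono_fmeasurable) (auto simp: S_def fmeasurable_def)
    have gV: "g t \<le> V2" for t
      unfolding g_def V2_def using emeasure_lborel_ball_finite[of "0::'a" 2]
      by (intro measure_mono_fmeasurable) (auto simp: S_def fmeasurable_def)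
    have Sl: "{x. 0 < lev v t x} = S t" if "0 \<le> t" for t
    proof -
      have "norm x < 2" if "0 < cutoff x - t - v x" for x
        using that v0[of x] cutoff_eq_0[of x] \<open>0 \<le> t\<close> by (cases "norm x < 2") auto
      then show ?thesis unfolding S_def lev_def by (auto simp: max_def)
    qed
    \<comment> \<open>The far error B times the weighted integral stands on both sides and is
      finite, so it cancels and leaves the surplus m.\<close>
    have est: "ennreal ((1 / 2) powr p) * near_energy (lev v t) + ennreal m * wint (lev v t) \<le> ennreal (A * g t)" if t: "0 \<le> t" for t
    proof -
      let ?W = "wint (lev v t)"
      have "ennreal B * ?W + (ennreal ((1 / 2) powr p) * near_energy (lev v t) + ennreal m * ?W)
        = ennreal ((1 / 2) powr p) * near_energy (lev v t) + (ennreal m + ennreal B) * ?W"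
        by (simp add: distrib_right add_ac)
      also have "\<dots> \<le> ennreal ((1 / 2) powr p) * near_energy (lev v t) + (ennreal c4 * wint (big_part v)) * ?W"
        by (intro add_left_mono mult_right_mono big) auto
      also have "\<dots> \<le> ennreal A * emeasure lborel {x. 0 < lev v t x} + ennreal B * ?W"
        using en[OF v t] by (simp add: c4_def mult.assoc)
      also have "\<dots> = ennreal B * ?W + ennreal (A * g t)"
        using Sl[OF t] eg[of t] AB g0[of t] by (simp add: ennreal_mult add.commute)
      finally have le: "ennreal B * ?W + (ennreal ((1 / 2) powr p) * near_energy (lev v t) + ennreal m * ?W)
          \<le> ennreal B * ?W + ennreal (A * g t)" .
      have "ennreal B * ?W \<noteq> top" using wint_lev_finite[OF v t] by (simp add: ennreal_mult_eq_top_iff)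
      then show ?thesis using le by (simp add: ennreal_add_left_cancel_le)
    qed
    \<comment> \<open>On the level set at 1/4 the test function of level 0 is at least 1/4 and the
      weight at least 2^(-\<beta>).\<close>
    have start: "g (1 / 4) \<le> \<delta>"
    proof -
      have "ennreal ((1 / 4) * 2 powr (- \<beta>) * g (1 / 4)) = (\<integral>\<^sup>+x. ennreal ((1 / 4) * 2 powr (- \<beta>)) * indicator (S (1 / 4)) x \<partial>lborel)"
      proof -
        have "(\<integral>\<^sup>+x. ennreal ((1 / 4) * 2 powr (- \<beta>)) * indicator (S (1 / 4)) x \<partial>lborel) = ennreal ((1 / 4) * 2 powr (- \<beta>)) * ennreal (g (1 / 4))"
          unfolding eg[symmetric] by (rule nn_integral_cmult_indicator) simp
        also have "\<dots> = ennreal ((1 / 4) * 2 powr (- \<beta>) * g (1 / 4))"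
          using g0[of "1 / 4"] by (intro ennreal_mult[symmetric]) auto
        finally show ?thesis by simp
      qed
      also have "\<dots> \<le> wint (lev v 0)"
        unfolding wint_def
      proof (rule nn_integral_mono_AE)
        have ne0: "AE x in lborel. (x::'a) \<noteq> 0" using AE_lborel_singleton[of 0] by (simp add: eq_commute)
        then show "AE x in lborel. ennreal ((1 / 4) * 2 powr (- \<beta>)) * indicator (S (1 / 4)) x \<le> ennreal (lev v 0 x * norm x powr (- \<beta>))"
        proof eventually_elim
          case (elim x)
          show ?case
          proof (cases "x \<in> S (1 / 4)")
            case True
            have "1 / 4 * 2 powr (- \<beta>) \<le> lev v 0 x * norm x powr (- \<beta>)"
              using True elim \<beta>_nonneg by (intro mult_mono powr_mono2') (auto simp: S_def lev_def)
            then show ?thesis using True by (simp add: ennreal_leI)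
          qed simp
        qed
      qed
      finally have "ennreal m * ennreal ((1 / 4) * 2 powr (- \<beta>) * g (1 / 4)) \<le> ennreal m * wint (lev v 0)"
        by (rule mult_left_mono) simp
      also have "\<dots> \<le> ennreal (A * g 0)" using est[of 0] by (metis (no_types, lifting) add_increasing order.trans order_refl zero_le)
      finally have "ennreal (m * ((1 / 4) * 2 powr (- \<beta>) * g (1 / 4))) \<le> ennreal (A * g 0)"
        using m g0 by (subst ennreal_mult) auto
      then have "m * ((1 / 4) * 2 powr (- \<beta>) * g (1 / 4)) \<le> A * g 0"
        using AB g0 by (subst (asm) ennreal_le_iff) auto
      also have "\<dots> \<le> A * (V2 + 1)" using AB gV[of 0] by (intro mult_left_mono) auto
      finally have "m * ((1 / 4) * 2 powr (- \<beta>)) * g (1 / 4) \<le> A * (V2 + 1)" by (simp add: mult.assoc)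
      moreover have "m * ((1 / 4) * 2 powr (- \<beta>)) = A * (V2 + 1) / \<delta>"
        by (simp add: m_def powr_minus)
      ultimately have "A * (V2 + 1) / \<delta> * g (1 / 4) \<le> A * (V2 + 1)" by (simp only:)
      also have "A * (V2 + 1) = A * (V2 + 1) / \<delta> * \<delta>" using \<delta> by simp
      finally have "A * (V2 + 1) / \<delta> * g (1 / 4) \<le> A * (V2 + 1) / \<delta> * \<delta>" .
      moreover have "0 < A * (V2 + 1) / \<delta>" using AB V20 \<delta> by simp
      ultimately show ?thesis by (simp only: mult_le_cancel_left_pos)
    qed
    have step: "g h \<le> Cs * (h - t) powr (- p) * g t powr (1 + l)" if t: "1 / 4 \<le> t" "t < h" "h < 1 / 2" for t h
    proof (cases "g t = 0")
      case True
      then show ?thesis using ganti[of t h] t g0[of h] by simp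
    next
      case False
      then have gt: "0 < g t" using g0[of t] by simp
      \<comment> \<open>A ball of radius \<sigma> has measure 2 g t; even if it contains the whole
        level set, measure g t is left over. One factor g t then cancels, and \<sigma> to the power
        N + ps becomes g t to the power 1 + l.\<close>
      define \<sigma> where "\<sigma> = (2 * g t / \<omega>) powr (1 / N)"
      have \<sigma>: "0 < \<sigma>" using gt \<omega> by (simp add: \<sigma>_def)
      have \<sigma>N: "\<sigma> powr N = 2 * g t / \<omega>" using gt \<omega> Npos by (simp add: \<sigma>_def powr_powr)
      have "g t \<le> g (1 / 4)" using t by (intro ganti)
      also have "\<dots> \<le> \<delta>" by (rule start)
      also have "\<dots> \<le> \<omega> * (1 / 4) powr N / 2" by (simp add: \<delta>_def)
      finally have "\<sigma> powr N \<le> (1 / 4) powr N" unfolding \<sigma>N using \<omega> by (simp add: field_simps)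
      then have \<sigma>4: "\<sigma> \<le> 1 / 4" using Npos \<sigma> by (metis linorder_not_le powr_less_mono2 zero_le_divide_1_iff zero_le_numeral)
      have ball: "emeasure lborel (ball x \<sigma>) = ennreal (2 * g t)" for x :: 'a
      proof -
        have "\<sigma> ^ DIM('a) = 2 * g t / \<omega>" using \<sigma> \<sigma>N by (simp add: N_def powr_realpow)
        then have "\<omega> * \<sigma> ^ DIM('a) = 2 * g t" using \<omega> by simp
        then show ?thesis using \<sigma> emeasure_ball[of \<sigma> x] by (simp add: \<omega>_def N_def)
      qed
      have "ennreal (g t) \<le> emeasure lborel (ball x \<sigma> - S t)" for x :: 'a
      proof -
        have "ennreal (g t) + ennreal (g t) = emeasure lborel (ball x \<sigma>)" using g0[of t] by (simp add: ball flip: ennreal_plus)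
        also have "\<dots> \<le> emeasure lborel ((ball x \<sigma> - S t) \<union> S t)" by (rule emeasure_mono) auto
        also have "\<dots> \<le> emeasure lborel (ball x \<sigma> - S t) + emeasure lborel (S t)" by (rule emeasure_subadditive) auto
        finally have "ennreal (g t) + ennreal (g t) \<le> ennreal (g t) + emeasure lborel (ball x \<sigma> - S t)"
          by (simp add: eg add.commute)
        then show ?thesis by (simp add: ennreal_add_left_cancel_le)
      qed
      then have "ennreal ((h - t) powr p * 3 powr (- 2 * \<beta>) * \<sigma> powr (- ?a)) * (ennreal (g t) * emeasure lborel (S h)) \<le> near_energy (lev v t)"
        using t \<sigma> \<sigma>4 by (intro near_energy_level_ge[OF vm _ _ _ _ S_def v0]) auto
      then have "ennreal ((1 / 2) powr p) * (ennreal ((h - t) powr p * 3 powr (- 2 * \<beta>) * \<sigma> powr (- ?a)) * (ennreal (g t) * emeasure lborel (S h)))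
          \<le> ennreal ((1 / 2) powr p) * near_energy (lev v t)" by (rule mult_left_mono) simp
      also have "\<dots> \<le> ennreal (A * g t)" 
        using t by (intro order_trans[OF add_increasing2[OF zero_le order_refl] est[of t]]) auto
      finally have "ennreal ((1 / 2) powr p * ((h - t) powr p * 3 powr (- 2 * \<beta>) * \<sigma> powr (- ?a) * (g t * g h))) \<le> ennreal (A * g t)"
        using g0 by (simp add: eg ennreal_mult)
      then have "(1 / 2) powr p * ((h - t) powr p * 3 powr (- 2 * \<beta>) * \<sigma> powr (- ?a) * (g t * g h)) \<le> A * g t"
        using AB g0 by (subst (asm) ennreal_le_iff) auto
      then have "g t * ((1 / 2) powr p * (h - t) powr p * 3 powr (- 2 * \<beta>) * \<sigma> powr (- ?a) * g h) \<le> g t * A" by (simp add: mult_ac)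
      then have le: "(1 / 2) powr p * (h - t) powr p * 3 powr (- 2 * \<beta>) * \<sigma> powr (- ?a) * g h \<le> A" using gt by simp
      \<comment> \<open>The reciprocal of the coefficient of g h in the inequality just
        obtained.\<close>
      define k where "k = 2 powr p * (h - t) powr (- p) * 3 powr (2 * \<beta>) * \<sigma> powr ?a"
      have k0: "0 \<le> k" by (simp add: k_def)
      have k1: "k * ((1 / 2) powr p * (h - t) powr p * 3 powr (- 2 * \<beta>) * \<sigma> powr (- ?a)) = 1"
      proof -
        have "k * ((1 / 2) powr p * (h - t) powr p * 3 powr (- 2 * \<beta>) * \<sigma> powr (- ?a))
          = (2 powr p * (1 / 2) powr p) * ((h - t) powr (- p) * (h - t) powr p) * (3 powr (2 * \<beta>) * 3 powr (- 2 * \<beta>)) * (\<sigma> powr ?a * \<sigma> powr (- ?a))"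
          by (simp add: k_def mult_ac)
        also have "2 powr p * (1 / 2) powr p = (1::real)" by (simp add: powr_divide)
        also have "(h - t) powr (- p) * (h - t) powr p = 1" using t by (simp add: powr_add[symmetric])
        also have "3 powr (2 * \<beta>) * 3 powr (- 2 * \<beta>) = (1::real)" by (simp add: powr_add[symmetric])
        also have "\<sigma> powr ?a * \<sigma> powr (- ?a) = 1" using \<sigma> by (simp only: powr_add[symmetric]) simp
        finally show ?thesis by simp
      qed
      have "g h = k * ((1 / 2) powr p * (h - t) powr p * 3 powr (- 2 * \<beta>) * \<sigma> powr (- ?a)) * g h" unfolding k1 by simp
      also have "\<dots> = k * ((1 / 2) powr p * (h - t) powr p * 3 powr (- 2 * \<beta>) * \<sigma> powr (- ?a) * g h)" by (simp only: mult.assoc)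
      also have "\<dots> \<le> k * A" by (rule mult_left_mono[OF le k0])
      also have "\<sigma> powr ?a = (2 / \<omega>) powr (1 + l) * g t powr (1 + l)"
      proof -
        have "?a = N * (1 + l)" using Npos by (simp add: l_def field_simps)
        then have "\<sigma> powr ?a = (\<sigma> powr N) powr (1 + l)" by (simp add: powr_powr)
        also have "\<dots> = ((2 / \<omega>) * g t) powr (1 + l)" by (simp add: \<sigma>N)
        also have "\<dots> = (2 / \<omega>) powr (1 + l) * g t powr (1 + l)" by (rule powr_mult)
        finally show ?thesis .
      qed
      then have "k * A = Cs * (h - t) powr (- p) * g t powr (1 + l)" unfolding k_def Cs_def by (simp add: mult_ac)
      finally show ?thesis .
    qed
    have small: "Cs * 8 powr p * \<delta> powr l \<le> 2 powr (- p / l)"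
    proof -
      have "\<delta> powr l \<le> ((2 powr (- p / l) / (Cs * 8 powr p)) powr (1 / l)) powr l"
        using \<delta> l by (intro powr_mono2) (auto simp: \<delta>_def)
      also have "\<dots> = 2 powr (- p / l) / (Cs * 8 powr p)" using l Cs by (simp add: powr_powr)
      finally show ?thesis using Cs by (simp add: field_simps)
    qed
    have "g (1 / 2) = 0"
      by (rule De_Giorgi_iteration[OF g0 ganti step l _ _ \<delta> start small]) (use p_gt Cs in auto)
    then have "emeasure lborel (S (1 / 2)) = 0" by (simp add: eg)
    then have "S (1 / 2) \<in> null_sets lborel" by (intro null_setsI) simp_all
    then have "AE x in lborel. x \<notin> S (1 / 2)" by (rule AE_not_in)
    then have "AE x in lborel. norm x < 3 / 2 \<longrightarrow> 1 / 2 \<le> v x"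
    proof eventually_elim
      case (elim x)
      then show ?case using cutoff_eq_1[of x] by (auto simp: S_def)
    qed
    then show False using bad by contradiction
  qed
  then show ?thesis using M by blast
qed

text \<open>The previous bound in the form needed as an error term: where w >= 2 the integrand is a
  multiple of the density in \<open>wint (big_part w)\<close>, elsewhere it is at most 3^(p-1) times
  the integrable weight.\<close>

lemma upper_integral_bound:
  "\<exists>C>0. \<forall>w. unit_supersolution w \<longrightarrow> \<not> (AE x in lborel. norm x < 3 / 2 \<longrightarrow> 1 / 2 \<le> w x) \<longrightarrow>
     (\<integral>\<^sup>+x\<in>ball 0 2. ennreal ((w x + 1) powr (p - 1) * (1 + norm (x::'a) powr (- \<beta>))) \<partial>lborel) \<le> ennreal C"
proof -
  obtain M where M: "M > 0" "\<And>v. unit_supersolution v \<Longrightarrow> \<not> (AE x in lborel. norm x < 3 / 2 \<longrightarrow> 1 / 2 \<le> v x) \<Longrightarrow> wint (big_part v) \<le> ennreal M"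
    using barrier_conclusion by blast
  define I where "I = (\<integral>\<^sup>+x\<in>ball 0 2. ennreal (1 + norm (x::'a) powr (- \<beta>)) \<partial>lborel)"
  have I: "I < \<infinity>" unfolding I_def by (rule nn_integral_weight_ball) simp
  define k where "k = 2 * 4 powr (p - 1) * (1 + 2 powr \<beta>)"
  have k: "0 < k" by (simp add: k_def add_pos_pos)
  define X where "X = ennreal (3 powr (p - 1)) * I + ennreal k * ennreal M"
  have X: "X < \<infinity>" using I by (simp add: X_def ennreal_mult_less_top)
  have [measurable]: "ball (0::'a) 2 \<in> sets borel" by simp
  have "(\<integral>\<^sup>+x\<in>ball 0 2. ennreal ((w x + 1) powr (p - 1) * (1 + norm (x::'a) powr (- \<beta>))) \<partial>lborel) \<le> ennreal (enn2real X + 1)"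
    if w: "unit_supersolution w" "\<not> (AE x in lborel. norm x < 3 / 2 \<longrightarrow> 1 / 2 \<le> w x)" for w
  proof -
    have wm[measurable]: "w \<in> borel_measurable borel" and w0: "\<And>x. 0 \<le> w x"
      using w by (auto simp: unit_supersolution_def)
    have "(\<integral>\<^sup>+x\<in>ball 0 2. ennreal ((w x + 1) powr (p - 1) * (1 + norm (x::'a) powr (- \<beta>))) \<partial>lborel)
      \<le> (\<integral>\<^sup>+x. ennreal (3 powr (p - 1)) * (ennreal (1 + norm x powr (- \<beta>)) * indicator (ball 0 2) x)
           + ennreal k * ennreal (big_part w x * norm x powr (- \<beta>)) \<partial>lborel)"
    proof (rule nn_integral_mono_AE)
      have "AE x in lborel. (x::'a) \<noteq> 0" using AE_lborel_singleton[of 0] by (simp add: eq_commute)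
      then show "AE x in lborel. ennreal ((w x + 1) powr (p - 1) * (1 + norm x powr (- \<beta>))) * indicator (ball 0 2) x
        \<le> ennreal (3 powr (p - 1)) * (ennreal (1 + norm x powr (- \<beta>)) * indicator (ball 0 2) x)
           + ennreal k * ennreal (big_part w x * norm x powr (- \<beta>))"
      proof eventually_elim
        case (elim x)
        have wt0: "0 \<le> 1 + norm x powr (- \<beta>)" by (simp add: add_nonneg_nonneg)
        show ?case
        proof (cases "norm x < 2")
          case nx: True
          show ?thesis
          proof (cases "2 \<le> w x")
            case True
            \<comment> \<open>Since w >= 2, w + 1 is at most 2w, that is 4 times w/2.\<close>
            have "(w x + 1) powr (p - 1) \<le> (4 * (w x / 2)) powr (p - 1)" using True p_gt by (intro powr_mono2) auto
            also have "\<dots> = 4 powr (p - 1) * (w x / 2) powr (p - 1)" by (rule powr_mult)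
            also have "\<dots> = 2 * 4 powr (p - 1) * big_part w x" using True nx by (simp add: big_part_def)
            finally have 1: "(w x + 1) powr (p - 1) \<le> 2 * 4 powr (p - 1) * big_part w x" .
            have "2 powr (- \<beta>) \<le> norm x powr (- \<beta>)" using nx elim \<beta>_nonneg by (intro powr_mono2') auto
            then have "2 powr \<beta> * 2 powr (- \<beta>) \<le> 2 powr \<beta> * norm x powr (- \<beta>)" by (intro mult_left_mono) auto
            then have "1 + norm x powr (- \<beta>) \<le> (1 + 2 powr \<beta>) * norm x powr (- \<beta>)"
              by (simp add: powr_add[symmetric] algebra_simps)
            then have "(w x + 1) powr (p - 1) * (1 + norm x powr (- \<beta>)) \<le> (2 * 4 powr (p - 1) * big_part w x) * ((1 + 2 powr \<beta>) * norm x powr (- \<beta>))"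
              using 1 wt0 big_part_nonneg[of w x] by (intro mult_mono) auto
            also have "\<dots> = k * (big_part w x * norm x powr (- \<beta>))" by (simp add: k_def mult_ac)
            finally have "ennreal ((w x + 1) powr (p - 1) * (1 + norm x powr (- \<beta>))) \<le> ennreal k * ennreal (big_part w x * norm x powr (- \<beta>))"
              using k big_part_nonneg[of w x] by (subst ennreal_mult[symmetric]) (auto intro: ennreal_leI)
            then show ?thesis using nx by (simp add: add_increasing)
          next
            case False
            have "(w x + 1) powr (p - 1) \<le> 3 powr (p - 1)" using False w0[of x] p_gt by (intro powr_mono2) auto
            then have "(w x + 1) powr (p - 1) * (1 + norm x powr (- \<beta>)) \<le> 3 powr (p - 1) * (1 + norm x powr (- \<beta>))"
              using wt0 by (rule mult_right_mono)
            then have "ennreal ((w x + 1) powr (p - 1) * (1 + norm x powr (- \<beta>))) \<le> ennreal (3 powr (p - 1)) * ennreal (1 + norm x powr (- \<beta>))"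
              using wt0 by (subst ennreal_mult[symmetric]) (auto intro: ennreal_leI)
            then show ?thesis using nx by (simp add: add_increasing2)
          qed
        qed simp
      qed
    qed
    also have "\<dots> = (\<integral>\<^sup>+x. ennreal (3 powr (p - 1)) * (ennreal (1 + norm (x::'a) powr (- \<beta>)) * indicator (ball 0 2) x) \<partial>lborel)
           + (\<integral>\<^sup>+x. ennreal k * ennreal (big_part w x * norm x powr (- \<beta>)) \<partial>lborel)"
      by (rule nn_integral_add) measurable
    also have "(\<integral>\<^sup>+x. ennreal (3 powr (p - 1)) * (ennreal (1 + norm (x::'a) powr (- \<beta>)) * indicator (ball 0 2) x) \<partial>lborel) = ennreal (3 powr (p - 1)) * I"
      unfolding I_def by (rule nn_integral_cmult) measurable
    also have "(\<integral>\<^sup>+x. ennreal k * ennreal (big_part w x * norm x powr (- \<beta>)) \<partial>lborel) = ennreal k * wint (big_part w)"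
      unfolding wint_def by (rule nn_integral_cmult) measurable
    also have "ennreal (3 powr (p - 1)) * I + ennreal k * wint (big_part w) \<le> X"
      unfolding X_def by (intro add_left_mono mult_left_mono M w) auto
    also have "X = ennreal (enn2real X)" using X by simp
    also have "\<dots> \<le> ennreal (enn2real X + 1)" by (intro ennreal_leI) simp
    finally show ?thesis .
  qed
  then show ?thesis by (intro exI[of _ "enn2real X + 1"]) (auto simp: add_nonneg_pos)
qed

end

section \<open>Higher integrability\<close>

text \<open>Together with the next bound this makes the test function built from negative powers a
  Lipschitz function of the cutoff and w, hence of finite energy.\<close>

lemma powr_diff_le_unit:
  fixes a b p :: real
  assumes "1 < p" "0 \<le> a" "a \<le> 1" "0 \<le> b" "b \<le> 1"
  shows "\<bar>a powr p - b powr p\<bar> \<le> p * \<bar>a - b\<bar>"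
proof -
  have *: "a powr p - b powr p \<le> p * (a - b)" if "0 \<le> b" "b \<le> a" "a \<le> 1" for a b :: real
  proof -
    have "p * (a powr (p - 1) * b) \<le> (p - 1) * a powr p + b powr p"
      using Jp_tangent[OF assms(1), of a b] that by (simp add: Jp_nonneg_eq)
    then have "a powr p - b powr p \<le> p * (a powr p - a powr (p - 1) * b)" by (simp add: algebra_simps)
    also have "a powr p - a powr (p - 1) * b = a powr (p - 1) * (a - b)"
      using powr_mult_self[of a p] that by (simp add: algebra_simps)
    also have "p * (a powr (p - 1) * (a - b)) \<le> p * (1 * (a - b))"
      using that assms(1) powr_mono2[of "p - 1" a 1] by (intro mult_left_mono mult_right_mono) auto
    finally show ?thesis by simp
  qed
  show ?thesis
  proof (cases "b \<le> a")
    case True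
    moreover have "b powr p \<le> a powr p" using True assms by (intro powr_mono2) auto
    ultimately show ?thesis using *[of b a] assms by simp
  next
    case False
    moreover have "a powr p \<le> b powr p" using False assms by (intro powr_mono2) auto
    ultimately show ?thesis using *[of a b] assms by simp
  qed
qed

lemma powr_neg_diff_le:
  fixes A B \<epsilon> :: real
  assumes "0 < \<epsilon>" "\<epsilon> \<le> 1" "1 \<le> A" "1 \<le> B"
  shows "\<bar>A powr (- \<epsilon>) - B powr (- \<epsilon>)\<bar> \<le> \<bar>A - B\<bar>"
proof -
  have *: "\<bar>A powr (- \<epsilon>) - B powr (- \<epsilon>)\<bar> \<le> A - B" if "1 \<le> B" "B \<le> A" for A B :: real
  proof -
    have le: "A powr (- \<epsilon>) \<le> B powr (- \<epsilon>)" using that assms by (intro powr_mono2') auto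
    have "B powr (- \<epsilon>) - A powr (- \<epsilon>) = B powr (- \<epsilon>) * (1 - (B / A) powr \<epsilon>)"
      using that by (simp add: powr_divide powr_minus field_simps)
    also have "\<dots> \<le> 1 * (1 - B / A)"
    proof (intro mult_mono)
      show "B powr (- \<epsilon>) \<le> 1" using powr_mono2'[of "- \<epsilon>" 1 B] that assms by simp
      have "(B / A) powr 1 \<le> (B / A) powr \<epsilon>" using that assms by (intro powr_mono') auto
      then show "1 - (B / A) powr \<epsilon> \<le> 1 - B / A" using that by simp
      show "0 \<le> 1 - (B / A) powr \<epsilon>" using powr_mono2[of \<epsilon> "B / A" 1] that assms by simp
    qed auto
    also have "\<dots> = (A - B) / A" using that by (simp add: field_simps)
    also have "\<dots> \<le> A - B" using divide_left_mono[of 1 A "A - B"] that by simp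
    finally show ?thesis using le by simp
  qed
  show ?thesis using *[of A B] *[of B A] assms by (cases "B \<le> A") (auto simp: abs_minus_commute)
qed

text \<open>The symmetric form of the inequality for ordered A and B. If the cutoff vanishes at the
  point with the larger value, the product is nonpositive, so the error can be confined to points
  where the cutoff is positive.\<close>

lemma negative_power_pointwise:
  fixes A B a1 a2 \<epsilon> p :: real
  assumes p: "1 < p" and \<epsilon>: "0 < \<epsilon>" "\<epsilon> \<le> 1" and AB: "1 \<le> A" "1 \<le> B" and a: "0 \<le> a1" "0 \<le> a2"
  shows "Jp p (A - B) * (a1 powr p * A powr (- \<epsilon>) - a2 powr p * B powr (- \<epsilon>))
    \<le> (2 * p - 1) powr (p - 1) * \<epsilon> powr (1 - p) *
        (\<bar>a1 - a2\<bar> powr p * (of_bool (0 < a1) * A powr (p - 1 - \<epsilon>) + of_bool (0 < a2) * B powr (p - 1 - \<epsilon>)))"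
proof -
  define C where "C = (2 * p - 1) powr (p - 1) * \<epsilon> powr (1 - p)"
  have C: "0 \<le> C" by (simp add: C_def)
  have *: "Jp p (A - B) * (a1 powr p * A powr (- \<epsilon>) - a2 powr p * B powr (- \<epsilon>))
     \<le> C * (\<bar>a1 - a2\<bar> powr p * (of_bool (0 < a1) * A powr (p - 1 - \<epsilon>)))"
    if "1 \<le> B" "B \<le> A" "0 \<le> a1" "0 \<le> a2" for A B a1 a2
  proof (cases "a1 = 0")
    case True
    have "Jp p (A - B) * (a1 powr p * A powr (- \<epsilon>) - a2 powr p * B powr (- \<epsilon>)) \<le> 0"
      using True that by (simp add: Jp_nonneg_eq)
    then show ?thesis using True by simp
  next
    case False
    then show ?thesis
      using Jp_negative_power_ineq[OF p _ that(2) that(3,4) \<epsilon>] that by (simp add: Jp_nonneg_eq C_def)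
  qed
  have "Jp p (A - B) * (a1 powr p * A powr (- \<epsilon>) - a2 powr p * B powr (- \<epsilon>))
     \<le> C * (\<bar>a1 - a2\<bar> powr p * (of_bool (0 < a1) * A powr (p - 1 - \<epsilon>) + of_bool (0 < a2) * B powr (p - 1 - \<epsilon>)))"
  proof (cases "B \<le> A")
    case True
    have "Jp p (A - B) * (a1 powr p * A powr (- \<epsilon>) - a2 powr p * B powr (- \<epsilon>))
      \<le> C * (\<bar>a1 - a2\<bar> powr p * (of_bool (0 < a1) * A powr (p - 1 - \<epsilon>)))"
      using True AB a by (intro *) auto
    also have "\<dots> \<le> C * (\<bar>a1 - a2\<bar> powr p * (of_bool (0 < a1) * A powr (p - 1 - \<epsilon>) + of_bool (0 < a2) * B powr (p - 1 - \<epsilon>)))"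
      using C by (intro mult_left_mono) auto
    finally show ?thesis .
  next
    case False
    have "Jp p (A - B) = - Jp p (B - A)" using Jp_minus[of p "B - A"] by simp
    then have "Jp p (A - B) * (a1 powr p * A powr (- \<epsilon>) - a2 powr p * B powr (- \<epsilon>))
      = Jp p (B - A) * (a2 powr p * B powr (- \<epsilon>) - a1 powr p * A powr (- \<epsilon>))" by (simp add: algebra_simps)
    also have "\<dots> \<le> C * (\<bar>a2 - a1\<bar> powr p * (of_bool (0 < a2) * B powr (p - 1 - \<epsilon>)))"
      using False AB a by (intro *) auto
    also have "\<dots> \<le> C * (\<bar>a1 - a2\<bar> powr p * (of_bool (0 < a1) * A powr (p - 1 - \<epsilon>) + of_bool (0 < a2) * B powr (p - 1 - \<epsilon>)))"
      unfolding abs_minus_commute[of a2 a1] using C by (intro mult_left_mono) auto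
    finally show ?thesis .
  qed
  then show ?thesis by (simp add: C_def)
qed

section \<open>The energy of negative powers\<close>

context weighted_kernel
begin

text \<open>For u >= 1 and a test function equal to u to the power -\<epsilon> on the ball, this
  integrand is minus that of the form: the two increments have opposite signs.\<close>

definition neg_energy :: "real \<Rightarrow> ('a \<Rightarrow> real) \<Rightarrow> ennreal" where
  "neg_energy \<epsilon> u = (\<integral>\<^sup>+z. ennreal (if norm (fst z) < 3 / 2 \<and> norm (snd z) < 3 / 2
     then \<bar>u (fst z) - u (snd z)\<bar> powr (p - 1) * \<bar>u (fst z) powr (- \<epsilon>) - u (snd z) powr (- \<epsilon>)\<bar> * K (fst z) (snd z) else 0) \<partial>M2)"

lemma gag_cmult_finite:
  assumes [measurable]: "f \<in> borel_measurable borel" and "gag f < \<infinity>"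
  shows "gag (\<lambda>x. c * f x) < \<infinity>"
proof -
  have "gag (\<lambda>x. c * f x) = (\<integral>\<^sup>+z. ennreal (\<bar>c\<bar> powr p) * ennreal (\<bar>f (fst z) - f (snd z)\<bar> powr p * K (fst z) (snd z)) \<partial>M2)"
    unfolding gag_def
  proof (rule nn_integral_cong)
    fix z :: "'a \<times> 'a"
    have "\<bar>c * f (fst z) - c * f (snd z)\<bar> powr p = \<bar>c\<bar> powr p * \<bar>f (fst z) - f (snd z)\<bar> powr p"
      by (simp only: right_diff_distrib[symmetric] abs_mult powr_mult)
    then show "ennreal (\<bar>c * f (fst z) - c * f (snd z)\<bar> powr p * K (fst z) (snd z))
      = ennreal (\<bar>c\<bar> powr p) * ennreal (\<bar>f (fst z) - f (snd z)\<bar> powr p * K (fst z) (snd z))"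
      by (subst ennreal_mult[symmetric]) (simp_all add: mult.assoc)
  qed
  also have "\<dots> = ennreal (\<bar>c\<bar> powr p) * gag f" unfolding gag_def by (rule nn_integral_cmult) measurable
  also have "\<dots> < \<infinity>" using assms by (simp add: ennreal_mult_less_top)
  finally show ?thesis .
qed

text \<open>On the ball of radius 3/2 the cutoff is 1 and the form contributes exactly minus the
  energy. Elsewhere the pointwise inequality leaves an error in which one integration meets
  \<open>cutoff_kernel_bound\<close> and the other \<open>upper_integral_bound\<close>. Since u >=
  1, the test function is bounded by 1 and has finite energy.\<close>

lemma negative_power_energy:
  assumes \<epsilon>: "0 < \<epsilon>" "\<epsilon> \<le> 1"
  shows "\<exists>C>0. \<forall>w. unit_supersolution w \<longrightarrow> \<not> (AE x in lborel. norm x < 3 / 2 \<longrightarrow> 1 / 2 \<le> w x) \<longrightarrow>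
     neg_energy \<epsilon> (\<lambda>x. w x + 1) \<le> ennreal C"
proof -
  obtain CA where CA: "CA > 0" "\<And>w. unit_supersolution w \<Longrightarrow> \<not> (AE x in lborel. norm x < 3 / 2 \<longrightarrow> 1 / 2 \<le> w x) \<Longrightarrow>
     (\<integral>\<^sup>+x\<in>ball 0 2. ennreal ((w x + 1) powr (p - 1) * (1 + norm (x::'a) powr (- \<beta>))) \<partial>lborel) \<le> ennreal CA"
    using upper_integral_bound by blast
  obtain CK where CK: "CK > 0" "\<And>x::'a. (\<integral>\<^sup>+y. ennreal (\<bar>cutoff x - cutoff y\<bar> powr p * K x y) \<partial>lborel) \<le> ennreal (CK * (1 + norm x powr (- \<beta>)))"
    using cutoff_kernel_bound by blast
  define C3 where "C3 = (2 * p - 1) powr (p - 1) * \<epsilon> powr (1 - p)"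
  have C3: "0 < C3" using p_gt \<epsilon> by (simp add: C3_def)
  have "neg_energy \<epsilon> (\<lambda>x. w x + 1) \<le> ennreal (2 * (C3 * CK * CA))"
    if w: "unit_supersolution w" "\<not> (AE x in lborel. norm x < 3 / 2 \<longrightarrow> 1 / 2 \<le> w x)" for w
  proof -
    have wm[measurable]: "w \<in> borel_measurable borel" and w0: "\<And>x. 0 \<le> w x" and gw: "gag w < \<infinity>"
      and pos: "\<And>h. admissible 2 h \<Longrightarrow> 0 \<le> form w h"
      using w by (auto simp: unit_supersolution_def)
    define u where "u x = w x + 1" for x
    have um[measurable]: "u \<in> borel_measurable borel" unfolding u_def by measurable
    have u1: "1 \<le> u x" for x using w0[of x] by (simp add: u_def)
    define f where "f x = cutoff x powr p * u x powr (- \<epsilon>)" for x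
    have fm[measurable]: "f \<in> borel_measurable borel" unfolding f_def by measurable
    have ue: "u x powr (- \<epsilon>) \<le> 1" for x using powr_mono2'[of "- \<epsilon>" 1 "u x"] u1[of x] \<epsilon> by simp
    have cp: "cutoff x powr p \<le> 1" for x :: 'a
      using powr_mono2[of p "cutoff x" 1] cutoff_range[of x] p_gt by simp
    have adm: "admissible 2 f"
    proof -
      have "gag f < \<infinity>"
      proof (rule gag_finite_add[where f="\<lambda>x. p * cutoff x" and g=w])
        fix x y
        have "f x - f y = (cutoff x powr p - cutoff y powr p) * u x powr (- \<epsilon>) + cutoff y powr p * (u x powr (- \<epsilon>) - u y powr (- \<epsilon>))"
          by (simp add: f_def algebra_simps)
        then have "\<bar>f x - f y\<bar> \<le> \<bar>cutoff x powr p - cutoff y powr p\<bar> * u x powr (- \<epsilon>) + cutoff y powr p * \<bar>u x powr (- \<epsilon>) - u y powr (- \<epsilon>)\<bar>"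
          using abs_triangle_ineq[of "(cutoff x powr p - cutoff y powr p) * u x powr (- \<epsilon>)" "cutoff y powr p * (u x powr (- \<epsilon>) - u y powr (- \<epsilon>))"]
          by (simp add: abs_mult)
        also have "\<dots> \<le> \<bar>cutoff x powr p - cutoff y powr p\<bar> + \<bar>u x powr (- \<epsilon>) - u y powr (- \<epsilon>)\<bar>"
          using ue cp by (intro add_mono mult_left_le mult_left_le_one_le) auto
        also have "\<dots> \<le> p * \<bar>cutoff x - cutoff y\<bar> + \<bar>u x - u y\<bar>"
          using cutoff_range p_gt u1 \<epsilon> by (intro add_mono powr_diff_le_unit powr_neg_diff_le) auto
        also have "\<dots> = \<bar>p * cutoff x - p * cutoff y\<bar> + \<bar>w x - w y\<bar>"
          using p_gt by (simp add: u_def right_diff_distrib[symmetric] abs_mult)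
        finally show "\<bar>f x - f y\<bar> \<le> \<bar>p * cutoff x - p * cutoff y\<bar> + \<bar>w x - w y\<bar>" .
      qed (use gw gag_cmult_finite[OF cutoff_measurable gag_cutoff, of p] in auto)
      moreover have "f x \<le> 1" for x unfolding f_def using ue cp by (intro mult_le_one) auto
      moreover have "f x = 0" if "2 \<le> norm x" for x using cutoff_eq_0[OF that] p_gt by (simp add: f_def)
      ultimately show ?thesis unfolding admissible_def by (auto simp: f_def)
    qed
    define P where "P z = (if norm (fst z) < 3 / 2 \<and> norm (snd z) < 3 / 2
     then \<bar>u (fst z) - u (snd z)\<bar> powr (p - 1) * \<bar>u (fst z) powr (- \<epsilon>) - u (snd z) powr (- \<epsilon>)\<bar> * K (fst z) (snd z) else 0)" for z
    have Pm[measurable]: "P \<in> borel_measurable M2" unfolding P_def by measurable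
    define q where "q x y = (C3 * (of_bool (0 < cutoff x) * u x powr (p - 1 - \<epsilon>))) * (\<bar>cutoff x - cutoff y\<bar> powr p * K x y)" for x y
    have qm[measurable]: "(\<lambda>z. q (fst z) (snd z)) \<in> borel_measurable M2" "(\<lambda>z. q (snd z) (fst z)) \<in> borel_measurable M2"
      unfolding q_def by measurable
    have nn: "0 \<le> P z" "0 \<le> q x y" for z x y using C3 by (auto simp: P_def q_def)
    have "neg_energy \<epsilon> u = (\<integral>\<^sup>+z. ennreal (P z) \<partial>M2)" by (simp add: neg_energy_def P_def)
    also have "\<dots> \<le> (\<integral>\<^sup>+z. ennreal (q (fst z) (snd z) + q (snd z) (fst z)) \<partial>M2)"
    proof (rule nn_integral_energy_le)
      show "integrable M2 (form_integrand w f)"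
        using adm gw by (intro form_integrable) (auto simp: admissible_def)
      show "0 \<le> (\<integral>z. form_integrand w f z \<partial>M2)" using pos[OF adm] by (simp add: form_def)
      show "AE z in M2. 0 \<le> P z \<and> 0 \<le> q (fst z) (snd z) + q (snd z) (fst z) \<and> form_integrand w f z + P z \<le> q (fst z) (snd z) + q (snd z) (fst z)"
      proof (rule AE_I2, intro conjI)
        fix z :: "'a \<times> 'a"
        define x y where "x = fst z" and "y = snd z"
        have dw: "w x - w y = u x - u y" by (simp add: u_def)
        have qs: "q x y + q y x = C3 * (\<bar>cutoff x - cutoff y\<bar> powr p * (of_bool (0 < cutoff x) * u x powr (p - 1 - \<epsilon>) + of_bool (0 < cutoff y) * u y powr (p - 1 - \<epsilon>))) * K x y"
          by (simp add: q_def K_sym[of y x] abs_minus_commute[of "cutoff y"] algebra_simps)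
        have "Jp p (u x - u y) * (f x - f y) * K x y + P z \<le> q x y + q y x"
        proof (cases "norm x < 3 / 2 \<and> norm y < 3 / 2")
          case True
          then have c1: "cutoff x = 1" "cutoff y = 1" by (auto intro: cutoff_eq_1)
          have anti: "Jp p (A - B) * (A powr (- \<epsilon>) - B powr (- \<epsilon>)) = - (\<bar>A - B\<bar> powr (p - 1) * \<bar>A powr (- \<epsilon>) - B powr (- \<epsilon>)\<bar>)" if "1 \<le> A" "1 \<le> B" for A B
          proof (cases "B \<le> A")
            case True
            have "A powr (- \<epsilon>) \<le> B powr (- \<epsilon>)" using True that \<epsilon> by (intro powr_mono2') auto
            then show ?thesis using True by (simp add: Jp_nonneg_eq algebra_simps)
          next
            case False
            have "B powr (- \<epsilon>) \<le> A powr (- \<epsilon>)" using False that \<epsilon> by (intro powr_mono2') auto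
            then show ?thesis using False Jp_minus[of p "B - A"] by (simp add: Jp_nonneg_eq algebra_simps)
          qed
          have "Jp p (u x - u y) * (f x - f y) = - (\<bar>u x - u y\<bar> powr (p - 1) * \<bar>u x powr (- \<epsilon>) - u y powr (- \<epsilon>)\<bar>)"
            using anti[OF u1 u1, of x y] by (simp add: f_def c1)
          moreover have "P z = \<bar>u x - u y\<bar> powr (p - 1) * \<bar>u x powr (- \<epsilon>) - u y powr (- \<epsilon>)\<bar> * K x y"
            using True by (simp add: P_def x_def y_def)
          ultimately have "Jp p (u x - u y) * (f x - f y) * K x y + P z = 0" by simp
          then show ?thesis using nn by simp
        next
          case False
          have "Jp p (u x - u y) * (f x - f y) \<le> C3 * (\<bar>cutoff x - cutoff y\<bar> powr p * (of_bool (0 < cutoff x) * u x powr (p - 1 - \<epsilon>) + of_bool (0 < cutoff y) * u y powr (p - 1 - \<epsilon>)))"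
            unfolding f_def C3_def by (rule negative_power_pointwise[OF p_gt \<epsilon> u1 u1 cutoff_range(1) cutoff_range(1)])
          then have "Jp p (u x - u y) * (f x - f y) * K x y \<le> q x y + q y x"
            unfolding qs by (rule mult_right_mono) simp
          moreover have "P z = 0" using False by (auto simp: P_def x_def y_def)
          ultimately show ?thesis by simp
        qed
        then show "form_integrand w f z + P z \<le> q (fst z) (snd z) + q (snd z) (fst z)"
          by (simp add: form_integrand_def x_def y_def dw[unfolded x_def y_def])
        show "0 \<le> P z" "0 \<le> q (fst z) (snd z) + q (snd z) (fst z)" using nn by auto
      qed
    qed measurable
    also have "\<dots> = (\<integral>\<^sup>+z. ennreal (q (fst z) (snd z)) + ennreal (q (snd z) (fst z)) \<partial>M2)"
      using nn by (simp add: ennreal_plus)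
    also have "\<dots> = (\<integral>\<^sup>+z. ennreal (q (fst z) (snd z)) \<partial>M2) + (\<integral>\<^sup>+z. ennreal (q (snd z) (fst z)) \<partial>M2)"
      by (rule nn_integral_add) measurable
    also have "(\<integral>\<^sup>+z. ennreal (q (snd z) (fst z)) \<partial>M2) = (\<integral>\<^sup>+x. \<integral>\<^sup>+y. ennreal (q x y) \<partial>lborel \<partial>lborel)"
      by (rule nn_integral_lborel_pair(2)) measurable
    also have "(\<integral>\<^sup>+z. ennreal (q (fst z) (snd z)) \<partial>M2) = (\<integral>\<^sup>+x. \<integral>\<^sup>+y. ennreal (q x y) \<partial>lborel \<partial>lborel)"
      by (rule nn_integral_lborel_pair(1)) measurable
    also have "(\<integral>\<^sup>+x. \<integral>\<^sup>+y. ennreal (q x y) \<partial>lborel \<partial>lborel) \<le> (\<integral>\<^sup>+x. ennreal (C3 * CK) * (ennreal ((w x + 1) powr (p - 1) * (1 + norm x powr (- \<beta>))) * indicator (ball 0 2) x) \<partial>lborel)"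
    proof (rule nn_integral_mono)
      fix x :: 'a
      let ?c = "C3 * (of_bool (0 < cutoff x) * u x powr (p - 1 - \<epsilon>))"
      have c0: "0 \<le> ?c" using C3 by simp
      have "(\<integral>\<^sup>+y. ennreal (q x y) \<partial>lborel) = (\<integral>\<^sup>+y. ennreal ?c * ennreal (\<bar>cutoff x - cutoff y\<bar> powr p * K x y) \<partial>lborel)"
        using c0 by (intro nn_integral_cong) (simp only: q_def ennreal_mult[OF c0 mult_nonneg_nonneg[OF powr_ge_zero K_nonneg]])
      also have "\<dots> = ennreal ?c * (\<integral>\<^sup>+y. ennreal (\<bar>cutoff x - cutoff y\<bar> powr p * K x y) \<partial>lborel)"
        by (rule nn_integral_cmult) measurable
      also have "\<dots> \<le> ennreal ?c * ennreal (CK * (1 + norm x powr (- \<beta>)))" by (intro mult_left_mono CK) auto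
      also have "\<dots> \<le> ennreal (C3 * CK) * (ennreal ((w x + 1) powr (p - 1) * (1 + norm x powr (- \<beta>))) * indicator (ball 0 2) x)"
      proof (cases "norm x < 2")
        case True
        have "u x powr (p - 1 - \<epsilon>) \<le> u x powr (p - 1)" using u1[of x] \<epsilon> by (intro powr_mono) auto
        then have "?c \<le> C3 * u x powr (p - 1)" using C3 by (intro mult_left_mono) (auto simp: of_bool_def)
        then have "?c * (CK * (1 + norm x powr (- \<beta>))) \<le> (C3 * u x powr (p - 1)) * (CK * (1 + norm x powr (- \<beta>)))"
          using CK(1) by (intro mult_right_mono) (auto simp: add_nonneg_nonneg)
        also have "\<dots> = (C3 * CK) * ((w x + 1) powr (p - 1) * (1 + norm x powr (- \<beta>)))" by (simp add: u_def mult_ac)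
        finally have "ennreal (?c * (CK * (1 + norm x powr (- \<beta>)))) \<le> ennreal ((C3 * CK) * ((w x + 1) powr (p - 1) * (1 + norm x powr (- \<beta>))))"
          by (rule ennreal_leI)
        moreover have "ennreal ?c * ennreal (CK * (1 + norm x powr (- \<beta>))) = ennreal (?c * (CK * (1 + norm x powr (- \<beta>))))"
          using c0 CK(1) by (intro ennreal_mult[symmetric]) (auto simp: add_nonneg_nonneg)
        moreover have "ennreal (C3 * CK) * ennreal ((w x + 1) powr (p - 1) * (1 + norm x powr (- \<beta>))) = ennreal ((C3 * CK) * ((w x + 1) powr (p - 1) * (1 + norm x powr (- \<beta>))))"
          using C3 CK(1) by (intro ennreal_mult[symmetric]) (auto simp: add_nonneg_nonneg)
        ultimately show ?thesis using True by simp
      next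
        case False
        then have "cutoff x = 0" by (intro cutoff_eq_0) simp
        then show ?thesis by simp
      qed
      finally show "(\<integral>\<^sup>+y. ennreal (q x y) \<partial>lborel) \<le> ennreal (C3 * CK) * (ennreal ((w x + 1) powr (p - 1) * (1 + norm x powr (- \<beta>))) * indicator (ball 0 2) x)" .
    qed
    also have "\<dots> = ennreal (C3 * CK) * (\<integral>\<^sup>+x\<in>ball 0 2. ennreal ((w x + 1) powr (p - 1) * (1 + norm (x::'a) powr (- \<beta>))) \<partial>lborel)"
    proof -
      have [measurable]: "ball (0::'a) 2 \<in> sets borel" by simp
      show ?thesis by (rule nn_integral_cmult) measurable
    qed
    also have "\<dots> \<le> ennreal (C3 * CK) * ennreal CA" by (intro mult_left_mono CA w) auto
    also have "\<dots> = ennreal (C3 * CK * CA)" using C3 CK(1) CA(1) by (intro ennreal_mult[symmetric]) auto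
    finally have "neg_energy \<epsilon> u \<le> ennreal (C3 * CK * CA) + ennreal (C3 * CK * CA)" by (simp add: add_mono)
    also have "\<dots> = ennreal (2 * (C3 * CK * CA))" using C3 CK(1) CA(1) by (simp flip: ennreal_plus)
    finally show ?thesis unfolding u_def .
  qed
  moreover have "0 < 2 * (C3 * CK * CA)" using C3 CK(1) CA(1) by simp
  ultimately show ?thesis by blast
qed

text \<open>The comparison set \<open>Y x\<close> may depend on x because it is used in two ways:
  once as a fixed subset of a dyadic ball, once as a small neighbourhood of x. Only a lower bound
  for its measure and for the kernel is required.\<close>

lemma neg_energy_level_ge:
  assumes [measurable]: "u \<in> borel_measurable borel" and u1: "\<And>x. 1 \<le> u x"
    and \<epsilon>: "0 < \<epsilon>" and \<kappa>: "1 < \<kappa>" and L: "0 < L" and k0: "0 \<le> k0"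
    and [measurable]: "X \<in> sets borel" "\<And>x. Y x \<in> sets borel"
    and X: "\<And>x. x \<in> X \<Longrightarrow> norm x < 3 / 2 \<and> L \<le> u x"
    and Y: "\<And>x y. x \<in> X \<Longrightarrow> y \<in> Y x \<Longrightarrow> norm y < 3 / 2 \<and> u y \<le> L / \<kappa>"
    and k: "\<And>x y. x \<in> X \<Longrightarrow> y \<in> Y x \<Longrightarrow> x \<noteq> 0 \<Longrightarrow> y \<noteq> 0 \<Longrightarrow> y \<noteq> x \<Longrightarrow> k0 \<le> K x y"
    and g: "\<And>x. x \<in> X \<Longrightarrow> ennreal g \<le> emeasure lborel (Y x)"
  shows "ennreal ((1 - 1 / \<kappa>) powr (p - 1) * (\<kappa> powr \<epsilon> - 1) * L powr (p - 1 - \<epsilon>) * k0) * (ennreal g * emeasure lborel X) \<le> neg_energy \<epsilon> u"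
proof -
  define c where "c = (1 - 1 / \<kappa>) powr (p - 1) * (\<kappa> powr \<epsilon> - 1) * L powr (p - 1 - \<epsilon>) * k0"
  let ?F = "\<lambda>x y::'a. ennreal (if norm x < 3 / 2 \<and> norm y < 3 / 2
     then \<bar>u x - u y\<bar> powr (p - 1) * \<bar>u x powr (- \<epsilon>) - u y powr (- \<epsilon>)\<bar> * K x y else 0)"
  have ne0: "AE x in lborel. (x::'a) \<noteq> 0" using AE_lborel_singleton[of 0] by (simp add: eq_commute)
  have "ennreal c * (ennreal g * emeasure lborel X) = (\<integral>\<^sup>+x. (ennreal c * ennreal g) * indicator X x \<partial>lborel)"
    by (subst nn_integral_cmult_indicator) (simp_all add: mult.assoc)
  also have "\<dots> \<le> (\<integral>\<^sup>+x. \<integral>\<^sup>+y. ?F x y \<partial>lborel \<partial>lborel)"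
  proof (rule nn_integral_mono_AE)
    show "AE x in lborel. (ennreal c * ennreal g) * indicator X x \<le> (\<integral>\<^sup>+y. ?F x y \<partial>lborel)"
      using ne0
    proof eventually_elim
      case (elim x)
      show ?case
      proof (cases "x \<in> X")
        case x: True
        have "(ennreal c * ennreal g) * indicator X x \<le> ennreal c * emeasure lborel (Y x)"
          using x g[of x] by (simp add: mult_left_mono)
        also have "\<dots> = (\<integral>\<^sup>+y. ennreal c * indicator (Y x) y \<partial>lborel)"
          by (subst nn_integral_cmult_indicator) simp_all
        also have "\<dots> \<le> (\<integral>\<^sup>+y. ?F x y \<partial>lborel)"
        proof (rule nn_integral_mono_AE)
          have "AE y in lborel. y \<noteq> x" using AE_lborel_singleton[of x] by (simp add: eq_commute)
          with ne0 show "AE y in lborel. ennreal c * indicator (Y x) y \<le> ?F x y"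
          proof eventually_elim
            case (elim y)
            show ?case
            proof (cases "y \<in> Y x")
              case y: True
              have "0 < u y" using u1[of y] by simp
              then have "(1 - 1 / \<kappa>) powr (p - 1) * (\<kappa> powr \<epsilon> - 1) * L powr (p - 1 - \<epsilon>)
                  \<le> \<bar>u x - u y\<bar> powr (p - 1) * \<bar>u x powr (- \<epsilon>) - u y powr (- \<epsilon>)\<bar>"
                using X[OF x] Y[OF x y] \<kappa> \<epsilon> L by (intro gap_energy_ge[OF p_gt]) auto
              then have "c \<le> \<bar>u x - u y\<bar> powr (p - 1) * \<bar>u x powr (- \<epsilon>) - u y powr (- \<epsilon>)\<bar> * K x y"
                unfolding c_def using k[OF x y \<open>x \<noteq> 0\<close> elim] by (rule mult_mono) (use k0 in auto)
              then show ?thesis using y X[OF x] Y[OF x y] by (simp add: ennreal_leI)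
            qed simp
          qed
        qed
        finally show ?thesis .
      qed simp
    qed
  qed
  also have "\<dots> = neg_energy \<epsilon> u"
    unfolding neg_energy_def by (rule nn_integral_lborel_pair(1)[symmetric]) measurable
  finally show ?thesis unfolding c_def .
qed

end

section \<open>Superlevel sets in balls\<close>

lemma ennreal_mult3:
  "0 \<le> a \<Longrightarrow> 0 \<le> b \<Longrightarrow> 0 \<le> c \<Longrightarrow> ennreal a * (ennreal b * ennreal c) = ennreal (a * (b * c))"
  by (simp add: ennreal_mult)

text \<open>Interior ball property of a ball: moving x towards the origin by at most \<sigma>/2
  makes room for a ball of half the radius.\<close>

lemma ball_inter_ball_ge:
  fixes x :: "'a::euclidean_space"
  assumes "norm x < \<rho>" "0 < \<sigma>" "\<sigma> \<le> \<rho>"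
  shows "ball (x - (\<sigma> / (2 * \<rho>)) *\<^sub>R x) (\<sigma> / 2) \<subseteq> ball 0 \<rho> \<inter> ball x \<sigma>"
proof
  fix y assume "y \<in> ball (x - (\<sigma> / (2 * \<rho>)) *\<^sub>R x) (\<sigma> / 2)"
  then have y: "norm (y - (x - (\<sigma> / (2 * \<rho>)) *\<^sub>R x)) < \<sigma> / 2" by (simp add: dist_norm norm_minus_commute)
  have \<rho>: "0 < \<rho>" using assms by linarith
  define c where "c = \<sigma> / (2 * \<rho>)"
  have c: "0 < c" "c \<le> 1 / 2" using assms \<rho> by (auto simp: c_def field_simps)
  have "x - c *\<^sub>R x = (1 - c) *\<^sub>R x" by (simp add: algebra_simps)
  then have "norm (x - c *\<^sub>R x) = (1 - c) * norm x" using c by simp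
  also have "\<dots> \<le> (1 - c) * \<rho>" using c assms by (intro mult_left_mono) auto
  also have "\<dots> = \<rho> - \<sigma> / 2" using \<rho> by (simp add: c_def field_simps)
  finally have "norm (x - c *\<^sub>R x) \<le> \<rho> - \<sigma> / 2" .
  moreover have "norm y \<le> norm (y - (x - c *\<^sub>R x)) + norm (x - c *\<^sub>R x)"
    using norm_triangle_ineq[of "y - (x - c *\<^sub>R x)" "x - c *\<^sub>R x"] by simp
  ultimately have 1: "norm y < \<rho>" using y unfolding c_def by linarith
  have "norm (c *\<^sub>R x) \<le> \<sigma> / 2"
  proof -
    have "norm (c *\<^sub>R x) = c * norm x" using c by simp
    also have "\<dots> \<le> c * \<rho>" using c assms by (intro mult_left_mono) auto
    also have "\<dots> = \<sigma> / 2" using \<rho> by (simp add: c_def)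
    finally show ?thesis .
  qed
  moreover have "norm (y - x) \<le> norm (y - (x - c *\<^sub>R x)) + norm (c *\<^sub>R x)"
    using norm_triangle_ineq4[of "y - (x - c *\<^sub>R x)" "c *\<^sub>R x"] by (simp add: algebra_simps)
  ultimately have "norm (y - x) < \<sigma>" using y unfolding c_def by linarith
  then show "y \<in> ball 0 \<rho> \<inter> ball x \<sigma>" using 1 by (simp add: dist_norm norm_minus_commute)
qed

text \<open>Dyadic layer cake: the level between 2^i L and 2^(i+1) L contributes a term of a
  geometric series, convergent because the decay rate \<sigma> exceeds q.\<close>

lemma nn_integral_powr_le_levels:
  fixes u :: "'a::euclidean_space \<Rightarrow> real" and C L q \<sigma> :: real
  assumes [measurable]: "u \<in> borel_measurable borel" "B \<in> sets borel" and L: "0 < L" and q: "0 < q" "q < \<sigma>" and C: "0 \<le> C"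
    and u0: "\<And>x. 0 \<le> u x" and B: "emeasure lborel B \<le> ennreal C"
    and lev: "\<And>i::nat. emeasure lborel {x \<in> B. 2 ^ i * L \<le> u x} \<le> ennreal (C * 2 powr (- (real i * \<sigma>)))"
  shows "(\<integral>\<^sup>+x\<in>B. ennreal (u x powr q) \<partial>lborel) \<le> ennreal (C * L powr q * (1 + 2 powr q / (1 - 2 powr (q - \<sigma>))))"
proof -
  define X where "X i = {x \<in> B. 2 ^ i * L \<le> u x}" for i :: nat
  have [measurable]: "X i \<in> sets borel" for i unfolding X_def by measurable
  define c where "c i = (2 ^ Suc i * L) powr q" for i :: nat
  have "(\<integral>\<^sup>+x\<in>B. ennreal (u x powr q) \<partial>lborel)
      \<le> (\<integral>\<^sup>+x. ennreal (L powr q) * indicator B x + (\<Sum>i. ennreal (c i) * indicator (X i) x) \<partial>lborel)"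
  proof (rule nn_integral_mono)
    fix x :: 'a
    show "ennreal (u x powr q) * indicator B x \<le> ennreal (L powr q) * indicator B x + (\<Sum>i. ennreal (c i) * indicator (X i) x)"
    proof (cases "x \<in> B")
      case x: True
      show ?thesis
      proof (cases "u x \<le> L")
        case True
        then have "ennreal (u x powr q) \<le> ennreal (L powr q)" using u0 q by (intro ennreal_leI powr_mono2) auto
        then show ?thesis using x by (simp add: add_increasing2)
      next
        case False
        then obtain i where i: "L * 2 ^ i \<le> u x" "u x < L * 2 ^ Suc i" using ex_dyadic_above[of L "u x"] L by auto
        have "ennreal (u x powr q) \<le> ennreal (c i)" unfolding c_def using i u0 q
          by (intro ennreal_leI powr_mono2) (auto simp: mult_ac)
        also have "\<dots> = ennreal (c i) * indicator (X i) x" using i x by (simp add: X_def mult.commute)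
        also have "\<dots> \<le> (\<Sum>i. ennreal (c i) * indicator (X i) x)"
          using sum_le_suminf[of "\<lambda>i. ennreal (c i) * indicator (X i) x" "{i}"] by (simp del: sum_mult_indicator)
        finally show ?thesis using x by (simp add: add_increasing)
      qed
    qed simp
  qed
  also have "\<dots> = (\<integral>\<^sup>+x. ennreal (L powr q) * indicator B x \<partial>lborel) + (\<integral>\<^sup>+x. (\<Sum>i. ennreal (c i) * indicator (X i) x) \<partial>lborel)"
    by (rule nn_integral_add) measurable
  also have "(\<integral>\<^sup>+x. ennreal (L powr q) * indicator B x \<partial>lborel) = ennreal (L powr q) * emeasure lborel B"
    by (rule nn_integral_cmult_indicator) simp
  also have "(\<integral>\<^sup>+x. (\<Sum>i. ennreal (c i) * indicator (X i) x) \<partial>lborel) = (\<Sum>i. \<integral>\<^sup>+x. ennreal (c i) * indicator (X i) x \<partial>lborel)"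
    by (rule nn_integral_suminf) measurable
  also have "\<dots> = (\<Sum>i. ennreal (c i) * emeasure lborel (X i))"
    by (intro suminf_cong nn_integral_cmult_indicator) simp
  also have "\<dots> \<le> (\<Sum>i. ennreal (C * L powr q * 2 powr q * (2 powr (q - \<sigma>)) ^ i))"
  proof (intro suminf_le allI)
    fix i
    have "ennreal (c i) * emeasure lborel (X i) \<le> ennreal (c i) * ennreal (C * 2 powr (- (real i * \<sigma>)))"
      unfolding X_def by (intro mult_left_mono lev) auto
    also have "\<dots> = ennreal (c i * (C * 2 powr (- (real i * \<sigma>))))" using C by (intro ennreal_mult[symmetric]) (auto simp: c_def)
    also have "c i * (C * 2 powr (- (real i * \<sigma>))) = C * L powr q * 2 powr q * (2 powr (q - \<sigma>)) ^ i"
    proof -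
      have "c i = (2 ^ Suc i) powr q * L powr q" unfolding c_def by (rule powr_mult)
      also have "(2 ^ Suc i :: real) powr q = 2 powr q * 2 powr (real i * q)"
        by (simp add: powr_realpow[symmetric] powr_powr powr_add[symmetric] powr_mult algebra_simps)
      finally have "c i * (C * 2 powr (- (real i * \<sigma>))) = C * L powr q * 2 powr q * (2 powr (real i * q) * 2 powr (- (real i * \<sigma>)))" by simp
      also have "2 powr (real i * q) * 2 powr (- (real i * \<sigma>)) = (2 powr (q - \<sigma>)) ^ i"
        by (simp add: powr_add[symmetric] powr_power algebra_simps)
      finally show ?thesis .
    qed
    finally show "ennreal (c i) * emeasure lborel (X i) \<le> ennreal (C * L powr q * 2 powr q * (2 powr (q - \<sigma>)) ^ i)" .
  qed auto
  also have "\<dots> = ennreal (C * L powr q * 2 powr q * (1 / (1 - 2 powr (q - \<sigma>))))"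
  proof (rule suminf_ennreal_eq)
    show "(\<lambda>i. C * L powr q * 2 powr q * (2 powr (q - \<sigma>)) ^ i) sums (C * L powr q * 2 powr q * (1 / (1 - 2 powr (q - \<sigma>))))"
      using q by (intro sums_mult geometric_sums) (auto simp: powr_less_one)
  qed (use C in auto)
  finally have "(\<integral>\<^sup>+x\<in>B. ennreal (u x powr q) \<partial>lborel) \<le> ennreal (L powr q) * emeasure lborel B + ennreal (C * L powr q * 2 powr q * (1 / (1 - 2 powr (q - \<sigma>))))"
    by (simp add: add_left_mono)
  also have "\<dots> \<le> ennreal (L powr q) * ennreal C + ennreal (C * L powr q * 2 powr q * (1 / (1 - 2 powr (q - \<sigma>))))"
    by (intro add_right_mono mult_left_mono B) auto
  also have "\<dots> = ennreal (L powr q * C + C * L powr q * 2 powr q * (1 / (1 - 2 powr (q - \<sigma>))))"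
  proof -
    have "2 powr (q - \<sigma>) < 1" using q by (simp add: powr_less_one)
    then show ?thesis using C by (subst ennreal_plus) (auto simp: ennreal_mult)
  qed
  also have "L powr q * C + C * L powr q * 2 powr q * (1 / (1 - 2 powr (q - \<sigma>))) = C * L powr q * (1 + 2 powr q / (1 - 2 powr (q - \<sigma>)))"
    by (simp add: algebra_simps)
  finally show ?thesis .
qed

context weighted_kernel
begin

definition \<omega> :: real where "\<omega> = unit_ball_vol N"

lemma N_pos: "0 < N" using p_gt p_less by linarith

lemma \<omega>_pos: "0 < \<omega>" unfolding \<omega>_def using N_pos by simp

lemma emeasure_ball_\<omega>: "0 \<le> r \<Longrightarrow> emeasure lborel (ball (x::'a) r) = ennreal (\<omega> * r ^ DIM('a))"
  unfolding \<omega>_def using emeasure_ball[of r x] N_def by simp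

lemma kernel_ge_on_ball:
  assumes "norm x < \<rho>" "norm y < \<rho>" "x \<noteq> 0" "y \<noteq> 0" "y \<noteq> x" "norm (x - y) \<le> \<sigma>"
  shows "\<sigma> powr (- (N + p * s)) * \<rho> powr (- 2 * \<beta>) \<le> K x y"
proof -
  have "\<sigma> powr (- (N + p * s)) \<le> norm (x - y) powr (- (N + p * s))"
    using assms ps_pos N_pos by (intro powr_mono2') auto
  moreover have "\<rho> powr (- \<beta>) * \<rho> powr (- \<beta>) \<le> norm x powr (- \<beta>) * norm y powr (- \<beta>)"
    using assms \<beta>_nonneg by (intro mult_mono powr_mono2') auto
  ultimately have "\<sigma> powr (- (N + p * s)) * (\<rho> powr (- \<beta>) * \<rho> powr (- \<beta>)) \<le> norm (x - y) powr (- (N + p * s)) * (norm x powr (- \<beta>) * norm y powr (- \<beta>))"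
    by (rule mult_mono) auto
  moreover have "\<rho> powr (- \<beta>) * \<rho> powr (- \<beta>) = \<rho> powr (- 2 * \<beta>)" by (simp add: powr_add[symmetric])
  ultimately show ?thesis by (simp add: K_eq mult.assoc)
qed

abbreviation rad :: "nat \<Rightarrow> real" where "rad j \<equiv> (1 / 2) ^ j"

definition lset :: "('a \<Rightarrow> real) \<Rightarrow> nat \<Rightarrow> real \<Rightarrow> 'a set" where
  "lset u j t = {x \<in> ball 0 (rad j). t \<le> u x}"

lemma lset_measurable [measurable]:
  assumes [measurable]: "u \<in> borel_measurable borel"
  shows "lset u j t \<in> sets borel"
  unfolding lset_def by measurable

lemma emeasure_lset:
  "emeasure lborel (lset u j t) = ennreal (measure lborel (lset u j t))"
  "measure lborel (lset u j t) \<le> \<omega> * rad j ^ DIM('a)" if [measurable]: "u \<in> borel_measurable borel"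
proof -
  have le: "emeasure lborel (lset u j t) \<le> ennreal (\<omega> * rad j ^ DIM('a))"
    unfolding emeasure_ball_\<omega>[of "rad j" 0, symmetric, simplified] by (rule emeasure_mono) (auto simp: lset_def)
  then have "emeasure lborel (lset u j t) \<noteq> \<infinity>" by (metis ennreal_neq_top infinity_ennreal_def neq_top_trans)
  then show eq: "emeasure lborel (lset u j t) = ennreal (measure lborel (lset u j t))"
    by (intro emeasure_eq_ennreal_measure) simp
  show "measure lborel (lset u j t) \<le> \<omega> * rad j ^ DIM('a)"
    using le unfolding eq by (subst (asm) ennreal_le_iff) (use \<omega>_pos in auto)
qed

lemma lset_diff_ge:
  assumes [measurable]: "u \<in> borel_measurable borel" "A \<in> sets borel" and "ennreal (a + measure lborel (lset u j t)) \<le> emeasure lborel A" and "0 \<le> a"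
  shows "ennreal a \<le> emeasure lborel (A - lset u j t)"
proof -
  let ?m = "measure lborel (lset u j t)"
  have "ennreal ?m + ennreal a = ennreal (a + ?m)" using assms by (simp add: ennreal_plus add.commute)
  also have "\<dots> \<le> emeasure lborel A" by (rule assms)
  also have "\<dots> \<le> emeasure lborel ((A - lset u j t) \<union> lset u j t)" by (rule emeasure_mono) auto
  also have "\<dots> \<le> emeasure lborel (A - lset u j t) + emeasure lborel (lset u j t)" by (rule emeasure_subadditive) auto
  finally have "ennreal ?m + ennreal a \<le> ennreal ?m + emeasure lborel (A - lset u j t)"
    by (simp add: emeasure_lset(1) add.commute)
  then show ?thesis by (simp add: ennreal_add_left_cancel_le)
qed

text \<open>If the bound passed from the ball of radius \<open>rad j\<close> to the next one failed, then the interaction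
  between the two balls would exceed the energy; the exponent \<open>\<gamma>\<close> makes this scale invariant.\<close>

lemma dyadic_density_bound:
  assumes um[measurable]: "u \<in> borel_measurable borel" and u1: "\<And>x. 1 \<le> u x"
    and \<epsilon>: "0 < \<epsilon>" and \<theta>: "\<theta> = p - 1 - \<epsilon>" "0 < \<theta>" and \<gamma>: "\<gamma> = cap_exp / \<theta>"
    and en: "neg_energy \<epsilon> u \<le> ennreal CE" and CE: "0 \<le> CE"
    and D: "0 < D"
    and base: "measure lborel (lset u 0 D) \<le> \<omega> * (1 / 2) ^ (DIM('a) + 1)"
    and big: "CE < (1 - 1 / 2 powr \<gamma>) powr (p - 1) * ((2 powr \<gamma>) powr \<epsilon> - 1) * D powr \<theta> * 2 powr (cap_exp - (N + p * s)) *
       (\<omega> / 2 * (\<omega> * (1 / 2) ^ (DIM('a) + 1) * (1 / 2) ^ DIM('a)))"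
  shows "measure lborel (lset u j (D * (2 powr \<gamma>) ^ j)) \<le> \<omega> * (1 / 2) ^ (DIM('a) + 1) * rad j ^ DIM('a)"
proof (induction j)
  case 0
  then show ?case using base by simp
next
  case (Suc j)
  let ?a = "N + p * s" and ?n = "DIM('a)"
  define \<kappa> where "\<kappa> = 2 powr \<gamma>"
  have \<gamma>0: "0 < \<gamma>" unfolding \<gamma> using cap_exp_pos \<theta> by simp
  have \<kappa>: "1 < \<kappa>" unfolding \<kappa>_def using \<gamma>0 by simp
  define L where "L = D * \<kappa> ^ Suc j"
  have L: "0 < L" using D \<kappa> by (simp add: L_def)
  have Lk: "L / \<kappa> = D * \<kappa> ^ j" using \<kappa> by (simp add: L_def)
  define X where "X = lset u (Suc j) L"
  define Y where "Y = ball 0 (rad j) - lset u j (L / \<kappa>)"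
  define \<rho> where "\<rho> = rad j"
  have \<rho>: "0 < \<rho>" "\<rho> \<le> 1" by (auto simp: \<rho>_def power_le_one)
  have IH: "measure lborel (lset u j (L / \<kappa>)) \<le> \<omega> * (1 / 2) ^ (?n + 1) * \<rho> ^ ?n"
    using Suc.IH unfolding Lk by (simp add: \<kappa>_def \<rho>_def)
  have [measurable]: "X \<in> sets borel" "Y \<in> sets borel" unfolding X_def Y_def by measurable
  show ?case
  proof (rule ccontr)
    assume "\<not> ?case"
    moreover have "rad (Suc j) ^ ?n = (1 / 2) ^ ?n * \<rho> ^ ?n" by (simp only: \<rho>_def power_Suc power_mult_distrib)
    ultimately have XL: "\<omega> * (1 / 2) ^ (?n + 1) * ((1 / 2) ^ ?n * \<rho> ^ ?n) \<le> measure lborel X"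
      unfolding X_def L_def \<kappa>_def by (simp only: not_le less_imp_le)
    have Y2: "ennreal (\<omega> / 2 * \<rho> ^ ?n) \<le> emeasure lborel Y"
      unfolding Y_def
    proof (rule lset_diff_ge)
      \<comment> \<open>The exceptional set fills at most half of the ball, so at least half of it
        lies below the lower level.\<close>
      have "(1 / 2 :: real) ^ (?n + 1) \<le> 1 / 2" by (simp add: power_le_one)
      then have "\<omega> * (1 / 2) ^ (?n + 1) * \<rho> ^ ?n \<le> \<omega> * (1 / 2) * \<rho> ^ ?n"
        using \<omega>_pos \<rho> by (intro mult_right_mono mult_left_mono) auto
      then have "\<omega> / 2 * \<rho> ^ ?n + measure lborel (lset u j (L / \<kappa>)) \<le> \<omega> * \<rho> ^ ?n" using IH by (simp add: algebra_simps)
      then show "ennreal (\<omega> / 2 * \<rho> ^ ?n + measure lborel (lset u j (L / \<kappa>))) \<le> emeasure lborel (ball (0::'a) (rad j))"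
        by (subst emeasure_ball_\<omega>) (auto simp: \<rho>_def[symmetric] \<rho>(1) less_imp_le intro: ennreal_leI)
    qed (use \<omega>_pos \<rho> in auto)
    define k0 where "k0 = (2 * \<rho>) powr (- ?a) * \<rho> powr (- 2 * \<beta>)"
    define c where "c = (1 - 1 / \<kappa>) powr (p - 1) * (\<kappa> powr \<epsilon> - 1)"
    have c: "0 \<le> c" using \<kappa> \<epsilon> by (auto simp: c_def ge_one_powr_ge_zero)
    have "ennreal ((1 - 1 / \<kappa>) powr (p - 1) * (\<kappa> powr \<epsilon> - 1) * L powr (p - 1 - \<epsilon>) * k0) * (ennreal (\<omega> / 2 * \<rho> ^ ?n) * emeasure lborel X) \<le> neg_energy \<epsilon> u"
    proof (rule neg_energy_level_ge[OF um u1 \<epsilon> \<kappa> L, where Y="\<lambda>_. Y"])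
      show "norm x < 3 / 2 \<and> L \<le> u x" if "x \<in> X" for x
        using that \<rho> by (auto simp: X_def lset_def \<rho>_def[symmetric])
      show "norm y < 3 / 2 \<and> u y \<le> L / \<kappa>" if "y \<in> Y" for y
        using that \<rho> by (auto simp: Y_def lset_def \<rho>_def[symmetric])
      show "k0 \<le> K x y" if "x \<in> X" "y \<in> Y" "x \<noteq> 0" "y \<noteq> 0" "y \<noteq> x" for x y
        unfolding k0_def
      proof (rule kernel_ge_on_ball)
        show nx: "norm x < \<rho>" using that \<rho> by (auto simp: X_def lset_def \<rho>_def[symmetric])
        show ny: "norm y < \<rho>" using that by (auto simp: Y_def \<rho>_def)
        show "norm (x - y) \<le> 2 * \<rho>" using norm_triangle_ineq4[of x y] nx ny by linarith
      qed (use that in auto)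
      show "0 \<le> k0" by (simp add: k0_def)
      show "ennreal (\<omega> / 2 * \<rho> ^ ?n) \<le> emeasure lborel Y" by (rule Y2)
    qed measurable
    also have "\<dots> \<le> ennreal CE" by (rule en)
    also have "emeasure lborel X = ennreal (measure lborel X)" unfolding X_def by (rule emeasure_lset(1)) simp
    finally have "ennreal (c * L powr \<theta> * k0) * (ennreal (\<omega> / 2 * \<rho> ^ ?n) * ennreal (measure lborel X)) \<le> ennreal CE"
      by (simp only: c_def \<theta>(1))
    then have "ennreal (c * L powr \<theta> * k0 * (\<omega> / 2 * \<rho> ^ ?n * measure lborel X)) \<le> ennreal CE"
      using c \<omega>_pos \<rho> by (subst (asm) ennreal_mult3) (auto simp: k0_def)
    then have "c * L powr \<theta> * k0 * (\<omega> / 2 * \<rho> ^ ?n * measure lborel X) \<le> CE"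
      using CE by (subst (asm) ennreal_le_iff) auto
    moreover have "c * L powr \<theta> * k0 * (\<omega> / 2 * \<rho> ^ ?n * (\<omega> * (1 / 2) ^ (?n + 1) * ((1 / 2) ^ ?n * \<rho> ^ ?n))) \<le> c * L powr \<theta> * k0 * (\<omega> / 2 * \<rho> ^ ?n * measure lborel X)"
      using c \<omega>_pos \<rho> by (intro mult_left_mono XL) (auto simp: k0_def)
    ultimately have "c * L powr \<theta> * k0 * (\<omega> / 2 * \<rho> ^ ?n * (\<omega> * (1 / 2) ^ (?n + 1) * ((1 / 2) ^ ?n * \<rho> ^ ?n))) \<le> CE" by linarith
    also have "c * L powr \<theta> * k0 * (\<omega> / 2 * \<rho> ^ ?n * (\<omega> * (1 / 2) ^ (?n + 1) * ((1 / 2) ^ ?n * \<rho> ^ ?n)))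
      = c * (L powr \<theta> * k0 * (\<rho> ^ ?n * \<rho> ^ ?n)) * (\<omega> / 2 * (\<omega> * (1 / 2) ^ (?n + 1) * (1 / 2) ^ ?n))" by (simp add: mult_ac)
    \<comment> \<open>Here L to the power \<theta> grows like 2^(\<open>cap_exp\<close> (j + 1)),
      while the kernel bound times two volumes decays like 2^(-\<open>cap_exp\<close> j). Only one
      factor 2^\<open>cap_exp\<close> remains, independent of j, so a single choice of D contradicts
      the energy bound at all scales.\<close>
    also have "L powr \<theta> * k0 * (\<rho> ^ ?n * \<rho> ^ ?n) = D powr \<theta> * 2 powr (cap_exp - ?a)"
    proof -
      have \<rho>p: "\<rho> = 2 powr (- real j)" by (simp add: \<rho>_def powr_minus powr_realpow power_one_over inverse_eq_divide)
      have "\<kappa> ^ Suc j = 2 powr (\<gamma> * real (Suc j))" unfolding \<kappa>_def by (subst powr_power) (simp_all add: mult.commute del: of_nat_Suc)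
      then have "L powr \<theta> = D powr \<theta> * 2 powr (\<gamma> * real (Suc j) * \<theta>)" unfolding L_def by (simp add: powr_mult powr_powr)
      also have "\<gamma> * real (Suc j) * \<theta> = cap_exp * real (Suc j)" using \<theta> by (simp add: \<gamma>)
      finally have L': "L powr \<theta> = D powr \<theta> * 2 powr (cap_exp * real (Suc j))" .
      have "\<rho> ^ ?n = 2 powr (- real j * N)" using \<rho>(1) by (simp add: powr_realpow[symmetric] \<rho>p powr_powr N_def)
      moreover have "k0 = 2 powr (- ?a) * (2 powr (real j * ?a) * 2 powr (real j * (2 * \<beta>)))"
        unfolding k0_def powr_mult \<rho>p powr_powr by (simp add: algebra_simps)
      ultimately have "L powr \<theta> * k0 * (\<rho> ^ ?n * \<rho> ^ ?n) = D powr \<theta> * (2 powr (cap_exp * real (Suc j)) * 2 powr (- ?a) * (2 powr (real j * ?a) * 2 powr (real j * (2 * \<beta>))) * (2 powr (- real j * N) * 2 powr (- real j * N)))"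
        unfolding L' by (simp only: mult_ac)
      also have "2 powr (cap_exp * real (Suc j)) * 2 powr (- ?a) * (2 powr (real j * ?a) * 2 powr (real j * (2 * \<beta>))) * (2 powr (- real j * N) * 2 powr (- real j * N))
        = 2 powr (cap_exp * real (Suc j) + (- ?a) + (real j * ?a + real j * (2 * \<beta>)) + (- real j * N + - real j * N))"
        by (simp only: powr_add)
      also have "cap_exp * real (Suc j) + (- ?a) + (real j * ?a + real j * (2 * \<beta>)) + (- real j * N + - real j * N) = cap_exp - ?a"
        by (simp add: cap_exp_def algebra_simps)
      finally show ?thesis .
    qed
    finally show False using big unfolding \<kappa>_def[symmetric] c_def[symmetric] by (simp add: mult_ac)
  qed
qed


text \<open>The comparison set is the part of a small ball around x that lies below the next lower
  level, with the radius adapted to the measure m of the lower superlevel set. The kernel then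
  yields m to the power 1 + l, of which one factor m cancels against the measure of the comparison
  set, and the sublinear recursion remains.\<close>

lemma level_decay:
  assumes um[measurable]: "u \<in> borel_measurable borel" and u1: "\<And>x. 1 \<le> u x"
    and \<epsilon>: "0 < \<epsilon>" and \<theta>: "\<theta> = p - 1 - \<epsilon>" "0 < \<theta>"
    and en: "neg_energy \<epsilon> u \<le> ennreal CE" and CE: "0 < CE" and D: "0 < D"
    and \<rho>: "\<rho> = rad j" and L: "0 < L" "L powr \<theta> = D powr \<theta> * \<rho> powr (- cap_exp)"
    and dens: "measure lborel (lset u j L) \<le> \<omega> * (1 / 2) ^ (DIM('a) + 1) * \<rho> ^ DIM('a)"
    and l: "l = p * s / N"
    and C: "C = CE / ((1 / 2) powr (p - 1) * (2 powr \<epsilon> - 1)) * (2 * 2 powr N / \<omega>) powr (1 + l) * D powr (- \<theta>) * 2 powr (- \<theta>)"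
  shows "measure lborel (lset u j (2 ^ i * L)) \<le> max \<omega> ((C * 2 powr (\<theta> / (1 - l))) powr (1 / (1 - l))) * \<rho> ^ DIM('a) * 2 powr (- (real i * (\<theta> / (1 - l))))"
proof -
  let ?n = "DIM('a)" and ?a = "N + p * s"
  have \<rho>0: "0 < \<rho>" "\<rho> \<le> 1" by (auto simp: \<rho> power_le_one)
  have \<rho>N: "\<rho> ^ ?n = \<rho> powr N" using \<rho>0 by (simp add: powr_realpow N_def)
  define c where "c = (1 / 2) powr (p - 1) * (2 powr \<epsilon> - 1)"
  have c: "0 < c" using \<epsilon> by (simp add: c_def)
  have C0: "0 < C" using C CE c \<omega>_pos D by (simp add: c_def[symmetric])
  have l01: "0 \<le> l" "l < 1" using l ps_pos ps_less N_pos by auto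
  define m where "m i = measure lborel (lset u j (2 ^ i * L))" for i :: nat
  have m0: "0 \<le> m i" for i by (simp add: m_def)
  have em: "emeasure lborel (lset u j (2 ^ i * L)) = ennreal (m i)" for i
    unfolding m_def by (rule emeasure_lset(1)) simp
  have anti: "lset u j (2 ^ i' * L) \<subseteq> lset u j (2 ^ i * L)" if "i \<le> i'" for i i'
  proof -
    have "2 ^ i * L \<le> 2 ^ i' * L" using that L by (intro mult_right_mono power_increasing) auto
    then show ?thesis by (auto simp: lset_def)
  qed
  have manti: "m i' \<le> m i" if "i \<le> i'" for i i'
  proof -
    have "ennreal (m i') \<le> ennreal (m i)" unfolding em[symmetric] by (rule emeasure_mono[OF anti[OF that]]) simp
    then show ?thesis using m0 by (simp add: ennreal_le_iff)
  qed
  have mstep: "m (Suc i) \<le> C * 2 powr (- (real i * \<theta>)) * (m i powr l * \<rho> powr (cap_exp + 2 * \<beta>))" for i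
  proof (cases "m i = 0")
    case True
    then show ?thesis using manti[of i "Suc i"] C0 by simp
  next
    case False
    then have mi: "0 < m i" using m0[of i] by simp
    \<comment> \<open>A ball of radius \<sigma>/2 has measure 2 m i, and such a ball fits into the
      intersection of the ball around x with the dyadic ball; so measure m i survives removal of the
      superlevel set.\<close>
    define \<sigma> where "\<sigma> = 2 * (2 * m i / \<omega>) powr (1 / N)"
    have \<sigma>0: "0 < \<sigma>" using mi \<omega>_pos by (simp add: \<sigma>_def)
    have \<sigma>N: "(\<sigma> / 2) powr N = 2 * m i / \<omega>" using mi \<omega>_pos N_pos by (simp add: \<sigma>_def powr_powr)
    have "m i \<le> m 0" by (rule manti) simp
    also have "\<dots> \<le> \<omega> * (1 / 2) ^ (?n + 1) * \<rho> ^ ?n" using dens by (simp add: m_def)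
    also have "\<dots> = \<omega> / 2 * ((1 / 2) ^ ?n * \<rho> ^ ?n)" by simp
    \<comment> \<open>The reason for the density 2^(-n-1) rather than 1/2: a ball of measure 2 m i
      then has radius at most \<rho>/2, i.e. \<sigma> is at most \<rho>.\<close>
    also have "(1 / 2) ^ ?n * \<rho> ^ ?n = (\<rho> / 2) powr N" using \<rho>0 by (simp add: N_def powr_realpow power_divide)
    finally have "(\<sigma> / 2) powr N \<le> (\<rho> / 2) powr N" unfolding \<sigma>N using \<omega>_pos by (simp add: field_simps)
    then have "\<sigma> / 2 \<le> \<rho> / 2" using N_pos \<sigma>0 \<rho>0 powr_less_mono2[of N "\<rho> / 2" "\<sigma> / 2"] by linarith
    then have \<sigma>\<rho>: "\<sigma> \<le> \<rho>" by simp
    define k0 where "k0 = \<sigma> powr (- ?a) * \<rho> powr (- 2 * \<beta>)"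
    define L' where "L' = 2 ^ Suc i * L"
    have L'0: "0 < L'" using L by (simp add: L'_def)
    have "ennreal ((1 - 1 / 2) powr (p - 1) * (2 powr \<epsilon> - 1) * L' powr (p - 1 - \<epsilon>) * k0) * (ennreal (m i) * emeasure lborel (lset u j L')) \<le> neg_energy \<epsilon> u"
    proof (rule neg_energy_level_ge[OF um u1 \<epsilon> _ L'0, where Y="\<lambda>x. (ball 0 \<rho> \<inter> ball x \<sigma>) - lset u j (2 ^ i * L)"])
      show "norm x < 3 / 2 \<and> L' \<le> u x" if "x \<in> lset u j L'" for x
        using that \<rho>0 by (auto simp: lset_def \<rho>[symmetric])
      show "norm y < 3 / 2 \<and> u y \<le> L' / 2" if "y \<in> (ball 0 \<rho> \<inter> ball x \<sigma>) - lset u j (2 ^ i * L)" for x y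
        using that \<rho>0 by (auto simp: lset_def \<rho>[symmetric] L'_def)
      show "k0 \<le> K x y" if "x \<in> lset u j L'" "y \<in> (ball 0 \<rho> \<inter> ball x \<sigma>) - lset u j (2 ^ i * L)" "x \<noteq> 0" "y \<noteq> 0" "y \<noteq> x" for x y
        unfolding k0_def by (rule kernel_ge_on_ball) (use that in \<open>auto simp: lset_def \<rho>[symmetric] dist_norm\<close>)
      show "ennreal (m i) \<le> emeasure lborel ((ball 0 \<rho> \<inter> ball x \<sigma>) - lset u j (2 ^ i * L))" if "x \<in> lset u j L'" for x
      proof (rule lset_diff_ge)
        have "norm x < \<rho>" using that by (auto simp: lset_def \<rho>)
        then have sub: "ball (x - (\<sigma> / (2 * \<rho>)) *\<^sub>R x) (\<sigma> / 2) \<subseteq> ball 0 \<rho> \<inter> ball x \<sigma>"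
          using \<sigma>0 \<sigma>\<rho> by (intro ball_inter_ball_ge)
        have "(\<sigma> / 2) ^ ?n = 2 * m i / \<omega>" unfolding \<sigma>N[symmetric] using \<sigma>0 by (simp add: powr_realpow N_def)
        then have "m i + measure lborel (lset u j (2 ^ i * L)) = \<omega> * (\<sigma> / 2) ^ ?n"
          using \<omega>_pos by (simp add: m_def)
        then have "ennreal (m i + measure lborel (lset u j (2 ^ i * L))) = emeasure lborel (ball (x - (\<sigma> / (2 * \<rho>)) *\<^sub>R x) (\<sigma> / 2))"
          using \<sigma>0 by (subst emeasure_ball_\<omega>) auto
        also have "\<dots> \<le> emeasure lborel (ball 0 \<rho> \<inter> ball x \<sigma>)" by (rule emeasure_mono[OF sub]) simp
        finally show "ennreal (m i + measure lborel (lset u j (2 ^ i * L))) \<le> emeasure lborel (ball 0 \<rho> \<inter> ball x \<sigma>)" .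
      qed (use m0 in auto)
    qed (auto simp: k0_def)
    also have "\<dots> \<le> ennreal CE" by (rule en)
    also have "emeasure lborel (lset u j L') = ennreal (m (Suc i))" unfolding L'_def by (rule em)
    finally have "ennreal (c * L' powr \<theta> * k0) * (ennreal (m i) * ennreal (m (Suc i))) \<le> ennreal CE"
      unfolding c_def \<theta>(1) by simp
    then have "ennreal (c * L' powr \<theta> * k0 * (m i * m (Suc i))) \<le> ennreal CE"
      using c m0 by (subst (asm) ennreal_mult3) (auto simp: k0_def)
    then have le: "c * L' powr \<theta> * k0 * (m i * m (Suc i)) \<le> CE"
      using CE by (subst (asm) ennreal_le_iff) auto
    \<comment> \<open>The reciprocal of the coefficient of m (i + 1); its denominator cancels one of
      the factors m i in \<sigma> to the power N + ps.\<close>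
    define k where "k = L' powr (- \<theta>) * (\<sigma> powr ?a * \<rho> powr (2 * \<beta>)) / (c * m i)"
    have k1: "k * (c * L' powr \<theta> * k0 * m i) = 1"
    proof -
      have "k * (c * L' powr \<theta> * k0 * m i) = (L' powr (- \<theta>) * L' powr \<theta>) * (\<sigma> powr ?a * \<sigma> powr (- ?a)) * (\<rho> powr (2 * \<beta>) * \<rho> powr (- 2 * \<beta>))"
        using c mi by (simp add: k_def k0_def)
      also have "L' powr (- \<theta>) * L' powr \<theta> = 1" using L'0 by (simp add: powr_add[symmetric])
      also have "\<sigma> powr ?a * \<sigma> powr (- ?a) = 1" using \<sigma>0 by (simp only: powr_add[symmetric]) simp
      also have "\<rho> powr (2 * \<beta>) * \<rho> powr (- 2 * \<beta>) = 1" using \<rho>0 by (simp add: powr_add[symmetric])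
      finally show ?thesis by simp
    qed
    have k0': "0 \<le> k" using c m0 by (simp add: k_def)
    have "m (Suc i) = k * (c * L' powr \<theta> * k0 * m i) * m (Suc i)" unfolding k1 by simp
    also have "\<dots> = k * (c * L' powr \<theta> * k0 * (m i * m (Suc i)))" by (simp only: mult.assoc)
    also have "\<dots> \<le> k * CE" by (rule mult_left_mono[OF le k0'])
    also have "k * CE = C * 2 powr (- (real i * \<theta>)) * (m i powr l * \<rho> powr (cap_exp + 2 * \<beta>))"
    proof -
      have "?a = N * (1 + l)" using N_pos by (simp add: l field_simps)
      then have "\<sigma> powr ?a = (\<sigma> powr N) powr (1 + l)" by (simp add: powr_powr)
      also have "\<sigma> powr N = 2 powr N * (\<sigma> / 2) powr N" using \<sigma>0 by (simp add: powr_mult[symmetric])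
      also have "\<dots> = (2 * 2 powr N / \<omega>) * m i" unfolding \<sigma>N by simp
      also have "((2 * 2 powr N / \<omega>) * m i) powr (1 + l) = (2 * 2 powr N / \<omega>) powr (1 + l) * m i powr (1 + l)" by (rule powr_mult)
      also have "m i powr (1 + l) = m i * m i powr l" using mi by (simp add: powr_add)
      finally have sa: "\<sigma> powr ?a = (2 * 2 powr N / \<omega>) powr (1 + l) * (m i * m i powr l)" .
      have "L' powr (- \<theta>) = (2 ^ Suc i) powr (- \<theta>) * L powr (- \<theta>)" unfolding L'_def by (rule powr_mult)
      also have "(2 ^ Suc i :: real) powr (- \<theta>) = 2 powr (- (real i * \<theta>)) * 2 powr (- \<theta>)"
        by (simp add: powr_realpow[symmetric] powr_powr powr_add[symmetric] powr_mult algebra_simps)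
      also have "L powr (- \<theta>) = D powr (- \<theta>) * \<rho> powr cap_exp"
        unfolding powr_minus L(2) by (simp add: powr_minus)
      finally have La: "L' powr (- \<theta>) = 2 powr (- (real i * \<theta>)) * 2 powr (- \<theta>) * (D powr (- \<theta>) * \<rho> powr cap_exp)" .
      have ra: "\<rho> powr (cap_exp + 2 * \<beta>) = \<rho> powr cap_exp * \<rho> powr (2 * \<beta>)" by (rule powr_add)
      have kk: "x * (y * (mm * z) * r) / (c * mm) * CE = CE / c * y * z * (x * r)" if "mm \<noteq> 0" for x y z r mm :: real
        using that c by (simp add: field_simps)
      have "k * CE = CE / c * (2 * 2 powr N / \<omega>) powr (1 + l) * m i powr l * (L' powr (- \<theta>) * \<rho> powr (2 * \<beta>))"
        unfolding k_def sa using mi by (intro kk) simp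
      also have "\<dots> = C * 2 powr (- (real i * \<theta>)) * (m i powr l * \<rho> powr (cap_exp + 2 * \<beta>))"
        unfolding La ra C c_def[symmetric] by (simp only: mult_ac)
      finally show ?thesis .
    qed
    finally show ?thesis .
  qed
  \<comment> \<open>Measured relative to the volume scale of the ball the recursion no longer
    contains \<rho>: the exponents ps, N - ps and -N add up to 0.\<close>
  define \<alpha> where "\<alpha> i = m i / \<rho> powr N" for i
  have "\<alpha> i \<le> max \<omega> ((C * 2 powr (\<theta> / (1 - l))) powr (1 / (1 - l))) * 2 powr (- (real i * (\<theta> / (1 - l))))"
  proof (rule sublinear_recursion_decay)
    show "0 \<le> \<alpha> i" for i using m0 by (simp add: \<alpha>_def)
    have "m 0 \<le> \<omega> * \<rho> ^ ?n" unfolding m_def \<rho> by (rule emeasure_lset(2)) simp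
    then show "\<alpha> 0 \<le> \<omega>" using \<rho>0 by (simp add: \<alpha>_def \<rho>N[symmetric] field_simps)
    fix i
    have "\<alpha> (Suc i) \<le> C * 2 powr (- (real i * \<theta>)) * (m i powr l * \<rho> powr (cap_exp + 2 * \<beta>)) / \<rho> powr N"
      unfolding \<alpha>_def by (intro divide_right_mono mstep) simp
    also have "m i powr l = \<alpha> i powr l * \<rho> powr (N * l)"
      using \<rho>0 m0[of i] by (simp add: \<alpha>_def powr_divide powr_powr)
    also have "C * 2 powr (- (real i * \<theta>)) * (\<alpha> i powr l * \<rho> powr (N * l) * \<rho> powr (cap_exp + 2 * \<beta>)) / \<rho> powr N
      = C * 2 powr (- (real i * \<theta>)) * \<alpha> i powr l * (\<rho> powr (N * l) * \<rho> powr (cap_exp + 2 * \<beta>) * \<rho> powr (- N))"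
      by (simp add: powr_minus field_simps)
    also have "\<rho> powr (N * l) * \<rho> powr (cap_exp + 2 * \<beta>) * \<rho> powr (- N) = \<rho> powr (N * l + (cap_exp + 2 * \<beta>) + - N)"
      by (simp only: powr_add)
    also have "N * l + (cap_exp + 2 * \<beta>) + - N = 0" using N_pos by (simp add: cap_exp_def l)
    finally show "\<alpha> (Suc i) \<le> C * 2 powr (- (real i * \<theta>)) * \<alpha> i powr l" using \<rho>0 by simp
  qed (use l01 C0 in auto)
  then show ?thesis using \<rho>0 unfolding \<alpha>_def m_def \<rho>N by (simp add: field_simps)
qed

text \<open>Two geometric series: over levels within one dyadic ball, which needs \<sigma> > q, and
  over the balls towards the origin, which needs the weight, the growth of the base level and the
  volume to combine to a ratio below 1.\<close>

lemma higher_integrability: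
  assumes q: "0 < q" "q < N * (p - 1) / (N - p * s)"
  shows "\<exists>C>0. \<forall>w. unit_supersolution w \<longrightarrow> \<not> (AE x in lborel. norm x < 3 / 2 \<longrightarrow> 1 / 2 \<le> w x) \<longrightarrow>
     (\<integral>\<^sup>+x\<in>ball 0 1. ennreal (w x powr q * norm (x::'a) powr (- 2 * \<beta>)) \<partial>lborel) \<le> ennreal C"
proof -
  let ?n = "DIM('a)" and ?a = "N + p * s"
  \<comment> \<open>The room left by q: every \<epsilon> < e0 gives \<theta> = p - 1 - \<epsilon> >
    q (N - ps)/N, equivalently \<sigma> = \<theta> N/(N - ps) > q. The cap at 1 is required by the
    inequality for negative powers.\<close>
  define e0 where "e0 = p - 1 - q * (N - p * s) / N"
  have Nps: "0 < N - p * s" using ps_less by simp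
  have e0: "0 < e0" using q Nps N_pos by (simp add: e0_def field_simps)
  define \<epsilon> where "\<epsilon> = min 1 (e0 / 2)"
  have \<epsilon>: "0 < \<epsilon>" "\<epsilon> \<le> 1" "\<epsilon> < e0" using e0 by (auto simp: \<epsilon>_def)
  define \<theta> where "\<theta> = p - 1 - \<epsilon>"
  have \<theta>q: "q * (N - p * s) / N < \<theta>" using \<epsilon>(3) by (simp add: \<theta>_def e0_def)
  moreover have "0 < q * (N - p * s) / N" using q Nps N_pos by simp
  ultimately have \<theta>0: "0 < \<theta>" by linarith
  define \<gamma> where "\<gamma> = cap_exp / \<theta>"
  have \<gamma>0: "0 < \<gamma>" using cap_exp_pos \<theta>0 by (simp add: \<gamma>_def)
  define l where "l = p * s / N"
  have l: "0 < l" "l < 1" using ps_pos ps_less N_pos by (auto simp: l_def)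
  define \<sigma> where "\<sigma> = \<theta> / (1 - l)"
  have \<sigma>q: "q < \<sigma>"
  proof -
    have "\<sigma> = \<theta> * N / (N - p * s)" using N_pos Nps by (simp add: \<sigma>_def l_def field_simps)
    moreover have "q * (N - p * s) < \<theta> * N" using \<theta>q N_pos by (simp add: pos_divide_less_eq)
    ultimately show ?thesis using Nps by (simp add: pos_less_divide_eq)
  qed
  \<comment> \<open>Summability towards the origin needs no further restriction on q: \<gamma> q =
    \<open>cap_exp\<close> q/\<theta> is below \<open>cap_exp\<close> N/(N - ps), which is at most N
    - 2 \<beta>.\<close>
  have ratio: "2 * \<beta> + \<gamma> * q - N < 0"
  proof -
    have "q / \<theta> < N / (N - p * s)" using \<theta>q \<theta>0 Nps N_pos by (simp add: field_simps)
    then have "cap_exp * (q / \<theta>) < cap_exp * (N / (N - p * s))" using cap_exp_pos by (intro mult_strict_left_mono)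
    also have "\<dots> = N - 2 * \<beta> * (N / (N - p * s))" using Nps by (simp add: cap_exp_def field_simps)
    also have "\<dots> \<le> N - 2 * \<beta> * 1"
      using Nps ps_pos \<beta>_nonneg by (intro diff_left_mono mult_left_mono) (auto simp: field_simps)
    finally show ?thesis by (simp add: \<gamma>_def)
  qed
  obtain CA where CA: "CA > 0" "\<And>w. unit_supersolution w \<Longrightarrow> \<not> (AE x in lborel. norm x < 3 / 2 \<longrightarrow> 1 / 2 \<le> w x) \<Longrightarrow>
     (\<integral>\<^sup>+x\<in>ball 0 2. ennreal ((w x + 1) powr (p - 1) * (1 + norm (x::'a) powr (- \<beta>))) \<partial>lborel) \<le> ennreal CA"
    using upper_integral_bound by blast
  obtain CE where CE: "CE > 0" "\<And>w. unit_supersolution w \<Longrightarrow> \<not> (AE x in lborel. norm x < 3 / 2 \<longrightarrow> 1 / 2 \<le> w x) \<Longrightarrow>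
     neg_energy \<epsilon> (\<lambda>x. w x + 1) \<le> ennreal CE"
    using negative_power_energy[OF \<epsilon>(1,2)] by blast
  define c1 where "c1 = (1 - 1 / 2 powr \<gamma>) powr (p - 1) * ((2 powr \<gamma>) powr \<epsilon> - 1)"
  define c2 where "c2 = 2 powr (cap_exp - ?a) * (\<omega> / 2 * (\<omega> * (1 / 2) ^ (?n + 1) * (1 / 2) ^ ?n))"
  have c1: "0 < c1"
  proof -
    have "1 < 2 powr \<gamma>" using \<gamma>0 by simp
    then have "0 < 1 - 1 / 2 powr \<gamma>" "0 < (2 powr \<gamma>) powr \<epsilon> - 1" using \<epsilon> by simp_all
    then have "0 < (1 - 1 / 2 powr \<gamma>) powr (p - 1)" "0 < (2 powr \<gamma>) powr \<epsilon> - 1" by (simp_all only: powr_gt_zero)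
    then show ?thesis unfolding c1_def by (rule mult_pos_pos)
  qed
  have c2: "0 < c2" using \<omega>_pos by (simp add: c2_def)
  define h where "h = \<omega> * (1 / 2) ^ (?n + 1)"
  have h: "0 < h" using \<omega>_pos by (simp add: h_def)
  \<comment> \<open>The first entry makes Chebyshev's inequality give the density bound on the unit
    ball, the second makes the energy inequality fail on smaller ones; adding 1 makes the latter
    strict.\<close>
  define D where "D = max ((CA / h) powr (1 / (p - 1))) ((CE / (c1 * c2)) powr (1 / \<theta>)) + 1"
  have D: "0 < D" by (simp add: D_def add_nonneg_pos le_max_iff_disj)
  have D1: "CA \<le> h * D powr (p - 1)"
  proof -
    have "CA / h = ((CA / h) powr (1 / (p - 1))) powr (p - 1)" using CA h p_gt by (simp add: powr_powr)
    also have "\<dots> \<le> D powr (p - 1)" using p_gt by (intro powr_mono2) (auto simp: D_def)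
    finally show ?thesis using h by (simp add: field_simps)
  qed
  have D2: "CE < c1 * D powr \<theta> * c2"
  proof -
    have "CE / (c1 * c2) = ((CE / (c1 * c2)) powr (1 / \<theta>)) powr \<theta>" using CE c1 c2 \<theta>0 by (simp add: powr_powr)
    also have "\<dots> < D powr \<theta>" using \<theta>0 by (intro powr_less_mono2) (auto simp: D_def)
    finally show ?thesis using c1 c2 by (simp add: field_simps)
  qed
  define C where "C = CE / ((1 / 2) powr (p - 1) * (2 powr \<epsilon> - 1)) * (2 * 2 powr N / \<omega>) powr (1 + l) * D powr (- \<theta>) * 2 powr (- \<theta>)"
  define CC where "CC = max \<omega> ((C * 2 powr (\<theta> / (1 - l))) powr (1 / (1 - l)))"
  have CC: "\<omega> \<le> CC" "0 < CC" using \<omega>_pos by (auto simp: CC_def less_max_iff_disj)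
  define c5 where "c5 = 1 + 2 powr q / (1 - 2 powr (q - \<sigma>))"
  have c5: "0 < c5"
  proof -
    have "2 powr (q - \<sigma>) < 1" using \<sigma>q by (simp add: powr_less_one)
    then show ?thesis by (simp add: c5_def add_pos_nonneg)
  qed
  define Lv where "Lv j = D * (2 powr \<gamma>) ^ j" for j :: nat
  have Lv: "0 < Lv j" for j using D by (simp add: Lv_def)
  have Lq: "Lv j powr t = D powr t * rad j powr (- \<gamma> * t)" for j t
  proof -
    have "((2 powr \<gamma>) ^ j) powr t = 2 powr (real j * \<gamma> * t)" by (simp add: powr_power powr_powr)
    moreover have "rad j powr (- \<gamma> * t) = 2 powr (real j * \<gamma> * t)"
    proof -
      have "rad j = 2 powr (- real j)" by (simp add: powr_minus powr_realpow power_one_over inverse_eq_divide)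
      then show ?thesis by (simp add: powr_powr mult.assoc)
    qed
    ultimately show ?thesis unfolding Lv_def by (simp add: powr_mult)
  qed
  \<comment> \<open>The ratio of consecutive dyadic contributions: the singular weight contributes 2
    \<beta>, the base level \<gamma> q, the volume -N.\<close>
  define R0 where "R0 = 2 powr (2 * \<beta> + \<gamma> * q - N)"
  have R0: "0 < R0" "R0 < 1" using ratio by (auto simp: R0_def powr_less_one)
  define C6 where "C6 = 2 powr (2 * \<beta>) * CC * D powr q * c5"
  have C6: "0 < C6" using CC D c5 by (simp add: C6_def)
  have main: "(\<integral>\<^sup>+x\<in>ball 0 1. ennreal (w x powr q * norm (x::'a) powr (- 2 * \<beta>)) \<partial>lborel) \<le> ennreal (C6 * (1 / (1 - R0)))"
    if w: "unit_supersolution w" "\<not> (AE x in lborel. norm x < 3 / 2 \<longrightarrow> 1 / 2 \<le> w x)" for w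
  proof -
    have wm[measurable]: "w \<in> borel_measurable borel" and w0: "\<And>x. 0 \<le> w x"
      using w by (auto simp: unit_supersolution_def)
    define u where "u x = w x + 1" for x
    have um[measurable]: "u \<in> borel_measurable borel" unfolding u_def by measurable
    have u1: "1 \<le> u x" for x using w0[of x] by (simp add: u_def)
    have en: "neg_energy \<epsilon> u \<le> ennreal CE" unfolding u_def using CE(2)[OF w] .
    have base: "measure lborel (lset u 0 D) \<le> h"
    proof -
      have "ennreal (D powr (p - 1)) * emeasure lborel (lset u 0 D) = (\<integral>\<^sup>+x. ennreal (D powr (p - 1)) * indicator (lset u 0 D) x \<partial>lborel)"
        by (rule nn_integral_cmult_indicator[symmetric]) simp
      also have "\<dots> \<le> (\<integral>\<^sup>+x\<in>ball 0 2. ennreal ((w x + 1) powr (p - 1) * (1 + norm (x::'a) powr (- \<beta>))) \<partial>lborel)"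
      proof (rule nn_integral_mono)
        fix x :: 'a
        show "ennreal (D powr (p - 1)) * indicator (lset u 0 D) x \<le> ennreal ((w x + 1) powr (p - 1) * (1 + norm x powr (- \<beta>))) * indicator (ball 0 2) x"
        proof (cases "x \<in> lset u 0 D")
          case True
          then have "D powr (p - 1) \<le> (w x + 1) powr (p - 1)" using D p_gt by (intro powr_mono2) (auto simp: lset_def u_def)
          then have "D powr (p - 1) * 1 \<le> (w x + 1) powr (p - 1) * (1 + norm x powr (- \<beta>))" by (rule mult_mono) auto
          moreover have "norm x < 2" using True by (auto simp: lset_def)
          ultimately show ?thesis using True by (simp add: ennreal_leI)
        qed simp
      qed
      also have "\<dots> \<le> ennreal CA" by (rule CA(2)[OF w])
      finally have "ennreal (D powr (p - 1)) * ennreal (measure lborel (lset u 0 D)) \<le> ennreal CA" by (simp only: emeasure_lset(1)[OF um])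
      then have "ennreal (D powr (p - 1) * measure lborel (lset u 0 D)) \<le> ennreal CA" by (simp add: ennreal_mult)
      then have "D powr (p - 1) * measure lborel (lset u 0 D) \<le> CA" using CA(1) by (subst (asm) ennreal_le_iff) auto
      also have "\<dots> \<le> D powr (p - 1) * h" using D1 by (simp add: mult.commute)
      finally show ?thesis using D by simp
    qed
    have dens: "measure lborel (lset u j (Lv j)) \<le> \<omega> * (1 / 2) ^ (?n + 1) * rad j ^ ?n" for j
      unfolding Lv_def
    proof (rule dyadic_density_bound[OF um u1 \<epsilon>(1) \<theta>_def \<theta>0 \<gamma>_def en _ D])
      show "measure lborel (lset u 0 D) \<le> \<omega> * (1 / 2) ^ (?n + 1)" using base by (simp only: h_def)
      show "CE < (1 - 1 / 2 powr \<gamma>) powr (p - 1) * ((2 powr \<gamma>) powr \<epsilon> - 1) * D powr \<theta> * 2 powr (cap_exp - ?a) *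
       (\<omega> / 2 * (\<omega> * (1 / 2) ^ (?n + 1) * (1 / 2) ^ ?n))"
        using D2 unfolding c1_def c2_def by (simp only: mult.assoc)
    qed (use CE in auto)
    have inner: "(\<integral>\<^sup>+x\<in>ball 0 (rad j). ennreal (u x powr q) \<partial>lborel) \<le> ennreal (CC * rad j ^ ?n * Lv j powr q * c5)" for j
      unfolding c5_def
    proof (rule nn_integral_powr_le_levels[OF um])
      show "emeasure lborel (ball (0::'a) (rad j)) \<le> ennreal (CC * rad j ^ ?n)"
        using CC by (subst emeasure_ball_\<omega>) (auto intro!: ennreal_leI mult_right_mono)
      fix i :: nat
      have "measure lborel (lset u j (2 ^ i * Lv j)) \<le> max \<omega> ((C * 2 powr (\<theta> / (1 - l))) powr (1 / (1 - l))) * rad j ^ ?n * 2 powr (- (real i * (\<theta> / (1 - l))))"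
      proof (rule level_decay[OF um u1 \<epsilon>(1) \<theta>_def \<theta>0 en CE(1) D refl Lv _ dens l_def C_def])
        show "Lv j powr \<theta> = D powr \<theta> * rad j powr (- cap_exp)" unfolding Lq using \<theta>0 by (simp add: \<gamma>_def)
      qed
      then have "ennreal (measure lborel (lset u j (2 ^ i * Lv j))) \<le> ennreal (CC * rad j ^ ?n * 2 powr (- (real i * \<sigma>)))"
        unfolding CC_def \<sigma>_def by (rule ennreal_leI)
      then show "emeasure lborel {x \<in> ball 0 (rad j). 2 ^ i * Lv j \<le> u x} \<le> ennreal (CC * rad j ^ ?n * 2 powr (- (real i * \<sigma>)))"
        unfolding emeasure_lset(1)[OF um, symmetric] by (simp add: lset_def)
    next
      show "0 \<le> u x" for x using u1[of x] by simp
    qed (use Lv q \<sigma>q CC in auto)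
    define F where "F j x = ennreal (rad (Suc j) powr (- 2 * \<beta>)) * (ennreal (u x powr q) * indicator (ball 0 (rad j)) x)" for j and x :: 'a
    have [measurable]: "ball (0::'a) (rad j) \<in> sets borel" for j by simp
    have Fm[measurable]: "F j \<in> borel_measurable borel" for j unfolding F_def by measurable
    have "(\<integral>\<^sup>+x\<in>ball 0 1. ennreal (w x powr q * norm (x::'a) powr (- 2 * \<beta>)) \<partial>lborel) \<le> (\<integral>\<^sup>+x. (\<Sum>j. F j x) \<partial>lborel)"
    proof (rule nn_integral_mono_AE)
      have "AE x in lborel. (x::'a) \<noteq> 0" using AE_lborel_singleton[of 0] by (simp add: eq_commute)
      then show "AE x in lborel. ennreal (w x powr q * norm x powr (- 2 * \<beta>)) * indicator (ball 0 1) x \<le> (\<Sum>j. F j x)"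
      proof eventually_elim
        case (elim x)
        show ?case
        proof (cases "norm x < 1")
          case True
          then obtain j where j: "1 * rad (Suc j) \<le> norm x" "norm x < 1 * rad j"
            using ex_dyadic_below[of "norm x" 1] elim by auto
          have "w x powr q \<le> u x powr q" using w0 q by (intro powr_mono2) (auto simp: u_def)
          moreover have "norm x powr (- 2 * \<beta>) \<le> rad (Suc j) powr (- 2 * \<beta>)"
            using j \<beta>_nonneg by (intro powr_mono2') auto
          ultimately have "w x powr q * norm x powr (- 2 * \<beta>) \<le> u x powr q * rad (Suc j) powr (- 2 * \<beta>)" by (rule mult_mono) auto
          then have "ennreal (w x powr q * norm x powr (- 2 * \<beta>)) \<le> ennreal (rad (Suc j) powr (- 2 * \<beta>)) * ennreal (u x powr q)"
            by (subst ennreal_mult[symmetric]) (auto intro: ennreal_leI simp: mult.commute)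
          then have "ennreal (w x powr q * norm x powr (- 2 * \<beta>)) * indicator (ball 0 1) x \<le> F j x"
            using True j unfolding F_def by simp
          also have "\<dots> \<le> (\<Sum>j. F j x)" using sum_le_suminf[of "\<lambda>j. F j x" "{j}"] by simp
          finally show ?thesis .
        qed simp
      qed
    qed
    also have "\<dots> = (\<Sum>j. \<integral>\<^sup>+x. F j x \<partial>lborel)" by (rule nn_integral_suminf) measurable
    also have "\<dots> \<le> (\<Sum>j. ennreal (C6 * R0 ^ j))"
    proof (intro suminf_le allI)
      fix j
      have "(\<integral>\<^sup>+x. F j x \<partial>lborel) = ennreal (rad (Suc j) powr (- 2 * \<beta>)) * (\<integral>\<^sup>+x\<in>ball 0 (rad j). ennreal (u x powr q) \<partial>lborel)"
        unfolding F_def by (rule nn_integral_cmult) measurable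
      also have "\<dots> \<le> ennreal (rad (Suc j) powr (- 2 * \<beta>)) * ennreal (CC * rad j ^ ?n * Lv j powr q * c5)"
        by (intro mult_left_mono inner) auto
      also have "\<dots> = ennreal (rad (Suc j) powr (- 2 * \<beta>) * (CC * rad j ^ ?n * Lv j powr q * c5))"
        using CC c5 by (intro ennreal_mult[symmetric]) auto
      also have "rad (Suc j) powr (- 2 * \<beta>) * (CC * rad j ^ ?n * Lv j powr q * c5) = C6 * R0 ^ j"
      proof -
        have r2: "rad i = 2 powr (- real i)" for i by (simp add: powr_minus powr_realpow power_one_over inverse_eq_divide)
        have a1: "rad (Suc j) powr (- 2 * \<beta>) = 2 powr (2 * \<beta>) * 2 powr (real j * (2 * \<beta>))"
          unfolding r2 by (simp add: powr_powr powr_add[symmetric] algebra_simps)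
        have a2: "rad j ^ ?n = 2 powr (- real j * N)"
          unfolding r2 by (simp add: powr_power N_def mult.commute)
        have a3: "Lv j powr q = D powr q * 2 powr (real j * (\<gamma> * q))"
          unfolding Lq r2 by (simp add: powr_powr algebra_simps)
        have a4: "2 powr (real j * (2 * \<beta>)) * 2 powr (- real j * N) * 2 powr (real j * (\<gamma> * q)) = R0 ^ j"
        proof -
          have "2 powr (real j * (2 * \<beta>)) * 2 powr (- real j * N) * 2 powr (real j * (\<gamma> * q)) = 2 powr (real j * (2 * \<beta>) + - real j * N + real j * (\<gamma> * q))"
            by (simp only: powr_add)
          also have "real j * (2 * \<beta>) + - real j * N + real j * (\<gamma> * q) = real j * (2 * \<beta> + \<gamma> * q - N)" by (simp add: algebra_simps)
          finally show ?thesis by (simp add: R0_def powr_power mult.commute)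
        qed
        show ?thesis unfolding a1 a2 a3 a4[symmetric] C6_def by (simp only: mult_ac)
      qed
      finally show "(\<integral>\<^sup>+x. F j x \<partial>lborel) \<le> ennreal (C6 * R0 ^ j)" .
    qed auto
    also have "\<dots> = ennreal (C6 * (1 / (1 - R0)))"
    proof (rule suminf_ennreal_eq)
      show "(\<lambda>j. C6 * R0 ^ j) sums (C6 * (1 / (1 - R0)))" using R0 by (intro sums_mult geometric_sums) auto
    qed (use C6 R0 in auto)
    finally show ?thesis .
  qed
  moreover have "0 < C6 * (1 / (1 - R0))" using C6 R0 by simp
  ultimately show ?thesis by blast
qed

end

section \<open>The weak Harnack inequality\<close>

lemma AE_lborel_scale:
  fixes P :: "'a::euclidean_space \<Rightarrow> bool"
  assumes [measurable]: "Measurable.pred borel P" and "r \<noteq> 0" and "AE x in lborel. P (r *\<^sub>R x)"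
  shows "AE x in lborel. P x"
  by (subst lborel_affine[OF assms(2), of 0]) (use assms in \<open>simp add: AE_density AE_distr_iff\<close>)

text \<open>The essential infimum is a finite real: a real-valued function cannot exceed every n
  almost everywhere on a set of positive measure. Above it the lower bound fails on a set that is
  not null, which is the hypothesis that the integral estimates need.\<close>

lemma ess_inf_on_cases:
  fixes v :: "'a::euclidean_space \<Rightarrow> real"
  assumes v0: "AE x in lborel. 0 \<le> v x" and A: "emeasure lborel A \<noteq> 0" "A \<in> sets borel"
  obtains m where "0 \<le> m" "ess_inf_on A v = ereal m"
    "\<And>t. m < t \<Longrightarrow> \<not> (AE x in lborel. x \<in> A \<longrightarrow> t \<le> v x)"
proof -
  define S where "S = {c::ereal. AE x in lborel. x \<in> A \<longrightarrow> c \<le> ereal (v x)}"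
  have inf: "ess_inf_on A v = Sup S" by (simp add: ess_inf_on_def S_def)
  have "0 \<in> S" unfolding S_def using v0 by (auto elim!: eventually_mono)
  then have ge: "0 \<le> Sup S" by (rule Sup_upper)
  have lt: "Sup S < \<infinity>"
  proof (rule ccontr)
    assume "\<not> Sup S < \<infinity>"
    then have top: "Sup S = \<infinity>" by simp
    have "AE x in lborel. x \<in> A \<longrightarrow> real n \<le> v x" for n :: nat
    proof -
      have "ereal (real n) < Sup S" using top by simp
      then obtain c where c: "c \<in> S" "ereal (real n) < c" by (auto simp: less_Sup_iff)
      have "AE x in lborel. x \<in> A \<longrightarrow> c \<le> ereal (v x)" using c(1) by (simp add: S_def)
      then show ?thesis
      proof eventually_elim
        case (elim x)
        then show ?case using c(2) by (metis ereal_less_eq(3) less_le_trans less_imp_le)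
      qed
    qed
    then have "AE x in lborel. \<forall>n::nat. x \<in> A \<longrightarrow> real n \<le> v x" unfolding AE_all_countable by (rule allI)
    then have "AE x in lborel. x \<notin> A"
    proof eventually_elim
      case (elim x)
      obtain n :: nat where "v x < real n" using reals_Archimedean2 by blast
      then show ?case using elim by (meson not_le)
    qed
    then have "emeasure lborel A = 0" using A(2) by (subst (asm) AE_iff_measurable[OF _ refl]) auto
    then show False using A by simp
  qed
  from ge lt obtain m where m: "Sup S = ereal m" "0 \<le> m" by (cases "Sup S") auto
  show ?thesis
  proof (rule that[OF m(2)])
    show "ess_inf_on A v = ereal m" using inf m by simp
    fix t assume t: "m < t"
    show "\<not> (AE x in lborel. x \<in> A \<longrightarrow> t \<le> v x)"
    proof
      assume "AE x in lborel. x \<in> A \<longrightarrow> t \<le> v x"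
      then have "ereal t \<in> S" by (simp add: S_def)
      then have "ereal t \<le> Sup S" by (rule Sup_upper)
      then show False using m t by simp
    qed
  qed
qed

context weighted_kernel
begin

lemma weighted_integral_bound:
  assumes q: "0 < q" "q < N * (p - 1) / (N - p * s)" and R: "0 < R" and \<Omega>: "ball (0::'a) R \<subseteq> \<Omega>"
    and f: "\<And>x. 0 \<le> f x"
  shows "\<exists>C>0. \<forall>v r t. v \<in> Wsp s p \<beta> \<longrightarrow> supersolution s p \<beta> \<Omega> f v \<longrightarrow> (AE x in lborel. 0 \<le> v x) \<longrightarrow>
     0 < r \<longrightarrow> r < R / 16 \<longrightarrow> 0 < t \<longrightarrow> \<not> (AE x in lborel. x \<in> ball 0 (3 * r / 2) \<longrightarrow> t \<le> v x) \<longrightarrow>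
     (\<integral>\<^sup>+x\<in>ball 0 r. ennreal (v x powr q * wmu \<beta> x) \<partial>lborel) \<le> ennreal ((C * t) powr q)"
proof -
  obtain C0 where C0: "C0 > 0" "\<And>w. unit_supersolution w \<Longrightarrow> \<not> (AE x in lborel. norm x < 3 / 2 \<longrightarrow> 1 / 2 \<le> w x) \<Longrightarrow>
     (\<integral>\<^sup>+x\<in>ball 0 1. ennreal (w x powr q * norm (x::'a) powr (- 2 * \<beta>)) \<partial>lborel) \<le> ennreal C0"
    using higher_integrability[OF q] by blast
  define B where "B = R powr (N - 2 * \<beta>) * C0"
  have B: "0 < B" using R C0 by (simp add: B_def)
  define C where "C = 2 * B powr (1 / q)"
  have C: "0 < C" using B by (simp add: C_def)
  have "(\<integral>\<^sup>+x\<in>ball 0 r. ennreal (v x powr q * wmu \<beta> x) \<partial>lborel) \<le> ennreal ((C * t) powr q)"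
    if v: "v \<in> Wsp s p \<beta>" and sup: "supersolution s p \<beta> \<Omega> f v" and v0: "AE x in lborel. 0 \<le> v x"
      and r: "0 < r" "r < R / 16" and t: "0 < t" and nae: "\<not> (AE x in lborel. x \<in> ball 0 (3 * r / 2) \<longrightarrow> t \<le> v x)" for v r t
  proof -
    have vm[measurable]: "v \<in> borel_measurable borel" using v by (auto simp: Wsp_def)
    \<comment> \<open>Division by 2t turns the failure of v >= t into the failure of w >= 1/2, the
      threshold of the barrier argument.\<close>
    define w where "w x = max 0 (v (r *\<^sub>R x)) / (2 * t)" for x
    have us: "unit_supersolution w"
      unfolding w_def using r t R by (intro supersolution_rescale[OF v sup f \<Omega> v0]) auto
    have nw: "\<not> (AE x in lborel. norm x < 3 / 2 \<longrightarrow> 1 / 2 \<le> w x)"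
    proof
      assume ae: "AE x in lborel. norm x < 3 / 2 \<longrightarrow> 1 / 2 \<le> w x"
      have [measurable]: "ball (0::'a) (3 * r / 2) \<in> sets borel" by simp
      have "AE x in lborel. x \<in> ball 0 (3 * r / 2) \<longrightarrow> t \<le> v x"
      proof (rule AE_lborel_scale)
        show "Measurable.pred borel (\<lambda>x. x \<in> ball 0 (3 * r / 2) \<longrightarrow> t \<le> v x)" by measurable
        show "AE x in lborel. r *\<^sub>R x \<in> ball 0 (3 * r / 2) \<longrightarrow> t \<le> v (r *\<^sub>R x)"
          using ae
        proof eventually_elim
          case (elim x)
          show ?case
          proof
            assume "r *\<^sub>R x \<in> ball 0 (3 * r / 2)"
            then have "r * norm x < r * (3 / 2)" using r by simp
            then have "norm x < 3 / 2" using r by (simp only: mult_less_cancel_left_pos)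
            then have "1 / 2 \<le> max 0 (v (r *\<^sub>R x)) / (2 * t)" using elim by (simp add: w_def)
            then show "t \<le> v (r *\<^sub>R x)" using t by (simp add: field_simps max_def split: if_splits)
          qed
        qed
      qed (use r in auto)
      then show False using nae by contradiction
    qed
    have wm[measurable]: "w \<in> borel_measurable borel" unfolding w_def by measurable
    have mu[measurable]: "wmu \<beta> \<in> borel_measurable (borel :: 'a measure)" unfolding wmu_def by measurable
    have [measurable]: "ball (0::'a) r \<in> sets borel" "ball (0::'a) 1 \<in> sets borel" by auto
    define F where "F x = ennreal (max 0 (v x) powr q * wmu \<beta> x) * indicator (ball 0 r) x" for x
    have Fm: "F \<in> borel_measurable borel" unfolding F_def by measurable
    have "(\<integral>\<^sup>+x\<in>ball 0 r. ennreal (v x powr q * wmu \<beta> x) \<partial>lborel) = (\<integral>\<^sup>+x. F x \<partial>lborel)"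
    proof (rule nn_integral_cong_AE)
      show "AE x in lborel. ennreal (v x powr q * wmu \<beta> x) * indicator (ball 0 r) x = F x"
        using v0 by eventually_elim (simp add: F_def max_def)
    qed
    also have "\<dots> = ennreal (\<bar>r\<bar> ^ DIM('a)) * (\<integral>\<^sup>+x. F (0 + r *\<^sub>R x) \<partial>lborel)"
      using r by (intro nn_integral_lborel_affine Fm) auto
    also have "(\<integral>\<^sup>+x. F (0 + r *\<^sub>R x) \<partial>lborel) = (\<integral>\<^sup>+x. ennreal ((2 * t) powr q * r powr (- 2 * \<beta>)) * (ennreal (w x powr q * norm x powr (- 2 * \<beta>)) * indicator (ball 0 1) x) \<partial>lborel)"
    proof (rule nn_integral_cong)
      fix x :: 'a
      have i: "indicator (ball 0 r) (r *\<^sub>R x) = (indicator (ball 0 1) x :: ennreal)"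
        using r by (auto simp: indicator_def)
      have "max 0 (v (r *\<^sub>R x)) = (2 * t) * w x" using t by (simp add: w_def)
      then have "max 0 (v (r *\<^sub>R x)) powr q = (2 * t) powr q * w x powr q" by (simp add: powr_mult)
      moreover have "wmu \<beta> (r *\<^sub>R x) = r powr (- 2 * \<beta>) * norm x powr (- 2 * \<beta>)"
        using r by (simp add: wmu_def powr_mult)
      ultimately have "max 0 (v (r *\<^sub>R x)) powr q * wmu \<beta> (r *\<^sub>R x) = ((2 * t) powr q * r powr (- 2 * \<beta>)) * (w x powr q * norm x powr (- 2 * \<beta>))"
        by (simp add: mult_ac)
      then have "ennreal (max 0 (v (r *\<^sub>R x)) powr q * wmu \<beta> (r *\<^sub>R x)) = ennreal ((2 * t) powr q * r powr (- 2 * \<beta>)) * ennreal (w x powr q * norm x powr (- 2 * \<beta>))"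
        by (simp only:) (rule ennreal_mult, auto)
      then show "F (0 + r *\<^sub>R x) = ennreal ((2 * t) powr q * r powr (- 2 * \<beta>)) * (ennreal (w x powr q * norm x powr (- 2 * \<beta>)) * indicator (ball 0 1) x)"
        by (simp only: F_def add_0 i mult.assoc)
    qed
    also have "\<dots> = ennreal ((2 * t) powr q * r powr (- 2 * \<beta>)) * (\<integral>\<^sup>+x\<in>ball 0 1. ennreal (w x powr q * norm (x::'a) powr (- 2 * \<beta>)) \<partial>lborel)"
      by (rule nn_integral_cmult) measurable
    also have "ennreal (\<bar>r\<bar> ^ DIM('a)) * \<dots> \<le> ennreal (\<bar>r\<bar> ^ DIM('a)) * (ennreal ((2 * t) powr q * r powr (- 2 * \<beta>)) * ennreal C0)"
      by (intro mult_left_mono C0 us nw) auto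
    also have "\<dots> = ennreal (\<bar>r\<bar> ^ DIM('a) * ((2 * t) powr q * r powr (- 2 * \<beta>) * C0))"
      using C0 by (subst ennreal_mult3) auto
    also have "\<dots> \<le> ennreal ((C * t) powr q)"
    proof (rule ennreal_leI)
      have "\<bar>r\<bar> ^ DIM('a) * ((2 * t) powr q * r powr (- 2 * \<beta>) * C0) = (2 * t) powr q * (r powr N * r powr (- 2 * \<beta>)) * C0"
        using r by (simp add: N_def powr_realpow)
      also have "r powr N * r powr (- 2 * \<beta>) = r powr (N - 2 * \<beta>)" by (simp add: powr_add[symmetric])
      \<comment> \<open>Rescaling produces r to the power N - 2 \<beta>. The exponent is positive,
        so r can be replaced by R and the constant becomes independent of r.\<close>
      also have "(2 * t) powr q * r powr (N - 2 * \<beta>) * C0 \<le> (2 * t) powr q * R powr (N - 2 * \<beta>) * C0"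
        using r R C0 \<beta>_less_N by (intro mult_right_mono mult_left_mono powr_mono2) auto
      also have "\<dots> = (2 * t) powr q * B" by (simp add: B_def)
      also have "B = (B powr (1 / q)) powr q" using B q by (simp add: powr_powr)
      also have "(2 * t) powr q * (B powr (1 / q)) powr q = (C * t) powr q"
        by (simp add: C_def powr_mult mult_ac)
      finally show "\<bar>r\<bar> ^ DIM('a) * ((2 * t) powr q * r powr (- 2 * \<beta>) * C0) \<le> (C * t) powr q" .
    qed
    finally show ?thesis .
  qed
  then show ?thesis using C by blast
qed

end

theorem theorem5p2:
  fixes s p \<beta> R :: real and \<Omega> :: "'a::euclidean_space set" and f :: "'a \<Rightarrow> real"
  assumes "0 < s" "s < 1" "1 < p" "p < real DIM('a)" "p * s < real DIM('a)"
    and "0 \<le> \<beta>" "\<beta> < (real DIM('a) - p * s) / 2"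
    and "smooth_bounded_domain \<Omega>" "0 \<in> \<Omega>"
    and "0 < R" "ball 0 R \<subseteq> \<Omega>"
    and "f \<in> borel_measurable lborel" "\<forall>x. 0 \<le> f x"
  shows "\<forall>q. 0 < q \<and> q < real DIM('a) * (p - 1) / (real DIM('a) - p * s) \<longrightarrow>
    (\<exists>C>0. \<forall>v r. v \<in> Wsp s p \<beta> \<and> supersolution s p \<beta> \<Omega> f v \<and>
        (AE x in lborel. 0 \<le> v x) \<and> \<not> (AE x in lborel. v x = 0) \<and> 0 < r \<and> r < R / 16 \<longrightarrow>
        (\<integral>\<^sup>+ x\<in>ball 0 r. ennreal (v x powr q * wmu \<beta> x) \<partial>lborel) < \<infinity> \<and>
        ereal ((enn2real (\<integral>\<^sup>+ x\<in>ball 0 r. ennreal (v x powr q * wmu \<beta> x) \<partial>lborel)) powr (1 / q))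
          \<le> ereal C * ess_inf_on (ball 0 (3 * r / 2)) v)"
proof (intro allI impI, elim conjE)
  fix q :: real
  assume q: "0 < q" "q < real DIM('a) * (p - 1) / (real DIM('a) - p * s)"
  interpret weighted_kernel s p \<beta> "real DIM('a)" "TYPE('a)"
    by unfold_locales (use assms in auto)
  obtain C where C: "C > 0" and bound: "\<And>v r t. v \<in> Wsp s p \<beta> \<Longrightarrow> supersolution s p \<beta> \<Omega> f v \<Longrightarrow> (AE x in lborel. 0 \<le> v x) \<Longrightarrow>
     0 < r \<Longrightarrow> r < R / 16 \<Longrightarrow> 0 < t \<Longrightarrow> \<not> (AE x in lborel. x \<in> ball 0 (3 * r / 2) \<longrightarrow> t \<le> v x) \<Longrightarrow>
     (\<integral>\<^sup>+x\<in>ball 0 r. ennreal (v x powr q * wmu \<beta> x) \<partial>lborel) \<le> ennreal ((C * t) powr q)"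
    using weighted_integral_bound[OF q, of R \<Omega> f] assms by blast
  show "\<exists>C>0. \<forall>v r. v \<in> Wsp s p \<beta> \<and> supersolution s p \<beta> \<Omega> f v \<and>
        (AE x in lborel. 0 \<le> v x) \<and> \<not> (AE x in lborel. v x = 0) \<and> 0 < r \<and> r < R / 16 \<longrightarrow>
        (\<integral>\<^sup>+ x\<in>ball 0 r. ennreal (v x powr q * wmu \<beta> x) \<partial>lborel) < \<infinity> \<and>
        ereal ((enn2real (\<integral>\<^sup>+ x\<in>ball 0 r. ennreal (v x powr q * wmu \<beta> x) \<partial>lborel)) powr (1 / q))
          \<le> ereal C * ess_inf_on (ball 0 (3 * r / 2)) v"
  proof (intro exI[of _ C] conjI[OF C] allI impI, elim conjE)
    fix v :: "'a \<Rightarrow> real" and r :: real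
    assume v: "v \<in> Wsp s p \<beta>" "supersolution s p \<beta> \<Omega> f v" "AE x in lborel. 0 \<le> v x" and r: "0 < r" "r < R / 16"
    define I where "I = (\<integral>\<^sup>+ x\<in>ball 0 r. ennreal (v x powr q * wmu \<beta> x) \<partial>lborel)"
    have "emeasure lborel (ball (0::'a) (3 * r / 2)) \<noteq> 0"
    proof
      assume "emeasure lborel (ball (0::'a) (3 * r / 2)) = 0"
      then show False using r unit_ball_vol_pos[of "real DIM('a)"] by (simp add: emeasure_ball)
    qed
    then obtain m where m: "0 \<le> m" "ess_inf_on (ball 0 (3 * r / 2)) v = ereal m"
      "\<And>t. m < t \<Longrightarrow> \<not> (AE x in lborel. x \<in> ball 0 (3 * r / 2) \<longrightarrow> t \<le> v x)"
      using ess_inf_on_cases[OF v(3), of "ball 0 (3 * r / 2)"] by auto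
    have It: "I \<le> ennreal ((C * t) powr q)" if "m < t" for t
      unfolding I_def using that m(1) by (intro bound v r m(3)) auto
    have Ifin: "I < \<infinity>" using It[of "m + 1"] by (simp add: le_less_trans)
    have "enn2real I powr (1 / q) \<le> C * m"
    proof (rule field_le_epsilon)
      fix e :: real assume e: "0 < e"
      \<comment> \<open>The integral bound is available only strictly above the infimum m, which may
        be 0; the excess e/C becomes e after multiplication by C and is then sent to 0.\<close>
      define t where "t = m + e / C"
      have t: "m < t" "0 < t" using e C m(1) by (auto simp: t_def add_nonneg_pos)
      have "ennreal (enn2real I) \<le> ennreal ((C * t) powr q)" using It[OF t(1)] Ifin by simp
      then have "enn2real I \<le> (C * t) powr q" by (subst (asm) ennreal_le_iff) auto
      then have "enn2real I powr (1 / q) \<le> ((C * t) powr q) powr (1 / q)" using q by (intro powr_mono2) auto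
      also have "\<dots> = C * t" using q C t by (simp add: powr_powr)
      also have "\<dots> = C * m + e" using C by (simp add: t_def field_simps)
      finally show "enn2real I powr (1 / q) \<le> C * m + e" .
    qed
    then show "(\<integral>\<^sup>+ x\<in>ball 0 r. ennreal (v x powr q * wmu \<beta> x) \<partial>lborel) < \<infinity> \<and>
        ereal ((enn2real (\<integral>\<^sup>+ x\<in>ball 0 r. ennreal (v x powr q * wmu \<beta> x) \<partial>lborel)) powr (1 / q))
          \<le> ereal C * ess_inf_on (ball 0 (3 * r / 2)) v"
      using Ifin unfolding I_def[symmetric] m(2) by simp
  qed
qed

end
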